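(* Let $\mathbb{E}=(J,b)$ be a pair on a regular local ring $(R,M)$ whose closed point $x$ lies in $\operatorname{Sing}(\mathbb{E})$. Fix a system of elements $(u)=(u_1,\dots,u_d)$ which can be extended to a regular system of parameters for $R$. Let $(y)=(y_1,\dots,y_s)\subset R$ be elements such that (i) $(u,y)$ is a regular system of parameters for $R$, (ii) $R\cong S[y]_{\langle u,y\rangle}$, where $S$ is a regular local ring with regular system of parameters $(u)$, and (iii) for every $j\in\{1,\dots,s\}$ there exist a differential operator $\mathcal{D}_{Q_j,y}\in\operatorname{Diff}^{\le b-1}_S(R)$ and an element $f_j\in J$ such that $\mathcal{D}_{Q_j,y}(f_j)=y_j$. Then $V(y)$ has maximal contact with $\mathbb{E}$ at $x$, and the polyhedron $\Delta(\mathbb{E};u;y)$ is independent of the choice of $(y)$ with these properties; that is, if $(z)=(z_1,\dots,z_s)\subset R$ is a system of elements such that the analogues of (i), (ii), (iii) (with $(y)$ replaced by $(z)$) hold, then $$\Delta(\mathbb{E};u;y)=\Delta(\mathbb{E};u;z).$$ Furthermore, $\Delta(\mathbb{E};u;y)=\Delta(\mathbb{E};u)$ if the images of $(y)$ in $R'=R/\langle u\rangle$ define the directrix of $\mathbb{E}'=(JR',b)$.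
   Context: Pairs. A pair $\mathbb{E}=(J,b)$ on a regular scheme $Z$ (or regular ring $R$, $Z=\operatorname{Spec}R$) is a quasi-coherent ideal sheaf $J$ with a positive integer $b$. $\operatorname{Sing}(\mathbb{E})=\{x\mid J_x\subseteq M_x^b\}$. A blow-up $Z'\to Z$ with center $D$ is permissible for $\mathbb{E}$ if $D$ is regular and $D\subseteq\operatorname{Sing}(\mathbb{E})$; the transform is $(J',b)$ with $J\mathcal{O}_{Z'}=J'H^b$, $H$ the ideal sheaf of the exceptional divisor. A local sequence of regular blow-ups (LSB) over $Z=Z_0$ consists of open $U_i\subset Z_i$, regular closed $D_i\subset U_i$ and blow-ups $Z_{i+1}\to U_i$ with center $D_i$, $0\le i\le\ell-1$, $\ell\in\mathbb{Z}_+\cup\{\infty\}$; it is permissible for $\mathbb{E}$ if each blow-up is permissible for the transform of $\mathbb{E}$ in $Z_i$ (restricted to $U_i$). For independent variables $(t)$ put $Z[t]=Z\times_{\operatorname{Spec}\mathbb{Z}}\operatorname{Spec}\mathbb{Z}[t]$, $\mathbb{E}[t]=(J\mathcal{O}_{Z[t]},b)$. $\mathbb{E}_1\subset\mathbb{E}_2$: for every finite system $(t)$ every LSB over $Z[t]$ permissible for $\mathbb{E}_1[t]$ is permissible for $\mathbb{E}_2[t]$; $\mathbb{E}_1\sim\mathbb{E}_2$: both inclusions. $\mathbb{E}_1\cap\mathbb{E}_2=(J_1^{c/b_1}+J_2^{c/b_2},c)$, $c=\mathrm{lcm}(b_1,b_2)$. $(y,1)$ denotes $(\langle y\rangle,1)$.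 $V(y)$ has maximal contact with $\mathbb{E}$ at $x$ if $\mathbb{E}\sim(y,1)\cap\mathbb{E}$ locally at $x$, i.e. as pairs on $R$. Differential operators. For $R=S[y]_{\langle u,y\rangle}$ and $Q\in\mathbb{Z}^s_{\ge0}$ with $q=|Q|$, $\mathcal{D}_{Q,y}\in\operatorname{Diff}^{\le q}_S(R)$ (the $S$-linear differential operators of order at most $q$ of $R$ to itself) is the operator defined by $\mathcal{D}_{Q,y}(Cy^D)=\binom{D}{Q}Cy^{D-Q}$ for $C\in S$; $\mathcal{D}_{Q_j,y}$ in (iii) is of this form with $Q_j\in\mathbb{Z}_{\ge0}^s$, $|Q_j|\le b-1$. Polyhedra. Every $g\in R$ has a finite expansion $g=\sum C_{A,B}u^Ay^B$ with $C_{A,B}\in R^\times\cup\{0\}$. $\Delta(\mathbb{E};u;y)$ is the smallest closed convex subset of $\mathbb{R}^d_{\ge0}$ containing all $\frac{A}{b-|B|}+\mathbb{R}^d_{\ge0}$ for monomials $u^Ay^B$ with $|B|<b$ appearing with non-zero coefficient in the expansions of the elements of a generating set of $J$ (independent of the generating set). $\Delta(\mathbb{E};u)=\bigcap_{(\widehat y)}\Delta(\mathbb{E};u;\widehat y)$, the intersection over all $(\widehat y)$ in the $M$-adic completion $\widehat R$ such that $(u,\widehat y)$ is a regular system of parameters of $\widehat R$ (with $\Delta(\mathbb{E};u;\widehat y)$ defined in the same way using $J\widehat R$). Directrix of $\mathbb{E}'$. With $M'$ the maximal ideal of $R'$, $K$ the residue field, $T=\operatorname{gr}_{M'}(R')$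 and $I=\langle f\bmod M'^{\,b+1}\mid f\in JR'\rangle\subset T$, the ideal of the directrix is generated by the smallest $K$-subspace $\bigoplus_jKY_j\subset T_1$ such that $(I\cap K[Y])T=I$. The images of $(y)$ define the directrix if their initial forms are such a minimal system $(Y)$. *)

theory Defs
  imports "HOL-Analysis.Analysis" "HOL-Algebra.Algebra"
begin

section \<open>Regular local rings\<close>

abbreviation on_carrier :: "('a, 'm) ring_scheme \<Rightarrow> 'a set \<Rightarrow> ('a, 'm) ring_scheme"
  where "on_carrier R A \<equiv> R\<lparr>carrier := A\<rparr>"

abbreviation ideal_pow :: "('a, 'm) ring_scheme \<Rightarrow> 'a set \<Rightarrow> nat \<Rightarrow> 'a set"
  where "ideal_pow R I n \<equiv> I [^]\<^bsub>ideals_set R\<^esub> n"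

definition local_ring :: "('a, 'm) ring_scheme \<Rightarrow> bool"
  where "local_ring R \<longleftrightarrow> cring R \<and> (\<exists>!M. maximalideal M R)"

definition max_ideal :: "('a, 'm) ring_scheme \<Rightarrow> 'a set"
  where "max_ideal R = (THE M. maximalideal M R)"

definition krull_dim :: "('a, 'm) ring_scheme \<Rightarrow> enat"
  where "krull_dim R = Sup {enat n | n P.
    (\<forall>i\<le>n. primeideal (P i) R) \<and> (\<forall>i<n. P i \<subset> P (Suc i))}"

text \<open>A family indexed by a finite set \<open>I\<close> is a regular system of parameters if it generates the
  maximal ideal and has as many members as the dimension of the ring. The ring is then regular.\<close>

definition regular_params :: "('a, 'm) ring_scheme \<Rightarrow> 'i set \<Rightarrow> ('i \<Rightarrow> 'a) \<Rightarrow> bool"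
  where "regular_params R I x \<longleftrightarrow> local_ring R \<and> noetherian_ring R \<and> finite I \<and>
    x ` I \<subseteq> carrier R \<and> enat (card I) = krull_dim R \<and> Idl\<^bsub>R\<^esub> (x ` I) = max_ideal R"

definition regular_local_ring :: "('a, 'm) ring_scheme \<Rightarrow> bool"
  where "regular_local_ring R \<longleftrightarrow> (\<exists>n (x :: nat \<Rightarrow> 'a). regular_params R {..<n} x)"

section \<open>Integral schemes as sets of local rings\<close>

text \<open>The schemes occurring in a local sequence of regular blow-ups over \<open>Spec R[t]\<close>, with \<open>R\<close> a
  regular local ring, are empty or integral, separated and of finite type over \<open>Spec R[t]\<close>, and
  their function field is \<open>K = Frac R[t]\<close>. Such a scheme \<open>Z\<close> is represented in Zariski's way, by
  the set of its local rings, as subrings of \<open>K\<close>: a point is identified with its local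
  ring, which is possible because \<open>Z\<close> is separated. Sections over an open set are the elements of
  \<open>K\<close> that lie in all of its local rings, and a morphism over \<open>Spec R[t]\<close> inducing the identity
  on \<open>K\<close> maps a point to the unique point that it dominates.\<close>

definition localization_at :: "('k, 'm) ring_scheme \<Rightarrow> 'k set \<Rightarrow> 'k set \<Rightarrow> 'k set"
  where "localization_at K A P = {a \<otimes>\<^bsub>K\<^esub> m_inv K s | a s. a \<in> A \<and> s \<in> A - P}"

definition spec_points :: "('k, 'm) ring_scheme \<Rightarrow> 'k set \<Rightarrow> 'k set set"
  where "spec_points K A = {localization_at K A P | P. primeideal P (on_carrier K A)}"

text \<open>Zariski topology. A finite set of rational functions is regular on an open set; conversely,
  in a separated scheme the affine open subscheme \<open>Spec A\<close> consists of the points whose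
  local ring contains (generators of) \<open>A\<close>, and a principal open subset \<open>D(g)\<close> of it of those whose
  local ring also contains \<open>1/g\<close>.\<close>

definition zariski_open :: "'k set set \<Rightarrow> 'k set set \<Rightarrow> bool"
  where "zariski_open Z U \<longleftrightarrow>
    U \<subseteq> Z \<and> (\<forall>p\<in>U. \<exists>F. finite F \<and> F \<subseteq> p \<and> {q \<in> Z. F \<subseteq> q} \<subseteq> U)"

definition dominates :: "('k, 'm) ring_scheme \<Rightarrow> 'k set \<Rightarrow> 'k set \<Rightarrow> bool"
  where "dominates K q p \<longleftrightarrow>
    p \<subseteq> q \<and> max_ideal (on_carrier K q) \<inter> p = max_ideal (on_carrier K p)"

text \<open>An ideal sheaf is given by its stalks. As the schemes are noetherian, quasi-coherence means
  that near each point the stalks are generated by the same finitely many sections.\<close>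

definition ideal_sheaf :: "('k, 'm) ring_scheme \<Rightarrow> 'k set set \<Rightarrow> ('k set \<Rightarrow> 'k set) \<Rightarrow> bool"
  where "ideal_sheaf K Z J \<longleftrightarrow> (\<forall>p\<in>Z. ideal (J p) (on_carrier K p)) \<and>
    (\<forall>p\<in>Z. \<exists>F W. finite F \<and> zariski_open Z W \<and> p \<in> W \<and>
      (\<forall>q\<in>W. F \<subseteq> q \<and> J q = Idl\<^bsub>on_carrier K q\<^esub> F))"

text \<open>A closed subscheme is represented by its ideal sheaf \<open>C\<close>; its support is the set of points
  \<open>p\<close> with \<open>C p \<noteq> p\<close>.\<close>

definition closed_support :: "'k set set \<Rightarrow> ('k set \<Rightarrow> 'k set) \<Rightarrow> 'k set set"
  where "closed_support Z C = {p \<in> Z. C p \<noteq> p}"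

definition regular_center :: "('k, 'm) ring_scheme \<Rightarrow> 'k set set \<Rightarrow> ('k set \<Rightarrow> 'k set) \<Rightarrow> bool"
  where "regular_center K Z C \<longleftrightarrow> ideal_sheaf K Z C \<and>
    (\<forall>p\<in>closed_support Z C. regular_local_ring (on_carrier K p Quot C p))"

text \<open>The blow-up is \<open>Proj\<close> of the Rees algebra of the center: over the point \<open>p\<close> it is covered by
  the affine charts \<open>Spec p[C p / f]\<close> with \<open>0 \<noteq> f \<in> C p\<close>.\<close>

definition blowup :: "('k, 'm) ring_scheme \<Rightarrow> 'k set set \<Rightarrow> ('k set \<Rightarrow> 'k set) \<Rightarrow> 'k set set"
  where "blowup K Z C = (\<Union>p\<in>Z. \<Union>f\<in>C p - {\<zero>\<^bsub>K\<^esub>}.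
    spec_points K (generate_ring K (p \<union> {a \<otimes>\<^bsub>K\<^esub> m_inv K f | a. a \<in> C p})))"

section \<open>Pairs and local sequences of regular blow-ups\<close>

definition sing :: "('k, 'm) ring_scheme \<Rightarrow> 'k set set \<Rightarrow> ('k set \<Rightarrow> 'k set) \<Rightarrow> nat \<Rightarrow> 'k set set"
  where "sing K Z J b =
    {p \<in> Z. J p \<subseteq> ideal_pow (on_carrier K p) (max_ideal (on_carrier K p)) b}"

text \<open>\<open>(J', b)\<close> is the transform of \<open>(J, b)\<close> under the blow-up of \<open>Z\<close> with center \<open>C\<close>; the ideal
  of the exceptional divisor at \<open>q\<close> is the extension of \<open>C p\<close>, where \<open>p\<close> is the image of \<open>q\<close>.\<close>

definition is_transform :: "('k, 'm) ring_scheme \<Rightarrow> 'k set set \<Rightarrow> ('k set \<Rightarrow> 'k set) \<Rightarrow> nat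
    \<Rightarrow> ('k set \<Rightarrow> 'k set) \<Rightarrow> ('k set \<Rightarrow> 'k set) \<Rightarrow> bool"
  where "is_transform K Z C b J J' \<longleftrightarrow> ideal_sheaf K (blowup K Z C) J' \<and>
    (\<forall>q\<in>blowup K Z C. \<forall>p\<in>Z. dominates K q p \<longrightarrow>
      Idl\<^bsub>on_carrier K q\<^esub> (J p) =
        J' q \<cdot>\<^bsub>on_carrier K q\<^esub> ideal_pow (on_carrier K q) (Idl\<^bsub>on_carrier K q\<^esub> (C p)) b)"

text \<open>A local sequence of regular blow-ups of length \<open>l\<close> over \<open>Z\<^sub>0\<close>, with schemes \<open>Z i\<close>, open
  subsets \<open>U i\<close> and centers \<open>C i\<close>.\<close>

definition lsb :: "('k, 'm) ring_scheme \<Rightarrow> 'k set set \<Rightarrow> enat \<Rightarrow> (nat \<Rightarrow> 'k set set)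
    \<Rightarrow> (nat \<Rightarrow> 'k set set) \<Rightarrow> (nat \<Rightarrow> 'k set \<Rightarrow> 'k set) \<Rightarrow> bool"
  where "lsb K Z\<^sub>0 l Z U C \<longleftrightarrow> 0 < l \<and> Z 0 = Z\<^sub>0 \<and>
    (\<forall>i. enat i < l \<longrightarrow> zariski_open (Z i) (U i) \<and> regular_center K (U i) (C i) \<and>
      Z (Suc i) = blowup K (U i) (C i))"

text \<open>\<open>Js i\<close> is the ideal sheaf of the transform of \<open>(J, b)\<close> in \<open>Z i\<close>. The transforms are unique
  because the ideals of the exceptional divisors are invertible.\<close>

definition permissible :: "('k, 'm) ring_scheme \<Rightarrow> ('k set \<Rightarrow> 'k set) \<Rightarrow> nat \<Rightarrow> enat
    \<Rightarrow> (nat \<Rightarrow> 'k set set) \<Rightarrow> (nat \<Rightarrow> 'k set set) \<Rightarrow> (nat \<Rightarrow> 'k set \<Rightarrow> 'k set) \<Rightarrow> bool"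
  where "permissible K J b l Z U C \<longleftrightarrow> (\<exists>Js. (\<forall>p\<in>Z 0. Js 0 p = J p) \<and>
    (\<forall>i. enat i < l \<longrightarrow> closed_support (U i) (C i) \<subseteq> sing K (U i) (Js i) b \<and>
      is_transform K (U i) (C i) b (Js i) (Js (Suc i))))"

section \<open>Polynomial extension and field of fractions\<close>

text \<open>\<open>R[t]\<close> with \<open>n\<close> independent variables, on the indexed polynomials of the library, where a
  monomial is a multiset of variables.\<close>

definition mpoly_ring :: "('a, 'm) ring_scheme \<Rightarrow> nat \<Rightarrow> (nat multiset \<Rightarrow> 'a) ring"
  where "mpoly_ring R n =
    \<lparr>carrier = ring.indexed_pset R {..<n} (carrier R),
     mult = (\<lambda>p q m. \<Oplus>\<^bsub>R\<^esub>k\<in>{k. k \<subseteq># m}. p k \<otimes>\<^bsub>R\<^esub> q (m - k)),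
     one = ring.indexed_const R \<one>\<^bsub>R\<^esub>,
     ring.zero = ring.indexed_const R \<zero>\<^bsub>R\<^esub>,
     add = ring.indexed_padd R\<rparr>"

definition fraction :: "('a, 'm) ring_scheme \<Rightarrow> 'a \<Rightarrow> 'a \<Rightarrow> ('a \<times> 'a) set"
  where "fraction A a s = {(a', s'). a' \<in> carrier A \<and> s' \<in> carrier A - {\<zero>\<^bsub>A\<^esub>} \<and>
    a \<otimes>\<^bsub>A\<^esub> s' = a' \<otimes>\<^bsub>A\<^esub> s}"

definition fraction_field :: "('a, 'm) ring_scheme \<Rightarrow> ('a \<times> 'a) set ring"
  where "fraction_field A =
    \<lparr>carrier = {fraction A a s | a s. a \<in> carrier A \<and> s \<in> carrier A - {\<zero>\<^bsub>A\<^esub>}},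
     mult = (\<lambda>p q. \<Union>(a, s)\<in>p. \<Union>(a', s')\<in>q. fraction A (a \<otimes>\<^bsub>A\<^esub> a') (s \<otimes>\<^bsub>A\<^esub> s')),
     one = fraction A \<one>\<^bsub>A\<^esub> \<one>\<^bsub>A\<^esub>,
     ring.zero = fraction A \<zero>\<^bsub>A\<^esub> \<one>\<^bsub>A\<^esub>,
     add = (\<lambda>p q. \<Union>(a, s)\<in>p. \<Union>(a', s')\<in>q.
       fraction A ((a \<otimes>\<^bsub>A\<^esub> s') \<oplus>\<^bsub>A\<^esub> (a' \<otimes>\<^bsub>A\<^esub> s)) (s \<otimes>\<^bsub>A\<^esub> s'))\<rparr>"

abbreviation function_field ::
    "('a, 'm) ring_scheme \<Rightarrow> nat \<Rightarrow> ((nat multiset \<Rightarrow> 'a) \<times> (nat multiset \<Rightarrow> 'a)) set ring"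
  where "function_field R n \<equiv> fraction_field (mpoly_ring R n)"

definition affine_space :: "('a, 'm) ring_scheme \<Rightarrow> nat
    \<Rightarrow> ((nat multiset \<Rightarrow> 'a) \<times> (nat multiset \<Rightarrow> 'a)) set set set"
  where "affine_space R n = spec_points (function_field R n)
    ((\<lambda>a. fraction (mpoly_ring R n) a \<one>\<^bsub>mpoly_ring R n\<^esub>) ` carrier (mpoly_ring R n))"

definition extended_ideal :: "('a, 'm) ring_scheme \<Rightarrow> nat \<Rightarrow> 'a set
    \<Rightarrow> ((nat multiset \<Rightarrow> 'a) \<times> (nat multiset \<Rightarrow> 'a)) set set
    \<Rightarrow> ((nat multiset \<Rightarrow> 'a) \<times> (nat multiset \<Rightarrow> 'a)) set set"
  where "extended_ideal R n J p = Idl\<^bsub>on_carrier (function_field R n) p\<^esub>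
    ((\<lambda>a. fraction (mpoly_ring R n) (ring.indexed_const R a) \<one>\<^bsub>mpoly_ring R n\<^esub>) ` J)"

section \<open>Equivalence of pairs and maximal contact\<close>

text \<open>A pair on \<open>R\<close> is given by an ideal of \<open>R\<close> and a positive integer.\<close>

definition pair_le :: "('a, 'm) ring_scheme \<Rightarrow> 'a set \<times> nat \<Rightarrow> 'a set \<times> nat \<Rightarrow> bool"
  where "pair_le R E1 E2 \<longleftrightarrow> (\<forall>n l Z U C.
    lsb (function_field R n) (affine_space R n) l Z U C \<longrightarrow>
    permissible (function_field R n) (extended_ideal R n (fst E1)) (snd E1) l Z U C \<longrightarrow>
    permissible (function_field R n) (extended_ideal R n (fst E2)) (snd E2) l Z U C)"

definition pair_equiv :: "('a, 'm) ring_scheme \<Rightarrow> 'a set \<times> nat \<Rightarrow> 'a set \<times> nat \<Rightarrow> bool"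
  where "pair_equiv R E1 E2 \<longleftrightarrow> pair_le R E1 E2 \<and> pair_le R E2 E1"

definition pair_inter :: "('a, 'm) ring_scheme \<Rightarrow> 'a set \<times> nat \<Rightarrow> 'a set \<times> nat \<Rightarrow> 'a set \<times> nat"
  where "pair_inter R E1 E2 = (let c = lcm (snd E1) (snd E2) in
    (set_add R (ideal_pow R (fst E1) (c div snd E1)) (ideal_pow R (fst E2) (c div snd E2)), c))"

definition maximal_contact :: "('a, 'm) ring_scheme \<Rightarrow> ('s \<Rightarrow> 'a) \<Rightarrow> 'a set \<times> nat \<Rightarrow> bool"
  where "maximal_contact R y E \<longleftrightarrow> pair_equiv R E (pair_inter R (Idl\<^bsub>R\<^esub> (range y), 1) E)"

section \<open>Differential operators\<close>

definition monomial :: "('a, 'm) ring_scheme \<Rightarrow> ('i::finite \<Rightarrow> 'a) \<Rightarrow> ('i \<Rightarrow> nat) \<Rightarrow> 'a"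
  where "monomial R x A = (\<Otimes>\<^bsub>R\<^esub>i\<in>UNIV. x i [^]\<^bsub>R\<^esub> A i)"

abbreviation degree_of :: "('i::finite \<Rightarrow> nat) \<Rightarrow> nat"
  where "degree_of A \<equiv> \<Sum>i\<in>UNIV. A i"

definition linear_over :: "('a, 'm) ring_scheme \<Rightarrow> 'a set \<Rightarrow> ('a \<Rightarrow> 'a) \<Rightarrow> bool"
  where "linear_over R S D \<longleftrightarrow> D \<in> carrier R \<rightarrow> carrier R \<and>
    (\<forall>x\<in>carrier R. \<forall>y\<in>carrier R. D (x \<oplus>\<^bsub>R\<^esub> y) = D x \<oplus>\<^bsub>R\<^esub> D y) \<and>
    (\<forall>c\<in>S. \<forall>x\<in>carrier R. D (c \<otimes>\<^bsub>R\<^esub> x) = c \<otimes>\<^bsub>R\<^esub> D x)"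

text \<open>Grothendieck's differential operators: \<open>D\<close> has order at most \<open>n + 1\<close> if all
  commutators \<open>[D, a]\<close> have order at most \<open>n\<close>.\<close>

primrec diff_op :: "('a, 'm) ring_scheme \<Rightarrow> 'a set \<Rightarrow> nat \<Rightarrow> ('a \<Rightarrow> 'a) \<Rightarrow> bool" where
  "diff_op R S 0 D \<longleftrightarrow> linear_over R S D \<and>
     (\<forall>a\<in>carrier R. \<forall>x\<in>carrier R. D (a \<otimes>\<^bsub>R\<^esub> x) = a \<otimes>\<^bsub>R\<^esub> D x)"
| "diff_op R S (Suc n) D \<longleftrightarrow> linear_over R S D \<and>
     (\<forall>a\<in>carrier R. diff_op R S n (\<lambda>x. D (a \<otimes>\<^bsub>R\<^esub> x) \<ominus>\<^bsub>R\<^esub> (a \<otimes>\<^bsub>R\<^esub> D x)))"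

text \<open>The binomial coefficient vanishes unless \<open>Q \<le> E\<close>, so truncated subtraction is harmless.\<close>

definition is_hasse_op :: "('a, 'm) ring_scheme \<Rightarrow> 'a set \<Rightarrow> ('s::finite \<Rightarrow> 'a) \<Rightarrow> ('s \<Rightarrow> nat)
    \<Rightarrow> ('a \<Rightarrow> 'a) \<Rightarrow> bool"
  where "is_hasse_op R S y Q D \<longleftrightarrow> diff_op R S (degree_of Q) D \<and>
    (\<forall>c\<in>S. \<forall>E. D (c \<otimes>\<^bsub>R\<^esub> monomial R y E) =
      [(\<Prod>i\<in>UNIV. E i choose Q i)] \<cdot>\<^bsub>R\<^esub> (c \<otimes>\<^bsub>R\<^esub> monomial R y (\<lambda>i. E i - Q i)))"

text \<open>\<open>R = S[y]\<^bsub>\<langle>u, y\<rangle>\<^esub>\<close>, for a regular local ring \<open>S\<close> with regular system of parameters \<open>(u)\<close>,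
  where \<open>S\<close> is identified with its image in \<open>R\<close>: the elements \<open>(y)\<close> are algebraically
  independent over \<open>S\<close>, and \<open>R\<close> is the localization of its subring \<open>S[y]\<close> at \<open>\<langle>u, y\<rangle>\<close>.\<close>

definition is_localized_polynomial_ring :: "('a, 'm) ring_scheme \<Rightarrow> 'a set
    \<Rightarrow> ('d::finite \<Rightarrow> 'a) \<Rightarrow> ('s::finite \<Rightarrow> 'a) \<Rightarrow> bool"
  where "is_localized_polynomial_ring R S u y \<longleftrightarrow>
    subring S R \<and> regular_params (on_carrier R S) UNIV u \<and> range y \<subseteq> carrier R \<and>
    (\<forall>F c. finite F \<longrightarrow> c \<in> F \<rightarrow> S \<longrightarrow>
      (\<Oplus>\<^bsub>R\<^esub>B\<in>F. c B \<otimes>\<^bsub>R\<^esub> monomial R y B) = \<zero>\<^bsub>R\<^esub> \<longrightarrow> (\<forall>B\<in>F. c B = \<zero>\<^bsub>R\<^esub>)) \<and>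
    (let P = generate_ring R (S \<union> range y);
         N = Idl\<^bsub>on_carrier R P\<^esub> (range u \<union> range y)
     in P - N \<subseteq> Units R \<and> carrier R = localization_at R P N)"

definition attained_by_hasse_ops :: "('a, 'm) ring_scheme \<Rightarrow> 'a set \<Rightarrow> 'a set \<times> nat
    \<Rightarrow> ('s::finite \<Rightarrow> 'a) \<Rightarrow> bool"
  where "attained_by_hasse_ops R S E y \<longleftrightarrow>
    (\<forall>j. \<exists>Q D f. degree_of Q \<le> snd E - 1 \<and> is_hasse_op R S y Q D \<and>
      diff_op R S (snd E - 1) D \<and> f \<in> fst E \<and> D f = y j)"

section \<open>Polyhedra\<close>

text \<open>The coefficients of a finite expansion in monomials \<open>u\<^sup>A y\<^sup>B\<close> are units or zero.\<close>

definition is_expansion :: "('a, 'm) ring_scheme \<Rightarrow> ('d::finite \<Rightarrow> 'a) \<Rightarrow> ('s::finite \<Rightarrow> 'a)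
    \<Rightarrow> 'a \<Rightarrow> (('d \<Rightarrow> nat) \<times> ('s \<Rightarrow> nat) \<Rightarrow> 'a) \<Rightarrow> bool"
  where "is_expansion R u y g c \<longleftrightarrow>
    finite {m. c m \<noteq> \<zero>\<^bsub>R\<^esub>} \<and> range c \<subseteq> Units R \<union> {\<zero>\<^bsub>R\<^esub>} \<and>
    g = (\<Oplus>\<^bsub>R\<^esub>m\<in>{m. c m \<noteq> \<zero>\<^bsub>R\<^esub>}.
      c m \<otimes>\<^bsub>R\<^esub> monomial R u (fst m) \<otimes>\<^bsub>R\<^esub> monomial R y (snd m))"

text \<open>The polyhedron does not depend on the generating set nor on the chosen expansions, which are
  not unique; here the generating set is \<open>J\<close> itself, with all expansions of its elements.\<close>

definition newton_polyhedron :: "('a, 'm) ring_scheme \<Rightarrow> 'a set \<times> nat \<Rightarrow> ('d::finite \<Rightarrow> 'a)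
    \<Rightarrow> ('s::finite \<Rightarrow> 'a) \<Rightarrow> (real ^ 'd) set"
  where "newton_polyhedron R E u y = (\<lambda>P. closed P \<and> convex P) hull
    {(\<chi> i. real (A i) / (real (snd E) - real (degree_of B))) + v | A B v g c.
      g \<in> fst E \<and> is_expansion R u y g c \<and> c (A, B) \<noteq> \<zero>\<^bsub>R\<^esub> \<and> degree_of B < snd E \<and>
      (\<forall>i. 0 \<le> v $ i)}"

text \<open>The completion with respect to the maximal ideal \<open>M\<close>, as the inverse limit of the rings
  \<open>R / M\<^sup>n\<close>: its elements are the decreasing sequences of cosets of \<open>M\<^sup>n\<close>.\<close>

definition completion :: "('a, 'm) ring_scheme \<Rightarrow> (nat \<Rightarrow> 'a set) ring"
  where "completion R = (let Q = (\<lambda>n. R Quot ideal_pow R (max_ideal R) n) in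
    \<lparr>carrier = {x. \<forall>n. x n \<in> carrier (Q n) \<and> x (Suc n) \<subseteq> x n},
     mult = (\<lambda>x y n. x n \<otimes>\<^bsub>Q n\<^esub> y n),
     one = (\<lambda>n. \<one>\<^bsub>Q n\<^esub>),
     ring.zero = (\<lambda>n. \<zero>\<^bsub>Q n\<^esub>),
     add = (\<lambda>x y n. x n \<oplus>\<^bsub>Q n\<^esub> y n)\<rparr>)"

definition to_completion :: "('a, 'm) ring_scheme \<Rightarrow> 'a \<Rightarrow> nat \<Rightarrow> 'a set"
  where "to_completion R a = (\<lambda>n. ideal_pow R (max_ideal R) n +>\<^bsub>R\<^esub> a)"

text \<open>The type argument is the index type of the families \<open>y\<close> completing \<open>u\<close>.\<close>

definition characteristic_polyhedron :: "('s::finite) itself \<Rightarrow> ('a, 'm) ring_scheme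
    \<Rightarrow> 'a set \<times> nat \<Rightarrow> ('d::finite \<Rightarrow> 'a) \<Rightarrow> (real ^ 'd) set"
  where "characteristic_polyhedron _ R E u =
    (\<Inter>y \<in> {y :: 's \<Rightarrow> nat \<Rightarrow> 'a set.
        regular_params (completion R) UNIV (case_sum (to_completion R \<circ> u) y)}.
      newton_polyhedron (completion R) (Idl\<^bsub>completion R\<^esub> (to_completion R ` fst E), snd E)
        (to_completion R \<circ> u) y)"

section \<open>The directrix\<close>

text \<open>The associated graded ring of a local ring. The \<open>n\<close>-th component of an element is a coset of
  \<open>M\<^sup>n\<^sup>+\<^sup>1\<close> in \<open>M\<^sup>n\<close>; a product of cosets is formed, without choice, from all of their
  representatives.\<close>

definition graded_ring :: "('a, 'm) ring_scheme \<Rightarrow> (nat \<Rightarrow> 'a set) ring"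
  where "graded_ring R = (let P = ideal_pow R (max_ideal R) in
    \<lparr>carrier = {F. (\<forall>n. \<exists>a\<in>P n. F n = P (Suc n) +>\<^bsub>R\<^esub> a) \<and> finite {n. F n \<noteq> P (Suc n)}},
     mult = (\<lambda>F G n. \<Union>{P (Suc n) +>\<^bsub>R\<^esub> (\<Oplus>\<^bsub>R\<^esub>i\<in>{..n}. f i \<otimes>\<^bsub>R\<^esub> g (n - i)) | f g.
       (\<forall>i. f i \<in> F i) \<and> (\<forall>i. g i \<in> G i)}),
     one = (\<lambda>n. if n = 0 then P 1 +>\<^bsub>R\<^esub> \<one>\<^bsub>R\<^esub> else P (Suc n)),
     ring.zero = (\<lambda>n. P (Suc n)),
     add = (\<lambda>F G n. set_add R (F n) (G n))\<rparr>)"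

text \<open>The class of \<open>a \<in> M\<^sup>n\<close> modulo \<open>M\<^sup>n\<^sup>+\<^sup>1\<close>, as a homogeneous element of degree \<open>n\<close>.\<close>

definition homogeneous_class :: "('a, 'm) ring_scheme \<Rightarrow> nat \<Rightarrow> 'a \<Rightarrow> nat \<Rightarrow> 'a set"
  where "homogeneous_class R n a = (\<lambda>k. if k = n then ideal_pow R (max_ideal R) (Suc n) +>\<^bsub>R\<^esub> a
    else ideal_pow R (max_ideal R) (Suc k))"

definition graded_part :: "('a, 'm) ring_scheme \<Rightarrow> nat \<Rightarrow> (nat \<Rightarrow> 'a set) set"
  where "graded_part R n = homogeneous_class R n ` ideal_pow R (max_ideal R) n"

definition initial_ideal :: "('a, 'm) ring_scheme \<Rightarrow> 'a set \<times> nat \<Rightarrow> (nat \<Rightarrow> 'a set) set"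
  where "initial_ideal R E = Idl\<^bsub>graded_ring R\<^esub> (homogeneous_class R (snd E) ` fst E)"

text \<open>\<open>V\<close> is a subspace of the degree-one part over the residue field \<open>K\<close>, which is the part of
  degree zero, and \<open>I\<close> is generated by its elements in \<open>K[V]\<close>.\<close>

definition generating_subspace :: "('a, 'm) ring_scheme \<Rightarrow> (nat \<Rightarrow> 'a set) set
    \<Rightarrow> (nat \<Rightarrow> 'a set) set \<Rightarrow> bool"
  where "generating_subspace R I V \<longleftrightarrow>
    V \<subseteq> graded_part R 1 \<and> subgroup V (add_monoid (graded_ring R)) \<and>
    (\<forall>k\<in>graded_part R 0. \<forall>v\<in>V. k \<otimes>\<^bsub>graded_ring R\<^esub> v \<in> V) \<and>
    Idl\<^bsub>graded_ring R\<^esub> (I \<inter> generate_ring (graded_ring R) (graded_part R 0 \<union> V)) = I"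

text \<open>The initial forms of \<open>(y)\<close> are a basis of the smallest such subspace. Degree one is
  meant here: \<open>(y)\<close> is to be part of a regular system of parameters.\<close>

definition defines_directrix :: "('a, 'm) ring_scheme \<Rightarrow> 'a set \<times> nat \<Rightarrow> ('s::finite \<Rightarrow> 'a) \<Rightarrow> bool"
  where "defines_directrix R E y \<longleftrightarrow> (let T = graded_ring R; K = graded_part R 0;
      Y = (\<lambda>j. homogeneous_class R 1 (y j)); I = initial_ideal R E;
      V = {\<Oplus>\<^bsub>T\<^esub>j\<in>UNIV. k j \<otimes>\<^bsub>T\<^esub> Y j | k. range k \<subseteq> K} in
    range y \<subseteq> max_ideal R \<and>
    (\<forall>k. range k \<subseteq> K \<longrightarrow> (\<Oplus>\<^bsub>T\<^esub>j\<in>UNIV. k j \<otimes>\<^bsub>T\<^esub> Y j) = \<zero>\<^bsub>T\<^esub> \<longrightarrow> (\<forall>j. k j = \<zero>\<^bsub>T\<^esub>)) \<and>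
    generating_subspace R I V \<and>
    (\<forall>W. generating_subspace R I W \<longrightarrow> V \<subseteq> W))"

end

theory Submission
 imports Defs "HOL-Library.Multiset_Order"
begin

notation iff (infixr "<->" 25) and carrier ("\<K>\<index>")

text \<open>Let \<open>D\<close> be an \<open>S\<close>-linear differential operator of order at most \<open>b - 1\<close>.

For positive weights of \<open>(u)\<close>, give each \<open>z\<^sub>j\<close> the weight \<open>1\<close>. The polyhedron for \<open>(u;z)\<close> lies in the
corresponding half-space if and only if \<open>J\<close> has weight at least \<open>b\<close>. Since \<open>D\<close> is linear over the
ring containing \<open>(u)\<close>, it lowers weights by at most \<open>b - 1\<close>; so each \<open>y\<^sub>j = D f\<^sub>j\<close> has weight at least
\<open>1\<close> with respect to \<open>(u,z)\<close>, and then the half-space also contains the polyhedron for \<open>(u;y)\<close>. The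
same applies to parameters in the completion after approximating them by elements of \<open>R\<close>.

For maximal contact, let \<open>\<Phi>\<close> be a local equation of the total exceptional divisor. At every stage
of a sequence of blow-ups permissible for \<open>(J,b)\<close>, the element \<open>y\<^sub>j / \<Phi>\<close> is the image of an element of
the transform of \<open>J\<close> under an operator of order at most \<open>b - 1\<close> on the function field that preserves
the local rings: if \<open>f\<close> is an equation of the new exceptional divisor, then \<open>D\<close> is replaced by
\<open>f\<^sup>-\<^sup>1 D f\<^sup>b\<close>. As such operators map \<open>M\<^sup>b\<close> into \<open>M\<close>, the elements \<open>y\<^sub>j / \<Phi>\<close> vanish on every permissible
center.\<close>

section \<open>Ideals and prime chains in Noetherian rings\<close>

text \<open>For a regular system of parameters only the number of generators is postulated to equal
  the dimension, so Krull's principal ideal theorem comes first: it shows that the parameters form a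
  regular sequence in any order. One consequence carries all statements on polyhedra: modulo the
  ideal of the powers \<open>x_i^(m_i+1)\<close>, the monomial \<open>x^m\<close> is annihilated by
  nonunits only. This isolates a unit coefficient and makes weights independent of the expansion.
  Separating linear forms are taken with positive coefficients because then high powers of
  \<open>M\<close> have high weight, which is what makes approximation in the completion possible.

  For maximal contact the obstacle is that an operator on \<open>R\<close> has to act on the
  function field of \<open>R[t]\<close> and to respect every local ring that occurs. It acts on
  coefficients first and extends to fractions by induction on its order; charts are handled through
  their generators \<open>c/f\<close>. That \<open>y_j\<close> divided by the exceptional equation
  lies in the ideal of a center is tested at the generic point of the center: its ideal is prime, as
  regular local rings are domains, and permissibility applies at that point too.\<close>

definition adjoin :: "('a, 'm) ring_scheme => 'a set => 'a => 'a set"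
 where "adjoin R I x = {i\<oplus>\<^bsub>R\<^esub>r\<otimes>\<^bsub>R\<^esub>x | i r. i\<in>I & r\<in>carrier R}"

text \<open>The contraction to \<open>R\<close> of the extension of \<open>I\<close> to the
  localization at \<open>P\<close>. Arguments local at \<open>P\<close> are carried out with such
  ideals, so that no localized ring has to be formed.\<close>

definition saturation :: "('a, 'm) ring_scheme => 'a set => 'a set => 'a set"
 where "saturation R P I = {a\<in>carrier R. \<exists>s\<in>carrier R - P. s\<otimes>\<^bsub>R\<^esub>a\<in>I}"

lemma (in ring) idealI':
 assumes "I<=\<K>" "\<zero>\<in>I" and "!!a b. a\<in>I ==> b\<in>I ==> a\<oplus>b\<in>I"
  and "!!a r. a\<in>I ==> r\<in>\<K> ==> r\<otimes>a\<in>I"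
  and "!!a r. a\<in>I ==> r\<in>\<K> ==> a\<otimes>r\<in>I" shows "ideal I R"
proof (rule idealI)
 show "subgroup I (add_monoid R)"
 proof (rule add.subgroupI)
  show "I~={}" using assms(2) by auto
 next
  fix a assume a: "a\<in>I"
  have "\<ominus>\<one>\<otimes>a = \<ominus>a" using a assms(1) by (metis l_minus l_one one_closed subsetD)
  then show "\<ominus>a\<in>I" using assms(4)[OF a, of "\<ominus>\<one>"] by simp
 qed (use assms in auto)
qed (use assms ring_axioms in auto)

lemma (in cring) cidealI:
 assumes "I<=\<K>" "\<zero>\<in>I" and "!!a b. a\<in>I ==> b\<in>I ==> a\<oplus>b\<in>I"
  and "!!a r. a\<in>I ==> r\<in>\<K> ==> r\<otimes>a\<in>I" shows "ideal I R" using assms by (intro idealI') (auto simp: m_comm subset_iff)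

lemma (in ring) ideal_facts:
 assumes "ideal I R" shows "I<=\<K>" "\<zero>\<in>I"
  "!!a b. a\<in>I ==> b\<in>I ==> a\<oplus>b\<in>I"
  "!!a r. a\<in>I ==> r\<in>\<K> ==> r\<otimes>a\<in>I"
  "!!a r. a\<in>I ==> r\<in>\<K> ==> a\<otimes>r\<in>I"
  "!!a. a\<in>I ==>\<ominus>a\<in>I"
  "!!a b. a\<in>I ==> b\<in>I ==> a\<ominus>b\<in>I"
proof -
 interpret ideal I R by fact
 show "I<=\<K>" "\<zero>\<in>I"
  "!!a b. a\<in>I ==> b\<in>I ==> a\<oplus>b\<in>I"
  "!!a r. a\<in>I ==> r\<in>\<K> ==> r\<otimes>a\<in>I"
  "!!a r. a\<in>I ==> r\<in>\<K> ==> a\<otimes>r\<in>I"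
  "!!a. a\<in>I ==>\<ominus>a\<in>I"
  "!!a b. a\<in>I ==> b\<in>I ==> a\<ominus>b\<in>I" by (auto simp: a_subset I_l_closed I_r_closed minus_eq)
qed

lemma (in ring) ideal_add_cancel:
 assumes "ideal I R" "a\<oplus>b\<in>I" "a\<in>I" "b\<in>\<K>" shows "b\<in>I"
proof -
 have "a\<in>\<K>" using assms ideal_facts(1) by blast
 then have "b = (a\<oplus>b)\<ominus>a" using assms by algebra
 then show ?thesis using ideal_facts(7)[OF assms(1,2,3)] by simp
qed

lemma (in ring) Idl_induct [consumes 2, case_names gen zero add mult]:
 assumes "a\<in>Idl S" "S<=\<K>" and "!!s. s\<in>S ==> Q s" "Q \<zero>"
  and "!!a b. a\<in>Idl S ==> b\<in>Idl S ==> Q a ==> Q b ==> Q (a\<oplus>b)"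
  and "!!a r. a\<in>Idl S ==> r\<in>\<K> ==> Q a ==> Q (r\<otimes>a) & Q (a\<otimes>r)" shows "Q a"
proof -
 note I = ideal_facts[OF genideal_ideal[OF assms(2)]]
 have "ideal {a\<in>Idl S. Q a} R" using I assms by (intro idealI') auto
 moreover have "S<={a\<in>Idl S. Q a}" using assms(3) genideal_self[OF assms(2)] by auto
 ultimately show ?thesis using genideal_minimal assms(1) by blast
qed

lemma (in cring) adjoin_ideal:
 assumes "ideal I R" "x\<in>\<K>" shows "ideal (adjoin R I x) R"
proof (rule cidealI)
 note I = ideal_facts[OF assms(1)]
 show "adjoin R I x<=\<K>" using I(1) assms unfolding adjoin_def by auto
 show "\<zero>\<in>adjoin R I x" unfolding adjoin_def using I(2) assms by (force intro: exI[of _ \<zero>])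
 fix a assume "a\<in>adjoin R I x"
 then obtain i r where a: "i\<in>I" "r\<in>\<K>" "a = i\<oplus>r\<otimes>x" unfolding adjoin_def by auto
 have ic: "i\<in>\<K>" using I a by auto
 {
  fix b assume "b\<in>adjoin R I x"
  then obtain j t where b: "j\<in>I" "t\<in>\<K>" "b = j\<oplus>t\<otimes>x" unfolding adjoin_def by auto
  have "j\<in>\<K>" using I b by auto
  then have "a\<oplus>b = (i\<oplus>j)\<oplus>(r\<oplus>t)\<otimes>x" using a b ic assms by (simp add: l_distr a_ac)
  then show "a\<oplus>b\<in>adjoin R I x" unfolding adjoin_def using a b I(3) by blast
 }
 fix t assume t: "t\<in>\<K>"
 then have "t\<otimes>a = t\<otimes>i\<oplus>(t\<otimes>r)\<otimes>x" using a ic assms by (simp add: r_distr m_assoc)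
 then show "t\<otimes>a\<in>adjoin R I x" unfolding adjoin_def using a t I(4) by blast
qed

lemma (in cring) adjoin_facts:
 assumes "ideal I R" "x\<in>\<K>" shows "I<=adjoin R I x" "x\<in>adjoin R I x"
  "!!K. ideal K R ==> I<=K ==> x\<in>K ==> adjoin R I x<=K"
proof -
 note I = ideal_facts[OF assms(1)]
 have "i = i\<oplus>\<zero>\<otimes>x" if "i\<in>I" for i using that I assms by auto
 then show "I<=adjoin R I x" unfolding adjoin_def by blast
 have "x = \<zero>\<oplus>\<one>\<otimes>x" using assms by auto
 then show "x\<in>adjoin R I x" unfolding adjoin_def using I(2) by blast
 fix K assume "ideal K R" "I<=K" "x\<in>K"
 then show "adjoin R I x<=K" unfolding adjoin_def using ideal_facts[of K] by auto
qed

lemma (in cring) Idl_insert: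
 assumes "S<=\<K>" "x\<in>\<K>" shows "Idl (insert x S) = adjoin R (Idl S) x"
proof
 note a = adjoin_ideal[OF genideal_ideal[OF assms(1)] assms(2)]
 note b = adjoin_facts[OF genideal_ideal[OF assms(1)] assms(2)]
 show "Idl (insert x S)<=adjoin R (Idl S) x" using a b genideal_self[OF assms(1)] by (intro genideal_minimal) auto
 have c: "insert x S<=\<K>" using assms by auto
 show "adjoin R (Idl S) x<=Idl (insert x S)"
 proof (rule b(3)[OF genideal_ideal[OF c]])
  show "Idl S<=Idl (insert x S)" using genideal_self[OF c] by (intro genideal_minimal[OF genideal_ideal[OF c]]) auto
  show "x\<in>Idl (insert x S)" using genideal_self[OF c] by auto
 qed
qed

lemma (in cring) prime_facts:
 assumes "primeideal P R" shows "ideal P R" "P~=\<K>" "\<one>~:P"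
  "!!a b. a\<in>\<K> ==> b\<in>\<K> ==> a\<otimes>b\<in>P ==> a\<in>P \<or> b\<in>P"
proof -
 interpret primeideal P R by fact
 show "ideal P R" "P~=\<K>" by (simp add: is_ideal, rule I_notcarr[symmetric])
 show "\<one>~:P" using one_imp_carrier I_notcarr by auto
 show "!!a b. a\<in>\<K> ==> b\<in>\<K> ==> a\<otimes>b\<in>P ==> a\<in>P \<or> b\<in>P" by (rule I_prime)
qed

lemma (in cring) saturation_ideal:
 assumes "primeideal P R" "ideal I R" shows "ideal (saturation R P I) R"
proof (rule cidealI)
 note P = prime_facts[OF assms(1)] and I = ideal_facts[OF assms(2)]
 show "saturation R P I<=\<K>" unfolding saturation_def by auto
 show "\<zero>\<in>saturation R P I" unfolding saturation_def using I(2) P(3) by force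
 fix a assume "a\<in>saturation R P I"
 then obtain s where a: "a\<in>\<K>" "s\<in>\<K>" "s~:P" "s\<otimes>a\<in>I" unfolding saturation_def by auto
 {
  fix b assume "b\<in>saturation R P I"
  then obtain t where b: "b\<in>\<K>" "t\<in>\<K>" "t~:P" "t\<otimes>b\<in>I" unfolding saturation_def by auto
  have "(s\<otimes>t)\<otimes>(a\<oplus>b) = t\<otimes>(s\<otimes>a)\<oplus>s\<otimes>(t\<otimes>b)" using a b by algebra
  moreover have "s\<otimes>t~:P" using P(4) a b by blast
  ultimately show "a\<oplus>b\<in>saturation R P I" unfolding saturation_def using a b I(3,4) by (auto intro!: bexI[of _ "s\<otimes>t"])
 }
 fix r assume r: "r\<in>\<K>"
 have "s\<otimes>(r\<otimes>a) = r\<otimes>(s\<otimes>a)" using a r by algebra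
 then show "r\<otimes>a\<in>saturation R P I" unfolding saturation_def using a r I(4) by (auto intro!: bexI[of _ s])
qed

lemma (in cring) saturation_facts:
 assumes "primeideal P R" "ideal I R" shows "I<=saturation R P I"
  "!!s a. s\<in>\<K> ==> s~:P ==> a\<in>\<K> ==> s\<otimes>a\<in>saturation R P I ==> a\<in>saturation R P I"
proof -
 note P = prime_facts[OF assms(1)] and I = ideal_facts[OF assms(2)]
 show "I<=saturation R P I" unfolding saturation_def using I(1) P(3) by (force intro: bexI[of _ \<one>])
 fix s a assume s: "s\<in>\<K>" "s~:P" "a\<in>\<K>" "s\<otimes>a\<in>saturation R P I"
 then obtain t where t: "t\<in>\<K>" "t~:P" "t\<otimes>(s\<otimes>a)\<in>I" unfolding saturation_def by auto
 have "t\<otimes>s~:P" using P(4) s t by blast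
 then show "a\<in>saturation R P I" unfolding saturation_def using s t by (auto simp: m_assoc intro!: bexI[of _ "t\<otimes>s"])
qed

lemma (in cring) colon_ideal:
 assumes "ideal I R" "a\<in>\<K>" shows "ideal {r\<in>\<K>. r\<otimes>a\<in>I} R"
proof (rule cidealI)
 note I = ideal_facts[OF assms(1)]
 fix r t assume "r\<in>{r\<in>\<K>. r\<otimes>a\<in>I}"
 then have r: "r\<in>\<K>" "r\<otimes>a\<in>I" by auto
 show "r\<oplus>t\<in>{r\<in>\<K>. r\<otimes>a\<in>I}" if "t\<in>{r\<in>\<K>. r\<otimes>a\<in>I}"
  using r that assms I(3) by (auto simp: l_distr)
 show "t\<otimes>r\<in>{r\<in>\<K>. r\<otimes>a\<in>I}" if "t\<in>\<K>" using r that assms I(4) by (auto simp: m_assoc)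
qed (use assms ideal_facts[OF assms(1)] in auto)

lemma (in noetherian_ring) ex_maximal_ideal_in:
 assumes "\<C>~={}" "!!I. I\<in>\<C> ==> ideal I R"
 shows "EX N:\<C>. ALL I:\<C>. N<=I --> I = N"
proof (rule subset_Zorn)
 fix C assume C: "subset.chain \<C> C"
 show "EX U:\<C>. ALL Y:C. Y<=U"
 proof (cases "C = {}")
  case True
  then show ?thesis using assms(1) by auto
 next
  case False
  have "subset.chain {I. ideal I R} C" using C assms(2) unfolding pred_on.chain_def by auto
  then have "\<Union>C\<in>C" using ideal_chain_is_trivial False by blast
  moreover have "\<Union>C\<in>\<C>" using C \<open>\<Union>C\<in>C\<close> unfolding pred_on.chain_def by auto
  ultimately show ?thesis by (intro bexI[of _ "\<Union>C"]) auto
 qed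
qed

locale noetherian_cring = noetherian_ring + cring

context noetherian_cring
begin

text \<open>The witness is any \<open>(I : a)\<close> that is maximal among those with \<open>a \<notin> I\<close>.\<close>

lemma ex_associated_prime:
 assumes "ideal I R" "I~=\<K>"
 shows "EX a:\<K>. a~:I & primeideal {r\<in>\<K>. r\<otimes>a\<in>I} R"
proof -
 note I = ideal_facts[OF assms(1)]
 define \<C> where "\<C> = {{r\<in>\<K>. r\<otimes>a\<in>I} | a. a\<in>\<K> - I}"
 have "\<C>~={}" "!!K. K\<in>\<C> ==> ideal K R" unfolding \<C>_def using assms I(1) colon_ideal by auto
 from ex_maximal_ideal_in[OF this] obtain a where a: "a\<in>\<K>" "a~:I"
  and mx: "!!c. c\<in>\<K> - I ==> {r\<in>\<K>. r\<otimes>a\<in>I}<={r\<in>\<K>. r\<otimes>c\<in>I}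
   ==> {r\<in>\<K>. r\<otimes>c\<in>I} = {r\<in>\<K>. r\<otimes>a\<in>I}" unfolding \<C>_def by auto
 have "primeideal {r\<in>\<K>. r\<otimes>a\<in>I} R"
 proof (rule primeidealI)
  show "ideal {r\<in>\<K>. r\<otimes>a\<in>I} R" by (rule colon_ideal[OF assms(1) a(1)])
  show "cring R" by (rule is_cring)
  have "\<one>~:{r\<in>\<K>. r\<otimes>a\<in>I}" using a by auto
  then show "\<K>~={r\<in>\<K>. r\<otimes>a\<in>I}" by blast
  fix b c assume bc: "b\<in>\<K>" "c\<in>\<K>" "b\<otimes>c\<in>{r\<in>\<K>. r\<otimes>a\<in>I}"
  show "b\<in>{r\<in>\<K>. r\<otimes>a\<in>I} \<or> c\<in>{r\<in>\<K>. r\<otimes>a\<in>I}"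
  proof (rule disjCI)
   assume "c~:{r\<in>\<K>. r\<otimes>a\<in>I}"
   then have ca: "c\<otimes>a\<in>\<K> - I" using a bc by auto
   have "r\<otimes>(c\<otimes>a) = c\<otimes>(r\<otimes>a)" if "r\<in>\<K>" for r using that bc a by algebra
   then have "{r\<in>\<K>. r\<otimes>a\<in>I}<={r\<in>\<K>. r\<otimes>(c\<otimes>a)\<in>I}" using I(4) bc by auto
   from mx[OF ca this] have "{r\<in>\<K>. r\<otimes>(c\<otimes>a)\<in>I} = {r\<in>\<K>. r\<otimes>a\<in>I}" .
   moreover have "b\<in>{r\<in>\<K>. r\<otimes>(c\<otimes>a)\<in>I}" using bc a by (auto simp: m_assoc)
   ultimately show "b\<in>{r\<in>\<K>. r\<otimes>a\<in>I}" by blast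
  qed
 qed
 with a show ?thesis by blast
qed

end

lemma (in ring) ideal_finsum:
 assumes "ideal I R" "!!x. x\<in>A ==> f x\<in>I" shows "(\<Oplus>x\<in>A. f x)\<in>I"
proof (cases "finite A")
 case True
 note I = ideal_facts[OF assms(1)]
 from True assms(2) show ?thesis
 proof (induction A rule: finite_induct)
  case (insert x F)
  then have "f\<in>F \<rightarrow> \<K>" "f x\<in>\<K>" using I(1) by auto
  then show ?case using insert I(3) by (subst finsum_insert) auto
 qed (use I in auto)
qed (use ideal_facts[OF assms(1)] in auto)

lemma (in cring) Idl_image_iff:
 assumes "finite I" "x ` I<=\<K>"
 shows "a\<in>Idl (x ` I) <-> (\<exists>c\<in>I \<rightarrow> \<K>. a = (\<Oplus>i\<in>I. c i\<otimes>x i))"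
proof
 note J = genideal_ideal[OF assms(2)]
 {
  assume "\<exists>c\<in>I \<rightarrow> \<K>. a = (\<Oplus>i\<in>I. c i\<otimes>x i)"
  then show "a\<in>Idl (x ` I)" using genideal_self[OF assms(2)] ideal_facts(4)[OF J] by (auto intro!: ideal_finsum[OF J])
 }
 assume "a\<in>Idl (x ` I)"
 from this assms(2) show "\<exists>c\<in>I \<rightarrow> \<K>. a = (\<Oplus>i\<in>I. c i\<otimes>x i)"
 proof (induction rule: Idl_induct)
  case (gen s)
  then obtain j where j: "j\<in>I" "s = x j" by auto
  have "(\<Oplus>i\<in>I. (if i = j then \<one> else \<zero>)\<otimes>x i) = (\<Oplus>i\<in>I. (if j = i then x i else \<zero>))"
   using assms by (intro finsum_cong') auto
  also have "... = x j" using j assms by (subst finsum_singleton) auto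
  finally show ?case using j by (intro bexI[of _ "%i. if i = j then \<one> else \<zero>"]) auto
 next
  case zero
  have "(\<Oplus>i\<in>I. \<zero>\<otimes>x i) = (\<Oplus>i\<in>I. \<zero>)" using assms by (intro finsum_cong') auto
  then show ?case by (intro bexI[of _ "%_. \<zero>"]) auto
 next
  case (add a b)
  then obtain c d where c: "c\<in>I \<rightarrow> \<K>" "a = (\<Oplus>i\<in>I. c i\<otimes>x i)"
   and d: "d\<in>I \<rightarrow> \<K>" "b = (\<Oplus>i\<in>I. d i\<otimes>x i)" by auto
  have "a\<oplus>b = (\<Oplus>i\<in>I. c i\<otimes>x i\<oplus>d i\<otimes>x i)"
   unfolding c(2) d(2) using c(1) d(1) assms by (subst finsum_addf) (auto simp: Pi_iff)
  also have "... = (\<Oplus>i\<in>I. (c i\<oplus>d i)\<otimes>x i)" using c(1) d(1) assms by (intro finsum_cong') (auto simp: l_distr Pi_iff)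
  finally show ?case using c d by (intro bexI[of _ "%i. c i\<oplus>d i"]) auto
 next
  case (mult a r)
  then obtain c where c: "c\<in>I \<rightarrow> \<K>" "a = (\<Oplus>i\<in>I. c i\<otimes>x i)" by auto
  have "r\<otimes>a = (\<Oplus>i\<in>I. (r\<otimes>c i)\<otimes>x i)" unfolding c(2) using c(1) assms mult
   by (subst finsum_rdistr) (auto simp: m_assoc Pi_iff intro!: finsum_cong')
  moreover have "a\<otimes>r = r\<otimes>a" using mult ideal_facts(1)[OF J] by (auto simp: m_comm)
  ultimately show ?case using c mult by (auto intro!: bexI[of _ "%i. r\<otimes>c i"])
 qed
qed

lemma (in cring) Idl_finite_iff:
 assumes "finite A" "A<=\<K>"
 shows "a\<in>Idl A <-> (\<exists>c\<in>A \<rightarrow> \<K>. a = (\<Oplus>x\<in>A. c x\<otimes>x))"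
 using Idl_image_iff[of A "%x. x" a] assms by simp

context noetherian_cring
begin

text \<open>\<open>P\<close> is minimal over \<open>I0\<close>, so the localization of
  \<open>R/I0\<close> at \<open>P\<close> is Artinian, and its ideals correspond to the saturated
  ideals above \<open>I0\<close>. Noetherian induction on a lower bound \<open>I\<close> of the
  chain: a bound that is maximal among the bad ones is enlarged by one element \<open>a\<close>
  whose annihilator modulo \<open>I\<close> is \<open>P\<close>.\<close>

lemma saturated_dcc:
 assumes P: "primeideal P R" and I0: "ideal I0 R"
  and only: "!!P'. primeideal P' R ==> I0<=P' ==> P'<=P ==> P' = P"
  and C: "!!n. ideal (C n) R" "!!n. saturation R P (C n) = C n" "!!n. C (Suc n)<=C n"
   "!!n. I0<=C n"
 shows "EX n. C (Suc n) = C n"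
proof -
 define good where "good I <-> (\<forall>C :: nat => 'a set. (ALL n. ideal (C n) R & saturation R P (C n) = C n &
  C (Suc n)<=C n & I<=C n) --> (EX N. \<forall>n\<ge>N. C n = C N))" for I
 define \<C> where "\<C> = {I. ideal I R & saturation R P I = I & I0<=I & \<not> good I}"
 have "\<C> = {}"
 proof (rule ccontr)
  assume "\<C>~={}"
  from ex_maximal_ideal_in[OF this] obtain I where IX: "I\<in>\<C>"
   and mx: "!!I'. I'\<in>\<C> ==> I<=I' ==> I' = I" unfolding \<C>_def by auto
  from IX have Ii: "ideal I R" and Is: "saturation R P I = I" and I0I: "I0<=I" and ng: "\<not> good I" unfolding \<C>_def by auto
  note I = ideal_facts[OF Ii]
  from ng obtain C :: "nat => 'a set" where C': "ALL n. ideal (C n) R & saturation R P (C n) = C n &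
    C (Suc n)<=C n & I<=C n" and nc': "\<not> (EX N. \<forall>n\<ge>N. C n = C N)"
   unfolding good_def not_all not_imp by (elim exE conjE) (rule that)
  have C: "!!n. ideal (C n) R" "!!n. saturation R P (C n) = C n"
   "!!n. C (Suc n)<=C n" "!!n. I<=C n" and nc: "!!N. \<exists>n\<ge>N. C n~=C N" using C' nc' by auto
  have anti: "C n<=C m" if "m<=n" for m n using that C(3) by (metis lift_Suc_antimono_le)
  have "I~=\<K>" using nc[of 0] C(4) ideal_facts(1)[OF C(1)] by blast
  then obtain a where a: "a\<in>\<K>" "a~:I" and pr: "primeideal {r\<in>\<K>. r\<otimes>a\<in>I} R"
   using ex_associated_prime[OF Ii] by auto
  have "{r\<in>\<K>. r\<otimes>a\<in>I}<=P" using a Is unfolding saturation_def by blast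
  moreover have "I0<={r\<in>\<K>. r\<otimes>a\<in>I}" using I0I I a ideal_facts(1)[OF I0] by auto
  \<comment> \<open>Locally at \<open>P\<close>, the element \<open>a\<close> spans a copy of the
    residue field modulo \<open>I\<close>: adjoining it changes a saturated ideal by at most one
    composition factor.\<close>
  ultimately have Pa: "{r\<in>\<K>. r\<otimes>a\<in>I} = P" using only pr by blast
  have sat: "c\<in>C n" if "s\<in>\<K>" "s~:P" "s\<otimes>c\<in>C n" "c\<in>\<K>" for s c n
   using saturation_facts(2)[OF P C(1), of s c n] that C(2) by simp
  define E where "E n = saturation R P (adjoin R (C n) a)" for n
  note aj = adjoin_ideal[OF C(1) a(1)] adjoin_facts[OF C(1) a(1)]
  have Eid: "ideal (E n) R" for n unfolding E_def by (rule saturation_ideal[OF P aj(1)])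
  have Esat: "saturation R P (E n) = E n" for n
  proof
   show "saturation R P (E n)<=E n"
   proof
    fix c assume "c\<in>saturation R P (E n)"
    then obtain s where "c\<in>\<K>" "s\<in>\<K>" "s~:P" "s\<otimes>c\<in>E n" unfolding saturation_def by auto
    then show "c\<in>E n" using saturation_facts(2)[OF P aj(1)] unfolding E_def by blast
   qed
   show "E n<=saturation R P (E n)" by (rule saturation_facts(1)[OF P Eid])
  qed
  have Edec: "E (Suc n)<=E n" for n
  proof -
   have "adjoin R (C (Suc n)) a<=adjoin R (C n) a" using C(3) unfolding adjoin_def by blast
   then show ?thesis unfolding E_def saturation_def by auto
  qed
  define I' where "I' = saturation R P (adjoin R I a)"
  have I'id: "ideal I' R" unfolding I'_def by (rule saturation_ideal[OF P adjoin_ideal[OF Ii a(1)]])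
  have I'sat: "saturation R P I' = I'"
  proof
   show "saturation R P I'<=I'"
   proof
    fix c assume "c\<in>saturation R P I'"
    then obtain s where "c\<in>\<K>" "s\<in>\<K>" "s~:P" "s\<otimes>c\<in>I'" unfolding saturation_def by auto
    then show "c\<in>I'" using saturation_facts(2)[OF P adjoin_ideal[OF Ii a(1)]] unfolding I'_def by blast
   qed
   show "I'<=saturation R P I'" by (rule saturation_facts(1)[OF P I'id])
  qed
  have aI': "a\<in>I'" "I<=I'"
   unfolding I'_def using saturation_facts(1)[OF P adjoin_ideal[OF Ii a(1)]] adjoin_facts(1,2)[OF Ii a(1)] by auto
  have "good I'" using mx[of I'] aI' a I'id I'sat I0I unfolding \<C>_def by blast
  moreover have "I'<=E n" for n
  proof -
   have "adjoin R I a<=adjoin R (C n) a" using C(4) unfolding adjoin_def by blast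
   then show ?thesis unfolding I'_def E_def saturation_def by auto
  qed
  ultimately obtain N where N: "!!n. n \<ge> N ==> E n = E N" unfolding good_def using Eid Esat Edec by meson
  \<comment> \<open>Beyond \<open>N\<close> the enlarged chain is constant. The ideals
    \<open>C n\<close> decrease, so \<open>a\<close> can drop out only once, and \<open>K\<close> is
    taken past that moment.\<close>
  obtain K where K: "K \<ge> N" "!!n. n \<ge> K ==> a\<in>C n <-> a\<in>C K"
  proof (cases "ALL n. a\<in>C n")
   case True
   then show ?thesis using that[of N] by auto
  next
   case False
   then obtain m where "a~:C m" by auto
   then show ?thesis using anti that[of "max m N"] by (meson max.cobounded1 max.cobounded2 subsetD order_trans)
  qed
  have "C n = C K" if n: "n \<ge> K" for n
  proof
   show "C n<=C K" using anti n by auto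
   show "C K<=C n"
   proof
    fix c assume c: "c\<in>C K"
    have cc: "c\<in>\<K>" using c ideal_facts(1)[OF C(1)] by auto
    have "c\<in>E K" unfolding E_def using saturation_facts(1)[OF P aj(1)] aj(2) c by blast
    then have "c\<in>E n" using N K(1) n by (metis le_trans)
    then obtain s where s: "s\<in>\<K>" "s~:P" "s\<otimes>c\<in>adjoin R (C n) a" unfolding E_def saturation_def by auto
    then obtain c' r where c': "c'\<in>C n" "r\<in>\<K>" "s\<otimes>c = c'\<oplus>r\<otimes>a" unfolding adjoin_def by auto
    have c'c: "c'\<in>\<K>" using c' ideal_facts(1)[OF C(1)] by auto
    have "r\<otimes>a\<in>C n"
    proof (cases "a\<in>C n")
     case True
     then show ?thesis using ideal_facts(4)[OF C(1)] c' by blast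
    next
     case False
     then have aK: "a~:C K" using K(2)[OF n] by blast
     have "c'\<in>C K" using anti n c' by blast
     moreover have "s\<otimes>c\<in>C K" using c s ideal_facts(4)[OF C(1)] by blast
     ultimately have "r\<otimes>a\<in>C K" using ideal_add_cancel[OF C(1), of c' "r\<otimes>a" K] c'(2) a(1) unfolding c'(3) by blast
     \<comment> \<open>A multiplier outside \<open>P\<close> would put \<open>a\<close> into the
       saturated ideal \<open>C K\<close>. Hence \<open>r\<close> lies in \<open>P\<close>, and
       \<open>P a\<close> lies in \<open>I\<close> by the choice of \<open>a\<close>.\<close>
     then have "r\<in>P" using sat[OF c'(2) _ _ a(1)] aK by auto
     then have "r\<otimes>a\<in>I" unfolding Pa[symmetric] by auto
     then show ?thesis using C(4) by blast
    qed
    then have "s\<otimes>c\<in>C n" using c' ideal_facts(3)[OF C(1)] by auto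
    then show "c\<in>C n" using sat s cc by blast
   qed
  qed
  then show False using nc[of K] by blast
 qed
 moreover have "saturation R P (saturation R P I0) = saturation R P I0" (is "?l = ?r")
 proof
  show "?l<=?r"
  proof
   fix c assume "c\<in>?l"
   then obtain s where "c\<in>\<K>" "s\<in>\<K>" "s~:P" "s\<otimes>c\<in>?r" by (subst (asm) (1) saturation_def) auto
   then show "c\<in>?r" using saturation_facts(2)[OF P I0] by blast
  qed
  show "?r<=?l" by (rule saturation_facts(1)[OF P saturation_ideal[OF P I0]])
 qed
 ultimately have "good (saturation R P I0)" using saturation_ideal[OF P I0] saturation_facts(1)[OF P I0] unfolding \<C>_def by blast
 moreover have "saturation R P I0<=C n" for n
 proof -
  have "saturation R P I0<=saturation R P (C n)" using C(4) unfolding saturation_def by blast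
  then show ?thesis using C(2) by simp
 qed
 ultimately obtain N where "\<forall>n\<ge>N. C n = C N" unfolding good_def using C by meson
 then show ?thesis by (metis le_SucI le_refl)
qed

text \<open>Nakayama's lemma after localization at \<open>P\<close>, without localizing: one generator is eliminated at a
  time. The ideal \<open>I\<close> below stands for a subset of the maximal ideal.\<close>

lemma nakayama_aux:
 assumes P: "primeideal P R" and IP: "I<=P" "ideal I R" and N: "ideal N R"
 shows "finite A ==> A<=\<K> ==>
  (!!a. a\<in>A ==> \<exists>s\<in>\<K> - P. \<exists>c\<in>A \<rightarrow> I. EX n:N. s\<otimes>a = (\<Oplus>x\<in>A. c x\<otimes>x)\<oplus>n) ==>
  A<=saturation R P N"
proof (induction A rule: finite_induct)
 case (insert w A)
 note Pf = prime_facts[OF P] and If = ideal_facts[OF IP(2)] and Nf = ideal_facts[OF N]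
 have Ac: "A<=\<K>" and wc: "w\<in>\<K>" using insert by auto
 obtain s c n where s: "s\<in>\<K>" "s~:P" and c: "c\<in>insert w A \<rightarrow> I" and n: "n\<in>N"
  and sw: "s\<otimes>w = (\<Oplus>x\<in>insert w A. c x\<otimes>x)\<oplus>n" using insert.prems(2)[of w] by auto
 have cc: "c x\<in>\<K>" if "x\<in>insert w A" for x using that c If(1) by auto
 have cw: "c w\<in>\<K>" using cc by auto
 have nc: "n\<in>\<K>" using n Nf by auto
 define \<Sigma> where "\<Sigma> = (\<Oplus>x\<in>A. c x\<otimes>x)"
 have \<Sigma>c: "\<Sigma>\<in>\<K>" unfolding \<Sigma>_def using Ac cc by (intro finsum_closed) auto
 \<comment> \<open>The pivot that eliminates \<open>w\<close> from the other relations. It stays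
   outside \<open>P\<close> because \<open>c w\<close> lies in \<open>I\<close>, hence in
   \<open>P\<close>.\<close>
 define t where "t = s\<ominus>c w"
 have tc: "t\<in>\<K>" unfolding t_def using s cc by auto
 have tP: "t~:P"
 proof
  assume "t\<in>P"
  moreover have "c w\<in>P" using c IP by auto
  ultimately have "t\<oplus>c w\<in>P" using ideal_facts(3)[OF Pf(1)] by auto
  moreover have "t\<oplus>c w = s" unfolding t_def using s cw by (simp add: minus_eq a_assoc l_neg)
  ultimately show False using s by auto
 qed
 have sw': "s\<otimes>w = (c w\<otimes>w\<oplus>\<Sigma>)\<oplus>n" unfolding sw \<Sigma>_def using insert.hyps Ac wc cc by (subst finsum_insert) auto
 have tw: "t\<otimes>w = \<Sigma>\<oplus>n"
 proof -
  have "t\<otimes>w = s\<otimes>w\<ominus>c w\<otimes>w" unfolding t_def using s wc cw by algebra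
  also have "... = \<Sigma>\<oplus>n" unfolding sw' using \<Sigma>c nc wc cw by algebra
  finally show ?thesis .
 qed
 have "A<=saturation R P N"
 proof (rule insert.IH[OF Ac])
  fix a assume a: "a\<in>A"
  have ac: "a\<in>\<K>" using a Ac by auto
  obtain s' d m where s': "s'\<in>\<K>" "s'~:P" and d: "d\<in>insert w A \<rightarrow> I" and m: "m\<in>N"
   and sa: "s'\<otimes>a = (\<Oplus>x\<in>insert w A. d x\<otimes>x)\<oplus>m" using insert.prems(2)[of a] a by auto
  have dc: "d x\<in>\<K>" if "x\<in>insert w A" for x using that d If(1) by auto
  have dw: "d w\<in>\<K>" using dc by auto
  have mc: "m\<in>\<K>" using m Nf by auto
  define \<Delta> where "\<Delta> = (\<Oplus>x\<in>A. d x\<otimes>x)"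
  have \<Delta>c: "\<Delta>\<in>\<K>" unfolding \<Delta>_def using Ac dc by (intro finsum_closed) auto
  have sa': "s'\<otimes>a = (d w\<otimes>w\<oplus>\<Delta>)\<oplus>m"
   unfolding sa \<Delta>_def using insert.hyps Ac wc dc by (subst finsum_insert) auto
  have "t\<otimes>s'\<otimes>a = t\<otimes>(s'\<otimes>a)" using tc s' ac by algebra
  also have "... = d w\<otimes>(t\<otimes>w)\<oplus>t\<otimes>\<Delta>\<oplus>t\<otimes>m" unfolding sa' using tc dw wc \<Delta>c mc by algebra
  also have "... = (t\<otimes>\<Delta>\<oplus>d w\<otimes>\<Sigma>)\<oplus>(d w\<otimes>n\<oplus>t\<otimes>m)"
   unfolding tw using tc dw wc \<Delta>c mc nc \<Sigma>c by algebra
  also have "t\<otimes>\<Delta> = (\<Oplus>x\<in>A. t\<otimes>d x\<otimes>x)"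
   unfolding \<Delta>_def using insert.hyps Ac dc tc by (subst finsum_rdistr) (auto intro!: finsum_cong' simp: m_assoc subset_iff)
  also have "d w\<otimes>\<Sigma> = (\<Oplus>x\<in>A. d w\<otimes>c x\<otimes>x)"
   unfolding \<Sigma>_def using insert.hyps Ac dc cc by (subst finsum_rdistr) (auto intro!: finsum_cong' simp: m_assoc subset_iff)
  also have "(\<Oplus>x\<in>A. t\<otimes>d x\<otimes>x)\<oplus>(\<Oplus>x\<in>A. d w\<otimes>c x\<otimes>x) = (\<Oplus>x\<in>A. t\<otimes>d x\<otimes>x\<oplus>d w\<otimes>c x\<otimes>x)"
   using Ac dc cc tc by (subst finsum_addf) auto
  also have "... = (\<Oplus>x\<in>A. (t\<otimes>d x\<oplus>d w\<otimes>c x)\<otimes>x)"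
   using Ac dc cc tc by (intro finsum_cong') (auto simp: l_distr subset_iff)
  finally have eq: "t\<otimes>s'\<otimes>a = (\<Oplus>x\<in>A. (t\<otimes>d x\<oplus>d w\<otimes>c x)\<otimes>x)\<oplus>(d w\<otimes>n\<oplus>t\<otimes>m)" .
  have "t\<otimes>s'\<in>\<K> - P" using Pf(4) tc tP s' by blast
  moreover have "(%x. t\<otimes>d x\<oplus>d w\<otimes>c x)\<in>A \<rightarrow> I"
  proof
   fix x assume x: "x\<in>A"
   then have "t\<otimes>d x\<in>I" using d tc If(4) by auto
   moreover have "d w\<otimes>c x\<in>I" using dw c x If(4) by auto
   ultimately show "t\<otimes>d x\<oplus>d w\<otimes>c x\<in>I" by (rule If(3))
  qed
  moreover have "d w\<otimes>n\<oplus>t\<otimes>m\<in>N" using dw n tc m Nf(3,4) by auto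
  ultimately show "\<exists>s\<in>\<K> - P. \<exists>c\<in>A \<rightarrow> I. EX n:N. s\<otimes>a = (\<Oplus>x\<in>A. c x\<otimes>x)\<oplus>n"
   using eq by (intro bexI[of _ "t\<otimes>s'"] bexI[of _ "%x. t\<otimes>d x\<oplus>d w\<otimes>c x"] bexI[of _ "d w\<otimes>n\<oplus>t\<otimes>m"])
 qed
 moreover have "w\<in>saturation R P N"
 proof -
  note S = saturation_ideal[OF P N]
  have "\<Sigma>\<in>saturation R P N"
   unfolding \<Sigma>_def using cc Ac \<open>A<=saturation R P N\<close> ideal_facts(4)[OF S] by (intro ideal_finsum[OF S]) auto
  then have "t\<otimes>w\<in>saturation R P N" unfolding tw using n saturation_facts(1)[OF P N] ideal_facts(3)[OF S] by auto
  then show ?thesis using saturation_facts(2)[OF P N tc tP wc] by auto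
 qed
 ultimately show ?case by auto
qed auto

lemma ideal_prod_Idl_finite:
 assumes "ideal I R" "finite A" "A<=\<K>" "q\<in>I \<cdot> (Idl A)"
 shows "\<exists>c\<in>A \<rightarrow> I. q = (\<Oplus>x\<in>A. c x\<otimes>x)" using assms(4)
proof (induction rule: ideal_prod.induct)
 note I = ideal_facts[OF assms(1)]
 case (prod i j)
 then obtain c where c: "c\<in>A \<rightarrow> \<K>" "j = (\<Oplus>x\<in>A. c x\<otimes>x)" using Idl_finite_iff[OF assms(2,3)] by auto
 have "i\<otimes>j = (\<Oplus>x\<in>A. (i\<otimes>c x)\<otimes>x)" unfolding c(2) using c(1) assms prod I(1)
  by (subst finsum_rdistr) (auto simp: m_assoc Pi_iff subset_iff intro!: finsum_cong')
 then show ?case using c prod by (intro bexI[of _ "%x. i\<otimes>c x"]) (auto intro!: I(5))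
next
 note I = ideal_facts[OF assms(1)]
 case (sum a b)
 then obtain c d where c: "c\<in>A \<rightarrow> I" "a = (\<Oplus>x\<in>A. c x\<otimes>x)" and d: "d\<in>A \<rightarrow> I" "b = (\<Oplus>x\<in>A. d x\<otimes>x)"
  by auto
 have cc: "c x\<in>\<K>" "d x\<in>\<K>" if "x\<in>A" for x using that c d I by auto
 have "a\<oplus>b = (\<Oplus>x\<in>A. c x\<otimes>x\<oplus>d x\<otimes>x)"
  unfolding c(2) d(2) using cc assms by (subst finsum_addf) (auto simp: Pi_iff)
 also have "... = (\<Oplus>x\<in>A. (c x\<oplus>d x)\<otimes>x)" using cc assms by (intro finsum_cong') (auto simp: l_distr subset_iff)
 finally show ?case using c d by (intro bexI[of _ "%x. c x\<oplus>d x"]) (auto intro!: I(3))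
qed

lemma saturation_prime:
 assumes "primeideal P R" "primeideal Q R" "P<=Q" shows "saturation R Q P = P"
proof
 show "saturation R Q P<=P" unfolding saturation_def using prime_facts(4)[OF assms(1)] assms(3) by blast
 show "P<=saturation R Q P" by (rule saturation_facts(1)[OF assms(2) prime_facts(1)[OF assms(1)]])
qed

end

context noetherian_cring
begin

text \<open>Krull's principal ideal theorem. The ideals \<open>Qs n\<close> are symbolic powers of \<open>Q\<close> modulo
  \<open>P0\<close>.\<close>

lemma principal_ideal_theorem:
 assumes P0: "primeideal P0 R" and Q: "primeideal Q R" and P: "primeideal P R"
  and lt: "P0 \<subset> Q" "Q \<subset> P" and x: "x\<in>P"
 shows "EX P'. primeideal P' R & P0<=P' & x\<in>P' & P' \<subset> P"
proof (rule ccontr)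
 \<comment> \<open>So \<open>P\<close> is minimal over \<open>P0 + (x)\<close>, and
   \<open>saturated_dcc\<close> applies to the saturated chains above that ideal.\<close>
 assume contr: "\<not> ?thesis"
 then have xQ: "x~:Q" using Q lt by auto
 note P0f = prime_facts[OF P0] and Qf = prime_facts[OF Q] and Pf = prime_facts[OF P]
 have xc: "x\<in>\<K>" using x ideal_facts(1)[OF Pf(1)] by auto
 define Qs where "Qs = rec_nat Q (%_ A. saturation R Q (P0 <+> Q \<cdot> A))"
 have Qs0: "Qs 0 = Q" and QsS: "Qs (Suc n) = saturation R Q (P0 <+> Q \<cdot> Qs n)" for n unfolding Qs_def by auto
 have Qid: "ideal (Qs n) R" for n
 proof (induction n)
  case 0
  then show ?case unfolding Qs0 by (rule Qf(1))
 next
  case (Suc n)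
  show ?case unfolding QsS by (intro saturation_ideal[OF Q] add_ideals P0f ideal_prod_is_ideal Qf(1) Suc)
 qed
 have sid: "ideal (P0 <+> Q \<cdot> Qs n) R" for n by (intro add_ideals P0f ideal_prod_is_ideal Qf(1) Qid)
 have Qsat: "a\<in>Qs n" if "s\<in>\<K>" "s~:Q" "a\<in>\<K>" "s\<otimes>a\<in>Qs n" for n s a
 proof (cases n)
  case 0
  then show ?thesis using that Qs0 Qf(4) by auto
 next
  case (Suc m)
  show ?thesis using saturation_facts(2)[OF Q sid that(1,2,3)] that(4) unfolding Suc QsS by blast
 qed
 have sub1: "P0<=P0 <+> Q \<cdot> Qs n" "Q \<cdot> Qs n<=P0 <+> Q \<cdot> Qs n" for n
 proof -
  note f = ideal_facts[OF P0f(1)] and g = ideal_facts[OF ideal_prod_is_ideal[OF Qf(1) Qid[of n]]]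
  show "P0<=P0 <+> Q \<cdot> Qs n"
  proof
   fix a assume "a\<in>P0"
   then have "a\<in>P0" "a = a\<oplus>\<zero>" using f(1) by auto
   then show "a\<in>P0 <+> Q \<cdot> Qs n" unfolding set_add_def' using g(2) by blast
  qed
  show "Q \<cdot> Qs n<=P0 <+> Q \<cdot> Qs n"
  proof
   fix a assume "a\<in>Q \<cdot> Qs n"
   then have "a\<in>Q \<cdot> Qs n" "a = \<zero>\<oplus>a" using g(1) by auto
   then show "a\<in>P0 <+> Q \<cdot> Qs n" unfolding set_add_def' using f(2) by blast
  qed
 qed
 have P0Q: "P0<=Qs n" for n
 proof (cases n)
  case 0
  then show ?thesis using lt Qs0 by auto
 next
  case (Suc m)
  then show ?thesis using sub1(1)[of m] saturation_facts(1)[OF Q sid[of m]] QsS[of m] by auto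
 qed
 have dec: "Qs (Suc n)<=Qs n" for n
 proof
  fix a assume "a\<in>Qs (Suc n)"
  then obtain s where s: "s\<in>\<K>" "s~:Q" "a\<in>\<K>" "s\<otimes>a\<in>P0 <+> Q \<cdot> Qs n" unfolding QsS saturation_def by auto
  have "P0 <+> Q \<cdot> Qs n<=Qs n" using P0Q[of n] ideal_prod_inter[OF Qf(1) Qid[of n]]
   unfolding set_add_def' by (auto intro!: ideal_facts(3)[OF Qid[of n]])
  then have "s\<otimes>a\<in>Qs n" using s(4) by (rule subsetD)
  then show "a\<in>Qs n" by (rule Qsat[OF s(1,2,3)])
 qed
 define C where "C n = saturation R P (adjoin R (Qs n) x)" for n
 note aj = adjoin_ideal[OF Qid xc] and aj' = adjoin_facts[OF Qid xc]
 have "EX n. C (Suc n) = C n"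
 proof (rule saturated_dcc[OF P adjoin_ideal[OF P0f(1) xc]])
  fix P' assume P': "primeideal P' R" "adjoin R P0 x<=P'" "P'<=P"
  then have "P0<=P'" "x\<in>P'" using adjoin_facts(1,2)[OF P0f(1) xc] by auto
  then show "P' = P" using contr P' by auto
 next
  fix n
  show "ideal (C n) R" unfolding C_def by (rule saturation_ideal[OF P aj])
  show "saturation R P (C n) = C n"
  proof
   show "saturation R P (C n)<=C n"
   proof
    fix c assume "c\<in>saturation R P (C n)"
    then obtain s where "c\<in>\<K>" "s\<in>\<K>" "s~:P" "s\<otimes>c\<in>C n" by (subst (asm) saturation_def) auto
    then show "c\<in>C n" using saturation_facts(2)[OF P aj] unfolding C_def by blast
   qed
   show "C n<=saturation R P (C n)" by (rule saturation_facts(1)[OF P \<open>ideal (C n) R\<close>])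
  qed
  have "adjoin R (Qs (Suc n)) x<=adjoin R (Qs n) x" using dec unfolding adjoin_def by blast
  then show "C (Suc n)<=C n" unfolding C_def saturation_def by auto
  have "adjoin R P0 x<=adjoin R (Qs n) x" using P0Q unfolding adjoin_def by blast
  then show "adjoin R P0 x<=C n" unfolding C_def using saturation_facts(1)[OF P aj] by blast
 qed
 then obtain n where n: "C (Suc n) = C n" by auto
 obtain A where A: "A<=\<K>" "finite A" "Qs n = Idl A" using finetely_gen[OF Qid[of n]] by auto
 have AQ: "A<=Qs n" using A genideal_self by auto
 have xid: "PIdl x<=P" "ideal (PIdl x) R" using cgenideal_minimal[OF Pf(1) x] cgenideal_ideal[OF xc] by auto
 \<comment> \<open>\<open>C (Suc n) = C n\<close> places \<open>Qs n\<close> inside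
   \<open>Qs (Suc n) + (x)\<close>, locally at \<open>P\<close>. As \<open>x\<close> is outside
   \<open>Q\<close>, the cofactor of \<open>x\<close> again lies in \<open>Qs n\<close>, and
   Nakayama with the ideal \<open>(x)\<close> removes this term.\<close>
 have "A<=saturation R P (Qs (Suc n))"
 proof (rule nakayama_aux[OF P xid Qid A(2,1)])
  fix a assume a: "a\<in>A"
  have ac: "a\<in>\<K>" using a A by auto
  have "a\<in>C n" unfolding C_def using a AQ aj' saturation_facts(1)[OF P aj] by blast
  then have "a\<in>C (Suc n)" using n by simp
  then obtain s where s: "s\<in>\<K>" "s~:P" "s\<otimes>a\<in>adjoin R (Qs (Suc n)) x" unfolding C_def saturation_def by auto
  then obtain q r where q: "q\<in>Qs (Suc n)" "r\<in>\<K>" "s\<otimes>a = q\<oplus>r\<otimes>x" unfolding adjoin_def by auto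
  have qc: "q\<in>\<K>" using q ideal_facts(1)[OF Qid] by auto
  have "s\<otimes>a\<in>Qs n" using s a AQ ideal_facts(4)[OF Qid] by auto
  then have "r\<otimes>x\<in>Qs n" using ideal_add_cancel[OF Qid, of q "r\<otimes>x" n] q dec xc by auto
  then have "r\<in>Qs n" using Qsat[OF xc xQ q(2)] q(2) xc by (simp add: m_comm)
  then obtain c where c: "c\<in>A \<rightarrow> \<K>" "r = (\<Oplus>z\<in>A. c z\<otimes>z)"
   unfolding A(3) using Idl_finite_iff[OF A(2,1)] by auto
  have cc: "c z\<in>\<K>" "z\<in>\<K>" if "z\<in>A" for z using c that A by auto
  have "r\<otimes>x = (\<Oplus>z\<in>A. (c z\<otimes>x)\<otimes>z)"
  proof -
   have "r\<otimes>x = (\<Oplus>z\<in>A. c z\<otimes>z\<otimes>x)" unfolding c(2) using A cc xc by (subst finsum_ldistr) (auto intro!: finsum_cong')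
   also have "... = (\<Oplus>z\<in>A. (c z\<otimes>x)\<otimes>z)"
   proof (rule finsum_cong')
    fix z assume "z\<in>A"
    then show "c z\<otimes>z\<otimes>x = c z\<otimes>x\<otimes>z" using cc[of z] xc by (simp add: m_ac)
   qed (use cc xc in auto)
   finally show ?thesis .
  qed
  moreover have "s\<otimes>a = r\<otimes>x\<oplus>q" unfolding q(3) using q(2) xc qc by (simp add: a_comm)
  ultimately have "s\<otimes>a = (\<Oplus>z\<in>A. (c z\<otimes>x)\<otimes>z)\<oplus>q" by simp
  moreover have "(%z. c z\<otimes>x)\<in>A \<rightarrow> PIdl x" using cc unfolding cgenideal_def by auto
  ultimately show "\<exists>s\<in>\<K> - P. \<exists>c\<in>A \<rightarrow> PIdl x. \<exists>n'\<in>Qs (Suc n). s\<otimes>a = (\<Oplus>x\<in>A. c x\<otimes>x)\<oplus>n'"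
   using s q(1) by (intro bexI[of _ s] bexI[of _ "%z. c z\<otimes>x"] bexI[of _ q]) auto
 qed
 have AQ': "A<=Qs (Suc n)"
 proof
  fix a assume "a\<in>A"
  then obtain s where s: "s\<in>\<K>" "s~:P" "a\<in>\<K>" "s\<otimes>a\<in>Qs (Suc n)"
   using \<open>A<=saturation R P (Qs (Suc n))\<close> unfolding saturation_def by auto
  have "s~:Q" using s(2) lt by auto
  then show "a\<in>Qs (Suc n)" by (rule Qsat[OF s(1) _ s(3,4)])
 qed
 \<comment> \<open>Now locally at \<open>Q\<close>: \<open>Qs n\<close> lies in
   \<open>P0 + Q (Qs n)\<close>, and a second use of Nakayama puts it into
   \<open>P0\<close>.\<close>
 have "A<=saturation R Q P0"
 proof (rule nakayama_aux[OF Q subset_refl Qf(1) P0f(1) A(2,1)])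
  fix a assume a: "a\<in>A"
  have "a\<in>saturation R Q (P0 <+> Q \<cdot> Qs n)" using subsetD[OF AQ' a] unfolding QsS .
  then obtain s where s: "s\<in>\<K>" "s~:Q" "s\<otimes>a\<in>P0 <+> Q \<cdot> Qs n" unfolding saturation_def by blast
  then obtain p q where pq: "p\<in>P0" "q\<in>Q \<cdot> Qs n" "s\<otimes>a = p\<oplus>q" unfolding set_add_def' by auto
  from ideal_prod_Idl_finite[OF Qf(1) A(2,1)] pq(2) obtain c where c: "c\<in>A \<rightarrow> Q" "q = (\<Oplus>x\<in>A. c x\<otimes>x)"
   unfolding A(3) by blast
  have "p\<in>\<K>" "q\<in>\<K>"
   using pq(1,2) ideal_facts(1)[OF P0f(1)] ideal_facts(1)[OF ideal_prod_is_ideal[OF Qf(1) Qid[of n]]] by blast+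
  then have "s\<otimes>a = q\<oplus>p" using pq by (simp add: a_comm)
  then show "\<exists>s\<in>\<K> - Q. \<exists>c\<in>A \<rightarrow> Q. EX n:P0. s\<otimes>a = (\<Oplus>x\<in>A. c x\<otimes>x)\<oplus>n"
   using s c pq(1) by (intro bexI[of _ s] bexI[of _ c] bexI[of _ p]) auto
 qed
 then have "A<=P0" using saturation_prime[OF P0 Q] lt by auto
 then have "Qs n<=P0" unfolding A(3) by (intro genideal_minimal P0f(1))
 \<comment> \<open>\<open>P0\<close> is prime and contains the product of \<open>Q\<close> and
   \<open>Qs m\<close>, so the inclusion descends to \<open>Qs 0 = Q\<close> and contradicts the
   strict chain.\<close>
 moreover have "Qs m<=P0 ==> Q<=P0" for m
 proof (induction m)
  case (Suc m)
  have "Q \<cdot> Qs m<=P0" using Suc.prems sub1(2)[of m] saturation_facts(1)[OF Q sid[of m]] unfolding QsS by blast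
  have "q\<in>P0 \<or> a\<in>P0" if "q\<in>Q" "a\<in>Qs m" for q a
  proof (rule P0f(4))
   show "q\<otimes>a\<in>P0" using ideal_prod.prod[OF that, of R] \<open>Q \<cdot> Qs m<=P0\<close> by auto
  qed (use that ideal_facts(1)[OF Qf(1)] ideal_facts(1)[OF Qid[of m]] in auto)
  then show ?case using Suc.IH by blast
 qed (simp add: Qs0)
 ultimately show False using lt by blast
qed

end

section \<open>Chains of primes and dimension relative to an ideal\<close>

definition prime_chain :: "('a, 'm) ring_scheme => nat => (nat => 'a set) => bool"
 where "prime_chain R n P <-> (\<forall>i\<le>n. primeideal (P i) R) & (\<forall>i<n. P i \<subset> P (Suc i))"

text \<open>This is \<open>dim R/I >= n\<close>; the relative form replaces the passage to quotient
  rings in all inductions on the dimension.\<close>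

definition chain_above :: "('a, 'm) ring_scheme => 'a set => nat => bool"
 where "chain_above R I n <-> (EX P. prime_chain R n P & I<=P 0)"

lemma prime_chain_snoc:
 assumes "prime_chain R n P" "primeideal Q R" "P n \<subset> Q" shows "prime_chain R (Suc n) (P(Suc n := Q))"
 using assms unfolding prime_chain_def by (auto simp: le_Suc_eq less_Suc_eq)

context noetherian_cring
begin

text \<open>By the principal ideal theorem, the second member of a chain can be moved so that it
  contains \<open>x\<close>, working down from the top.\<close>

lemma prime_chain_adjoin:
 "prime_chain R (Suc n) P ==> x\<in>P (Suc n) ==>
  EX P'. prime_chain R n P' & P' n = P (Suc n) & P 0<=P' 0 & x\<in>P' 0"
proof (induction n arbitrary: P)
 case 0
 then show ?case by (intro exI[of _ "%_. P 1"]) (auto simp: prime_chain_def)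
next
 case (Suc n)
 note c = Suc.prems(1)
 have top: "primeideal (P (Suc (Suc n))) R" "P (Suc n) \<subset> P (Suc (Suc n))" using c unfolding prime_chain_def by auto
 have "EX Q. primeideal Q R & P n \<subset> Q & Q \<subset> P (Suc (Suc n)) & x\<in>Q"
 proof (cases "x\<in>P (Suc n)")
  case True
  then show ?thesis using c unfolding prime_chain_def by (intro exI[of _ "P (Suc n)"]) auto
 next
  case False
  have pr: "primeideal (P n) R" "primeideal (P (Suc n)) R" "P n \<subset> P (Suc n)" using c unfolding prime_chain_def by auto
  obtain Q where Q: "primeideal Q R" "P n<=Q" "x\<in>Q" "Q \<subset> P (Suc (Suc n))"
   using principal_ideal_theorem[OF pr(1,2) top(1) pr(3) top(2) Suc.prems(2)] by auto
  moreover have "x~:P n" using False pr by auto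
  ultimately show ?thesis by blast
 qed
 then obtain Q where Q: "primeideal Q R" "P n \<subset> Q" "Q \<subset> P (Suc (Suc n))" "x\<in>Q" by auto
 have "prime_chain R n P" using c unfolding prime_chain_def by auto
 from Suc.IH[OF prime_chain_snoc[OF this Q(1,2)]] Q(4)
 obtain P' where P': "prime_chain R n P'" "P' n = Q" "P 0<=P' 0" "x\<in>P' 0" by auto
 have "prime_chain R (Suc n) (P'(Suc n := P (Suc (Suc n))))" by (rule prime_chain_snoc[OF P'(1) top(1)]) (use P' Q in auto)
 then show ?case using P' by (intro exI[of _ "P'(Suc n := P (Suc (Suc n)))"]) (simp add: fun_upd_def)
qed

end

section \<open>Noetherian local rings: Nakayama's lemma and dimension bounds\<close>

locale noetherian_local_ring = noetherian_cring +
 fixes M assumes M_maximal: "maximalideal M R" and M_unique: "!!N. maximalideal N R ==> N = M"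
begin

lemma M_prime: "primeideal M R" by (rule maximalideal_prime[OF M_maximal])

lemmas M_ideal = prime_facts(1)[OF M_prime]
lemmas M_carr = ideal_facts(1)[OF M_ideal]

lemma one_not_M: "\<one>~:M" by (rule prime_facts(3)[OF M_prime])

lemma proper_ideal_sub_M:
 assumes "ideal I R" "I~=carrier R" shows "I<=M"
proof -
 define X' where "X' = {K. ideal K R & I<=K & K~=carrier R}"
 have "X'~={}" "!!K. K\<in>X' ==> ideal K R" unfolding X'_def using assms by auto
 from ex_maximal_ideal_in[OF this] obtain N where N: "N\<in>X'" "ALL K:X'. N<=K --> K = N" by blast
 have "maximalideal N R"
 proof (rule maximalidealI)
  show "ideal N R" "carrier R~=N" using N(1) unfolding X'_def by auto
  fix K assume "ideal K R" "N<=K" "K<=carrier R"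
  then show "K = N \<or> K = carrier R" using N unfolding X'_def by blast
 qed
 then have "N = M" by (rule M_unique)
 then show ?thesis using N(1) unfolding X'_def by simp
qed

lemma Units_iff: "a\<in>Units R <-> a\<in>carrier R & a~:M"
proof
 assume a: "a\<in>Units R"
 have "a~:M"
 proof
  assume "a\<in>M"
  from ideal_facts(4)[OF M_ideal this, of "inv a"] a show False using one_not_M by simp
 qed
 then show "a\<in>carrier R & a~:M" using a by auto
next
 assume a: "a\<in>carrier R & a~:M"
 have "PIdl a = carrier R" using proper_ideal_sub_M[OF cgenideal_ideal] cgenideal_self a by blast
 then have "\<one>\<in>PIdl a" by simp
 then obtain r where "r\<in>carrier R" "\<one> = r\<otimes>a" unfolding cgenideal_def by auto
 then show "a\<in>Units R" using a unfolding Units_def by (auto intro!: bexI[of _ r] simp: m_comm)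
qed

lemma nakayama:
 assumes "ideal A R" "ideal N R" "!!a. a\<in>A ==> \<exists>q\<in>M \<cdot> A. EX n:N. a = q\<oplus>n"
 shows "A<=N"
proof -
 obtain S where S: "S<=carrier R" "finite S" "A = Idl S" using finetely_gen[OF assms(1)] by auto
 have "S<=saturation R M N"
 proof (rule nakayama_aux[OF M_prime subset_refl M_ideal assms(2) S(2,1)])
  fix a assume a: "a\<in>S"
  then have "a\<in>A" using S genideal_self by auto
  then obtain q n where q: "q\<in>M \<cdot> A" "n\<in>N" "a = q\<oplus>n" using assms(3) by blast
  from ideal_prod_Idl_finite[OF M_ideal S(2,1)] q(1)[unfolded S(3)]
  obtain c where c: "c\<in>S \<rightarrow> M" "q = (\<Oplus>x\<in>S. c x\<otimes>x)" by blast
  have "\<one>\<otimes>a = (\<Oplus>x\<in>S. c x\<otimes>x)\<oplus>n" using q c a S by auto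
  then show "\<exists>s\<in>carrier R - M. \<exists>c\<in>S \<rightarrow> M. EX n:N. s\<otimes>a = (\<Oplus>x\<in>S. c x\<otimes>x)\<oplus>n"
   using c(1) q(2) one_not_M by (intro bexI[of _ \<one>] bexI[of _ c] bexI[of _ n]) auto
 qed
 moreover have "saturation R M N<=N"
 proof
  fix a assume "a\<in>saturation R M N"
  then obtain s where s: "a\<in>carrier R" "s\<in>carrier R" "s~:M" "s\<otimes>a\<in>N" unfolding saturation_def by auto
  then have "s\<in>Units R" using Units_iff by auto
  then have "a = inv s\<otimes>(s\<otimes>a)" using s by (simp add: m_assoc[symmetric])
  then show "a\<in>N" using s \<open>s\<in>Units R\<close> ideal_facts(4)[OF assms(2)] by (metis Units_inv_closed)
 qed
 ultimately show ?thesis unfolding S(3) by (intro genideal_minimal assms(2)) auto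
qed

lemma prime_chain_top:
 assumes "prime_chain R (Suc n) P" shows "prime_chain R (Suc n) (P(Suc n := M))"
proof -
 have "P n \<subset> P (Suc n)" "P (Suc n)<=M" "prime_chain R n P"
  using assms proper_ideal_sub_M prime_facts(1,2) unfolding prime_chain_def by auto
 then show ?thesis by (intro prime_chain_snoc M_prime) auto
qed

text \<open>Passing to \<open>R/(I + (x))\<close> lowers the dimension by at most one. The top of
  the chain is first replaced by \<open>M\<close>, so that it contains \<open>x\<close>, as
  \<open>prime_chain_adjoin\<close> requires.\<close>

lemma chain_above_adjoin:
 assumes "chain_above R I (Suc n)" "x\<in>M" "ideal I R" shows "chain_above R (adjoin R I x) n"
proof -
 obtain P where P: "prime_chain R (Suc n) P" "I<=P 0" using assms unfolding chain_above_def by auto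
 from prime_chain_adjoin[OF prime_chain_top[OF P(1)], of x] assms(2) obtain P'
  where P': "prime_chain R n P'" "P 0<=P' 0" "x\<in>P' 0" by auto
 then have "ideal (P' 0) R" using prime_facts(1) unfolding prime_chain_def by auto
 then have "adjoin R I x<=P' 0" using P' P(2) assms M_carr by (intro adjoin_facts(3)) auto
 then show ?thesis using P' unfolding chain_above_def by auto
qed

text \<open>Krull's height theorem in the form \<open>dim R/I <= card W\<close>: each generator
  moved from \<open>W\<close> into the ideal costs at most one link of the chain.\<close>

lemma chain_above_le:
 "finite W ==> W<=carrier R ==> ideal I R ==> M = Idl (I\<union>W) ==> chain_above R I n ==> n<=card W"
proof (induction W arbitrary: I n rule: finite_induct)
 case empty
 then have "M<=I" by (simp add: genideal_minimal)
 obtain P where P: "prime_chain R n P" "I<=P 0" using empty unfolding chain_above_def by auto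
 show ?case
 proof (cases n)
  case (Suc m)
  have "P 0 \<subset> P 1" "P 1<=M" using P Suc proper_ideal_sub_M prime_facts(1,2) unfolding prime_chain_def by auto
  then show ?thesis using \<open>M<=I\<close> P(2) by auto
 qed simp
next
 case (insert x W)
 show ?case
 proof (cases n)
  case (Suc m)
  have c: "I\<union>insert x W<=carrier R" using insert ideal_facts(1) by auto
  have xM: "x\<in>M" unfolding insert.prems(3) using genideal_self[OF c] by auto
  have c': "adjoin R I x\<union>W<=carrier R" using adjoin_ideal[OF insert.prems(2), of x] c ideal_facts(1) by auto
  have "M = Idl (adjoin R I x\<union>W)"
  proof
   show "M<=Idl (adjoin R I x\<union>W)" unfolding insert.prems(3) using genideal_self[OF c'] adjoin_facts(1,2)[OF insert.prems(2), of x] c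
    by (intro genideal_minimal genideal_ideal c') auto
   have "adjoin R I x<=M" using adjoin_facts(3)[OF insert.prems(2), of x M] genideal_self[OF c] M_ideal xM c
    unfolding insert.prems(3) by auto
   then show "Idl (adjoin R I x\<union>W)<=M" using genideal_self[OF c] by (intro genideal_minimal M_ideal) (auto simp: insert.prems(3))
  qed
  moreover have "chain_above R (adjoin R I x) m" using chain_above_adjoin insert.prems(2,4) Suc xM by auto
  ultimately have "m<=card W" using insert.IH[of "adjoin R I x" m] insert.prems(1,2) adjoin_ideal by auto
  then show ?thesis using insert.hyps Suc by auto
 qed simp
qed

lemma Idl_adjoin_Un:
 assumes "ideal I R" "x\<in>carrier R" "W<=carrier R"
 shows "Idl (adjoin R I x\<union>W) = Idl (I\<union>insert x W)"
proof
 have c: "I\<union>insert x W<=carrier R" using assms ideal_facts(1) by auto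
 have c': "adjoin R I x\<union>W<=carrier R" using adjoin_ideal[OF assms(1,2)] assms(3) ideal_facts(1) by auto
 show "Idl (I\<union>insert x W)<=Idl (adjoin R I x\<union>W)"
  using genideal_self[OF c'] adjoin_facts(1,2)[OF assms(1,2)] by (intro genideal_minimal genideal_ideal c') auto
 have "adjoin R I x<=Idl (I\<union>insert x W)" using genideal_self[OF c] by (intro adjoin_facts(3)[OF assms(1,2)] genideal_ideal c) auto
 then show "Idl (adjoin R I x\<union>W)<=Idl (I\<union>insert x W)"
  using genideal_self[OF c] by (intro genideal_minimal genideal_ideal c) auto
qed

text \<open>A regular local ring is a domain, relative to \<open>I\<close>. If \<open>P0\<close> is the bottom of a maximal chain
  and \<open>w \<notin> P0\<close>, then by induction \<open>I + (w)\<close> and \<open>P0 + (w)\<close> are primes of the same dimension,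
  hence equal; so \<open>P0 \<subseteq> I + w P0\<close>.\<close>

lemma regular_imp_prime:
 "finite W ==> W<=carrier R ==> ideal I R ==> M = Idl (I\<union>W) ==> chain_above R I (card W) ==> primeideal I R"
proof (induction "card W" arbitrary: W I)
 case 0
 then have "M = Idl I" by simp
 also have "... = I" using 0 by (intro subset_antisym genideal_minimal genideal_self) (auto simp: ideal_facts)
 finally show ?case using M_prime by simp
next
 case (Suc k)
 obtain P where P: "prime_chain R (Suc k) P" "I<=P 0" using Suc unfolding chain_above_def by auto
 define P0 where "P0 = P 0"
 have P0: "primeideal P0 R" "P0 \<subset> P 1" "P 1<=M" using P proper_ideal_sub_M prime_facts(1,2) unfolding prime_chain_def P0_def by auto
 note P0i = prime_facts(1)[OF P0(1)]
 have c: "I\<union>W<=carrier R" using Suc ideal_facts(1) by auto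
 have "\<not> W<=P0"
 proof
  assume "W<=P0"
  then have "M<=P0" unfolding Suc.prems(4) using P(2) P0i by (intro genideal_minimal) (auto simp: P0_def)
  then show False using P0 by auto
 qed
 then obtain w where w: "w\<in>W" "w~:P0" by auto
 have wM: "w\<in>M" unfolding Suc.prems(4) using genideal_self[OF c] w by auto
 have wc: "w\<in>carrier R" using wM M_carr by auto
 define W' where "W' = W - {w}"
 have W': "finite W'" "W'<=carrier R" "card W' = k" "insert w W' = W" using Suc.prems Suc.hyps(2) w unfolding W'_def by auto
 have gen: "M = Idl (adjoin R K w\<union>W')" if "ideal K R" "I<=K" "K<=M" for K
 proof -
  have cK: "K\<union>W<=carrier R" using that c M_carr by auto
  have "Idl (adjoin R K w\<union>W') = Idl (K\<union>W)" using Idl_adjoin_Un[OF that(1) wc W'(2)] W'(4) by simp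
  also have "... = M"
  proof
   show "Idl (K\<union>W)<=M" using that genideal_self[OF c] by (intro genideal_minimal M_ideal) (auto simp: Suc.prems(4))
   show "M<=Idl (K\<union>W)" unfolding Suc.prems(4) using that genideal_self[OF cK] by (intro genideal_minimal genideal_ideal cK) auto
  qed
  finally show ?thesis by simp
 qed
 have "P 0 = P0" by (simp add: P0_def)
 have ch: "chain_above R (adjoin R K w) k" if "ideal K R" "K<=P0" for K
  using that wM P unfolding P0_def by (intro chain_above_adjoin) (auto simp: chain_above_def)
 have pI: "primeideal (adjoin R I w) R" using Suc.hyps(1)[of W' "adjoin R I w"] W' gen[OF Suc.prems(3)] ch[OF Suc.prems(3)]
   adjoin_ideal[OF Suc.prems(3) wc] P(2) genideal_self[OF c] unfolding P0_def Suc.prems(4) by auto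
 have pP: "primeideal (adjoin R P0 w) R" using Suc.hyps(1)[of W' "adjoin R P0 w"] W' gen[OF P0i] ch[OF P0i]
   adjoin_ideal[OF P0i wc] P(2) P0 unfolding P0_def by auto
 have "adjoin R I w<=adjoin R P0 w" using P(2) unfolding adjoin_def P0_def by blast
 \<comment> \<open>A proper inclusion would allow \<open>I + (w)\<close> to be put in front of a
   chain of length \<open>k\<close> above \<open>P0 + (w)\<close>. That chain is too long for the
   \<open>k\<close> remaining generators.\<close>
 moreover have "\<not> adjoin R I w \<subset> adjoin R P0 w"
 proof
  assume lt: "adjoin R I w \<subset> adjoin R P0 w"
  obtain P' where P': "prime_chain R k P'" "adjoin R P0 w<=P' 0" using ch[OF P0i subset_refl] unfolding chain_above_def by auto
  define P'' where "P'' i = (case i of 0 => adjoin R I w | Suc j => P' j)" for i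
  have "prime_chain R (Suc k) P''" unfolding prime_chain_def
  proof (intro conjI allI impI)
   fix i assume "i<=Suc k"
   then show "primeideal (P'' i) R" using P'(1) pI unfolding prime_chain_def P''_def by (cases i) auto
  next
   fix i assume "i < Suc k"
   then show "P'' i \<subset> P'' (Suc i)" using P' lt unfolding prime_chain_def P''_def by (cases i) auto
  qed
  then have "chain_above R (adjoin R I w) (Suc k)" unfolding chain_above_def by (intro exI[of _ P'']) (auto simp: P''_def)
  from chain_above_le[OF W'(1,2) prime_facts(1)[OF pI] _ this] gen[OF Suc.prems(3)] W'(3) show False
   using genideal_self[OF c] unfolding Suc.prems(4) by auto
 qed
 ultimately have eq: "adjoin R I w = adjoin R P0 w" by blast
 have "P0<=I"
 proof (rule nakayama[OF P0i Suc.prems(3)])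
  fix a assume a: "a\<in>P0"
  have ac: "a\<in>carrier R" using a ideal_facts(1)[OF P0i] by auto
  have "a\<in>adjoin R I w" unfolding eq using adjoin_facts(1)[OF P0i wc] a by auto
  then obtain i r where i: "i\<in>I" "r\<in>carrier R" "a = i\<oplus>r\<otimes>w" unfolding adjoin_def by auto
  have ic: "i\<in>carrier R" using i c by auto
  have "i\<in>P0" using i P(2) unfolding P0_def by auto
  then have "r\<otimes>w\<in>P0" using ideal_add_cancel[OF P0i, of i "r\<otimes>w"] a i wc by auto
  then have "r\<in>P0" using prime_facts(4)[OF P0(1) i(2) wc] w by auto
  then have "w\<otimes>r\<in>M \<cdot> P0" using ideal_prod.prod[OF wM] by auto
  moreover have "a = w\<otimes>r\<oplus>i" unfolding i(3) using ic i(2) wc by (simp add: m_comm a_comm)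
  ultimately show "\<exists>q\<in>M \<cdot> P0. EX n:I. a = q\<oplus>n" using i(1) by (intro bexI)
 qed
 then have "I = P0" using P(2) unfolding P0_def by auto
 then show ?case using P0 by simp
qed

end

section \<open>Regular systems of parameters\<close>

lemma (in cring) ideal_prod_sub:
 assumes "ideal K R" "!!i j. i\<in>I ==> j\<in>J ==> i\<otimes>j\<in>K" shows "I \<cdot> J<=K"
proof
 fix a assume "a\<in>I \<cdot> J"
 then show "a\<in>K" by (induction rule: ideal_prod.induct) (auto intro: assms(2) ideal_facts(3)[OF assms(1)])
qed

lemma (in cring) Idl_prod_sub:
 assumes "ideal K R" "A<=\<K>" "B<=\<K>" "!!i j. i\<in>A ==> j\<in>B ==> i\<otimes>j\<in>K"
 shows "(Idl A) \<cdot> (Idl B)<=K"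
proof (rule ideal_prod_sub[OF assms(1)])
 note A = ideal_facts(1)[OF genideal_ideal[OF assms(2)]] and B = ideal_facts(1)[OF genideal_ideal[OF assms(3)]]
 have 1: "i\<otimes>j\<in>K" if "i\<in>A" "j\<in>Idl B" for i j
 proof -
  have i: "i\<in>\<K>" using that assms by auto
  have "B<={r\<in>\<K>. r\<otimes>i\<in>K}"
  proof
   fix t assume t: "t\<in>B"
   then have "i\<otimes>t\<in>K" "t\<in>\<K>" using assms that by auto
   then show "t\<in>{r\<in>\<K>. r\<otimes>i\<in>K}" using i by (simp add: m_comm)
  qed
  then have "Idl B<={r\<in>\<K>. r\<otimes>i\<in>K}" by (intro genideal_minimal colon_ideal[OF assms(1) i])
  then have "j\<in>\<K>" "j\<otimes>i\<in>K" using that by auto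
  then show ?thesis using i by (simp add: m_comm)
 qed
 fix i j assume ij: "i\<in>Idl A" "j\<in>Idl B"
 have "A<={r\<in>\<K>. r\<otimes>j\<in>K}" using 1 ij(2) assms(2) by auto
 then have "Idl A<={r\<in>\<K>. r\<otimes>j\<in>K}" using ij B by (intro genideal_minimal colon_ideal[OF assms(1)]) auto
 then show "i\<otimes>j\<in>K" using ij by auto
qed

lemma (in cring) ideal_pow_0: "ideal_pow R I 0 = \<K>" by (simp add: ideals_set_def)

lemma (in cring) ideal_pow_Suc: "ideal_pow R I (Suc n) = ideal_pow R I n \<cdot> I" by (simp add: ideals_set_def)

lemma (in cring) ideal_pow_ideal: "ideal I R ==> ideal (ideal_pow R I n) R"
 by (induction n) (simp_all only: ideal_pow_0 ideal_pow_Suc oneideal ideal_prod_is_ideal)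

lemma (in cring) ideal_pow_decseq: "ideal I R ==> ideal_pow R I (Suc n)<=ideal_pow R I n"
 unfolding ideal_pow_Suc using ideal_prod_inter[OF ideal_pow_ideal] by blast

lemma (in cring) ideal_pow_antimono: "ideal I R ==> m<=n ==> ideal_pow R I n<=ideal_pow R I m"
 using lift_Suc_antimono_le[of "ideal_pow R I", OF ideal_pow_decseq] by blast

lemma (in cring) ideal_pow_1: "ideal I R ==> ideal_pow R I (Suc 0) = I" unfolding ideal_pow_Suc ideal_pow_0
 using ideal_prod_commute[OF oneideal, of I] ideal_prod_one[of I] by simp

lemma (in cring) ideal_pow_add:
 assumes "ideal I R" "a\<in>ideal_pow R I m" "b\<in>ideal_pow R I n" shows "a\<otimes>b\<in>ideal_pow R I (m + n)" using assms(3)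
proof (induction n arbitrary: b)
 case 0
 then show ?case using ideal_facts(5)[OF ideal_pow_ideal[OF assms(1)] assms(2), of b] ideal_pow_0[of I] by simp
next
 case (Suc n)
 note ac = ideal_facts(1)[OF ideal_pow_ideal[OF assms(1)], THEN subsetD, OF assms(2)]
 note I = ideal_facts(1)[OF assms(1), THEN subsetD]
 note In = ideal_facts(1)[OF ideal_pow_ideal[OF assms(1)], THEN subsetD]
 have "ideal_pow R I n \<cdot> I<={r\<in>\<K>. r\<otimes>a\<in>ideal_pow R I (Suc (m + n))}"
 proof (rule ideal_prod_sub[OF colon_ideal[OF ideal_pow_ideal[OF assms(1)] ac]])
  fix c i assume c: "c\<in>ideal_pow R I n" "i\<in>I"
  have "a\<otimes>c\<in>ideal_pow R I (m + n)" by (rule Suc.IH[OF c(1)])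
  then have "(a\<otimes>c)\<otimes>i\<in>ideal_pow R I (Suc (m + n))" unfolding ideal_pow_Suc using c(2) by (rule ideal_prod.prod)
  moreover have "(a\<otimes>c)\<otimes>i = (c\<otimes>i)\<otimes>a" using ac In[OF c(1)] I[OF c(2)] by (simp add: m_ac)
  ultimately show "c\<otimes>i\<in>{r\<in>\<K>. r\<otimes>a\<in>ideal_pow R I (Suc (m + n))}" using In[OF c(1)] I[OF c(2)] by simp
 qed
 moreover have "b\<in>ideal_pow R I n \<cdot> I" using Suc.prems unfolding ideal_pow_Suc .
 ultimately have "b\<in>\<K>" "b\<otimes>a\<in>ideal_pow R I (Suc (m + n))" by auto
 then show ?case using ac by (simp add: m_comm)
qed

lemma noetherian_local_ring_max_ideal:
 assumes "local_ring R" "noetherian_ring R" shows "noetherian_local_ring R (max_ideal R)"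
proof -
 have ex: "\<exists>!M. maximalideal M R" and "cring R" using assms unfolding local_ring_def by auto
 have m: "maximalideal (max_ideal R) R" unfolding max_ideal_def by (rule theI'[OF ex])
 show ?thesis by (intro noetherian_local_ring.intro noetherian_cring.intro assms \<open>cring R\<close>
   noetherian_local_ring_axioms.intro m) (use ex m in auto)
qed

lemma (in noetherian_local_ring) max_ideal_eq: "max_ideal R = M" unfolding max_ideal_def by (rule the_equality) (rule M_maximal, rule M_unique)

lemma (in noetherian_local_ring) chain_above_krull_dim:
 assumes "krull_dim R = enat n" shows "chain_above R {\<zero>} n"
proof -
 define K where "K = {enat n | n P. prime_chain R n P}"
 have K: "Sup K = enat n" using assms unfolding krull_dim_def K_def prime_chain_def by simp
 have c0: "prime_chain R 0 (%_. M)" unfolding prime_chain_def using M_prime by auto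
 have "enat 0\<in>K" unfolding K_def by (rule CollectI, rule exI[of _ "0::nat"], rule exI[of _ "%_. M"]) (simp add: c0)
 then have "K~={}" by auto
 \<comment> \<open>An infinite set of extended naturals has supremum infinity, so a finite dimension
   is a maximum and is realized by an actual chain.\<close>
 moreover have "finite K"
 proof (rule ccontr)
  assume "infinite K"
  then have "Sup K = \<infinity>" using \<open>K~={}\<close> unfolding Sup_enat_def by simp
  then show False using K by simp
 qed
 ultimately have "Sup K\<in>K" unfolding Sup_enat_def by simp
 then obtain P where P: "prime_chain R n P" unfolding K using K_def by auto
 then have "\<zero>\<in>P 0" using ideal_facts(2)[OF prime_facts(1)] unfolding prime_chain_def by auto
 then show ?thesis using P unfolding chain_above_def by auto
qed

text \<open>A count from both sides. Adjoining the members indexed by \<open>T\<close> costs at most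
  \<open>card T\<close> links of a chain, so at least \<open>card I - card T\<close> further
  generators are needed for \<open>M\<close>. Hence \<open>regular_imp_prime\<close> applies, and a
  member \<open>x j\<close> already lying in the ideal of \<open>T\<close> would leave too
  few.\<close>

lemma (in noetherian_local_ring) regular_generators:
 assumes fin: "finite I" and x: "x ` I<=\<K>" and M: "M = Idl (x ` I)" and dim: "krull_dim R = enat (card I)"
  and T: "T<=I" shows "primeideal (Idl (x ` T)) R" "!!j. j\<in>I - T ==> x j~:Idl (x ` T)"
proof -
 have xM: "x i\<in>M" if "i\<in>I" for i unfolding M using genideal_self[OF x] that by auto
 have chain: "finite T ==> T<=I ==> chain_above R (Idl (x ` T)) (card I - card T)" for T
 proof (induction T rule: finite_induct)
  case empty
  have "Idl {}<={\<zero>}" by (intro genideal_minimal zeroideal) auto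
  then have "Idl {} = {\<zero>}" using ideal_facts(2)[OF genideal_ideal[of "{}"]] by auto
  then show ?case using chain_above_krull_dim[OF dim] by simp
 next
  case (insert j T)
  have c: "x ` T<=\<K>" "x j\<in>\<K>" using insert x by auto
  have "card (insert j T)<=card I" using insert fin by (intro card_mono)
  then have *: "card I - card T = Suc (card I - card (insert j T))" using insert by auto
  have "chain_above R (Idl (x ` T)) (Suc (card I - card (insert j T)))" using insert.IH insert.prems unfolding * by auto
  then have "chain_above R (adjoin R (Idl (x ` T)) (x j)) (card I - card (insert j T))"
   using xM insert.prems by (intro chain_above_adjoin genideal_ideal c) auto
  then show ?case using Idl_insert[OF c] by simp
 qed
 have c: "x ` T<=\<K>" "x ` (I - T)<=\<K>" using T x by auto
 have fT: "finite T" "finite (I - T)" using T fin finite_subset by auto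
 have cardT: "card (I - T) = card I - card T" using fT T by (simp add: card_Diff_subset)
 have gen: "M = Idl (Idl (x ` T)\<union>x ` W)" if "W<=I" "!!i. i\<in>I ==> i~:W ==> x i\<in>Idl (x ` T)" for W
 proof -
  have c': "Idl (x ` T)\<union>x ` W<=\<K>" using ideal_facts(1)[OF genideal_ideal[OF c(1)]] that(1) x by blast
  show ?thesis
  proof
   show "M<=Idl (Idl (x ` T)\<union>x ` W)" unfolding M
   proof (intro genideal_minimal genideal_ideal c' image_subsetI)
    fix i assume "i\<in>I"
    then show "x i\<in>Idl (Idl (x ` T)\<union>x ` W)" using that(2)[of i] genideal_self[OF c'] by (cases "i\<in>W") auto
   qed
   have "Idl (x ` T)<=M" using xM T by (intro genideal_minimal M_ideal) auto
   then show "Idl (Idl (x ` T)\<union>x ` W)<=M" using xM that(1) by (intro genideal_minimal M_ideal) blast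
  qed
 qed
 have gen1: "M = Idl (Idl (x ` T)\<union>x ` (I - T))" using genideal_self[OF c(1)] by (intro gen) auto
 \<comment> \<open>Generators are counted in the image, where the family might repeat itself; the
   two bounds rule this out.\<close>
 have le: "card I - card T<=card (x ` (I - T))" using chain_above_le[OF _ c(2) genideal_ideal[OF c(1)] gen1 chain[OF fT(1) T]] fT by auto
 have eq: "card (x ` (I - T)) = card I - card T" using le card_image_le[OF fT(2), of x] cardT by auto
 show "primeideal (Idl (x ` T)) R" using regular_imp_prime[OF _ c(2) genideal_ideal[OF c(1)] gen1] chain[OF fT(1) T] fT eq by auto
 fix j assume j: "j\<in>I - T"
 show "x j~:Idl (x ` T)"
 proof
  assume *: "x j\<in>Idl (x ` T)"
  have g: "M = Idl (Idl (x ` T)\<union>x ` (I - T - {j}))" using genideal_self[OF c(1)] * by (intro gen) auto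
  have "card I - card T<=card (x ` (I - T - {j}))" using fT c by (intro chain_above_le[OF _ _ genideal_ideal[OF c(1)] g chain[OF fT(1) T]]) auto
  also have "...<=card (I - T - {j})" using fT by (intro card_image_le) auto
  also have "... < card (I - T)" using j fT by (intro psubset_card_mono) auto
  finally show False using cardT by simp
 qed
qed

text \<open>What is retained of the dimension condition: any subfamily spans a prime that contains
  none of the other members. In particular the parameters form a regular sequence in every
  order.\<close>

locale regular_system = noetherian_local_ring +
 fixes x :: "'i::finite => 'a" assumes x_carr: "x i\<in>carrier R" and M_gen: "M = Idl (range x)"
  and x_prime: "primeideal (Idl (x ` T)) R" and x_notin: "j~:T ==> x j~:Idl (x ` T)"

lemma regular_params_system:
 fixes x :: "'i::finite => 'a" assumes "regular_params R UNIV x" shows "regular_system R (max_ideal R) x"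
proof -
 have *: "local_ring R" "noetherian_ring R" "range x<=carrier R" "krull_dim R = enat (card (UNIV :: 'i set))"
  "max_ideal R = genideal R (range x)" "finite (UNIV :: 'i set)" using assms unfolding regular_params_def by auto
 interpret noetherian_local_ring R "max_ideal R" by (rule noetherian_local_ring_max_ideal[OF *(1,2)])
 show ?thesis
 proof (intro regular_system.intro[OF noetherian_local_ring_axioms] regular_system_axioms.intro)
  show "x i\<in>carrier R" for i using *(3) by auto
  show "max_ideal R = genideal R (range x)" by (rule *(5))
  show "primeideal (genideal R (x ` T)) R" for T by (rule regular_generators(1)[OF *(6,3,5,4) subset_UNIV])
  show "x j~:genideal R (x ` T)" if "j~:T" for j T using regular_generators(2)[OF *(6,3,5,4) subset_UNIV, of j T] that by simp
 qed
qed

lemma regular_local_ring_domain: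
 assumes "regular_local_ring R" shows "domain R"
proof -
 obtain n and x :: "nat => 'a" where "regular_params R {..<n} x" using assms unfolding regular_local_ring_def by auto
 then have *: "local_ring R" "noetherian_ring R" "x ` {..<n}<=carrier R" "krull_dim R = enat (card {..<n})"
  "max_ideal R = genideal R (x ` {..<n})" unfolding regular_params_def by auto
 interpret noetherian_local_ring R "max_ideal R" by (rule noetherian_local_ring_max_ideal[OF *(1,2)])
 have "primeideal (genideal R {}) R" using regular_generators(1)[of "{..<n}" x "{}"] * by auto
 moreover have "genideal R {} = {\<zero>\<^bsub>R\<^esub>}"
  using ideal_facts(2)[OF genideal_ideal[of "{}"]] genideal_minimal[OF zeroideal, of "{}"] by auto
 ultimately show ?thesis using zeroprimeideal_domainI is_cring by simp
qed

section \<open>Monomials and the regular sequence property\<close>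

lemma (in cring) monomial_closed:
 assumes "range x<=\<K>" shows "monomial R x m\<in>\<K>" unfolding monomial_def using assms by (intro finprod_closed) auto

lemma (in cring) monomial_add:
 assumes "range x<=\<K>"
 shows "monomial R x (%i. m i + k i) = monomial R x m\<otimes>monomial R x k"
proof -
 have xc: "x i\<in>\<K>" for i using assms by auto
 have "monomial R x (%i. m i + k i) = (\<Otimes>i\<in>UNIV. x i [^] m i\<otimes>x i [^] k i)"
  unfolding monomial_def using xc by (intro finprod_cong') (auto simp: nat_pow_mult)
 also have "... = monomial R x m\<otimes>monomial R x k" unfolding monomial_def using assms by (intro finprod_multf) auto
 finally show ?thesis .
qed

lemma (in cring) monomial_zero: "monomial R x (%_. 0) = \<one>" unfolding monomial_def by (simp add: finprod_one)

lemma (in cring) monomial_single: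
 assumes "range x<=\<K>" shows "monomial R x (%i. if i = j then n else 0) = x j [^] n"
proof -
 have "monomial R x (%i. if i = j then n else 0) = (\<Otimes>i\<in>UNIV. if j = i then x i [^] n else \<one>)"
  unfolding monomial_def using assms by (intro finprod_cong') auto
 also have "... = x j [^] n" using assms by (subst finprod_singleton) auto
 finally show ?thesis .
qed

lemma (in cring) monomial_le:
 assumes "range x<=\<K>" "!!i. m i<=k i"
 shows "monomial R x k = monomial R x (%i. k i - m i)\<otimes>monomial R x m"
proof -
 have "k = (%i. (k i - m i) + m i)" using assms(2) by auto
 then show ?thesis using monomial_add[OF assms(1), of "%i. k i - m i" m] by simp
qed

lemma (in cring) monomial_in_pow_ideal:
 assumes "range x<=\<K>" "n i<=m i" "ideal K R" "x i [^] n i\<in>K" shows "monomial R x m\<in>K"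
proof -
 have "monomial R x m = monomial R x (%j. m j - (if j = i then n i else 0))\<otimes>monomial R x (%j. if j = i then n i else 0)"
  using assms by (intro monomial_le) auto
 also have "...\<in>K" unfolding monomial_single[OF assms(1)] using assms monomial_closed by (intro ideal_facts(4)) auto
 finally show ?thesis .
qed

lemma (in cring) ideal_pow_Idl_monomials:
 fixes x :: "'i::finite => 'a" assumes "range x<=\<K>"
 shows "ideal_pow R (Idl (range x)) n = Idl (monomial R x ` {m. degree_of m = n})"
proof (induction n)
 case 0
 have "{m :: 'i => nat. degree_of m = 0} = {%_. 0}" by auto
 then have *: "monomial R x ` {m. degree_of m = 0} = {\<one>}" by (simp add: monomial_zero)
 show ?case unfolding * ideal_pow_0 genideal_one ..
next
 case (Suc n)
 note xc = assms and mc = monomial_closed[OF assms]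
 have xi: "x i\<in>\<K>" for i using assms by auto
 have c: "monomial R x ` {m. degree_of m = k}<=\<K>" for k using mc by auto
 show ?case unfolding ideal_pow_Suc Suc.IH
 proof
  show "(Idl (monomial R x ` {m. degree_of m = n})) \<cdot> (Idl (range x))<=Idl (monomial R x ` {m. degree_of m = Suc n})"
  proof (rule Idl_prod_sub[OF genideal_ideal[OF c] c xc])
   fix a b assume "a\<in>monomial R x ` {m. degree_of m = n}" "b\<in>range x"
   then obtain m i where m: "degree_of m = n" "a = monomial R x m" "b = x i" by auto
   have "a\<otimes>b = monomial R x (%j. m j + (if j = i then 1 else 0))"
    unfolding m monomial_add[OF xc] monomial_single[OF xc] using xi by auto
   moreover have "degree_of (%j. m j + (if j = i then 1 else 0)) = Suc n" using m(1) by (simp add: sum.distrib)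
   ultimately show "a\<otimes>b\<in>Idl (monomial R x ` {m. degree_of m = Suc n})" using genideal_self[OF c] by auto
  qed
  have idl: "ideal ((Idl (monomial R x ` {m. degree_of m = n})) \<cdot> (Idl (range x))) R" by (intro ideal_prod_is_ideal genideal_ideal c xc)
  show "Idl (monomial R x ` {m. degree_of m = Suc n})<=(Idl (monomial R x ` {m. degree_of m = n})) \<cdot> (Idl (range x))"
  proof (intro genideal_minimal idl image_subsetI)
   fix m :: "'i => nat" assume "m\<in>{m. degree_of m = Suc n}"
   then have d: "degree_of m = Suc n" by auto
   have "EX i. m i~=0" by (rule ccontr) (use d in simp)
   then obtain i where i: "m i > 0" by auto
   define m' where "m' j = m j - (if j = i then 1 else 0)" for j
   have "degree_of m = degree_of (%j. m' j + (if j = i then 1 else 0))" using i unfolding m'_def by (intro sum.cong) auto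
   then have "degree_of m' = n" using d by (simp add: sum.distrib)
   moreover have "monomial R x m = monomial R x m'\<otimes>x i"
    using monomial_le[OF xc, of "%j. if j = i then 1 else 0" m] i monomial_single[OF xc, of i 1] xi
    unfolding m'_def by (auto simp: image_subset_iff)
   ultimately show "monomial R x m\<in>(Idl (monomial R x ` {m. degree_of m = n})) \<cdot> (Idl (range x))"
    using genideal_self[OF c] genideal_self[OF xc] by (auto intro!: ideal_prod.prod simp: image_subset_iff)
  qed
 qed
qed

context regular_system
begin

lemma xr: "range x<=\<K>" using x_carr by auto

lemmas mon_closed = monomial_closed[OF xr]

text \<open>The exponents are shifted by one on purpose: \<open>pows UNIV m\<close> consists of the
  first powers that do not divide \<open>x^m\<close>, and \<open>e = 0\<close> returns the
  parameters themselves.\<close>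

definition pows :: "'i set => ('i => nat) => 'a set"
 where "pows T e = (%i. x i [^] Suc (e i)) ` T"

lemma pows_carr: "pows T e<=\<K>" unfolding pows_def using x_carr by (auto simp del: nat_pow_Suc)

lemma pows_ideal: "ideal (Idl (pows T e)) R" by (rule genideal_ideal[OF pows_carr])

lemma pows_remove:
 assumes "i\<in>T" shows "Idl (pows T e) = adjoin R (Idl (pows (T - {i}) e)) (x i [^] Suc (e i))"
proof -
 have "pows T e = insert (x i [^] Suc (e i)) (pows (T - {i}) e)" using assms unfolding pows_def by auto
 then show ?thesis using Idl_insert[OF pows_carr, of "x i [^] Suc (e i)" "T - {i}" e] x_carr by simp
qed

lemma pows_upd: "pows (T - {i}) (e(i := n)) = pows (T - {i}) e" unfolding pows_def by (intro image_cong) auto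

text \<open>Induction on the total exponent; with all exponents zero the ideal is prime. Otherwise
  one exponent \<open>e i = n + 1\<close> is lowered twice. Lowered to 0 it gives
  \<open>r = k' + r' x_i\<close>. Cancelling \<open>x_i\<close> modulo the powers of the other
  members yields a relation for \<open>r'\<close>, to which the case of exponent \<open>n\<close>
  applies.\<close>

lemma nonzerodivisor:
 "j~:T ==> r\<in>\<K> ==> x j\<otimes>r\<in>Idl (pows T e) ==> r\<in>Idl (pows T e)"
proof (induction "\<Sum>i\<in>T. e i" arbitrary: T e j r rule: less_induct)
 case less
 note jT = less.prems(1) and rc = less.prems(2) and xr = less.prems(3)
 show ?case
 proof (cases "ALL i:T. e i = 0")
  case True
  then have "pows T e = x ` T" unfolding pows_def using x_carr by (intro image_cong) auto
  then show ?thesis using prime_facts(4)[OF x_prime x_carr rc] xr x_notin[OF jT] by auto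
 next
  case False
  then obtain i where i0: "i\<in>T" "e i~=0" by auto
  then obtain n where i: "i\<in>T" "e i = Suc n" using not0_implies_Suc by blast
  have ij: "i~=j" using i jT by auto
  define K where "K = Idl (pows (T - {i}) e)"
  have Ki: "ideal K R" unfolding K_def by (rule pows_ideal)
  note Kf = ideal_facts[OF Ki]
  have fT: "finite T" by simp
  have smaller: "(\<Sum>k\<in>T. (e(i := m)) k) < (\<Sum>k\<in>T. e k)" if "m < e i" for m using that i by (intro sum_strict_mono_ex1) auto
  have smaller': "(\<Sum>k\<in>T - {i}. e k) < (\<Sum>k\<in>T. e k)" using i by (subst sum.remove[OF fT i(1)]) auto
  have eqm: "Idl (pows T (e(i := m))) = adjoin R K (x i [^] Suc m)" for m unfolding pows_remove[OF i(1)] pows_upd K_def by simp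
  have eq: "Idl (pows T e) = adjoin R K (x i [^] Suc (e i))" unfolding pows_remove[OF i(1)] K_def by simp
  obtain k s where k: "k\<in>K" "s\<in>\<K>" "x j\<otimes>r = k\<oplus>s\<otimes>x i [^] Suc (e i)" using xr unfolding eq adjoin_def by blast
  have kc: "k\<in>\<K>" using k Kf by auto
  have xic: "x i\<in>\<K>" and xjc: "x j\<in>\<K>" by (rule x_carr)+
  have pc: "x i [^] m\<in>\<K>" for m :: nat using xic by auto
  have "x j\<otimes>r\<in>adjoin R K (x i [^] Suc 0)"
  proof -
   have "x j\<otimes>r = k\<oplus>(s\<otimes>x i [^] e i)\<otimes>x i [^] Suc 0" unfolding k(3) using xic k(2) by (simp add: m_assoc)
   then show ?thesis unfolding adjoin_def using k pc by blast
  qed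
  then have "r\<in>adjoin R K (x i [^] Suc 0)" using less.hyps[OF smaller jT rc, of 0] i unfolding eqm by auto
  then obtain k' r' where k': "k'\<in>K" "r'\<in>\<K>" "r = k'\<oplus>r'\<otimes>x i [^] Suc 0" unfolding adjoin_def by blast
  have r: "r = k'\<oplus>r'\<otimes>x i" using k'(3) xic by simp
  have k'c: "k'\<in>\<K>" using k' Kf by auto
  define z where "z = x j\<otimes>r'\<ominus>s\<otimes>x i [^] Suc n"
  have zc: "z\<in>\<K>" unfolding z_def using k'(2) k(2) xjc xic by simp
  have "x i\<otimes>z = x j\<otimes>(r'\<otimes>x i)\<ominus>s\<otimes>(x i [^] Suc n\<otimes>x i)"
   unfolding z_def using xic xjc k'(2) k(2) pc[of "Suc n"] by algebra
  also have "x i [^] Suc n\<otimes>x i = x i [^] Suc (e i)" using i by simp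
  also have "x j\<otimes>(r'\<otimes>x i) = x j\<otimes>r\<ominus>x j\<otimes>k'" unfolding r using xic xjc k'(2) k'c by algebra
  also have "x j\<otimes>r\<ominus>x j\<otimes>k'\<ominus>s\<otimes>x i [^] Suc (e i) = k\<ominus>x j\<otimes>k'"
   unfolding k(3) using kc k(2) pc[of "Suc (e i)"] xjc k'c by algebra
  also have "...\<in>K" using k(1) k'(1) xjc by (intro Kf(7) Kf(4))
  finally have "x i\<otimes>z\<in>K" .
  then have zK: "z\<in>K" unfolding K_def using less.hyps[OF smaller' _ zc, of i] by auto
  have "x j\<otimes>r' = z\<oplus>s\<otimes>x i [^] Suc n" unfolding z_def using xjc k'(2) k(2) pc[of "Suc n"] by algebra
  then have "x j\<otimes>r'\<in>adjoin R K (x i [^] Suc n)" unfolding adjoin_def using zK k(2) by blast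
  then have "r'\<in>adjoin R K (x i [^] Suc n)" using less.hyps[OF smaller jT k'(2), of n] i unfolding eqm by auto
  then obtain k'' t where k'': "k''\<in>K" "t\<in>\<K>" "r' = k''\<oplus>t\<otimes>x i [^] Suc n" unfolding adjoin_def by blast
  have k''c: "k''\<in>\<K>" using k'' Kf by auto
  have "r = (k'\<oplus>x i\<otimes>k'')\<oplus>t\<otimes>(x i [^] Suc n\<otimes>x i)"
   unfolding r k''(3) using k'c xic k''c k''(2) pc[of "Suc n"] by algebra
  then have "r = (k'\<oplus>x i\<otimes>k'')\<oplus>t\<otimes>x i [^] Suc (e i)" using i by simp
  moreover have "k'\<oplus>x i\<otimes>k''\<in>K" using k' k'' xic by (intro Kf(3) Kf(4))
  ultimately show ?thesis unfolding eq adjoin_def using k''(2) by blast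
 qed
qed

lemma nonzerodivisor_pow:
 "j~:T ==> r\<in>\<K> ==> x j [^] (n::nat)\<otimes>r\<in>Idl (pows T e) ==> r\<in>Idl (pows T e)"
proof (induction n arbitrary: r)
 case (Suc n)
 have "x j [^] Suc n\<otimes>r = x j [^] n\<otimes>(x j\<otimes>r)" using Suc.prems x_carr by (simp add: m_assoc)
 then have "x j\<otimes>r\<in>Idl (pows T e)" using Suc.IH[of "x j\<otimes>r"] Suc.prems x_carr by simp
 then show ?case using nonzerodivisor Suc.prems by blast
qed auto

text \<open>The variables of the monomial are removed one at a time: \<open>x_j^(m_j)\<close> is
  cancelled modulo the powers of the other parameters, which leaves the first power of
  \<open>x_j\<close> in the ideal. In the end the ideal is \<open>M\<close>.\<close>

lemma colon_aux:
 "finite T ==> c\<in>\<K> ==> c\<otimes>(\<Otimes>i\<in>T. x i [^] m i)\<in>Idl (pows UNIV (%i. if i\<in>T then m i else 0)) ==> c\<in>M"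
proof (induction T rule: finite_induct)
 case empty
 have "pows UNIV (%_. 0) = range x" unfolding pows_def using x_carr by auto
 then show ?case using empty M_gen by simp
next
 case (insert j T)
 define e where "e i = (if i\<in>insert j T then m i else 0)" for i
 define e' where "e' i = (if i\<in>T then m i else 0)" for i
 have ee: "e' = e(j := 0)" "e j = m j" unfolding e_def e'_def using insert.hyps by auto
 define K where "K = Idl (pows (- {j}) e)"
 have Ki: "ideal K R" unfolding K_def by (rule pows_ideal)
 have eq: "Idl (pows UNIV e) = adjoin R K (x j [^] Suc (m j))" using pows_remove[of j UNIV e] unfolding K_def ee(2) by (simp add: Compl_eq_Diff_UNIV)
 have eq': "Idl (pows UNIV e') = adjoin R K (x j [^] Suc 0)"
  using pows_remove[of j UNIV e'] pows_upd[of UNIV j e 0] unfolding K_def ee(1) by (simp add: Compl_eq_Diff_UNIV)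
 define z where "z = c\<otimes>(\<Otimes>i\<in>T. x i [^] m i)"
 have pT: "(\<Otimes>i\<in>T. x i [^] m i)\<in>\<K>" using x_carr by (intro finprod_closed) auto
 have zc: "z\<in>\<K>" unfolding z_def using insert pT by auto
 have "(\<Otimes>i\<in>insert j T. x i [^] m i) = x j [^] m j\<otimes>(\<Otimes>i\<in>T. x i [^] m i)"
  using insert.hyps x_carr by (intro finprod_insert) auto
 then have "c\<otimes>(\<Otimes>i\<in>insert j T. x i [^] m i) = x j [^] m j\<otimes>z"
  unfolding z_def using pT insert.prems x_carr by (simp add: m_ac)
 then have "x j [^] m j\<otimes>z\<in>adjoin R K (x j [^] Suc (m j))" using insert.prems(2) unfolding eq[symmetric] e_def by simp
 then obtain k a where k: "k\<in>K" "a\<in>\<K>" "x j [^] m j\<otimes>z = k\<oplus>a\<otimes>x j [^] Suc (m j)" unfolding adjoin_def by blast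
 have kc: "k\<in>\<K>" using k ideal_facts(1)[OF Ki] by auto
 have xjc: "x j\<in>\<K>" by (rule x_carr)
 have pc: "x j [^] m j\<in>\<K>" using xjc by auto
 have "x j [^] m j\<otimes>(z\<ominus>a\<otimes>x j) = x j [^] m j\<otimes>z\<ominus>a\<otimes>(x j [^] m j\<otimes>x j)"
  using pc zc k(2) xjc by algebra
 also have "... = k" unfolding k(3) nat_pow_Suc using kc k(2) xjc pc by algebra
 finally have "x j [^] m j\<otimes>(z\<ominus>a\<otimes>x j)\<in>Idl (pows (- {j}) e)" using k(1) unfolding K_def by simp
 then have "z\<ominus>a\<otimes>x j\<in>K" unfolding K_def using zc k(2) xjc by (rule_tac nonzerodivisor_pow[of j "- {j}" _ "m j" e]) auto
 moreover have "z = (z\<ominus>a\<otimes>x j)\<oplus>a\<otimes>x j [^] Suc 0" using zc k(2) xjc by (simp add: minus_eq a_assoc l_neg)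
 ultimately have "z\<in>adjoin R K (x j [^] Suc 0)" unfolding adjoin_def using k(2) by blast
 then show ?case using insert.IH insert.prems unfolding eq'[symmetric] z_def e'_def by auto
qed

text \<open>The key property of a regular sequence: \<open>(x\<^sub>i\<^sup>m\<^sup>i\<^sup>+\<^sup>1 | i) : x\<^sup>m\<close> is a proper ideal.\<close>

lemma monomial_colon:
 assumes "c\<in>\<K>" "c\<otimes>monomial R x m\<in>Idl (pows UNIV m)" shows "c\<in>M"
 using colon_aux[of UNIV c m] assms unfolding monomial_def by simp

lemma monomial_in_pows:
 assumes "m i < k i" shows "monomial R x k\<in>Idl (pows UNIV m)"
proof (rule monomial_in_pow_ideal[OF xr])
 show "Suc (m i)<=k i" using assms by simp
 show "x i [^] Suc (m i)\<in>Idl (pows UNIV m)" using genideal_self[OF pows_carr[of UNIV m]] unfolding pows_def by blast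
qed (rule pows_ideal)

lemma Idl_monomials_pows:
 assumes "!!k. k\<in>E ==> EX i. m i < k i" shows "Idl (monomial R x ` E)<=Idl (pows UNIV m)"
 by (intro genideal_minimal pows_ideal) (auto dest!: assms intro: monomial_in_pows)

lemma monomial_notin:
 assumes "!!k. k\<in>E ==> EX i. m i < k i" "c\<in>Units R"
 shows "c\<otimes>monomial R x m~:Idl (monomial R x ` E)"
proof
 assume *: "c\<otimes>monomial R x m\<in>Idl (monomial R x ` E)"
 have "Idl (monomial R x ` E)<=Idl (pows UNIV m)" by (rule Idl_monomials_pows[OF assms(1)])
 then show False using monomial_colon[of c m] * assms Units_iff by auto
qed

end

lemma (in ring) add_diff_cancel_left:
 "a\<in>\<K> ==> b\<in>\<K> ==> a\<oplus>b\<ominus>a = b" by algebra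

lemma (in cring) set_add_facts:
 assumes "ideal I R" "ideal J R"
 shows "I<=set_add R I J" "J<=set_add R I J" "!!K. ideal K R ==> I<=K ==> J<=K ==> set_add R I J<=K"
  "!!a. a\<in>set_add R I J <-> (EX i:I. EX j:J. a = i\<oplus>j)"
proof -
 note I = ideal_facts[OF assms(1)] and J = ideal_facts[OF assms(2)]
 show mem: "!!a. a\<in>set_add R I J <-> (EX i:I. EX j:J. a = i\<oplus>j)" unfolding set_add_def' by auto
 show "I<=set_add R I J"
 proof
  fix a assume "a\<in>I"
  then have "a = a\<oplus>\<zero>" using I(1) by auto
  then show "a\<in>set_add R I J" using mem \<open>a\<in>I\<close> J(2) by blast
 qed
 show "J<=set_add R I J"
 proof
  fix a assume "a\<in>J"
  then have "a = \<zero>\<oplus>a" using J(1) by auto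
  then show "a\<in>set_add R I J" using mem \<open>a\<in>J\<close> I(2) by blast
 qed
 fix K assume K: "ideal K R" "I<=K" "J<=K"
 show "set_add R I J<=K"
 proof
  fix a assume "a\<in>set_add R I J"
  then obtain i j where "i\<in>I" "j\<in>J" "a = i\<oplus>j" using mem by auto
  then show "a\<in>K" using K ideal_facts(3)[OF K(1), of i j] by auto
 qed
qed

context regular_system
begin

lemma Mpow_ideal: "ideal (ideal_pow R M n) R" by (rule ideal_pow_ideal[OF M_ideal])

lemma Mpow_gen: "ideal_pow R M n = Idl (monomial R x ` {m. degree_of m = n})" unfolding M_gen by (rule ideal_pow_Idl_monomials[OF xr])

lemma Mpow_sub:
 assumes "ideal K R" "!!m. degree_of m = n ==> monomial R x m\<in>K" shows "ideal_pow R M n<=K"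
 unfolding Mpow_gen using assms by (intro genideal_minimal) auto

text \<open>By pigeonhole a monomial of degree above \<open>|m|\<close> exceeds \<open>m\<close> in
  some exponent. Thus knowledge modulo \<open>M^(|m|+1)\<close> suffices to see the coefficient at
  \<open>x^m\<close>.\<close>

lemma Mpow_sub_pows:
 assumes "degree_of m < n" shows "ideal_pow R M n<=Idl (pows UNIV m)"
proof (rule Mpow_sub[OF pows_ideal])
 fix k :: "'i => nat" assume k: "degree_of k = n"
 have "EX i. m i < k i"
 proof (rule ccontr)
  assume "\<not> ?thesis"
  then have "degree_of k<=degree_of m" by (intro sum_mono) (auto simp: not_less)
  then show False using assms k by simp
 qed
 then show "monomial R x k\<in>Idl (pows UNIV m)" using monomial_in_pows by auto
qed

text \<open>Krull's intersection theorem, following Kaplansky: with \<open>N\<close> the intersection and \<open>L = I + M N\<close>,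
  an ideal \<open>K\<close> that is maximal with \<open>K \<inter> N = L\<close> contains a power of \<open>M\<close>.\<close>

lemma krull_intersection:
 assumes I: "ideal I R" and a: "!!n. a\<in>set_add R I (ideal_pow R M n)" shows "a\<in>I"
proof -
 define N where "N = (\<Inter>n. set_add R I (ideal_pow R M n))"
 have Si: "ideal (set_add R I (ideal_pow R M n)) R" for n by (rule add_ideals[OF I Mpow_ideal])
 have Ni: "ideal N R" unfolding N_def by (rule i_Intersect) (auto simp: Si)
 note Nf = ideal_facts[OF Ni]
 define L where "L = set_add R I (M \<cdot> N)"
 have MNi: "ideal (M \<cdot> N) R" by (rule ideal_prod_is_ideal[OF M_ideal Ni])
 have Li: "ideal L R" unfolding L_def by (rule add_ideals[OF I MNi])
 note Lf = set_add_facts[OF I MNi, folded L_def]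
 have LN: "L<=N" using set_add_facts(1)[OF I Mpow_ideal] ideal_prod_inter[OF M_ideal Ni] by (intro Lf(3)[OF Ni]) (auto simp: N_def)
 define KK where "KK = {K. ideal K R & K\<inter>N = L}"
 have "L\<in>KK" unfolding KK_def using Li LN by auto
 then obtain K where K: "K\<in>KK" "ALL K':KK. K<=K' --> K' = K"
 proof -
  have "EX N:KK. ALL I:KK. N<=I --> I = N"
   by (rule ex_maximal_ideal_in) (use \<open>L\<in>KK\<close> in auto, simp add: KK_def)
  then show ?thesis using that by blast
 qed
 have Ki: "ideal K R" and KN: "K\<inter>N = L" using K(1) unfolding KK_def by auto
 note Kf = ideal_facts[OF Ki]
 have pow: "EX n. w [^] (n::nat)\<in>K" if w: "w\<in>M" for w
 proof -
  have wc: "w\<in>\<K>" using w M_carr by auto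
  \<comment> \<open>The quotients \<open>(K : w^n)\<close> ascend and become stationary. From then
    on \<open>K + (w^n)\<close> still meets \<open>N\<close> in \<open>L\<close>, and the maximality
    of \<open>K\<close> puts \<open>w^n\<close> into \<open>K\<close>.\<close>
  define A where "A n = {r\<in>\<K>. r\<otimes>w [^] n\<in>K}" for n :: nat
  have Ai: "ideal (A n) R" for n unfolding A_def using wc by (intro colon_ideal[OF Ki]) auto
  have Ainc: "A n<=A (Suc n)" for n
  proof
   fix r assume "r\<in>A n"
   then have r: "r\<in>\<K>" "r\<otimes>w [^] n\<in>K" unfolding A_def by auto
   have "r\<otimes>w [^] Suc n = (r\<otimes>w [^] n)\<otimes>w" using r wc by (simp add: m_assoc)
   then show "r\<in>A (Suc n)" unfolding A_def using r Kf(5)[OF r(2) wc] by auto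
  qed
  have "\<exists>N\<in>range A. \<forall>I\<in>range A. N<=I --> I = N" by (rule ex_maximal_ideal_in) (use Ai in auto)
  then obtain n where "ALL m. A n<=A m --> A m = A n" by auto
  then have n: "A (Suc n) = A n" using Ainc[of n] by blast
  have wn: "w [^] n\<in>\<K>" using wc by auto
  define K' where "K' = adjoin R K (w [^] n)"
  have K'i: "ideal K' R" unfolding K'_def by (rule adjoin_ideal[OF Ki wn])
  have KK': "K<=K'" "w [^] n\<in>K'" unfolding K'_def using adjoin_facts(1,2)[OF Ki wn] by auto
  have "K'\<inter>N<=L"
  proof
   fix b assume b: "b\<in>K'\<inter>N"
   then obtain k r where k: "k\<in>K" "r\<in>\<K>" "b = k\<oplus>r\<otimes>w [^] n" unfolding K'_def adjoin_def by auto
   have kc: "k\<in>\<K>" using k(1) Kf(1) by auto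
   have "w\<otimes>b\<in>M \<cdot> N" using w b by (intro ideal_prod.prod) auto
   then have "w\<otimes>b\<in>K" using Lf(2) KN by auto
   moreover have "w\<otimes>b = w\<otimes>k\<oplus>r\<otimes>(w [^] n\<otimes>w)" unfolding k(3) using kc k(2) wn wc by algebra
   moreover have "w\<otimes>k\<in>K" by (rule Kf(4)[OF k(1) wc])
   ultimately have "r\<otimes>(w [^] n\<otimes>w)\<in>K"
    using ideal_add_cancel[OF Ki, of "w\<otimes>k" "r\<otimes>(w [^] n\<otimes>w)"] k(2) wn wc by simp
   then have "r\<in>A (Suc n)" unfolding A_def using k(2) by simp
   then have "r\<otimes>w [^] n\<in>K" unfolding n unfolding A_def by simp
   then have "b\<in>K" unfolding k(3) by (rule Kf(3)[OF k(1)])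
   then show "b\<in>L" using b KN by auto
  qed
  moreover have "L<=K'\<inter>N" using KN KK' by auto
  ultimately have "K'\<in>KK" unfolding KK_def using K'i by auto
  then have "K' = K" using K(2) KK' by blast
  then show ?thesis using KK'(2) by auto
 qed
 have xM: "x i\<in>M" for i unfolding M_gen using genideal_self[OF xr] by auto
 have "ALL i. EX n. x i [^] (n::nat)\<in>K" using pow xM by blast
 then obtain e :: "'i => nat" where e: "x i [^] e i\<in>K" for i by metis
 have "ideal_pow R M (Suc (degree_of e))<=K"
 proof (rule Mpow_sub[OF Ki])
  fix k :: "'i => nat" assume k: "degree_of k = Suc (degree_of e)"
  have "EX i. e i<=k i"
  proof (rule ccontr)
   assume "\<not> ?thesis"
   then have "degree_of k<=degree_of e" by (intro sum_mono) (auto simp: not_le less_imp_le)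
   then show False using k by simp
  qed
  then obtain i where "e i<=k i" by auto
  then show "monomial R x k\<in>K" by (rule monomial_in_pow_ideal[OF xr _ Ki e])
 qed
 moreover have "I<=K" using Lf(1) KN by auto
 ultimately have "set_add R I (ideal_pow R M (Suc (degree_of e)))<=K" by (intro set_add_facts(3)[OF I Mpow_ideal Ki])
 moreover have "N<=set_add R I (ideal_pow R M (Suc (degree_of e)))" unfolding N_def by (rule INF_lower) (rule UNIV_I)
 ultimately have "N<=K" by (rule order_trans[rotated])
 then have "N<=L" using KN by auto
 have "N<=I"
 proof (rule nakayama[OF Ni I])
  fix b assume "b\<in>N"
  then obtain i q where q: "i\<in>I" "q\<in>M \<cdot> N" "b = i\<oplus>q" using \<open>N<=L\<close> Lf(4) by blast
  have "b = q\<oplus>i" unfolding q(3) using ideal_facts(1)[OF I] ideal_facts(1)[OF MNi] q(1,2) by (intro a_comm) auto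
  then show "\<exists>q\<in>M \<cdot> N. EX n:I. b = q\<oplus>n" using q(1,2) by (intro bexI)
 qed
 then show ?thesis using a unfolding N_def by auto
qed

lemma finite_degree: "finite {m :: 'i => nat. degree_of m < n}" "finite {m :: 'i => nat. degree_of m = n}"
proof -
 have le: "m i<=degree_of m" for m :: "'i => nat" and i by (rule member_le_sum) auto
 have "{m :: 'i => nat. degree_of m<=n}<=(\<Pi>\<^sub>E i\<in>UNIV. {..n})"
  using le order_trans by (auto simp: PiE_def extensional_def) blast
 then have "finite {m :: 'i => nat. degree_of m<=n}" by (rule finite_subset) (intro finite_PiE, auto)
 then show "finite {m :: 'i => nat. degree_of m < n}" "finite {m :: 'i => nat. degree_of m = n}" by (auto elim!: finite_subset[rotated])
qed

definition part :: "(('i => nat) => 'a) => nat => 'a"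
 where "part c n = (\<Oplus>m\<in>{m. degree_of m < n}. c m\<otimes>monomial R x m)"

text \<open>Coefficients in \<open>M\<close> raise the degree of their monomial by one and are left
  to the remainder, so that only units and zeros stay.\<close>

lemma unit_coeff_step:
 assumes "r\<in>ideal_pow R M n"
 shows "EX d. range d<=Units R\<union>{\<zero>} & r\<ominus>(\<Oplus>m\<in>{m. degree_of m = n}. d m\<otimes>monomial R x m)\<in>ideal_pow R M (Suc n)"
proof -
 let ?D = "{m :: 'i => nat. degree_of m = n}"
 have mc: "monomial R x ` ?D<=\<K>" using mon_closed by auto
 from assms obtain a where a: "a\<in>?D \<rightarrow> \<K>" "r = (\<Oplus>m\<in>?D. a m\<otimes>monomial R x m)"
  unfolding Mpow_gen Idl_image_iff[OF finite_degree(2) mc] by auto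
 define d where "d m = (if degree_of m = n & a m\<in>Units R then a m else \<zero>)" for m
 have ac: "a m\<in>\<K>" if "degree_of m = n" for m using a(1) that by auto
 have dc: "d m\<in>\<K>" for m unfolding d_def using ac by auto
 have "(\<Oplus>m\<in>?D. d m\<otimes>monomial R x m)\<oplus>(\<Oplus>m\<in>?D. (a m\<ominus>d m)\<otimes>monomial R x m)
   = (\<Oplus>m\<in>?D. d m\<otimes>monomial R x m\<oplus>(a m\<ominus>d m)\<otimes>monomial R x m)"
  using ac dc mon_closed by (subst finsum_addf) auto
 also have "... = r" unfolding a(2)
 proof (rule finsum_cong')
  fix m assume "m\<in>?D"
  then have "a m\<in>\<K>" using ac by auto
  then show "d m\<otimes>monomial R x m\<oplus>(a m\<ominus>d m)\<otimes>monomial R x m = a m\<otimes>monomial R x m"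
   using dc[of m] mon_closed[of m] by algebra
 qed (use ac mon_closed in auto)
 finally have eq: "(\<Oplus>m\<in>?D. d m\<otimes>monomial R x m)\<oplus>(\<Oplus>m\<in>?D. (a m\<ominus>d m)\<otimes>monomial R x m) = r" .
 have sc: "(\<Oplus>m\<in>?D. d m\<otimes>monomial R x m)\<in>\<K>" using dc mon_closed by (intro finsum_closed) auto
 have "(\<Oplus>m\<in>?D. (a m\<ominus>d m)\<otimes>monomial R x m)\<in>ideal_pow R M (Suc n)"
 proof (rule ideal_finsum[OF Mpow_ideal])
  fix m assume m: "m\<in>?D"
  have "a m\<ominus>d m\<in>M"
  proof (cases "a m\<in>Units R")
   case True
   then have "a m\<ominus>d m = \<zero>" using m ac[of m] by (simp add: d_def minus_eq r_neg)
   then show ?thesis using ideal_facts(2)[OF M_ideal] by simp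
  next
   case False
   then have "a m\<in>M" using Units_iff ac[of m] m by auto
   then show ?thesis using False ac[of m] m by (simp add: d_def minus_eq)
  qed
  moreover have "monomial R x m\<in>ideal_pow R M n" unfolding Mpow_gen using m genideal_self[OF mc] by auto
  ultimately have "monomial R x m\<otimes>(a m\<ominus>d m)\<in>ideal_pow R M (Suc n)" unfolding ideal_pow_Suc by (intro ideal_prod.prod)
  then show "(a m\<ominus>d m)\<otimes>monomial R x m\<in>ideal_pow R M (Suc n)" using mon_closed[of m] ac[of m] dc[of m] m by (simp add: m_comm)
 qed
 moreover have "r\<ominus>(\<Oplus>m\<in>?D. d m\<otimes>monomial R x m) = (\<Oplus>m\<in>?D. (a m\<ominus>d m)\<otimes>monomial R x m)"
 proof -
  have "(\<Oplus>m\<in>?D. (a m\<ominus>d m)\<otimes>monomial R x m)\<in>\<K>" using ac dc mon_closed by (intro finsum_closed) auto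
  then show ?thesis unfolding eq[symmetric] using sc by (rule_tac add_diff_cancel_left)
 qed
 moreover have "range d<=Units R\<union>{\<zero>}" unfolding d_def by auto
 ultimately show ?thesis by (intro exI[of _ d]) simp
qed

text \<open>A formal expansion, built degree by degree. It converges in the \<open>M\<close>-adic
  sense but may have infinitely many terms; \<open>expansion_exists\<close> makes it finite.\<close>

lemma unit_coeffs_exist:
 assumes g: "g\<in>\<K>"
 shows "EX c. range c<=Units R\<union>{\<zero>} & (ALL n. g\<ominus>part c n\<in>ideal_pow R M n)"
proof -
 define P where "P n c <-> range c<=Units R\<union>{\<zero>} & g\<ominus>part c n\<in>ideal_pow R M n" for n c
 define Q where "Q n c c' <-> (ALL m. degree_of m < n --> c' m = c m)" for n and c c' :: "('i => nat) => 'a"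
 have closed: "c m\<in>\<K>" if "range c<=Units R\<union>{\<zero>}" for c :: "('i => nat) => 'a" and m
 proof -
  have "c m\<in>Units R\<union>{\<zero>}" using that by auto
  then show ?thesis by auto
 qed
 have pc: "part c n\<in>\<K>" if "range c<=Units R\<union>{\<zero>}" for c n
  unfolding part_def using closed[OF that] mon_closed by (intro finsum_closed) auto
 have "EX f. ALL n. P n (f n) & Q n (f n) (f (Suc n))"
 proof (rule dependent_nat_choice)
  have "g\<ominus>part (%_. \<zero>) 0\<in>\<K>" using g pc[of "%_. \<zero>" 0] by auto
  then show "EX c. P 0 c" unfolding P_def by (intro exI[of _ "%_. \<zero>"]) (simp only: ideal_pow_0, auto)
  fix c n assume "P n c"
  then have c: "range c<=Units R\<union>{\<zero>}" and r: "g\<ominus>part c n\<in>ideal_pow R M n" unfolding P_def by auto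
  from unit_coeff_step[OF r] obtain d where d: "range d<=Units R\<union>{\<zero>}"
   "g\<ominus>part c n\<ominus>(\<Oplus>m\<in>{m. degree_of m = n}. d m\<otimes>monomial R x m)\<in>ideal_pow R M (Suc n)" by auto
  define c' where "c' m = (if degree_of m = n then d m else c m)" for m
  have c': "range c'<=Units R\<union>{\<zero>}" unfolding c'_def using c d by auto
  have "{m :: 'i => nat. degree_of m < Suc n} = {m. degree_of m < n}\<union>{m. degree_of m = n}" by auto
  then have "part c' (Suc n) = (\<Oplus>m\<in>{m. degree_of m < n}. c' m\<otimes>monomial R x m)\<oplus>(\<Oplus>m\<in>{m. degree_of m = n}. c' m\<otimes>monomial R x m)"
   unfolding part_def using closed[OF c'] mon_closed finite_degree by (simp only:) (subst finsum_Un_disjoint, auto)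
  also have "(\<Oplus>m\<in>{m. degree_of m < n}. c' m\<otimes>monomial R x m) = part c n"
   unfolding part_def c'_def using closed[OF c] mon_closed by (intro finsum_cong') auto
  also have "(\<Oplus>m\<in>{m. degree_of m = n}. c' m\<otimes>monomial R x m) = (\<Oplus>m\<in>{m. degree_of m = n}. d m\<otimes>monomial R x m)"
   unfolding c'_def using closed[OF d(1)] mon_closed by (intro finsum_cong') auto
  finally have eq: "part c' (Suc n) = part c n\<oplus>(\<Oplus>m\<in>{m. degree_of m = n}. d m\<otimes>monomial R x m)" .
  have sc: "(\<Oplus>m\<in>{m. degree_of m = n}. d m\<otimes>monomial R x m)\<in>\<K>"
   using closed[OF d(1)] mon_closed by (intro finsum_closed) auto
  have "g\<ominus>part c' (Suc n) = g\<ominus>part c n\<ominus>(\<Oplus>m\<in>{m. degree_of m = n}. d m\<otimes>monomial R x m)"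
  proof -
   define w v where "w = (\<Oplus>m\<in>{m. degree_of m = n}. d m\<otimes>monomial R x m)" and "v = part c n"
   have "w\<in>\<K>" "v\<in>\<K>" unfolding w_def v_def using sc pc[OF c] by auto
   then have "g\<ominus>(v\<oplus>w) = g\<ominus>v\<ominus>w" using g by algebra
   then show ?thesis unfolding eq w_def v_def .
  qed
  then have "P (Suc n) c'" unfolding P_def using c' d(2) by simp
  moreover have "Q n c c'" unfolding Q_def c'_def by auto
  ultimately show "EX c'. P (Suc n) c' & Q n c c'" by auto
 qed
 then obtain f where f: "!!n. P n (f n)" "!!n. Q n (f n) (f (Suc n))" by auto
 \<comment> \<open>Stage \<open>n\<close> settles the degrees below \<open>n\<close>, so the
   coefficient at \<open>m\<close> is read off at stage \<open>|m| + 1\<close> and never changes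
   afterwards.\<close>
 define c where "c m = f (Suc (degree_of m)) m" for m
 have stable: "f n m = c m" if "degree_of m < n" for n m using that
 proof (induction n)
  case (Suc n)
  then show ?case using f(2)[of n] unfolding Q_def c_def by (cases "degree_of m = n") auto
 qed simp
 have cr: "range c<=Units R\<union>{\<zero>}" using f(1) unfolding P_def c_def by auto
 have fr: "range (f n)<=Units R\<union>{\<zero>}" for n using f(1) unfolding P_def by auto
 have "part c n = part (f n) n" for n unfolding part_def using stable closed[OF cr] closed[OF fr] mon_closed by (intro finsum_cong') auto
 then have "g\<ominus>part c n\<in>ideal_pow R M n" for n using f(1)[of n] unfolding P_def by simp
 then show ?thesis using cr by auto
qed

text \<open>The monomials of a formal expansion span an ideal that finitely many of them already
  span, and Krull's intersection theorem puts \<open>g\<close> into it. Writing \<open>g\<close> by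
  the minimal exponents alone gives a finite sum, and comparison with the formal expansion shows
  that its coefficients are units.\<close>

theorem expansion_exists:
 assumes g: "g\<in>\<K>"
 shows "EX c. finite {m. c m~=\<zero>} & range c<=Units R\<union>{\<zero>} & g = (\<Oplus>m\<in>{m. c m~=\<zero>}. c m\<otimes>monomial R x m)"
proof -
 obtain C where C: "range C<=Units R\<union>{\<zero>}" "!!n. g\<ominus>part C n\<in>ideal_pow R M n"
  using unit_coeffs_exist[OF g] by auto
 have CU: "C m\<in>Units R \<or> C m = \<zero>" for m using C(1) by auto
 have Cc: "C m\<in>\<K>" for m using CU[of m] by auto
 have pc: "part C n\<in>\<K>" for n unfolding part_def using Cc mon_closed by (intro finsum_closed) auto
 have ic: "monomial R x ` E<=\<K>" for E using mon_closed by auto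
 have idl: "ideal (Idl (monomial R x ` E)) R" for E by (rule genideal_ideal[OF ic])
 define GG where "GG = {Idl (monomial R x ` G) | G. finite G & G<={m. C m~=\<zero>}}"
 have "EX N:GG. ALL I:GG. N<=I --> I = N"
 proof (rule ex_maximal_ideal_in)
  show "GG~={}" unfolding GG_def by blast
  show "ideal I R" if "I\<in>GG" for I using that idl unfolding GG_def by auto
 qed
 then obtain N0 where N0: "N0\<in>GG" "!!I. I\<in>GG ==> N0<=I ==> I = N0" by auto
 from N0(1) obtain G where G': "N0 = Idl (monomial R x ` G) & finite G & G<={m. C m~=\<zero>}"
  unfolding GG_def mem_Collect_eq by (rule exE)
 have G: "finite G" "G<={m. C m~=\<zero>}" and N0G: "N0 = Idl (monomial R x ` G)" using G' by auto
 have mx: "Idl (monomial R x ` G') = Idl (monomial R x ` G)"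
  if "finite G'" "G'<={m. C m~=\<zero>}" "Idl (monomial R x ` G)<=Idl (monomial R x ` G')" for G'
 proof -
  have "Idl (monomial R x ` G')\<in>GG" unfolding GG_def using that(1,2) by (intro CollectI exI[of _ G']) simp
  then show ?thesis using N0(2) that(3) unfolding N0G by blast
 qed
 define I where "I = Idl (monomial R x ` G)"
 have Ii: "ideal I R" unfolding I_def by (rule idl)
 have supp: "monomial R x m\<in>I" if "C m~=\<zero>" for m
 proof -
  have "Idl (monomial R x ` G)<=Idl (monomial R x ` insert m G)"
   using genideal_self[OF ic[of "insert m G"]] by (intro genideal_minimal idl) auto
  then have "Idl (monomial R x ` insert m G) = I" unfolding I_def using G that by (intro mx) auto
  then show ?thesis using genideal_self[OF ic[of "insert m G"]] by auto
 qed
 have gI: "g\<in>I"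
 proof (rule krull_intersection[OF Ii])
  fix n
  have "part C n\<in>I" unfolding part_def
  proof (rule ideal_finsum[OF Ii])
   fix m
   show "C m\<otimes>monomial R x m\<in>I"
    using supp[of m] Cc[of m] mon_closed[of m] ideal_facts(2)[OF Ii] ideal_facts(4)[OF Ii, of "monomial R x m" "C m"] by (cases "C m = \<zero>") auto
  qed
  moreover have "g = part C n\<oplus>(g\<ominus>part C n)" using pc[of n] g by algebra
  ultimately show "g\<in>set_add R I (ideal_pow R M n)" using C(2)[of n] set_add_facts(4)[OF Ii Mpow_ideal] by blast
 qed
 \<comment> \<open>The minimal exponents generate the same ideal, and none of them divides another.
   Hence each coefficient can be isolated modulo the powers attached to its own exponent.\<close>
 define G0 where "G0 = {m\<in>G. ALL k:G. k<=m --> m = k}"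
 have G0: "finite G0" "G0<=G" unfolding G0_def using G by auto
 have low: "EX k:G0. k<=m" if "m\<in>G" for m using finite_has_minimal2[OF G(1) that] unfolding G0_def by blast
 have "I<=Idl (monomial R x ` G0)" unfolding I_def
 proof (intro genideal_minimal idl image_subsetI)
  fix m assume "m\<in>G"
  then obtain k where k: "k\<in>G0" "k<=m" using low by auto
  then have "monomial R x m = monomial R x (%i. m i - k i)\<otimes>monomial R x k" by (intro monomial_le[OF xr]) (auto simp: le_fun_def)
  then show "monomial R x m\<in>Idl (monomial R x ` G0)"
   using k genideal_self[OF ic[of G0]] mon_closed ideal_facts(4)[OF idl[of G0], of "monomial R x k" "monomial R x (%i. m i - k i)"] by auto
 qed
 then have "g\<in>Idl (monomial R x ` G0)" using gI by auto
 then obtain a where a: "a\<in>G0 \<rightarrow> \<K>" "g = (\<Oplus>m\<in>G0. a m\<otimes>monomial R x m)"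
  unfolding Idl_image_iff[OF G0(1) ic] by auto
 have aU: "a m\<in>Units R" if m: "m\<in>G0" for m
 proof -
  let ?P = "Idl (pows UNIV m)"
  note Pf = ideal_facts[OF pows_ideal[of UNIV m]]
  have ac: "a k\<in>\<K>" if "k\<in>G0" for k using that a(1) by auto
  have le: "k\<in>G0 ==> k<=m ==> k = m" for k using m unfolding G0_def by blast
  have inP: "monomial R x k\<in>?P" if "\<not> k<=m" for k using that monomial_in_pows[of m] by (auto simp: le_fun_def not_le)
  define A where "A = (\<Oplus>k\<in>G0 - {m}. a k\<otimes>monomial R x k)"
  have "(\<Oplus>k\<in>insert m (G0 - {m}). a k\<otimes>monomial R x k) = a m\<otimes>monomial R x m\<oplus>A"
   unfolding A_def using G0(1) ac m mon_closed by (intro finsum_insert) auto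
  then have gA: "g = a m\<otimes>monomial R x m\<oplus>A" unfolding a(2) using insert_Diff[OF m] by simp
  have AP: "A\<in>?P" unfolding A_def
  proof (rule ideal_finsum[OF pows_ideal])
   fix k assume "k\<in>G0 - {m}"
   then show "a k\<otimes>monomial R x k\<in>?P" using le inP ac by (intro Pf(4)) auto
  qed
  define n where "n = Suc (degree_of m)"
  let ?D = "{k :: 'i => nat. degree_of k < n}"
  have mD: "m\<in>?D" unfolding n_def by simp
  define B where "B = (\<Oplus>k\<in>?D - {m}. C k\<otimes>monomial R x k)"
  have "(\<Oplus>k\<in>insert m (?D - {m}). C k\<otimes>monomial R x k) = C m\<otimes>monomial R x m\<oplus>B"
   unfolding B_def using finite_degree(1)[of n] Cc m mon_closed by (intro finsum_insert) auto
  then have gB: "part C n = C m\<otimes>monomial R x m\<oplus>B" unfolding part_def using insert_Diff[OF mD] by simp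
  have BP: "B\<in>?P" unfolding B_def
  proof (rule ideal_finsum[OF pows_ideal])
   fix k assume k: "k\<in>?D - {m}"
   show "C k\<otimes>monomial R x k\<in>?P"
   proof (cases "C k = \<zero>")
    case True
    then show ?thesis using Pf(2) mon_closed by simp
   next
    case False
    have "EX j:G. j<=k"
    proof (rule ccontr)
     assume "\<not> ?thesis"
     then have "!!j. j\<in>G ==> EX i. k i < j i" by (auto simp: le_fun_def not_le)
     then have "\<one>\<otimes>monomial R x k~:I" unfolding I_def by (rule monomial_notin) auto
     then show False using supp[OF False] mon_closed by simp
    qed
    then obtain j where j: "j\<in>G0" "j<=k" using low order_trans by blast
    have "\<not> k<=m"
    proof
     assume "k<=m"
     then have "j = m" using le[of j] j by auto
     then show False using j \<open>k<=m\<close> k by auto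
    qed
    then show ?thesis using inP Cc by (intro Pf(4)) auto
   qed
  qed
  have r: "g\<ominus>part C n\<in>?P" using C(2)[of n] Mpow_sub_pows[of m n] unfolding n_def by auto
  have Ac: "A\<in>\<K>" and Bc: "B\<in>\<K>" using AP BP Pf(1) by auto
  \<comment> \<open>Modulo \<open>?P\<close> only the term at \<open>m\<close> survives, both in the
    finite sum and in the formal expansion. Hence the two coefficients agree modulo
    \<open>M\<close>, and one of them is a unit.\<close>
  have "(a m\<ominus>C m)\<otimes>monomial R x m = ((g\<ominus>part C n)\<oplus>B)\<ominus>A"
   unfolding gA gB using ac[OF m] Cc[of m] mon_closed[of m] Ac Bc by algebra
  also have "...\<in>?P" by (rule Pf(7)[OF Pf(3)[OF r BP] AP])
  finally have d: "a m\<ominus>C m\<in>M" using monomial_colon[of "a m\<ominus>C m" m] ac[OF m] Cc[of m] by auto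
  have "a m~:M"
  proof
   assume "a m\<in>M"
   from ideal_facts(7)[OF M_ideal this d] have "a m\<ominus>(a m\<ominus>C m)\<in>M" .
   moreover have "a m\<ominus>(a m\<ominus>C m) = C m" using ac[OF m] Cc[of m] by algebra
   moreover have "C m\<in>Units R" using CU[of m] m G0 G by auto
   ultimately show False using Units_iff by simp
  qed
  then show ?thesis using Units_iff ac[OF m] by auto
 qed
 define c where "c m = (if m\<in>G0 then a m else \<zero>)" for m
 have "\<zero>~:Units R" using Units_iff ideal_facts(2)[OF M_ideal] by auto
 then have "a m~=\<zero>" if "m\<in>G0" for m using aU[OF that] by metis
 then have supp_c: "{m. c m~=\<zero>} = G0" unfolding c_def by auto
 have "g = (\<Oplus>m\<in>G0. c m\<otimes>monomial R x m)" unfolding a(2) c_def using Units_closed[OF aU] mon_closed by (intro finsum_cong') auto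
 then show ?thesis using supp_c G0(1) aU by (intro exI[of _ c]) (auto simp: c_def)
qed

end

section \<open>Weighted monomial ideals and Newton polyhedra\<close>

definition weight :: "('i::finite => real) => ('i => nat) => real"
 where "weight w m = (\<Sum>i\<in>UNIV. w i * real (m i))"

text \<open>For a regular system of parameters and positive weights this is the ideal of value at
  least \<open>t\<close> for the monomial valuation with \<open>x i\<close> of value
  \<open>w i\<close>. Described by generators it involves no choice of expansions.\<close>

definition weight_ideal :: "('a, 'm) ring_scheme => ('i::finite => 'a) => ('i => real) => real => 'a set"
 where "weight_ideal R x w t = Idl\<^bsub>R\<^esub> (monomial R x ` {m. t<=weight w m})"

lemma weight_add: "weight w (%i. m i + k i) = weight w m + weight w k" unfolding weight_def by (simp add: sum.distrib distrib_left)

lemma weight_mono: "(!!i. 0<=w i) ==> m<=k ==> weight w m<=weight w k"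
 unfolding weight_def by (intro sum_mono mult_left_mono) (auto simp: le_fun_def)

lemma UNIV_sum_Un: "(UNIV :: ('d + 's) set) = Inl ` UNIV\<union>Inr ` UNIV" by (auto simp: UNIV_sum)

lemma weight_case_sum:
 fixes L :: "'d::finite => real" and m :: "'d + 's::finite => nat"
 shows "weight (case_sum L (%_. 1)) m = (\<Sum>i\<in>UNIV. L i * real (m (Inl i))) + real (degree_of (m\<circ>Inr))"
proof -
 have "weight (case_sum L (%_. 1)) m = (\<Sum>i\<in>Inl ` UNIV. case_sum L (%_. 1) i * real (m i)) +
   (\<Sum>i\<in>Inr ` UNIV. case_sum L (%_. 1) i * real (m i))" unfolding weight_def UNIV_sum_Un by (rule sum.union_disjoint) auto
 then show ?thesis by (simp add: sum.reindex)
qed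

lemma (in cring) monomial_case_sum:
 fixes u :: "'d::finite => 'a" and y :: "'s::finite => 'a"
 assumes "range u<=\<K>" "range y<=\<K>"
 shows "monomial R (case_sum u y) m = monomial R u (m\<circ>Inl)\<otimes>monomial R y (m\<circ>Inr)"
proof -
 have c: "u i\<in>\<K>" "y j\<in>\<K>" for i j using assms by auto
 have "monomial R (case_sum u y) m = (\<Otimes>i\<in>Inl ` UNIV. case_sum u y i [^] m i)\<otimes>(\<Otimes>i\<in>Inr ` UNIV. case_sum u y i [^] m i)"
  unfolding monomial_def UNIV_sum_Un using c by (intro finprod_Un_disjoint) auto
 also have "(\<Otimes>i\<in>Inl ` UNIV. case_sum u y i [^] m i) = monomial R u (m\<circ>Inl)"
  unfolding monomial_def using c by (subst finprod_reindex) (auto simp: inj_on_def)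
 also have "(\<Otimes>i\<in>Inr ` UNIV. case_sum u y i [^] m i) = monomial R y (m\<circ>Inr)"
  unfolding monomial_def using c by (subst finprod_reindex) (auto simp: inj_on_def)
 finally show ?thesis .
qed

lemma (in cring) weight_ideal_ideal:
 assumes "range x<=\<K>" shows "ideal (weight_ideal R x w t) R"
 unfolding weight_ideal_def using monomial_closed[OF assms] by (intro genideal_ideal) auto

lemma (in cring) weight_ideal_monomial:
 assumes "range x<=\<K>" "t<=weight w m" shows "monomial R x m\<in>weight_ideal R x w t"
 unfolding weight_ideal_def using monomial_closed[OF assms(1)] assms(2) by (intro genideal_self[THEN subsetD]) auto

lemma (in cring) weight_ideal_antimono:
 assumes "range x<=\<K>" "t<=t'" shows "weight_ideal R x w t'<=weight_ideal R x w t"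
 unfolding weight_ideal_def[of R x w t'] using assms by (intro genideal_minimal weight_ideal_ideal) (auto intro!: weight_ideal_monomial)

lemma (in cring) weight_ideal_mult:
 assumes x: "range x<=\<K>" and "a\<in>weight_ideal R x w s" "b\<in>weight_ideal R x w t"
 shows "a\<otimes>b\<in>weight_ideal R x w (s + t)"
proof -
 have c: "monomial R x ` E<=\<K>" for E using monomial_closed[OF x] by auto
 have "(weight_ideal R x w s) \<cdot> (weight_ideal R x w t)<=weight_ideal R x w (s + t)"
  unfolding weight_ideal_def[of R x w s] weight_ideal_def[of R x w t]
 proof (rule Idl_prod_sub[OF weight_ideal_ideal[OF x] c c])
  fix i j assume "i\<in>monomial R x ` {m. s<=weight w m}" "j\<in>monomial R x ` {m. t<=weight w m}"
  then obtain m k where m: "s<=weight w m" "i = monomial R x m" "t<=weight w k" "j = monomial R x k" by auto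
  have "s + t<=weight w (%i. m i + k i)" using m by (simp add: weight_add)
  then show "i\<otimes>j\<in>weight_ideal R x w (s + t)" using weight_ideal_monomial[OF x] unfolding m monomial_add[OF x, symmetric] by blast
 qed
 then show ?thesis using ideal_prod.prod[OF assms(2,3)] by auto
qed

lemma (in cring) weight_ideal_nonpos:
 assumes "range x<=\<K>" "t<=0" shows "weight_ideal R x w t = \<K>"
proof -
 have "monomial R x (%_. 0)\<in>weight_ideal R x w t" using assms by (intro weight_ideal_monomial) (auto simp: weight_def)
 then show ?thesis using ideal.one_imp_carrier[OF weight_ideal_ideal[OF assms(1)]] by (simp add: monomial_zero)
qed

lemma (in cring) weight_ideal_pow:
 assumes x: "range x<=\<K>" and a: "a\<in>weight_ideal R x w t"
 shows "a [^] n\<in>weight_ideal R x w (real n * t)"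
proof (induction n)
 case 0
 then show ?case using weight_ideal_nonpos[OF x, of 0 w] by simp
next
 case (Suc n)
 from weight_ideal_mult[OF x this a] show ?case by (simp add: distrib_right add.commute)
qed

lemma (in cring) weight_ideal_finprod:
 assumes x: "range x<=\<K>"
 shows "finite I ==> (!!i. i\<in>I ==> f i\<in>weight_ideal R x w (t i)) ==>
  (\<Otimes>i\<in>I. f i)\<in>weight_ideal R x w (\<Sum>i\<in>I. t i)"
proof (induction I rule: finite_induct)
 case empty
 then show ?case using weight_ideal_nonpos[OF x, of 0 w] by simp
next
 case (insert i I)
 have c: "f j\<in>\<K>" if "j\<in>insert i I" for j using insert.prems[OF that] ideal_facts(1)[OF weight_ideal_ideal[OF x]] by auto
 have "f i\<otimes>(\<Otimes>i\<in>I. f i)\<in>weight_ideal R x w (t i + (\<Sum>i\<in>I. t i))" using insert by (intro weight_ideal_mult[OF x]) auto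
 then show ?case using insert.hyps c by (simp add: Pi_iff)
qed

text \<open>The counterpart of \<open>is_expansion\<close> for a single family; \<open>(u,y)\<close>
  is treated as one family indexed by a sum type, so that the results on regular systems
  apply.\<close>

definition unit_expansion :: "('a, 'm) ring_scheme => ('i::finite => 'a) => 'a => (('i => nat) => 'a) => bool"
 where "unit_expansion R x g c <-> finite {m. c m~=\<zero>\<^bsub>R\<^esub>} & range c<=Units R\<union>{\<zero>\<^bsub>R\<^esub>} &
  g = (\<Oplus>\<^bsub>R\<^esub>m\<in>{m. c m~=\<zero>\<^bsub>R\<^esub>}. c m\<otimes>\<^bsub>R\<^esub>monomial R x m)"

lemma bij_pair_sum: "bij_betw (%m. (m\<circ>Inl, m\<circ>Inr)) UNIV UNIV"
 by (rule bij_betwI[where g = "%(A, B). case_sum A B"]) (auto simp: fun_eq_iff split: sum.splits)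

lemma (in cring) is_expansion_iff:
 fixes u :: "'d::finite => 'a" and y :: "'s::finite => 'a"
 assumes "range u<=\<K>" "range y<=\<K>"
 shows "is_expansion R u y g c <-> unit_expansion R (case_sum u y) g (%m. c (m\<circ>Inl, m\<circ>Inr))"
proof -
 define h where "h m = (m\<circ>Inl, m\<circ>Inr)" for m :: "'d + 's => nat"
 have bij: "bij h" unfolding h_def by (rule bij_pair_sum)
 have im: "{m. c m~=\<zero>} = h ` {m. c (h m)~=\<zero>}" using bij unfolding bij_def by (auto simp: image_iff) (metis surjD)
 have fin: "finite {m. c m~=\<zero>} <-> finite {m. c (h m)~=\<zero>}"
  unfolding im by (rule finite_image_iff) (use bij in \<open>auto simp: bij_def inj_on_def\<close>)
 have ran: "range c = range (%m. c (h m))" using bij unfolding bij_def by (metis fun.set_map image_image)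
 have "(\<Oplus>m\<in>{m. c m~=\<zero>}. c m\<otimes>monomial R u (fst m)\<otimes>monomial R y (snd m)) =
   (\<Oplus>m\<in>{m. c (h m)~=\<zero>}. c (h m)\<otimes>monomial R (case_sum u y) m)"
  if r: "range c<=Units R\<union>{\<zero>}"
 proof -
  have cc: "c m\<in>\<K>" for m
  proof -
   have "c m\<in>Units R\<union>{\<zero>}" using r by auto
   then show ?thesis by auto
  qed
  have "(\<Oplus>m\<in>h ` {m. c (h m)~=\<zero>}. c m\<otimes>monomial R u (fst m)\<otimes>monomial R y (snd m)) =
    (\<Oplus>m\<in>{m. c (h m)~=\<zero>}. c (h m)\<otimes>monomial R u (fst (h m))\<otimes>monomial R y (snd (h m)))"
   using cc monomial_closed[OF assms(1)] monomial_closed[OF assms(2)] bij by (intro finsum_reindex) (auto simp: bij_def inj_on_def)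
  also have "... = (\<Oplus>m\<in>{m. c (h m)~=\<zero>}. c (h m)\<otimes>monomial R (case_sum u y) m)"
   using cc monomial_closed[OF assms(1)] monomial_closed[OF assms(2)] by (intro finsum_cong') (auto simp: h_def monomial_case_sum[OF assms] m_assoc)
  finally show ?thesis unfolding im .
 qed
 then show ?thesis unfolding is_expansion_def unit_expansion_def fin[unfolded h_def] ran[unfolded h_def] by (auto simp: h_def)
qed

lemma (in cring) unit_expansion_weight_ideal:
 assumes x: "range x<=\<K>" and "unit_expansion R x g c" "!!m. c m~=\<zero> ==> t<=weight w m"
 shows "g\<in>weight_ideal R x w t"
proof -
 have "c m\<in>\<K>" for m
 proof -
  have "c m\<in>Units R\<union>{\<zero>}" using assms(2) unfolding unit_expansion_def by auto
  then show ?thesis by auto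
 qed
 then have "(\<Oplus>m\<in>{m. c m~=\<zero>}. c m\<otimes>monomial R x m)\<in>weight_ideal R x w t"
  using assms(3) by (intro ideal_finsum[OF weight_ideal_ideal[OF x]] ideal_facts(4)[OF weight_ideal_ideal[OF x]] weight_ideal_monomial[OF x]) auto
 then show ?thesis using assms(2) unfolding unit_expansion_def by simp
qed

text \<open>Among the exponents of weight below \<open>t\<close> in the expansion, a minimal one
  \<open>n\<close> could be isolated modulo \<open>pows UNIV n\<close>, and its unit coefficient
  would have to lie in \<open>M\<close>. Thus membership in a weight ideal can be read off from any
  expansion.\<close>

lemma (in regular_system) unit_expansion_weight:
 assumes w: "!!i. 0<=w i" and e: "unit_expansion R x g c" and g: "g\<in>weight_ideal R x w t" and m: "c m~=\<zero>"
 shows "t<=weight w m"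
proof (rule ccontr)
 assume contr: "\<not> t<=weight w m"
 define B where "B = {m. c m~=\<zero> & weight w m < t}"
 have fin: "finite {m. c m~=\<zero>}" and cU: "!!m. c m\<in>Units R\<union>{\<zero>}" and geq: "g = (\<Oplus>m\<in>{m. c m~=\<zero>}. c m\<otimes>monomial R x m)"
  using e unfolding unit_expansion_def by auto
 have cc: "c m\<in>\<K>" for m using cU[of m] by auto
 have "finite B" "m\<in>B" unfolding B_def using fin m contr by auto
 from finite_has_minimal2[OF this] obtain n where n: "n\<in>B" "!!k. k\<in>B ==> k<=n ==> n = k" by blast
 have nB: "c n~=\<zero>" "weight w n < t" using n unfolding B_def by auto
 let ?P = "Idl (pows UNIV n)"
 have inP: "monomial R x k\<in>?P" if "\<not> k<=n" for k using that monomial_in_pows[of n] by (auto simp: le_fun_def not_le)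
 have "weight_ideal R x w t<=?P" unfolding weight_ideal_def
 proof (intro genideal_minimal pows_ideal image_subsetI)
  fix k assume "k\<in>{m. t<=weight w m}"
  then have "\<not> k<=n" using weight_mono[of w, OF w] nB by fastforce
  then show "monomial R x k\<in>?P" by (rule inP)
 qed
 then have gP: "g\<in>?P" using g by auto
 define A where "A = (\<Oplus>k\<in>{m. c m~=\<zero>} - {n}. c k\<otimes>monomial R x k)"
 have "(\<Oplus>k\<in>insert n ({m. c m~=\<zero>} - {n}). c k\<otimes>monomial R x k) = c n\<otimes>monomial R x n\<oplus>A"
  unfolding A_def using fin cc mon_closed by (intro finsum_insert) auto
 moreover have "insert n ({m. c m~=\<zero>} - {n}) = {m. c m~=\<zero>}" using nB by auto
 ultimately have gA: "g = c n\<otimes>monomial R x n\<oplus>A" unfolding geq by simp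
 have AP: "A\<in>?P" unfolding A_def
 proof (rule ideal_finsum[OF pows_ideal])
  fix k assume k: "k\<in>{m. c m~=\<zero>} - {n}"
  have "\<not> k<=n"
  proof
   assume kn: "k<=n"
   then have "weight w k < t" using weight_mono[of w k n, OF w kn] nB by simp
   then show False using n(2)[of k] kn k unfolding B_def by auto
  qed
  then show "c k\<otimes>monomial R x k\<in>?P" using inP cc by (intro ideal_facts(4)[OF pows_ideal]) auto
 qed
 have Ac: "A\<in>\<K>" using AP ideal_facts(1)[OF pows_ideal[of UNIV n]] by auto
 have nc: "c n\<otimes>monomial R x n\<in>\<K>" using cc mon_closed by auto
 have "A\<oplus>c n\<otimes>monomial R x n\<in>?P" using gP unfolding gA a_comm[OF nc Ac] .
 then have "c n\<otimes>monomial R x n\<in>?P" by (rule ideal_add_cancel[OF pows_ideal _ AP nc])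
 then have "c n\<in>M" by (rule monomial_colon[OF cc])
 then show False using cU[of n] nB Units_iff by auto
qed

text \<open>Every property follows from the minimality of the hull: the translate of
  \<open>N\<close> by \<open>-v\<close> and the coordinate half-spaces are closed, convex and
  contain the generating points, which absorb the nonnegative orthant.\<close>

lemma newton_polyhedron_props:
 fixes R :: "('a, 'm) ring_scheme" and J :: "'a set" and b :: nat and u :: "'d::finite => 'a" and y :: "'s::finite => 'a"
 defines "N \<equiv> newton_polyhedron R (J, b) u y"
 shows "closed N" "convex N" "!!p v. p\<in>N ==> (ALL i. 0<=v $ i) ==> p + v\<in>N" "!!p i. p\<in>N ==> 0<=p $ i"
  "!!g c A B. g\<in>J ==> is_expansion R u y g c ==> c (A, B)~=\<zero>\<^bsub>R\<^esub> ==> degree_of B < b ==>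
   (\<chi> i. real (A i) / (real b - real (degree_of B)))\<in>N"
proof -
 define G where "G = {(\<chi> i. real (A i) / (real b - real (degree_of B))) + v | A B v g c.
   g\<in>J & is_expansion R u y g c & c (A, B)~=\<zero>\<^bsub>R\<^esub> & degree_of B < b & (ALL i. 0<=v $ i)}"
 have N: "N = (%P. closed P & convex P) hull G" unfolding N_def newton_polyhedron_def G_def by simp
 have "closed N & convex N" unfolding N by (rule hull_in) (auto intro!: closed_Inter convex_Inter)
 then show NN: "closed N" "convex N" by auto
 have GN: "G<=N" unfolding N by (rule hull_subset)
 have least: "closed P ==> convex P ==> G<=P ==> N<=P" for P unfolding N by (rule hull_minimal) auto
 {
  fix p and v :: "real ^ 'd" assume p: "p\<in>N" "ALL i. 0<=v $ i"
  have eq: "(%x. x + v) -` N = (+) (- v) ` N" by (auto simp: image_iff) (metis add.commute add_diff_cancel_left' diff_conv_add_uminus)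
  have "N<=(%x. x + v) -` N"
  proof (rule least)
   show "closed ((%x. x + v) -` N)" unfolding eq by (intro closed_translation NN)
   show "convex ((%x. x + v) -` N)" unfolding eq by (intro convex_translation NN)
   show "G<=(%x. x + v) -` N"
   proof
    fix q assume "q\<in>G"
    then obtain A B w g c where q: "q = (\<chi> i. real (A i) / (real b - real (degree_of B))) + w"
     "g\<in>J & is_expansion R u y g c & c (A, B)~=\<zero>\<^bsub>R\<^esub> & degree_of B < b & (ALL i. 0<=w $ i)"
     unfolding G_def mem_Collect_eq by (elim exE conjE) simp
    have "q + v = (\<chi> i. real (A i) / (real b - real (degree_of B))) + (w + v)" using q by (simp add: add.assoc)
    moreover have "ALL i. 0<=(w + v) $ i" using q p by simp
    ultimately have "q + v\<in>G" unfolding G_def mem_Collect_eq using q(2) by blast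
    then show "q\<in>(%x. x + v) -` N" using GN by auto
   qed
  qed
  then show "p + v\<in>N" using p by auto
 }
 {
  fix p :: "real ^ 'd" and i assume p: "p\<in>N"
  have "N<={x. 0<=x $ i}"
  proof (rule least)
   show "closed {x :: real ^ 'd. 0<=x $ i}" by (rule closed_halfspace_component_ge_cart)
   show "convex {x :: real ^ 'd. 0<=x $ i}" by (auto simp: convex_def)
   show "G<={x. 0<=x $ i}"
   proof
    fix q assume "q\<in>G"
    then obtain A B w g c where q: "q = (\<chi> i. real (A i) / (real b - real (degree_of B))) + w"
     "g\<in>J & is_expansion R u y g c & c (A, B)~=\<zero>\<^bsub>R\<^esub> & degree_of B < b & (ALL i. 0<=w $ i)"
     unfolding G_def mem_Collect_eq by (elim exE conjE) simp
    then have "degree_of B < b" by simp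
    then have "real (degree_of B) < real b" by (rule of_nat_less_iff[THEN iffD2])
    then have "0<=real (A i) / (real b - real (degree_of B))" by (intro divide_nonneg_pos) (auto simp del: of_nat_sum)
    then show "q\<in>{x. 0<=x $ i}" unfolding q(1) using q(2) by (simp del: of_nat_sum)
   qed
  qed
  then show "0<=p $ i" using p by auto
 }
 fix g c A B assume *: "g\<in>J" "is_expansion R u y g c" "c (A, B)~=\<zero>\<^bsub>R\<^esub>" "degree_of B < b"
 have "(\<chi> i. real (A i) / (real b - real (degree_of B))) + 0\<in>G" unfolding G_def mem_Collect_eq using * by (intro exI conjI refl) auto
 then show "(\<chi> i. real (A i) / (real b - real (degree_of B)))\<in>N" using GN by auto
qed

text \<open>The polyhedron absorbs the nonnegative orthant, so the normal vector of a separating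
  hyperplane is nonnegative. It is then tilted slightly to make all its coefficients positive, as
  the approximation in the completion requires, and scaled to the threshold 1.\<close>

lemma newton_polyhedron_separation:
 fixes z :: "'s::finite => 'a" and P :: "real ^ 'd"
 assumes P: "P~:newton_polyhedron R (J, b) u z" "!!i. 0<=P $ i"
 shows "EX L. (ALL i. 0 < L i) & (\<Sum>i\<in>UNIV. L i * P $ i) < 1 &
  (\<forall>p\<in>newton_polyhedron R (J, b) u z. 1<=(\<Sum>i\<in>UNIV. L i * p $ i))"
proof -
 define N where "N = newton_polyhedron R (J, b) u z"
 note Np = newton_polyhedron_props[where R=R and J=J and b=b and u=u and y=z, folded N_def]
 have "EX a t. (ALL i. 0<=a $ i) & a \<bullet> P < t & (ALL p:N. t<=a \<bullet> p) & 0 < t"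
 proof (cases "N = {}")
  case True
  then show ?thesis by (intro exI[of _ 0] exI[of _ 1]) auto
 next
  case False
  then obtain p0 where p0: "p0\<in>N" by auto
  obtain a t where a: "a \<bullet> P < t" "!!p. p\<in>N ==> t < a \<bullet> p"
   using separating_hyperplane_closed_point[OF Np(2,1), of P] P(1) unfolding N_def by auto
  have nn: "0<=a $ i" for i
  proof (rule ccontr)
   assume neg: "\<not> 0<=a $ i"
   \<comment> \<open>So far along the axis that the inequality of the hyperplane fails if the
     coefficient \<open>a $ i\<close> is negative.\<close>
   define s where "s = max 0 ((t - a \<bullet> p0) / (a $ i))"
   have "p0 + s *\<^sub>R axis i 1\<in>N" by (rule Np(3)[OF p0]) (auto simp: axis_def s_def)
   then have "t < a \<bullet> (p0 + s *\<^sub>R axis i 1)" by (rule a(2))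
   then have "t < a \<bullet> p0 + s * (a $ i)" by (simp add: inner_add_right inner_axis)
   moreover have "s * (a $ i)<=t - a \<bullet> p0"
   proof -
    have "(t - a \<bullet> p0) / (a $ i)<=s" unfolding s_def by simp
    then show ?thesis using neg by (simp add: neg_divide_le_eq)
   qed
   ultimately show False by simp
  qed
  have "0<=a \<bullet> P" using nn P(2) by (auto simp: inner_vec_def intro!: sum_nonneg)
  then show ?thesis using a nn by (intro exI[of _ a] exI[of _ t]) (auto simp: less_imp_le)
 qed
 then obtain a t where a: "!!i. 0<=a $ i" "a \<bullet> P < t" "!!p. p\<in>N ==> t<=a \<bullet> p" "0 < t" by auto
 define S where "S = (\<Sum>i\<in>UNIV. P $ i)"
 have S: "0<=S" unfolding S_def using P(2) by (intro sum_nonneg) auto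
 \<comment> \<open>Half of the gap at \<open>P\<close>, divided by the sum of its coordinates;
   adding 1 avoids a zero denominator.\<close>
 define e where "e = (t - a \<bullet> P) / (2 * (S + 1))"
 have e: "0 < e" "e * S < t - a \<bullet> P"
 proof -
  show e0: "0 < e" unfolding e_def using a(2) S by (intro divide_pos_pos) auto
  have "e * (2 * (S + 1)) = t - a \<bullet> P" unfolding e_def using S by simp
  moreover have "e * S < e * (2 * (S + 1))" using e0 S by (intro mult_strict_left_mono) auto
  ultimately show "e * S < t - a \<bullet> P" by simp
 qed
 define L where "L i = (a $ i + e) / t" for i
 have sumL: "(\<Sum>i\<in>UNIV. L i * p $ i) = (a \<bullet> p + e * (\<Sum>i\<in>UNIV. p $ i)) / t" for p :: "real ^ 'd"
  unfolding L_def inner_vec_def by (simp add: sum_divide_distrib sum_distrib_left sum.distrib[symmetric] algebra_simps add_divide_distrib)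
 show ?thesis
 proof (intro exI[of _ L] conjI allI ballI)
  show "0 < L i" for i unfolding L_def using a(1)[of i] a(4) e by (intro divide_pos_pos) auto
  show "(\<Sum>i\<in>UNIV. L i * P $ i) < 1" unfolding sumL using e a(4) by (simp add: S_def)
  fix p assume p: "p\<in>newton_polyhedron R (J, b) u z"
  then have "0<=(\<Sum>i\<in>UNIV. p $ i)" using Np(4) by (intro sum_nonneg) (auto simp: N_def)
  then have "t<=a \<bullet> p + e * (\<Sum>i\<in>UNIV. p $ i)" using a(3)[of p] p e by (simp add: N_def add_increasing2)
  then show "1<=(\<Sum>i\<in>UNIV. L i * p $ i)" unfolding sumL using a(4) by simp
 qed
qed

text \<open>By separation an inclusion need only be tested on the half-spaces with positive
  coefficients that contain the larger polyhedron. The two polyhedra may belong to different rings,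
  which allows comparison with the completion.\<close>

lemma newton_polyhedron_subsetI:
 fixes u1 :: "'d::finite => 'a" and y1 :: "'s::finite => 'a" and u2 :: "'d => 'c" and y2 :: "'t::finite => 'c"
 assumes "!!L g c A B. (!!i. 0 < L i) ==> (!!p. p\<in>newton_polyhedron R2 (J2, b) u2 y2 ==> 1<=(\<Sum>i\<in>UNIV. L i * p $ i)) ==>
  g\<in>J1 ==> is_expansion R1 u1 y1 g c ==> c (A, B)~=\<zero>\<^bsub>R1\<^esub> ==> degree_of B < b ==>
  real b - real (degree_of B)<=(\<Sum>i\<in>UNIV. L i * real (A i))"
 shows "newton_polyhedron R1 (J1, b) u1 y1<=newton_polyhedron R2 (J2, b) u2 y2" unfolding newton_polyhedron_def[of R1]
proof (rule hull_minimal)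
 show "closed (newton_polyhedron R2 (J2, b) u2 y2) & convex (newton_polyhedron R2 (J2, b) u2 y2)" using newton_polyhedron_props(1,2) by auto
 show "{(\<chi> i. real (A i) / (real (snd (J1, b)) - real (degree_of B))) + v | A B v g c.
   g\<in>fst (J1, b) & is_expansion R1 u1 y1 g c & c (A, B)~=\<zero>\<^bsub>R1\<^esub> & degree_of B < snd (J1, b) &
   (ALL i. 0<=v $ i)}<=newton_polyhedron R2 (J2, b) u2 y2"
 proof
  fix q assume "q\<in>{(\<chi> i. real (A i) / (real (snd (J1, b)) - real (degree_of B))) + v | A B v g c.
   g\<in>fst (J1, b) & is_expansion R1 u1 y1 g c & c (A, B)~=\<zero>\<^bsub>R1\<^esub> & degree_of B < snd (J1, b) &
   (ALL i. 0<=v $ i)}"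
  then obtain A B v g c where q: "q = (\<chi> i. real (A i) / (real b - real (degree_of B))) + v"
   "g\<in>J1" "is_expansion R1 u1 y1 g c" "c (A, B)~=\<zero>\<^bsub>R1\<^esub>" "degree_of B < b" "ALL i. 0<=v $ i"
   unfolding mem_Collect_eq by (elim exE conjE) simp
  define P where "P = (\<chi> i. real (A i) / (real b - real (degree_of B)))"
  have "real (degree_of B) < real b" using q(5) by (rule of_nat_less_iff[THEN iffD2])
  then have pos: "0 < real b - real (degree_of B)" by simp
  have "P\<in>newton_polyhedron R2 (J2, b) u2 y2"
  proof (rule ccontr)
   assume nP: "P~:newton_polyhedron R2 (J2, b) u2 y2"
   have P0: "0<=P $ i" for i unfolding P_def using pos by (simp del: of_nat_sum)
   from newton_polyhedron_separation[OF nP P0]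
   obtain L where L': "(ALL i. 0 < L i) & (\<Sum>i\<in>UNIV. L i * P $ i) < 1 &
    (\<forall>p\<in>newton_polyhedron R2 (J2, b) u2 y2. 1<=(\<Sum>i\<in>UNIV. L i * p $ i))" by (rule exE)
   have L: "!!i. 0 < L i" "(\<Sum>i\<in>UNIV. L i * P $ i) < 1"
    "!!p. p\<in>newton_polyhedron R2 (J2, b) u2 y2 ==> 1<=(\<Sum>i\<in>UNIV. L i * p $ i)" using L' by simp_all
   have le: "real b - real (degree_of B)<=(\<Sum>i\<in>UNIV. L i * real (A i))" by (rule assms[OF L(1,3) q(2,3,4,5)])
   have eq: "(\<Sum>i\<in>UNIV. L i * P $ i) = (\<Sum>i\<in>UNIV. L i * real (A i)) / (real b - real (degree_of B))"
    unfolding P_def by (simp add: sum_divide_distrib del: of_nat_sum)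
   have "(\<Sum>i\<in>UNIV. L i * real (A i)) < real b - real (degree_of B)" using L(2) unfolding eq divide_less_eq_1_pos[OF pos] .
   with leD[OF le] show False by (rule notE)
  qed
  then show "q\<in>newton_polyhedron R2 (J2, b) u2 y2" unfolding q(1) P_def using q(6) by (rule newton_polyhedron_props(3))
 qed
qed

section \<open>Differential operators\<close>

definition commutator :: "('a, 'm) ring_scheme => 'a => ('a => 'a) => 'a => 'a"
 where "commutator R a D = (%x. D (a\<otimes>\<^bsub>R\<^esub>x) \<ominus>\<^bsub>R\<^esub>a\<otimes>\<^bsub>R\<^esub>D x)"

text \<open>Operators of order less than \<open>q\<close> over a subring \<open>A\<close>, defined on the whole ring but
  preserving \<open>A\<close>; the shift of the order makes the zero operator the base case.\<close>

primrec dop :: "('a, 'm) ring_scheme => 'a set => nat => ('a => 'a) => bool" where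
 "dop R A 0 D <-> (\<forall>x\<in>carrier R. D x = \<zero>\<^bsub>R\<^esub>)"
| "dop R A (Suc q) D <-> D\<in>carrier R \<rightarrow> carrier R &
   (\<forall>x\<in>carrier R. \<forall>y\<in>carrier R. D (x\<oplus>\<^bsub>R\<^esub>y) = D x\<oplus>\<^bsub>R\<^esub>D y) & D \<one>\<^bsub>R\<^esub>\<in>A &
   (ALL a:A. dop R A q (commutator R a D))"

text \<open>Order at most \<open>n\<close> becomes order less than \<open>n + 1\<close>, and
  linearity over \<open>S\<close> is forgotten: the argument for maximal contact uses the commutator
  property only.\<close>

lemma diff_op_dop: "diff_op R S n D ==> ring R ==> dop R (carrier R) (Suc n) D"
proof (induction n arbitrary: D)
 case 0
 then interpret ring R by simp
 have "commutator R a D x = \<zero>\<^bsub>R\<^esub>" if "a\<in>carrier R" "x\<in>carrier R" for a x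
 proof -
  have "D (a\<otimes>\<^bsub>R\<^esub>x) = a\<otimes>\<^bsub>R\<^esub>D x" "D x\<in>carrier R"
   using 0(1) that unfolding linear_over_def diff_op.simps by auto
  then show ?thesis unfolding commutator_def minus_eq using that by (simp add: r_neg)
 qed
 then show ?case using 0 one_closed unfolding linear_over_def diff_op.simps by auto
next
 case (Suc n)
 then interpret ring R by simp
 have "dop R (carrier R) (Suc n) (commutator R a D)" if "a\<in>carrier R" for a unfolding commutator_def using Suc.prems that by (intro Suc.IH) auto
 moreover have "D \<one>\<^bsub>R\<^esub>\<in>carrier R" using Suc.prems one_closed unfolding linear_over_def diff_op.simps by blast
 ultimately show ?case using Suc.prems(1) unfolding linear_over_def diff_op.simps by simp
qed

locale cring_with_subring = cring R for R (structure) + fixes A assumes A: "subring A R"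
begin

lemmas Asub = subringE(1)[OF A]

lemma Ac [simp, intro]: "a\<in>A ==> a\<in>carrier R" using Asub by auto

lemma dop_closed: "dop R A q D ==> x\<in>carrier R ==> D x\<in>carrier R" by (cases q) auto

lemma dop_additive: "dop R A q D ==> x\<in>carrier R ==> y\<in>carrier R ==> D (x\<oplus>y) = D x\<oplus>D y" by (cases q) auto

lemmas dop_add = dop_closed dop_additive

lemma dop_zero: "dop R A q D ==> D \<zero> = \<zero>"
 using dop_additive[of q D \<zero> \<zero>] dop_closed[of q D \<zero>] by (metis add.l_cancel_one' r_zero zero_closed)

lemma dop_cong:
 "(!!x. x\<in>carrier R ==> D x = E x) ==> dop R A q D ==> dop R A q E"
proof (induction q arbitrary: D E)
 case (Suc q)
 have "dop R A q (commutator R a E)" if a: "a\<in>A" for a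
 proof (rule Suc.IH[of "commutator R a D"])
  show "commutator R a D x = commutator R a E x" if "x\<in>carrier R" for x unfolding commutator_def using Suc.prems(1) a that by simp
  show "dop R A q (commutator R a D)" using Suc.prems(2) a by simp
 qed
 then show ?case using Suc.prems by (auto simp: Pi_iff)
qed simp

lemma dop_plus:
 "dop R A q D ==> dop R A q E ==> dop R A q (%x. D x\<oplus>E x)"
proof (induction q arbitrary: D E)
 case (Suc q)
 note D = dop_add[OF Suc.prems(1)] and E = dop_add[OF Suc.prems(2)]
 have "dop R A q (commutator R a (%x. D x\<oplus>E x))" if a: "a\<in>A" for a
 proof (rule dop_cong)
  show "dop R A q (%x. commutator R a D x\<oplus>commutator R a E x)" by (rule Suc.IH) (use Suc.prems a in simp_all)
  fix x assume x: "x\<in>carrier R"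
  have c: "D (a\<otimes>x)\<in>carrier R" "E (a\<otimes>x)\<in>carrier R" "D x\<in>carrier R" "E x\<in>carrier R" "a\<in>carrier R"
   using D(1) E(1) a x by auto
  show "commutator R a D x\<oplus>commutator R a E x = commutator R a (%x. D x\<oplus>E x) x" unfolding commutator_def using c by algebra
 qed
 moreover have "D (x\<oplus>y)\<oplus>E (x\<oplus>y) = D x\<oplus>E x\<oplus>(D y\<oplus>E y)" if "x\<in>carrier R" "y\<in>carrier R" for x y
  using D(2)[OF that] E(2)[OF that] D(1)[OF that(1)] E(1)[OF that(1)] D(1)[OF that(2)] E(1)[OF that(2)] by (simp add: a_ac)
 ultimately show ?case using Suc.prems D(1) E(1) subringE(7)[OF A] by simp
qed simp

lemma dop_lmult:
 assumes a: "a\<in>A" shows "dop R A q D ==> dop R A q (%x. a\<otimes>D x)"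
proof (induction q arbitrary: D)
 case (Suc q)
 note D = dop_add[OF Suc.prems]
 have "dop R A q (commutator R d (%x. a\<otimes>D x))" if d: "d\<in>A" for d
 proof (rule dop_cong)
  show "dop R A q (%x. a\<otimes>commutator R d D x)" by (rule Suc.IH) (use Suc.prems d in simp)
  fix x assume x: "x\<in>carrier R"
  have c: "D (d\<otimes>x)\<in>carrier R" "D x\<in>carrier R" "a\<in>carrier R" "d\<in>carrier R" using D(1) a d x by auto
  show "a\<otimes>commutator R d D x = commutator R d (%x. a\<otimes>D x) x" unfolding commutator_def using c by algebra
 qed
 moreover have "a\<otimes>D (x\<oplus>y) = a\<otimes>D x\<oplus>a\<otimes>D y" if "x\<in>carrier R" "y\<in>carrier R" for x y
  using D(2)[OF that] D(1)[OF that(1)] D(1)[OF that(2)] a by (simp add: r_distr)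
 ultimately show ?case using Suc.prems D(1) subringE(6)[OF A] a by simp
qed (use a in auto)

text \<open>\<open>D a = [D, a] 1 + a (D 1)\<close>. By induction on the order the values at 1
  control all values on \<open>A\<close>, which is why \<open>dop\<close> asks only for
  \<open>D 1\<close> in \<open>A\<close>.\<close>

lemma dop_preserve: "dop R A q D ==> a\<in>A ==> D a\<in>A"
proof (induction q arbitrary: D a)
 case 0
 then show ?case using subringE(2)[OF A] by auto
next
 case (Suc q)
 note D = dop_add[OF Suc.prems(1)]
 have ac: "a\<in>carrier R" using Suc.prems(2) by simp
 have c: "D a\<in>carrier R" "D \<one>\<in>carrier R" using D(1) ac by auto
 have "commutator R a D \<one>\<in>A" by (rule Suc.IH[of "commutator R a D" \<one>]) (use Suc.prems subringE(3)[OF A] in simp_all)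
 moreover have "a\<otimes>D \<one>\<in>A" using Suc.prems subringE(6)[OF A] by simp
 ultimately have "commutator R a D \<one>\<oplus>a\<otimes>D \<one>\<in>A" by (rule subringE(7)[OF A])
 moreover have "(D a\<ominus>a\<otimes>D \<one>)\<oplus>a\<otimes>D \<one> = D a" using ac c by algebra
 ultimately show ?case unfolding commutator_def using ac by simp
qed

lemma dop_rmult:
 assumes a: "a\<in>A" shows "dop R A q D ==> dop R A q (%x. D (a\<otimes>x))"
proof (induction q arbitrary: D)
 case (Suc q)
 note D = dop_add[OF Suc.prems]
 have "dop R A q (commutator R d (%x. D (a\<otimes>x)))" if d: "d\<in>A" for d
 proof (rule dop_cong)
  show "dop R A q (%x. commutator R d D (a\<otimes>x))" by (rule Suc.IH) (use Suc.prems d in simp)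
  fix x assume x: "x\<in>carrier R"
  show "commutator R d D (a\<otimes>x) = commutator R d (%x. D (a\<otimes>x)) x" unfolding commutator_def using a d x by (simp add: m_lcomm)
 qed
 moreover have "D (a\<otimes>(x\<oplus>y)) = D (a\<otimes>x)\<oplus>D (a\<otimes>y)" if "x\<in>carrier R" "y\<in>carrier R" for x y
  using D(2)[of "a\<otimes>x" "a\<otimes>y"] that a by (simp add: r_distr)
 moreover have "D (a\<otimes>\<one>)\<in>A" using dop_preserve[OF Suc.prems a] a by simp
 ultimately show ?case using D(1) a by simp
qed (use a in auto)

lemma dop_mono: "dop R A q D ==> dop R A (Suc q) D"
proof (induction q arbitrary: D)
 case 0
 then have "commutator R a D x = \<zero>" if "a\<in>A" "x\<in>carrier R" for a x unfolding commutator_def using that by (simp add: minus_eq)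
 then show ?case using 0 subringE(2)[OF A] by auto
next
 case (Suc q)
 have "dop R A (Suc q) (commutator R a D)" if "a\<in>A" for a by (rule Suc.IH) (use Suc.prems that in simp)
 then show ?case unfolding dop.simps(2)[of R A "Suc q"] using Suc.prems by simp
qed

lemma dop_null: "dop R A q (%_. \<zero>)"
proof (induction q)
 case (Suc q)
 then show ?case by (rule dop_mono)
qed simp

lemma dop_uminus: "dop R A q D ==> dop R A q (%x. \<ominus>D x)"
proof (rule dop_cong)
 assume D: "dop R A q D"
 show "dop R A q (%x. \<ominus>\<one>\<otimes>D x)" by (rule dop_lmult[OF _ D]) (simp add: subringE(3,5)[OF A])
 show "\<ominus>\<one>\<otimes>D x = \<ominus>D x" if "x\<in>carrier R" for x using dop_add(1)[OF D that] by (simp add: l_minus)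
qed

text \<open>The product rule \<open>[E, a d] = [E, a] d + a [E, d]\<close> is the essential closure
  property. It allows the order of an operator to be tested on ring generators, as for the charts of
  a blow-up.\<close>

lemma commutator_subring:
 assumes E: "E\<in>carrier R \<rightarrow> carrier R" "!!x y. x\<in>carrier R ==> y\<in>carrier R ==> E (x\<oplus>y) = E x\<oplus>E y"
 shows "subring {a\<in>A. dop R A q (commutator R a E)} R" (is "subring ?C R")
proof (rule subringI)
 have Ec: "E x\<in>carrier R" if "x\<in>carrier R" for x using E(1) that by auto
 have E0: "E \<zero> = \<zero>" using E(2)[of \<zero> \<zero>] Ec[of \<zero>] by (metis add.l_cancel_one' r_zero zero_closed)
 have Em: "E (\<ominus>x) = \<ominus>E x" if "x\<in>carrier R" for x
  using E(2)[of "\<ominus>x" x] Ec[of x] Ec[of "\<ominus>x"] that E0 by (simp add: l_neg minus_equality)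
 show "?C<=carrier R" by auto
 have "dop R A q (commutator R \<one> E)"
 proof (rule dop_cong)
  show "dop R A q (%_. \<zero>)" by (rule dop_null)
  show "\<zero> = commutator R \<one> E x" if "x\<in>carrier R" for x unfolding commutator_def using that Ec[OF that] by (simp add: minus_eq r_neg)
 qed
 then show "\<one>\<in>?C" using subringE(3)[OF A] by simp
 fix a assume a: "a\<in>?C"
 have "dop R A q (commutator R (\<ominus>a) E)"
 proof (rule dop_cong)
  show "dop R A q (%x. \<ominus>commutator R a E x)" by (rule dop_uminus) (use a in simp)
  fix x assume x: "x\<in>carrier R"
  have c: "a\<in>carrier R" "E (a\<otimes>x)\<in>carrier R" "E x\<in>carrier R" using a x Ec by auto
  have "\<ominus>(E (a\<otimes>x)\<ominus>a\<otimes>E x) = \<ominus>E (a\<otimes>x)\<ominus>(\<ominus>a)\<otimes>E x" using c by algebra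
  then show "\<ominus>commutator R a E x = commutator R (\<ominus>a) E x"
   unfolding commutator_def using c x Em[of "a\<otimes>x"] by (simp add: l_minus)
 qed
 then show "\<ominus>a\<in>?C" using a subringE(5)[OF A] by simp
 fix d assume d: "d\<in>?C"
 have "dop R A q (commutator R (a\<otimes>d) E)"
 proof (rule dop_cong)
  show "dop R A q (%x. commutator R a E (d\<otimes>x)\<oplus>a\<otimes>commutator R d E x)"
   using a d by (intro dop_plus dop_rmult[of d q "commutator R a E"] dop_lmult) simp_all
  fix x assume x: "x\<in>carrier R"
  have c: "a\<in>carrier R" "d\<in>carrier R" "E (a\<otimes>(d\<otimes>x))\<in>carrier R" "E (d\<otimes>x)\<in>carrier R" "E x\<in>carrier R"
   using a d x Ec by auto
  have "E (a\<otimes>(d\<otimes>x))\<ominus>a\<otimes>E (d\<otimes>x)\<oplus>a\<otimes>(E (d\<otimes>x)\<ominus>d\<otimes>E x) = E (a\<otimes>(d\<otimes>x))\<ominus>(a\<otimes>d)\<otimes>E x"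
   using c by algebra
  then show "commutator R a E (d\<otimes>x)\<oplus>a\<otimes>commutator R d E x = commutator R (a\<otimes>d) E x"
   unfolding commutator_def using c x by (simp add: m_assoc)
 qed
 then show "a\<otimes>d\<in>?C" using a d subringE(6)[OF A] by simp
 have "dop R A q (commutator R (a\<oplus>d) E)"
 proof (rule dop_cong)
  show "dop R A q (%x. commutator R a E x\<oplus>commutator R d E x)" using a d by (intro dop_plus) simp_all
  fix x assume x: "x\<in>carrier R"
  have c: "a\<in>carrier R" "d\<in>carrier R" "E (a\<otimes>x)\<in>carrier R" "E (d\<otimes>x)\<in>carrier R" "E x\<in>carrier R"
   using a d x Ec by auto
  have "E (a\<otimes>x)\<ominus>a\<otimes>E x\<oplus>(E (d\<otimes>x)\<ominus>d\<otimes>E x) = (E (a\<otimes>x)\<oplus>E (d\<otimes>x))\<ominus>(a\<oplus>d)\<otimes>E x"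
   using c by algebra
  then show "commutator R a E x\<oplus>commutator R d E x = commutator R (a\<oplus>d) E x"
   unfolding commutator_def using c x E(2) by (simp add: l_distr)
 qed
 then show "a\<oplus>d\<in>?C" using a d subringE(7)[OF A] by simp
qed

lemma dop_generated:
 assumes gen: "A = generate_ring R G" "G<=carrier R"
  and E: "E\<in>carrier R \<rightarrow> carrier R" "!!x y. x\<in>carrier R ==> y\<in>carrier R ==> E (x\<oplus>y) = E x\<oplus>E y"
  and one: "E \<one>\<in>A" and com: "!!g. g\<in>G ==> dop R A q (commutator R g E)" shows "dop R A (Suc q) E"
proof -
 have "G<={a\<in>A. dop R A q (commutator R a E)}" using com generate_ring.incl[of _ G R] gen(1) by auto
 from generate_ring_min_subring1[OF gen(2) commutator_subring[OF E] this]
 have "dop R A q (commutator R a E)" if "a\<in>A" for a using gen(1) that by auto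
 then show ?thesis using E one by simp
qed

text \<open>\<open>D (i j) = [D, j] i + j (D i)\<close> for \<open>i\<close> in \<open>I^q\<close>
  and \<open>j\<close> in \<open>I\<close>: the first term is covered by induction, as the
  commutator has smaller order, and the second because \<open>D\<close> preserves
  \<open>A\<close>.\<close>

lemma dop_ideal_pow:
 assumes I: "ideal I (on_carrier R A)" shows "dop R A q D ==> x\<in>ideal_pow (on_carrier R A) I q ==> D x\<in>I"
proof (induction q arbitrary: D x)
 interpret Q: cring "on_carrier R A" using subcring_iff[OF Asub] subcringI'[OF A] by simp
 note If = Q.ideal_facts[OF I, simplified]
 case 0
 have "x\<in>A" using 0(2) unfolding Q.ideal_pow_0 by simp
 with 0 show ?case using 0 If(2) by auto
next
 interpret Q: cring "on_carrier R A" using subcring_iff[OF Asub] subcringI'[OF A] by simp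
 note If = Q.ideal_facts[OF I, simplified]
 case (Suc q)
 have nA: "ideal_pow (on_carrier R A) I q<=A" using Q.ideal_facts(1)[OF Q.ideal_pow_ideal[OF I]] by simp
 have "x\<in>ideal_prod (on_carrier R A) (ideal_pow (on_carrier R A) I q) I" using Suc.prems(2) Q.ideal_pow_Suc by simp
 then have "D x\<in>I & x\<in>A"
 proof (induction rule: ideal_prod.induct)
  case (prod i j)
  have ij: "i\<in>A" "j\<in>A" using prod nA If(1) by auto
  have Di: "D i\<in>A" by (rule dop_preserve[OF Suc.prems(1) ij(1)])
  have "commutator R j D i\<in>I" by (rule Suc.IH) (use Suc.prems prod ij in simp_all)
  moreover have "j\<otimes>D i\<in>I" using If(5)[OF prod(2) Di] .
  ultimately have "commutator R j D i\<oplus>j\<otimes>D i\<in>I" using If(3) by simp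
  moreover have "commutator R j D i\<oplus>j\<otimes>D i = D (i\<otimes>j)"
  proof -
   have "D (j\<otimes>i)\<in>carrier R" using dop_add(1)[OF Suc.prems(1)] ij by simp
   then show ?thesis unfolding commutator_def using ij Di by (simp add: minus_eq a_assoc l_neg m_comm)
  qed
  ultimately show ?case using ij subringE(6)[OF A] by simp
 next
  case (sum s t)
  then have "D (s\<oplus>t) = D s\<oplus>D t" using dop_add(2)[OF Suc.prems(1)] by simp
  then show ?case using sum If(3) subringE(7)[OF A] by simp
 qed
 then show ?case ..
qed

end

lemma (in cring) cring_with_carrier: "cring_with_subring R \<K>"
 by (intro cring_with_subring.intro cring_with_subring_axioms.intro is_cring carrier_is_subring)

lemma (in cring) diff_op_ideal_pow:
 assumes I: "ideal I R" and D: "diff_op R S n D" and a: "a\<in>ideal_pow R I (Suc n)" shows "D a\<in>I"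
 using cring_with_subring.dop_ideal_pow[OF cring_with_carrier, of I "Suc n" D a] diff_op_dop[OF D ring_axioms] I a by simp

lemma (in cring) monomial_in_subring:
 assumes "subring S R" "range x<=S" shows "monomial R x m\<in>S"
proof -
 note S = subringE[OF assms(1)]
 have pow: "x i [^] (n::nat)\<in>S" for i n by (induction n) (use S(3) assms(2) in \<open>auto intro!: S(6)\<close>)
 have "finite T ==> (\<Otimes>i\<in>T. x i [^] m i)\<in>S" for T
 proof (induction T rule: finite_induct)
  case (insert i T)
  have "(\<Otimes>i\<in>insert i T. x i [^] m i) = x i [^] m i\<otimes>(\<Otimes>i\<in>T. x i [^] m i)"
   using insert.hyps pow S(1) by (intro finprod_insert) auto
  then show ?case using S(6)[OF pow insert.IH] by simp
 qed (use S in auto)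
 then show ?thesis unfolding monomial_def by simp
qed

section \<open>Weights under operators and under changes of parameters\<close>

lemma (in cring) weight_ideal_change:
 assumes x: "range x<=\<K>" and x': "range x'<=\<K>" and "!!i. x' i\<in>weight_ideal R x w (w i)"
 shows "weight_ideal R x' w t<=weight_ideal R x w t" unfolding weight_ideal_def[of R x']
proof (intro genideal_minimal weight_ideal_ideal[OF x] image_subsetI)
 fix m assume "m\<in>{m. t<=weight w m}"
 then have m: "t<=weight w m" by simp
 have "monomial R x' m\<in>weight_ideal R x w (\<Sum>i\<in>UNIV. real (m i) * w i)"
  unfolding monomial_def by (intro weight_ideal_finprod[OF x] weight_ideal_pow[OF x] assms(3)) auto
 moreover have "(\<Sum>i\<in>UNIV. real (m i) * w i) = weight w m" unfolding weight_def by (simp add: mult.commute)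
 ultimately show "monomial R x' m\<in>weight_ideal R x w t" using weight_ideal_antimono[OF x m] by auto
qed

lemma range_case_sum: "range (case_sum f g)<=C <-> range f<=C & range g<=C"
 by (auto simp: image_subset_iff split: sum.splits)

text \<open>For a generator \<open>u^A z^B\<close> there are two cases. If \<open>|B| >= b\<close>,
  then \<open>z^B\<close> lies in \<open>(z)^(n+1)\<close>, which \<open>D\<close> maps into
  \<open>(z)\<close>. Otherwise the weight of \<open>u^A\<close> is at least
  \<open>b - |B| >= 1\<close>, and \<open>u^A\<close> passes through \<open>D\<close> by linearity
  over \<open>S\<close>.\<close>

lemma (in cring) diff_op_weight_ideal:
 fixes u :: "'d::finite => 'a" and z :: "'s::finite => 'a"
 assumes S: "subring S R" "range u<=S" and z: "range z<=\<K>" and D: "diff_op R S n D" and nb: "n < b"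
  and L: "!!i. 0<=L i" and a: "a\<in>weight_ideal R (case_sum u z) (case_sum L (%_. 1)) (real b)"
 shows "D a\<in>weight_ideal R (case_sum u z) (case_sum L (%_. 1)) 1"
proof -
 let ?x = "case_sum u z" and ?w = "case_sum L (%_. 1) :: 'd + 's => real"
 define W where "W = weight_ideal R ?x ?w 1"
 have uc: "range u<=\<K>" using S subringE(1) by blast
 have xc: "range ?x<=\<K>" using uc z by (simp add: range_case_sum)
 have Wi: "ideal W R" unfolding W_def by (rule weight_ideal_ideal[OF xc])
 note Wf = ideal_facts[OF Wi]
 have lin: "linear_over R S D" using D by (cases n) auto
 have Dc: "D r\<in>\<K>" if "r\<in>\<K>" for r using lin that unfolding linear_over_def by auto
 have Dadd: "D (r\<oplus>t) = D r\<oplus>D t" if "r\<in>\<K>" "t\<in>\<K>" for r t using lin that unfolding linear_over_def by auto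
 have DS: "D (s\<otimes>r) = s\<otimes>D r" if "s\<in>S" "r\<in>\<K>" for s r using lin that unfolding linear_over_def by auto
 have D0: "D \<zero> = \<zero>" using DS[OF subringE(2)[OF S(1)], of \<zero>] Dc[of \<zero>] by simp
 have zW: "Idl (range z)<=W"
 proof (intro genideal_minimal Wi image_subsetI)
  fix k
  have "monomial R ?x (%i. if i = Inr k then 1 else 0)\<in>W"
   unfolding W_def by (rule weight_ideal_monomial[OF xc]) (simp add: weight_def if_distrib cong: if_cong)
  then show "z k\<in>W" unfolding monomial_single[OF xc] using z by (simp add: image_subset_iff)
 qed
 \<comment> \<open>\<open>D\<close> is not linear over \<open>R\<close>. Quantifying over all
   multiples turns the condition into membership in an ideal, so that it may be checked on
   generators.\<close>
 have "ideal {a\<in>\<K>. ALL r:\<K>. D (r\<otimes>a)\<in>W} R" (is "ideal ?A R")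
 proof (rule cidealI)
  fix a b assume a: "a\<in>?A"
  show "a\<oplus>b\<in>?A" if "b\<in>?A" using a that Wf(3) Dadd by (auto simp: r_distr)
  show "r\<otimes>a\<in>?A" if "r\<in>\<K>" for r using a that by (auto simp: m_assoc[symmetric])
 qed (use Wf(2) D0 in auto)
 moreover have "monomial R ?x ` {m. real b<=weight ?w m}<=?A"
 proof (intro image_subsetI CollectI conjI ballI)
  fix m r assume m: "m\<in>{m. real b<=weight ?w m}"
  show "monomial R ?x m\<in>\<K>" by (rule monomial_closed[OF xc])
  assume r: "r\<in>\<K>"
  define A B where "A = m\<circ>Inl" and "B = m\<circ>Inr"
  have uA: "monomial R u A\<in>S" by (rule monomial_in_subring[OF S])
  have uAc: "monomial R u A\<in>\<K>" and zBc: "monomial R z B\<in>\<K>" by (rule monomial_closed[OF uc], rule monomial_closed[OF z])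
  have "r\<otimes>monomial R ?x m = monomial R u A\<otimes>(r\<otimes>monomial R z B)"
   unfolding monomial_case_sum[OF uc z] A_def[symmetric] B_def[symmetric] using r uAc zBc by (simp add: m_ac)
  then have eq: "D (r\<otimes>monomial R ?x m) = monomial R u A\<otimes>D (r\<otimes>monomial R z B)" using DS[OF uA] r zBc by simp
  have Dr: "D (r\<otimes>monomial R z B)\<in>\<K>" using Dc r zBc by simp
  show "D (r\<otimes>monomial R ?x m)\<in>W"
  proof (cases "b<=degree_of B")
   case True
   have Ii: "ideal (Idl (range z)) R" by (rule genideal_ideal[OF z])
   have "monomial R z B\<in>ideal_pow R (Idl (range z)) (degree_of B)" unfolding ideal_pow_Idl_monomials[OF z]
    using monomial_closed[OF z] by (intro genideal_self[THEN subsetD]) auto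
   then have "monomial R z B\<in>ideal_pow R (Idl (range z)) (Suc n)" using ideal_pow_antimono[OF Ii, of "Suc n" "degree_of B"] True nb by auto
   then have "r\<otimes>monomial R z B\<in>ideal_pow R (Idl (range z)) (Suc n)" using r by (intro ideal_facts(4)[OF ideal_pow_ideal[OF Ii]])
   then have "D (r\<otimes>monomial R z B)\<in>W" using diff_op_ideal_pow[OF Ii D] zW by auto
   then show ?thesis unfolding eq by (rule Wf(4)[OF _ uAc])
  next
   case False
   have "real b<=(\<Sum>i\<in>UNIV. L i * real (A i)) + real (degree_of B)" using m unfolding weight_case_sum A_def B_def by simp
   moreover have "real (degree_of B) + 1<=real b" using False by linarith
   ultimately have LA: "1<=(\<Sum>i\<in>UNIV. L i * real (A i))" by linarith
   have "monomial R ?x (case_sum A (%_. 0))\<in>W"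
    unfolding W_def by (rule weight_ideal_monomial[OF xc]) (use LA in \<open>simp add: weight_case_sum\<close>)
   moreover have "monomial R ?x (case_sum A (%_. 0)) = monomial R u A"
    unfolding monomial_case_sum[OF uc z] using uAc by (simp add: comp_def monomial_zero)
   ultimately have "monomial R u A\<in>W" by simp
   then show ?thesis unfolding eq by (rule Wf(5)[OF _ Dr])
  qed
 qed
 ultimately have "weight_ideal R ?x ?w (real b)<=?A" unfolding weight_ideal_def by (rule genideal_minimal)
 then have "a\<in>?A" using a by auto
 then have "ALL r:\<K>. D (r\<otimes>a)\<in>W" "a\<in>\<K>" by simp_all
 from bspec[OF this(1) one_closed] this(2) show ?thesis unfolding W_def by simp
qed

text \<open>Modulo \<open>Wy\<close> every \<open>z k\<close> lies in \<open>M Z\<close>, so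
  Nakayama gives the claim. Write \<open>z k = p + q0\<close> with \<open>p\<close> in
  \<open>(u)\<close> and \<open>q0\<close> in \<open>(y)\<close>. The weight hypothesis makes
  \<open>q0\<close> an element \<open>q\<close> of \<open>Z\<close> up to an element of
  \<open>U\<close>; hence \<open>q\<close> lies in \<open>Wy\<close>, and \<open>z k - q\<close>
  lies in both \<open>Z\<close> and \<open>(u)\<close>, thus in \<open>M Z\<close>.\<close>

lemma weight_ideal_exchange:
 fixes R :: "('a, 'm) ring_scheme" (structure) and u :: "'d::finite => 'a" and y z :: "'s::finite => 'a"
 assumes "regular_system R M (case_sum u z)" and M: "M = genideal R (range (case_sum u y))"
  and yc: "range y<=\<K>" and L: "!!i. 0<=L i"
  and yW: "!!j. y j\<in>weight_ideal R (case_sum u z) (case_sum L (%_. 1)) 1"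
 shows "z k\<in>weight_ideal R (case_sum u y) (case_sum L (%_. 1)) 1"
proof -
 interpret regular_system R M "case_sum u z" by fact
 let ?w = "case_sum L (%_. 1) :: 'd + 's => real"
 define Wz where "Wz = weight_ideal R (case_sum u z) ?w 1"
 define Wy where "Wy = weight_ideal R (case_sum u y) ?w 1"
 have uc: "range u<=\<K>" and zc: "range z<=\<K>" using x_carr[of "Inl _"] x_carr[of "Inr _"] by auto
 have yx: "range (case_sum u y)<=\<K>" using uc yc by (simp add: range_case_sum)
 have Wzi: "ideal Wz R" and Wyi: "ideal Wy R" unfolding Wz_def Wy_def by (rule weight_ideal_ideal[OF xr], rule weight_ideal_ideal[OF yx])
 define Z Y U0 where "Z = Idl (range z)" and "Y = Idl (range y)" and "U0 = Idl (range u)"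
 have Zi: "ideal Z R" and Yi: "ideal Y R" and U0i: "ideal U0 R"
  unfolding Z_def Y_def U0_def by (rule genideal_ideal[OF zc], rule genideal_ideal[OF yc], rule genideal_ideal[OF uc])
 have mem: "z i\<in>Z" "y i\<in>Y" "u j\<in>U0" for i j
  unfolding Z_def Y_def U0_def using genideal_self[OF zc] genideal_self[OF yc] genideal_self[OF uc] by auto
 have c: "z i\<in>\<K>" "y i\<in>\<K>" "u j\<in>\<K>" for i j using zc yc uc by auto
 have YWy: "Y<=Wy" unfolding Y_def
 proof (intro genideal_minimal Wyi image_subsetI)
  fix j
  have "monomial R (case_sum u y) (%i. if i = Inr j then 1 else 0)\<in>Wy"
   unfolding Wy_def by (rule weight_ideal_monomial[OF yx]) (simp add: weight_def if_distrib cong: if_cong)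
  then show "y j\<in>Wy" unfolding monomial_single[OF yx] using c by simp
 qed
 have YWz: "Y<=Wz" unfolding Y_def Wz_def using yW by (intro genideal_minimal weight_ideal_ideal[OF xr]) auto
 \<comment> \<open>Monomials in \<open>u\<close> alone are the same in both systems; the
   intersection records their weight with respect to \<open>(u,y)\<close>.\<close>
 define U where "U = Wy\<inter>U0"
 have Ui: "ideal U R" unfolding U_def by (rule i_intersect[OF Wyi U0i])
 note ZU = set_add_facts[OF Zi Ui]
 have "Wz<=set_add R Z U" unfolding Wz_def weight_ideal_def
 proof (intro genideal_minimal add_ideals Zi Ui image_subsetI)
  fix m :: "'d + 's => nat" assume m: "m\<in>{m. 1<=weight ?w m}"
  show "monomial R (case_sum u z) m\<in>set_add R Z U"
  proof (cases "EX l. m (Inr l)~=0")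
   case True
   then obtain l where "m (Inr l)~=0" by auto
   then have "monomial R (case_sum u z) m\<in>Z" using mem c by (intro monomial_in_pow_ideal[OF xr, of "%_. 1" "Inr l" m Z] Zi) auto
   then show ?thesis using ZU(1) by auto
  next
   case False
   then have mr: "m\<circ>Inr = (%_. 0)" by (auto simp: comp_def)
   have "m~=(%_. 0)" using m by (auto simp: weight_def)
   then obtain i where i: "m i~=0" by (auto simp: fun_eq_iff)
   then obtain l where l: "i = Inl l" using False by (cases i) auto
   have "monomial R (case_sum u z) m\<in>U0"
    using mem c i unfolding l by (intro monomial_in_pow_ideal[OF xr, of "%_. 1" "Inl l" m U0] U0i) auto
   moreover have "monomial R (case_sum u z) m = monomial R (case_sum u y) m"
    unfolding monomial_case_sum[OF uc zc] monomial_case_sum[OF uc yc] mr by (simp add: monomial_zero)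
   moreover have "monomial R (case_sum u y) m\<in>Wy" unfolding Wy_def using m by (intro weight_ideal_monomial[OF yx]) simp
   ultimately show ?thesis using ZU(2) unfolding U_def by auto
  qed
 qed
 then have YZU: "Y<=set_add R Z U" using YWz by auto
 have MUY: "M<=set_add R U0 Y" unfolding M
 proof (intro genideal_minimal add_ideals U0i Yi)
  show "range (case_sum u y)<=set_add R U0 Y" unfolding range_case_sum using mem set_add_facts(1,2)[OF U0i Yi] by blast
 qed
  text \<open>An element \<open>\<Sum> e\<^sub>k z\<^sub>k\<close> of \<open>(u)\<close> has all \<open>e\<^sub>k\<close> in \<open>M\<close>.\<close>
 have inter: "a\<in>M \<cdot> Z" if a: "a\<in>Z" "a\<in>U0" for a
 proof -
  obtain e where e: "e\<in>UNIV \<rightarrow> carrier R" "a = (\<Oplus>l\<in>UNIV. e l\<otimes>z l)"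
   using a(1) unfolding Z_def Idl_image_iff[OF finite zc] by auto
  have ec: "e l\<in>carrier R" for l using e(1) by auto
  have "e l\<in>M" for l
  proof -
   define m :: "'d + 's => nat" where "m = (%i. if i = Inr l then 1 else 0)"
   let ?P = "Idl (pows UNIV m)"
   have P: "case_sum u z i\<in>?P" if "i~=Inr l" for i
    using monomial_in_pows[of m i "%j. if j = i then 1 else 0"] that monomial_single[OF xr, of i 1] x_carr[of i] unfolding m_def by simp
   have "U0<=?P" unfolding U0_def
   proof (intro genideal_minimal pows_ideal image_subsetI)
    fix j show "u j\<in>?P" using P[of "Inl j"] by simp
   qed
   then have aP: "a\<in>?P" using a(2) by (rule subsetD)
   define A where "A = (\<Oplus>j\<in>UNIV - {l}. e j\<otimes>z j)"
   have AP: "A\<in>?P" unfolding A_def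
   proof (rule ideal_finsum[OF pows_ideal])
    fix j assume "j\<in>UNIV - {l}"
    then show "e j\<otimes>z j\<in>?P" using P[of "Inr j"] ec by (intro ideal_facts(4)[OF pows_ideal]) auto
   qed
   have Ac: "A\<in>carrier R" using AP ideal_facts(1)[OF pows_ideal[of UNIV m]] by auto
   have "(\<Oplus>j\<in>insert l (UNIV - {l}). e j\<otimes>z j) = e l\<otimes>z l\<oplus>A" unfolding A_def using ec c by (intro finsum_insert) auto
   moreover have "insert l (UNIV - {l}) = UNIV" by auto
   ultimately have "a = e l\<otimes>z l\<oplus>A" using e(2) by simp
   then have "a = A\<oplus>e l\<otimes>z l" using ec c Ac by (simp add: a_comm)
   then have "e l\<otimes>z l\<in>?P" using ideal_add_cancel[OF pows_ideal, of A "e l\<otimes>z l"] aP AP ec c by simp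
   moreover have "monomial R (case_sum u z) m = z l" unfolding m_def monomial_single[OF xr] using c by simp
   ultimately show "e l\<in>M" using monomial_colon[OF ec, of l m] by simp
  qed
  then show ?thesis unfolding e(2) using mem by (intro ideal_finsum[OF ideal_prod_is_ideal[OF M_ideal Zi]] ideal_prod.prod) auto
 qed
 have MZi: "ideal (M \<cdot> Z) R" by (rule ideal_prod_is_ideal[OF M_ideal Zi])
 note MZW = set_add_facts[OF MZi Wyi]
 have zk: "z k\<in>set_add R (M \<cdot> Z) Wy" for k
 proof -
  have "z k\<in>M" unfolding M_gen using genideal_self[OF xr] by (auto intro!: rangeI[of "case_sum u z" "Inr k", simplified])
  then obtain p q0 where p: "p\<in>U0" "q0\<in>Y" "z k = p\<oplus>q0" using MUY set_add_facts(4)[OF U0i Yi] by blast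
  obtain q v where q: "q\<in>Z" "v\<in>U" "q0 = q\<oplus>v" using YZU p(2) ZU(4) by blast
  have cc: "p\<in>carrier R" "q\<in>carrier R" "v\<in>carrier R" using p q ideal_facts(1)[OF U0i] ideal_facts(1)[OF Zi] ideal_facts(1)[OF Ui] by auto
  have "q = q0\<ominus>v" unfolding q(3) using cc by algebra
  moreover have "q0\<ominus>v\<in>Wy" using p(2) q(2) YWy by (intro ideal_facts(7)[OF Wyi]) (auto simp: U_def)
  ultimately have qW: "q\<in>Wy" by simp
  have eq: "z k\<ominus>q = p\<oplus>v" unfolding p(3) q(3) using cc by algebra
  have "z k\<ominus>q\<in>U0" unfolding eq using p(1) q(2) by (intro ideal_facts(3)[OF U0i]) (auto simp: U_def)
  moreover have "z k\<ominus>q\<in>Z" by (rule ideal_facts(7)[OF Zi mem(1) q(1)])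
  ultimately have "z k\<ominus>q\<in>M \<cdot> Z" by (intro inter)
  moreover have "z k = (z k\<ominus>q)\<oplus>q" using c cc by algebra
  ultimately show ?thesis using qW MZW(4) by blast
 qed
 have "Z<=Wy"
 proof (rule nakayama[OF Zi Wyi])
  fix a assume "a\<in>Z"
  moreover have "Z<=set_add R (M \<cdot> Z) Wy" unfolding Z_def using zk
   by (intro genideal_minimal add_ideals MZi[unfolded Z_def] Wyi) (auto simp: Z_def)
  ultimately have "a\<in>set_add R (M \<cdot> Z) Wy" by auto
  then show "\<exists>q\<in>M \<cdot> Z. EX n:Wy. a = q\<oplus>n" unfolding MZW(4) .
 qed
 then show ?thesis using mem unfolding Wy_def by auto
qed

text \<open>The operators belonging to \<open>y\<close> are applied in the system
  \<open>(u,z)\<close>, where \<open>J\<close> is known to have weight \<open>b\<close>. This gives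
  \<open>y\<close> weight 1 over \<open>(u,z)\<close>; the inclusion wanted needs the reverse,
  \<open>z\<close> of weight 1 over \<open>(u,y)\<close>, which is the exchange lemma.\<close>

lemma weight_ideal_transfer:
 fixes u :: "'d::finite => 'a" and y z :: "'s::finite => 'a"
 assumes y: "regular_params R UNIV (case_sum u y)" and z: "regular_params R UNIV (case_sum u z)"
  and S: "subring S R" "range u<=S" and D: "attained_by_hasse_ops R S (J, b) y" and b: "0 < b"
  and L: "!!i. 0<=L i" and J: "J<=weight_ideal R (case_sum u z) (case_sum L (%_. 1)) (real b)"
 shows "J<=weight_ideal R (case_sum u y) (case_sum L (%_. 1)) (real b)"
proof -
 interpret y: regular_system R "max_ideal R" "case_sum u y" by (rule regular_params_system[OF y])
 interpret z: regular_system R "max_ideal R" "case_sum u z" by (rule regular_params_system[OF z])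
 have uc: "range u<=carrier R" and zc: "range z<=carrier R" and yc: "range y<=carrier R"
  using z.x_carr[of "Inl _"] z.x_carr[of "Inr _"] y.x_carr[of "Inr _"] by auto
 have yW: "y j\<in>weight_ideal R (case_sum u z) (case_sum L (%_. 1)) 1" for j
 proof -
  obtain D f where D: "diff_op R S (b - 1) D" "f\<in>J" "D f = y j" using spec[OF D[unfolded attained_by_hasse_ops_def], of j] by auto
  show ?thesis unfolding D(3)[symmetric] using D(2) J b L by (intro y.diff_op_weight_ideal[OF S zc D(1), where b = b]) auto
 qed
 have zW: "z k\<in>weight_ideal R (case_sum u y) (case_sum L (%_. 1)) 1" for k
  by (rule weight_ideal_exchange[OF z.regular_system_axioms y.M_gen yc L yW])
 have "weight_ideal R (case_sum u z) (case_sum L (%_. 1)) (real b)<=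
   weight_ideal R (case_sum u y) (case_sum L (%_. 1)) (real b)"
 proof (rule y.weight_ideal_change[OF y.xr z.xr])
  fix i :: "'d + 's"
  show "case_sum u z i\<in>weight_ideal R (case_sum u y) (case_sum L (%_. 1)) (case_sum L (%_. 1) i)"
  proof (cases i)
   case (Inl d)
   have "monomial R (case_sum u y) (%i. if i = Inl d then 1 else 0)\<in>
     weight_ideal R (case_sum u y) (case_sum L (%_. 1)) (L d)"
    by (rule y.weight_ideal_monomial[OF y.xr]) (simp add: weight_def if_distrib cong: if_cong)
   then show ?thesis unfolding y.monomial_single[OF y.xr] Inl using uc by (simp add: image_subset_iff)
  next
   case (Inr k)
   then show ?thesis using zW by simp
  qed
 qed
 then show ?thesis using J by auto
qed

text \<open>For \<open>|B| < b\<close> the inequality \<open>L(A) / (b - |B|) >= 1\<close> is the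
  same as \<open>L(A) + |B| >= b\<close>, and monomials with \<open>|B| >= b\<close> satisfy the
  latter anyway. The converse is \<open>weight_ideal_newton\<close>.\<close>

lemma newton_halfspace_weight_ideal:
 fixes u :: "'d::finite => 'a" and z :: "'s::finite => 'a"
 assumes z: "regular_params R UNIV (case_sum u z)" and J: "J<=carrier R"
  and L: "!!i. 0<=L i" and N: "!!p. p\<in>newton_polyhedron R (J, b) u z ==> 1<=(\<Sum>i\<in>UNIV. L i * p $ i)"
 shows "J<=weight_ideal R (case_sum u z) (case_sum L (%_. 1)) (real b)"
proof
 interpret z: regular_system R "max_ideal R" "case_sum u z" by (rule regular_params_system[OF z])
 have uc: "range u<=carrier R" and zc: "range z<=carrier R" using z.x_carr[of "Inl _"] z.x_carr[of "Inr _"] by auto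
 fix g assume g: "g\<in>J"
 then obtain c where c: "unit_expansion R (case_sum u z) g c" using z.expansion_exists[of g] J unfolding unit_expansion_def by auto
 define c' where "c' = (%(A, B). c (case_sum A B))"
 have "case_sum (m\<circ>Inl) (m\<circ>Inr) = m" for m :: "'d + 's => nat" by (auto simp: fun_eq_iff split: sum.splits)
 then have cc': "c = (%m. c' (m\<circ>Inl, m\<circ>Inr))" unfolding c'_def by auto
 have e: "is_expansion R u z g c'" unfolding z.is_expansion_iff[OF uc zc] using c unfolding cc' .
 show "g\<in>weight_ideal R (case_sum u z) (case_sum L (%_. 1)) (real b)"
 proof (rule z.unit_expansion_weight_ideal[OF z.xr c])
  fix m assume m: "c m~=\<zero>\<^bsub>R\<^esub>"
  define A B where "A = m\<circ>Inl" and "B = m\<circ>Inr"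
  have LA: "0<=(\<Sum>i\<in>UNIV. L i * real (A i))" using L by (intro sum_nonneg) auto
  have "real b<=(\<Sum>i\<in>UNIV. L i * real (A i)) + real (degree_of B)"
  proof (cases "degree_of B < b")
   case True
   then have "real (degree_of B) < real b" by (rule of_nat_less_iff[THEN iffD2])
   then have pos: "0 < real b - real (degree_of B)" by simp
   have "c' (A, B)~=\<zero>\<^bsub>R\<^esub>" using m unfolding cc' A_def B_def .
   then have "1<=(\<Sum>i\<in>UNIV. L i * (\<chi> i. real (A i) / (real b - real (degree_of B))) $ i)"
    using newton_polyhedron_props(5)[OF g e _ True] by (intro N)
   also have "... = (\<Sum>i\<in>UNIV. L i * real (A i)) / (real b - real (degree_of B))" by (simp add: sum_divide_distrib del: of_nat_sum)
   finally have "real b - real (degree_of B)<=(\<Sum>i\<in>UNIV. L i * real (A i))" unfolding le_divide_eq_1_pos[OF pos] .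
   then show ?thesis by linarith
  next
   case False
   then have "real b<=real (degree_of B)" by linarith
   then show ?thesis using LA by linarith
  qed
  then show "real b<=weight (case_sum L (%_. 1)) m" unfolding weight_case_sum A_def B_def by simp
 qed
qed

lemma weight_ideal_newton:
 fixes u :: "'d::finite => 'a" and y :: "'s::finite => 'a" assumes y: "regular_system R M (case_sum u y)"
  and L: "!!i. 0<=L i" and g: "g\<in>weight_ideal R (case_sum u y) (case_sum L (%_. 1)) (real b)"
  and e: "is_expansion R u y g c" "c (A, B)~=\<zero>\<^bsub>R\<^esub>"
 shows "real b - real (degree_of B)<=(\<Sum>i\<in>UNIV. L i * real (A i))"
proof -
 interpret y: regular_system R M "case_sum u y" by (rule y)
 have uc: "range u<=carrier R" and yc: "range y<=carrier R" using y.x_carr[of "Inl _"] y.x_carr[of "Inr _"] by auto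
 have e': "unit_expansion R (case_sum u y) g (%m. c (m\<circ>Inl, m\<circ>Inr))" using e(1) unfolding y.is_expansion_iff[OF uc yc] .
 have "real b<=weight (case_sum L (%_. 1)) (case_sum A B)"
  by (rule y.unit_expansion_weight[OF _ e' g]) (use L e(2) in \<open>auto simp: comp_def split: sum.splits\<close>)
 then show ?thesis unfolding weight_case_sum by (simp add: comp_def)
qed

theorem newton_polyhedron_le:
 fixes u :: "'d::finite => 'a" and y z :: "'s::finite => 'a"
 assumes y: "regular_params R UNIV (case_sum u y)" and z: "regular_params R UNIV (case_sum u z)"
  and S: "subring S R" "range u<=S" and D: "attained_by_hasse_ops R S (J, b) y" and b: "0 < b" and J: "J<=carrier R"
 shows "newton_polyhedron R (J, b) u y<=newton_polyhedron R (J, b) u z"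
proof (rule newton_polyhedron_subsetI)
 fix L :: "'d => real" and g c A B
 assume L: "!!i. 0 < L i" "!!p. p\<in>newton_polyhedron R (J, b) u z ==> 1<=(\<Sum>i\<in>UNIV. L i * p $ i)"
  and g: "g\<in>J" "is_expansion R u y g c" "c (A, B)~=\<zero>\<^bsub>R\<^esub>" "degree_of B < b"
 have L0: "0<=L i" for i using L(1)[of i] by simp
 have "J<=weight_ideal R (case_sum u z) (case_sum L (%_. 1)) (real b)" by (rule newton_halfspace_weight_ideal[OF z J L0 L(2)])
 then have "J<=weight_ideal R (case_sum u y) (case_sum L (%_. 1)) (real b)"
  by (rule weight_ideal_transfer[OF y z S D b, where L = L, rotated]) (rule L0)
 then show "real b - real (degree_of B)<=(\<Sum>i\<in>UNIV. L i * real (A i))"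
  using g by (intro weight_ideal_newton[OF regular_params_system[OF y] L0, where g = g and c = c]) auto
qed

section \<open>Complete filtered rings\<close>

text \<open>Completeness is asked for series with \<open>n\<close>-th term in \<open>F n\<close>
  rather than for Cauchy sequences, because limits are needed only for such series of
  coefficients.\<close>

locale complete_filtered = cring A for A (structure) +
 fixes F :: "nat => 'a set"
 assumes F_ideal: "ideal (F n) A" and F_0: "F 0 = carrier A" and F_dec: "F (Suc n)<=F n"
  and F_mult: "a\<in>F m ==> b\<in>F n ==> a\<otimes>b\<in>F (m + n)" and F_sep: "(!!n. a\<in>F n) ==> a = \<zero>"
  and F_complete: "(!!n. C n\<in>F n) ==> \<exists>Y\<in>carrier A. ALL n. Y\<ominus>(\<Oplus>k\<in>{..<n}. C k)\<in>F n"
begin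

lemma F_carr: "F n<=carrier A" by (rule ideal_facts(1)[OF F_ideal])

lemma F_pow:
 assumes "x\<in>F 1" shows "x [^] n\<in>F n"
proof (induction n)
 case (Suc n)
 then show ?case using F_mult[OF Suc assms] by simp
qed (simp add: F_0)

text \<open>The coefficients of all steps are summed to convergent series; what is left over lies in
  every \<open>F n\<close> and vanishes by separatedness.\<close>

lemma successive_approximation:
 assumes I: "finite I" "g ` I<=carrier A" and r: "!!n. r n\<in>F n"
  and step: "!!n. EX c. (ALL i:I. c i\<in>F n) & r n = (\<Oplus>i\<in>I. c i\<otimes>g i)\<oplus>r (Suc n)"
 shows "r 0\<in>Idl (g ` I)"
proof -
 have "ALL n. EX c. (ALL i:I. c i\<in>F n) & r n = (\<Oplus>i\<in>I. c i\<otimes>g i)\<oplus>r (Suc n)" using step by blast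
 then obtain c where c: "!!n i. i\<in>I ==> c n i\<in>F n" "!!n. r n = (\<Oplus>i\<in>I. c n i\<otimes>g i)\<oplus>r (Suc n)"
  using choice[of "%n c. (ALL i:I. c i\<in>F n) & r n = (\<Oplus>i\<in>I. c i\<otimes>g i)\<oplus>r (Suc n)"] by blast
 have cc: "c n i\<in>carrier A" if "i\<in>I" for n i using c(1)[OF that] F_carr by blast
 have gc: "g i\<in>carrier A" if "i\<in>I" for i using that I by auto
 have rc: "r n\<in>carrier A" for n using r F_carr by blast
 have "ALL i:I. EX Y. Y\<in>carrier A & (ALL n. Y\<ominus>(\<Oplus>k\<in>{..<n}. c k i)\<in>F n)"
 proof
  fix i assume "i\<in>I"
  then have "!!n. c n i\<in>F n" by (rule c(1))
  from F_complete[of "%n. c n i", OF this] show "EX Y. Y\<in>carrier A & (ALL n. Y\<ominus>(\<Oplus>k\<in>{..<n}. c k i)\<in>F n)"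
   by blast
 qed
 from bchoice[OF this] obtain Y where
  Y': "ALL i:I. Y i\<in>carrier A & (ALL n. Y i\<ominus>(\<Oplus>k\<in>{..<n}. c k i)\<in>F n)" by (rule exE)
 have Y: "Y i\<in>carrier A" "Y i\<ominus>(\<Oplus>k\<in>{..<n}. c k i)\<in>F n" if "i\<in>I" for i n using Y' that by auto
 define S where "S n i = (\<Oplus>k\<in>{..<n}. c k i)" for n :: nat and i
 have Sc: "S n i\<in>carrier A" if "i\<in>I" for n i unfolding S_def using cc that by (intro finsum_closed) auto
 have SS: "S (Suc n) i = c n i\<oplus>S n i" if "i\<in>I" for n i unfolding S_def lessThan_Suc using cc that by (subst finsum_insert) auto
 have part: "r 0 = (\<Oplus>i\<in>I. S n i\<otimes>g i)\<oplus>r n" for n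
 proof (induction n)
  case 0
  have "(\<Oplus>i\<in>I. S 0 i\<otimes>g i) = (\<Oplus>i\<in>I. \<zero>)" unfolding S_def using gc by (intro finsum_cong') auto
  then show ?case using rc by simp
 next
  case (Suc n)
  have "(\<Oplus>i\<in>I. S (Suc n) i\<otimes>g i) = (\<Oplus>i\<in>I. c n i\<otimes>g i\<oplus>S n i\<otimes>g i)"
   using SS cc Sc gc by (intro finsum_cong') (auto simp: l_distr)
  also have "... = (\<Oplus>i\<in>I. c n i\<otimes>g i)\<oplus>(\<Oplus>i\<in>I. S n i\<otimes>g i)" using cc Sc gc by (intro finsum_addf) auto
  finally have e: "(\<Oplus>i\<in>I. S (Suc n) i\<otimes>g i) = (\<Oplus>i\<in>I. c n i\<otimes>g i)\<oplus>(\<Oplus>i\<in>I. S n i\<otimes>g i)" .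
  have cl: "(\<Oplus>i\<in>I. c n i\<otimes>g i)\<in>carrier A" "(\<Oplus>i\<in>I. S n i\<otimes>g i)\<in>carrier A"
   using cc Sc gc by (auto intro!: finsum_closed)
  show ?case unfolding e by (subst Suc.IH, subst c(2)[of n]) (use cl rc in \<open>simp add: a_ac\<close>)
 qed
 define s where "s = (\<Oplus>i\<in>I. Y i\<otimes>g i)"
 have sc: "s\<in>carrier A" unfolding s_def using Y gc by (auto intro!: finsum_closed)
 have "r 0\<ominus>s\<in>F n" for n
 proof -
  have "(\<Oplus>i\<in>I. (Y i\<ominus>S n i)\<otimes>g i)\<in>F n"
   using Y(2) gc unfolding S_def by (intro ideal_finsum[OF F_ideal] ideal_facts(5)[OF F_ideal]) auto
  moreover have "s = (\<Oplus>i\<in>I. (Y i\<ominus>S n i)\<otimes>g i)\<oplus>(\<Oplus>i\<in>I. S n i\<otimes>g i)"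
  proof -
   have "(\<Oplus>i\<in>I. (Y i\<ominus>S n i)\<otimes>g i)\<oplus>(\<Oplus>i\<in>I. S n i\<otimes>g i) = (\<Oplus>i\<in>I. (Y i\<ominus>S n i)\<otimes>g i\<oplus>S n i\<otimes>g i)"
    using Y(1) Sc gc by (intro finsum_addf[symmetric]) auto
   also have "... = s" unfolding s_def
   proof (rule finsum_cong')
    fix i assume "i\<in>I"
    then show "(Y i\<ominus>S n i)\<otimes>g i\<oplus>S n i\<otimes>g i = Y i\<otimes>g i" using Y(1)[of i] Sc[of i n] gc[of i] by algebra
   qed (use Y gc in auto)
   finally show ?thesis by simp
  qed
  moreover define d e where "d = (\<Oplus>i\<in>I. (Y i\<ominus>S n i)\<otimes>g i)" and "e = (\<Oplus>i\<in>I. S n i\<otimes>g i)"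
  moreover have "d\<in>carrier A" "e\<in>carrier A" unfolding d_def e_def using Y(1) Sc gc by (auto intro!: finsum_closed)
  moreover have "(e\<oplus>r n)\<ominus>(d\<oplus>e) = r n\<ominus>d" using \<open>d\<in>carrier A\<close> \<open>e\<in>carrier A\<close> rc[of n] by algebra
  ultimately have "d\<in>F n" "r 0\<ominus>s = r n\<ominus>d" using part[of n] by simp_all
  then show ?thesis using ideal_facts(7)[OF F_ideal r[of n], of d] by simp
 qed
 then have z: "r 0\<ominus>s = \<zero>" by (rule F_sep)
 have "r 0 = (r 0\<ominus>s)\<oplus>s" using rc[of 0] sc by algebra
 then have "r 0 = s" using z sc by simp
 then show ?thesis unfolding s_def Idl_image_iff[OF I] using Y(1) by blast
qed

definition fin_gen :: "'a set => bool"
 where "fin_gen I <-> (\<exists>S\<subseteq>carrier A. finite S & I = Idl S)"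

text \<open>The analogue for power series of Hilbert's basis theorem: with \<open>I\<^sub>k = (I : x\<^sup>k)\<close>, the ideals
  \<open>I\<^sub>k + (x)\<close> become stationary.\<close>

lemma fin_gen_descend:
 assumes x: "x\<in>F 1" and H: "!!K. ideal K A ==> T<=K ==> x\<in>K ==> fin_gen K"
  and I: "ideal I A" "T<=I" shows "fin_gen I"
proof -
 have xc: "x\<in>carrier A" using x F_carr by blast
 have xp: "x [^] (k::nat)\<in>carrier A" for k using xc by simp
 note If = ideal_facts[OF I(1)]
 define Q where "Q k = {r\<in>carrier A. r\<otimes>x [^] k\<in>I}" for k :: nat
 have Qi: "ideal (Q k) A" for k unfolding Q_def by (rule colon_ideal[OF I(1) xp])
 have QS: "r\<in>Q (Suc k) <-> r\<in>carrier A & x\<otimes>r\<in>Q k" for r k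
 proof -
  have "r\<otimes>x [^] Suc k = (x\<otimes>r)\<otimes>x [^] k" if "r\<in>carrier A" using that xc xp[of k] by (simp add: m_ac)
  then show ?thesis unfolding Q_def using xc by auto
 qed
 have Qinc: "Q k<=Q (Suc k)" for k
 proof
  fix r assume r: "r\<in>Q k"
  then have "r\<in>carrier A" unfolding Q_def by simp
  then show "r\<in>Q (Suc k)" unfolding QS using ideal_facts(4)[OF Qi r xc] by simp
 qed
 have Qmono: "Q k<=Q l" if "k<=l" for k l by (rule lift_Suc_mono_le[of Q]) (rule Qinc, rule that)
 have Q0: "Q 0 = I" unfolding Q_def using If(1) by auto
 define J where "J k = adjoin A (Q k) x" for k
 have Ji: "ideal (J k) A" for k unfolding J_def by (rule adjoin_ideal[OF Qi xc])
 have QJ: "Q k<=J k" for k unfolding J_def by (rule adjoin_facts(1)[OF Qi xc])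
 have IQ: "I<=Q k" for k using Qmono[of 0 k] Q0 by simp
 have TJ: "T<=J k" "x\<in>J k" for k using order_trans[OF I(2) order_trans[OF IQ QJ]] adjoin_facts(2)[OF Qi xc] unfolding J_def by blast+
 have Jmono: "J k<=J l" if "k<=l" for k l unfolding J_def adjoin_def using Qmono[OF that] by blast
 define U where "U = (\<Union>k. J k)"
 have Ui: "ideal U A"
 proof (rule cidealI)
  show "U<=carrier A" "\<zero>\<in>U" unfolding U_def using ideal_facts(1,2)[OF Ji] by auto
  fix a assume a: "a\<in>U"
  then obtain k where k: "a\<in>J k" unfolding U_def by auto
  show "r\<otimes>a\<in>U" if "r\<in>carrier A" for r using ideal_facts(4)[OF Ji k that] unfolding U_def by auto
  fix b assume "b\<in>U"
  then obtain l where l: "b\<in>J l" unfolding U_def by auto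
  have "a\<in>J (max k l)" "b\<in>J (max k l)" using k l Jmono[of k "max k l"] Jmono[of l "max k l"] by auto
  then show "a\<oplus>b\<in>U" using ideal_facts(3)[OF Ji] unfolding U_def by blast
 qed
 have "fin_gen U" using Ui by (rule H) (use TJ in \<open>auto simp: U_def\<close>)
 then obtain S where S: "S<=carrier A" "finite S" "U = Idl S" unfolding fin_gen_def by auto
 have "EX k. S<=J k"
 proof -
  have "finite S' ==> S'<=U ==> EX k. S'<=J k" for S'
  proof (induction S' rule: finite_induct)
   case (insert s S')
   then obtain k l where "S'<=J k" "s\<in>J l" unfolding U_def by auto
   then have "insert s S'<=J (max k l)" using Jmono[of k "max k l"] Jmono[of l "max k l"] by auto
   then show ?case by blast
  qed simp
  then show ?thesis using S genideal_self by blast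
 qed
 then obtain k0 where "S<=J k0" by auto
 then have "U<=J k0" unfolding S(3) by (rule genideal_minimal[OF Ji])
 then have stable: "J k<=J k0" for k unfolding U_def by blast
 \<comment> \<open>Generators of \<open>J k\<close> are altered by multiples of \<open>x\<close>
   until they lie in \<open>Q k\<close>; the defect is a multiple of \<open>x\<close>.\<close>
 have "EX G. finite G & G<=Q k & Q k<=adjoin A (Idl G) x" for k
 proof -
  obtain B where B: "B<=carrier A" "finite B" "J k = Idl B" using H[OF Ji[of k] TJ(1)[of k] TJ(2)[of k]] unfolding fin_gen_def by auto
  have "ALL b:B. EX i. i\<in>Q k & (\<exists>r\<in>carrier A. b = i\<oplus>r\<otimes>x)"
  proof
   fix b assume "b\<in>B"
   then have "b\<in>J k" using B genideal_self by auto
   then show "EX i. i\<in>Q k & (\<exists>r\<in>carrier A. b = i\<oplus>r\<otimes>x)" unfolding J_def adjoin_def by auto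
  qed
  then obtain f where f: "!!b. b\<in>B ==> f b\<in>Q k" "!!b. b\<in>B ==> \<exists>r\<in>carrier A. b = f b\<oplus>r\<otimes>x"
   using bchoice[of B "%b i. i\<in>Q k & (\<exists>r\<in>carrier A. b = i\<oplus>r\<otimes>x)"] by blast
  have fc: "f ` B<=carrier A" using f(1) ideal_facts(1)[OF Qi] by blast
  have "B<=adjoin A (Idl (f ` B)) x"
  proof
   fix b assume b: "b\<in>B"
   then obtain r where "r\<in>carrier A" "b = f b\<oplus>r\<otimes>x" using f(2) by auto
   moreover have "f b\<in>Idl (f ` B)" using genideal_self[OF fc] b by auto
   ultimately show "b\<in>adjoin A (Idl (f ` B)) x" unfolding adjoin_def by blast
  qed
  then have "J k<=adjoin A (Idl (f ` B)) x" unfolding B(3) by (intro genideal_minimal adjoin_ideal genideal_ideal fc xc)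
  moreover have "Q k<=J k" unfolding J_def using adjoin_facts(1)[OF Qi xc] .
  ultimately have "finite (f ` B) & f ` B<=Q k & Q k<=adjoin A (Idl (f ` B)) x" using B(2) f(1) by blast
  then show ?thesis by blast
 qed
 then obtain G where G: "!!k. finite (G k)" "!!k. G k<=Q k" "!!k. Q k<=adjoin A (Idl (G k)) x" by metis
 have Gc: "G k<=carrier A" for k using G(2) ideal_facts(1)[OF Qi] by blast
 have GQ: "Idl (G k)<=Q k" for k by (rule genideal_minimal[OF Qi G(2)])
 \<comment> \<open>From \<open>k0\<close> on, one finite set serves all \<open>k\<close>: an element
   of \<open>Q (k0 + n)\<close> is a combination of \<open>G k0\<close> plus \<open>x\<close> times
   an element of \<open>Q (k0 + n + 1)\<close>. The growing powers of \<open>x\<close> make the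
   iteration converge, and no defect remains.\<close>
 have tail: "Q k0<=Idl (G k0)"
 proof
  fix a assume a: "a\<in>Q k0"
  define P1 where "P1 n b <-> b\<in>Q (k0 + n) & (n = 0 --> b = a)" for n b
  define P2 where "P2 b b' <-> (\<exists>s\<in>Idl (G k0). b = s\<oplus>x\<otimes>b')" for b b'
  have "EX f. ALL n. P1 n (f n) & P2 (f n) (f (Suc n))"
  proof (rule dependent_nat_choice)
   show "EX b. P1 0 b" unfolding P1_def using a by auto
   fix b n assume "P1 n b"
   then have "b\<in>Q (k0 + n) & (n = 0 --> b = a)" unfolding P1_def .
   then have b: "b\<in>Q (k0 + n)" ..
   then have "b\<in>J k0" using stable[of "k0 + n"] QJ[of "k0 + n"] by auto
   moreover have "J k0<=adjoin A (Idl (G k0)) x" unfolding J_def using G(3)[of k0] adjoin_facts(2)[OF genideal_ideal[OF Gc] xc]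
    by (intro adjoin_facts(3)[OF Qi xc] adjoin_ideal genideal_ideal Gc xc) auto
   ultimately have "b\<in>adjoin A (Idl (G k0)) x" by (rule_tac subsetD)
   then obtain s r where s: "s\<in>Idl (G k0)" "r\<in>carrier A" "b = s\<oplus>r\<otimes>x" unfolding adjoin_def by auto
   have sQ: "s\<in>Q (k0 + n)" using s(1) GQ[of k0] Qmono[of k0 "k0 + n"] by auto
   then have sc: "s\<in>carrier A" using ideal_facts(1)[OF Qi] by blast
   have rxc: "r\<otimes>x\<in>carrier A" using s(2) xc by simp
   have "s\<oplus>r\<otimes>x\<in>Q (k0 + n)" using b unfolding s(3) .
   then have "r\<otimes>x\<in>Q (k0 + n)" by (rule ideal_add_cancel[OF Qi _ sQ rxc])
   then have "r\<in>Q (k0 + Suc n)" using s(2) xc QS[of r "k0 + n"] by (simp add: m_comm)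
   moreover have "b = s\<oplus>x\<otimes>r" using s xc by (simp add: m_comm)
   ultimately have "P1 (Suc n) r" "P2 b r" unfolding P1_def P2_def using s(1) by auto
   then show "EX b'. P1 (Suc n) b' & P2 b b'" by blast
  qed
  then obtain f where ff: "ALL n. P1 n (f n) & P2 (f n) (f (Suc n))" by (rule exE)
  have f: "f n\<in>Q (k0 + n)" "f 0 = a" "\<exists>s\<in>Idl (G k0). f n = s\<oplus>x\<otimes>f (Suc n)" for n
   using spec[OF ff, of n] spec[OF ff, of 0] unfolding P1_def P2_def by blast+
  have fc: "f n\<in>carrier A" for n using f(1) ideal_facts(1)[OF Qi] by blast
  have "x [^] (0::nat)\<otimes>f 0\<in>Idl ((%g. g) ` G k0)"
  proof (rule successive_approximation[of "G k0" "%g. g" "%n. x [^] n\<otimes>f n"])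
   show "finite (G k0)" "(%g. g) ` G k0<=carrier A" using G(1) Gc by auto
   show "x [^] n\<otimes>f n\<in>F n" for n using ideal_facts(5)[OF F_ideal F_pow[OF x] fc] .
   fix n
   obtain s where s: "s\<in>Idl (G k0)" "f n = s\<oplus>x\<otimes>f (Suc n)" using f(3) by auto
   then obtain c where c: "c\<in>G k0 \<rightarrow> carrier A" "s = (\<Oplus>g\<in>G k0. c g\<otimes>g)" using Idl_finite_iff[OF G(1) Gc] by auto
   have cc: "c g\<in>carrier A" "g\<in>carrier A" if "g\<in>G k0" for g using that c(1) Gc by auto
   have sc: "s\<in>carrier A" unfolding c(2) using cc by (intro finsum_closed) auto
   have "x [^] n\<otimes>s = (\<Oplus>g\<in>G k0. (x [^] n\<otimes>c g)\<otimes>g)"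
    unfolding c(2) using G(1) cc xp by (subst finsum_rdistr) (auto simp: m_assoc intro!: finsum_cong')
   moreover have "x [^] n\<otimes>f n = x [^] n\<otimes>s\<oplus>x [^] Suc n\<otimes>f (Suc n)"
    unfolding s(2) using sc xc fc[of "Suc n"] by (simp add: r_distr m_assoc)
   moreover have "\<forall>g\<in>G k0. x [^] n\<otimes>c g\<in>F n" using ideal_facts(5)[OF F_ideal F_pow[OF x]] cc by blast
   ultimately show "EX c. (\<forall>i\<in>G k0. c i\<in>F n) & x [^] n\<otimes>f n = (\<Oplus>i\<in>G k0. c i\<otimes>i)\<oplus>x [^] Suc n\<otimes>f (Suc n)"
    by (intro exI[of _ "%g. x [^] n\<otimes>c g"]) simp
  qed
  then show "a\<in>Idl (G k0)" using f(2) fc[of 0] by simp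
 qed
 define GG where "GG = (\<Union>k\<in>{..k0}. (%g. g\<otimes>x [^] k) ` G k)"
 have GGc: "GG<=carrier A" unfolding GG_def using Gc xp by blast
 have GGi: "ideal (Idl GG) A" by (rule genideal_ideal[OF GGc])
 have mult_in: "a\<otimes>x [^] k\<in>Idl GG" if "a\<in>Idl (G k)" "k<=k0" for a k
 proof -
  have "Idl (G k)<={r\<in>carrier A. r\<otimes>x [^] k\<in>Idl GG}"
  proof (rule genideal_minimal[OF colon_ideal[OF GGi xp]])
   show "G k<={r\<in>carrier A. r\<otimes>x [^] k\<in>Idl GG}" using Gc[of k] that(2) genideal_self[OF GGc] unfolding GG_def by blast
  qed
  then show ?thesis using that by blast
 qed
 \<comment> \<open>Below \<open>k0\<close> the defect is pushed upwards:
   \<open>a x^k = s x^k + r x^(k+1)\<close> with \<open>r\<close> in \<open>Q (k + 1)\<close>, by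
   descending induction from \<open>k0\<close>.\<close>
 have head: "a\<otimes>x [^] k\<in>Idl GG" if "k<=k0" "a\<in>Q k" for a k using that
 proof (induction arbitrary: a rule: inc_induct)
  case base
  then show ?case using mult_in tail by blast
 next
  case (step k)
  have "a\<in>adjoin A (Idl (G k)) x" using G(3)[of k] step.prems by (rule subsetD)
  then obtain s r where s: "s\<in>Idl (G k)" "r\<in>carrier A" "a = s\<oplus>r\<otimes>x" unfolding adjoin_def by auto
  have sQ: "s\<in>Q k" using s(1) GQ by auto
  then have sc: "s\<in>carrier A" using ideal_facts(1)[OF Qi] by blast
  have rxc: "r\<otimes>x\<in>carrier A" using s(2) xc by simp
  have "s\<oplus>r\<otimes>x\<in>Q k" using step.prems unfolding s(3) .
  then have "r\<otimes>x\<in>Q k" by (rule ideal_add_cancel[OF Qi _ sQ rxc])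
  then have "r\<in>Q (Suc k)" using s(2) xc QS[of r k] by (simp add: m_comm)
  then have "r\<otimes>x [^] Suc k\<in>Idl GG" by (rule step.IH)
  moreover have "s\<otimes>x [^] k\<in>Idl GG" using mult_in s(1) step.hyps by simp
  moreover have "a\<otimes>x [^] k = s\<otimes>x [^] k\<oplus>r\<otimes>x [^] Suc k" unfolding s(3) nat_pow_Suc using sc s(2) xc xp[of k] by algebra
  ultimately show ?case using ideal_facts(3)[OF GGi] by simp
 qed
 have "I<=Idl GG"
 proof
  fix a assume "a\<in>I"
  then show "a\<in>Idl GG" using head[of 0 a] Q0 If(1) by auto
 qed
 moreover have "Idl GG<=I"
 proof (rule genideal_minimal[OF I(1)])
  show "GG<=I" unfolding GG_def using G(2) unfolding Q_def by blast
 qed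
 ultimately have "I = Idl GG" by blast
 moreover have "finite GG" unfolding GG_def using G(1) by auto
 ultimately show ?thesis unfolding fin_gen_def using GGc by blast
qed

text \<open>The requirement that the ideal contain \<open>W\<close> is dropped one element at a time
  by \<open>fin_gen_descend\<close>.\<close>

lemma noetherian_of_generators:
 assumes W: "finite W" "W<=F 1" "!!K. ideal K A ==> W<=K ==> fin_gen K" shows "noetherian_ring A"
proof -
 have "finite T ==> T<=W ==> ideal K A ==> W - T<=K ==> fin_gen K" for T K
 proof (induction T arbitrary: K rule: finite_induct)
  case empty
  then show ?case using W(3) by auto
 next
  case (insert x T)
  show ?case
  proof (rule fin_gen_descend[of x "W - insert x T"])
   show "x\<in>F 1" using insert.prems(1) W(2) by auto
   show "ideal K A" "W - insert x T<=K" using insert.prems by auto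
   fix K' assume K': "ideal K' A" "W - insert x T<=K'" "x\<in>K'"
   have "W - T<=K'" using K'(2,3) by auto
   then show "fin_gen K'" using insert.prems(1) K'(1) by (intro insert.IH) simp
  qed
 qed
 from this[OF W(1) subset_refl] have "fin_gen K" if "ideal K A" for K using that by simp
 then show ?thesis unfolding fin_gen_def by (intro noetherian_ringI) auto
qed

end

text \<open>Iterated boundary monoids. An ideal that is disjoint from the monoid of \<open>w # ws\<close> is
  contained in a prime \<open>P\<close> such that \<open>P + (w)\<close> is disjoint from the monoid of \<open>ws\<close>.\<close>

fun boundary_monoid :: "('a, 'm) ring_scheme => 'a list => 'a set" where
 "boundary_monoid R [] = {\<one>\<^bsub>R\<^esub>}"
| "boundary_monoid R (w # ws) = {w [^]\<^bsub>R\<^esub> (n::nat)\<otimes>\<^bsub>R\<^esub> (t\<oplus>\<^bsub>R\<^esub>a\<otimes>\<^bsub>R\<^esub>w) | n t a.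
   t\<in>boundary_monoid R ws & a\<in>carrier R}"

lemma (in cring) boundary_monoid_props:
 "set ws<=\<K> ==> boundary_monoid R ws<=\<K> & \<one>\<in>boundary_monoid R ws &
  (\<forall>s\<in>boundary_monoid R ws. \<forall>t\<in>boundary_monoid R ws. s\<otimes>t\<in>boundary_monoid R ws)"
proof (induction ws)
 case (Cons w ws)
 let ?T = "boundary_monoid R ws"
 have w: "w\<in>\<K>" and T: "?T<=\<K>" "\<one>\<in>?T" "!!s t. s\<in>?T ==> t\<in>?T ==> s\<otimes>t\<in>?T"
  using Cons by auto
 have Tc: "t\<in>\<K>" if "t\<in>?T" for t using that T(1) by auto
 have wn: "w [^] (n::nat)\<in>\<K>" for n using w by simp
 have sub: "boundary_monoid R (w # ws)<=\<K>" using w wn Tc by auto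
 have "\<one> = w [^] (0::nat)\<otimes>(\<one>\<oplus>\<zero>\<otimes>w)" using w by simp
 then have one: "\<one>\<in>boundary_monoid R (w # ws)" unfolding boundary_monoid.simps using T(2) by blast
 have "s\<otimes>t\<in>boundary_monoid R (w # ws)"
  if st: "s\<in>boundary_monoid R (w # ws)" "t\<in>boundary_monoid R (w # ws)" for s t
 proof -
  obtain n t1 a where 1: "s = w [^] (n::nat)\<otimes>(t1\<oplus>a\<otimes>w)" "t1\<in>?T" "a\<in>\<K>" using st(1) by auto
  obtain m t2 c where 2: "t = w [^] (m::nat)\<otimes>(t2\<oplus>c\<otimes>w)" "t2\<in>?T" "c\<in>\<K>" using st(2) by auto
  have "s\<otimes>t = (w [^] n\<otimes>w [^] m)\<otimes>(t1\<otimes>t2\<oplus>(t1\<otimes>c\<oplus>a\<otimes>t2\<oplus>a\<otimes>c\<otimes>w)\<otimes>w)"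
   unfolding 1(1) 2(1) using wn[of n] wn[of m] w Tc[OF 1(2)] Tc[OF 2(2)] 1(3) 2(3) by algebra
  also have "w [^] n\<otimes>w [^] m = w [^] (n + m)" using w by (simp add: nat_pow_mult)
  finally have "s\<otimes>t = w [^] (n + m)\<otimes>(t1\<otimes>t2\<oplus>(t1\<otimes>c\<oplus>a\<otimes>t2\<oplus>a\<otimes>c\<otimes>w)\<otimes>w)" .
  moreover have "t1\<otimes>t2\<in>?T" by (rule T(3)[OF 1(2) 2(2)])
  moreover have "t1\<otimes>c\<oplus>a\<otimes>t2\<oplus>a\<otimes>c\<otimes>w\<in>\<K>" using w Tc[OF 1(2)] Tc[OF 2(2)] 1(3) 2(3) by simp
  ultimately show ?thesis unfolding boundary_monoid.simps by blast
 qed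
 then show ?case using sub one by blast
qed simp

lemma (in noetherian_cring) ex_prime_disjoint:
 assumes I: "ideal I R" and T: "T<=\<K>" "\<one>\<in>T" "!!s t. s\<in>T ==> t\<in>T ==> s\<otimes>t\<in>T"
  and dis: "I\<inter>T = {}" shows "EX P. primeideal P R & I<=P & P\<inter>T = {}"
proof -
 define KK where "KK = {K. ideal K R & I<=K & K\<inter>T = {}}"
 have "EX N:KK. ALL I:KK. N<=I --> I = N" by (rule ex_maximal_ideal_in) (use I dis in \<open>auto simp: KK_def\<close>)
 then obtain P where P: "P\<in>KK" "ALL I:KK. P<=I --> I = P" by (rule bexE)
 have Pi: "ideal P R" and IP: "I<=P" and PT: "P\<inter>T = {}" using P(1) unfolding KK_def by auto
 note Pf = ideal_facts[OF Pi]
 have meet: "EX p:P. EX r:\<K>. p\<oplus>r\<otimes>a\<in>T" if a: "a\<in>\<K>" "a~:P" for a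
 proof (rule ccontr)
  assume "\<not> ?thesis"
  then have "adjoin R P a\<inter>T = {}" unfolding adjoin_def by auto
  then have "adjoin R P a\<in>KK" unfolding KK_def using adjoin_ideal[OF Pi a(1)] adjoin_facts(1)[OF Pi a(1)] IP by auto
  then have "adjoin R P a = P" using P(2) adjoin_facts(1)[OF Pi a(1)] by auto
  then show False using adjoin_facts(2)[OF Pi a(1)] a(2) by simp
 qed
 have "primeideal P R"
 proof (rule primeidealI[OF Pi is_cring])
  show "\<K>~=P" using PT T by blast
  fix a c assume ac: "a\<in>\<K>" "c\<in>\<K>" "a\<otimes>c\<in>P"
  show "a\<in>P \<or> c\<in>P"
  proof (rule ccontr)
   assume "\<not> (a\<in>P \<or> c\<in>P)"
   then obtain p r q t where pr: "p\<in>P" "r\<in>\<K>" "p\<oplus>r\<otimes>a\<in>T" and qt: "q\<in>P" "t\<in>\<K>" "q\<oplus>t\<otimes>c\<in>T"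
    using meet ac(1,2) by meson
   have pc: "p\<in>\<K>" "q\<in>\<K>" using pr qt Pf(1) by auto
   have "(p\<oplus>r\<otimes>a)\<otimes>(q\<oplus>t\<otimes>c) = (q\<oplus>t\<otimes>c)\<otimes>p\<oplus>(r\<otimes>a)\<otimes>q\<oplus>(r\<otimes>t)\<otimes>(a\<otimes>c)"
    using pc pr(2) qt(2) ac(1,2) by algebra
   moreover have "(q\<oplus>t\<otimes>c)\<otimes>p\<oplus>(r\<otimes>a)\<otimes>q\<oplus>(r\<otimes>t)\<otimes>(a\<otimes>c)\<in>P"
    using pr(2) qt(2) ac(1,2) pc by (intro Pf(3)[OF Pf(3)[OF Pf(4)[OF pr(1)] Pf(4)[OF qt(1)]] Pf(4)[OF ac(3)]]) auto
   ultimately have "(p\<oplus>r\<otimes>a)\<otimes>(q\<oplus>t\<otimes>c)\<in>P" by simp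
   then show False using T(3)[OF pr(3) qt(3)] PT by auto
  qed
 qed
 then show ?thesis using IP PT by (intro exI[of _ P] conjI)
qed

text \<open>Each entry of the list yields one strict inclusion. If \<open>p + a w\<close> were in
  the monoid of \<open>ws\<close> for some \<open>p\<close> in \<open>P0\<close>, then
  \<open>p = (p + a w) - a w\<close> would lie in the monoid that \<open>P0\<close> avoids. And
  \<open>w\<close> itself is in that monoid, so it lies in the next prime but not in
  \<open>P0\<close>.\<close>

lemma (in noetherian_cring) chain_above_boundary:
 "set ws<=\<K> ==> ideal I R ==> I\<inter>boundary_monoid R ws = {} ==> chain_above R I (length ws)"
proof (induction ws arbitrary: I)
 case Nil
 obtain P where "primeideal P R" "I<=P" using ex_prime_disjoint[OF Nil(2), of "{\<one>}"] Nil(3) by auto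
 then show ?case unfolding chain_above_def prime_chain_def by (intro exI[of _ "%_. P"]) auto
next
 case (Cons w ws)
 have w: "w\<in>\<K>" and ws: "set ws<=\<K>" using Cons.prems(1) by auto
 note T = boundary_monoid_props[OF Cons.prems(1)] and T' = boundary_monoid_props[OF ws]
 obtain P0 where P0: "primeideal P0 R" "I<=P0" "P0\<inter>boundary_monoid R (w # ws) = {}"
  using ex_prime_disjoint[OF Cons.prems(2), of "boundary_monoid R (w # ws)"] T Cons.prems(3) by blast
 note P0i = prime_facts(1)[OF P0(1)]
 have "adjoin R P0 w\<inter>boundary_monoid R ws = {}"
 proof (rule ccontr)
  assume "\<not> ?thesis"
  then obtain p a where pa: "p\<in>P0" "a\<in>\<K>" "p\<oplus>a\<otimes>w\<in>boundary_monoid R ws" unfolding adjoin_def by auto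
  have pc: "p\<in>\<K>" using pa ideal_facts(1)[OF P0i] by auto
  have "p = w [^] (0::nat)\<otimes>((p\<oplus>a\<otimes>w)\<oplus>(\<ominus>a)\<otimes>w)" using pc pa(2) w by (simp add: l_minus a_assoc r_neg)
  then have "p\<in>boundary_monoid R (w # ws)" unfolding boundary_monoid.simps using pa(2,3) by blast
  then show False using pa(1) P0(3) by auto
 qed
 from Cons.IH[OF ws adjoin_ideal[OF P0i w] this] obtain P' where P': "prime_chain R (length ws) P'" "adjoin R P0 w<=P' 0"
  unfolding chain_above_def by auto
 have "w = w [^] (1::nat)\<otimes>(\<one>\<oplus>\<zero>\<otimes>w)" using w by simp
 then have "w\<in>boundary_monoid R (w # ws)" unfolding boundary_monoid.simps using T' by blast
 then have "w~:P0" using P0(3) by auto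
 then have lt: "P0 \<subset> P' 0" using P'(2) adjoin_facts(1,2)[OF P0i w] by auto
 define P where "P i = (case i of 0 => P0 | Suc j => P' j)" for i
 have "prime_chain R (length (w # ws)) P" unfolding prime_chain_def
 proof (intro conjI allI impI)
  fix i assume "i<=length (w # ws)"
  then show "primeideal (P i) R" using P'(1) P0(1) unfolding prime_chain_def P_def by (cases i) auto
 next
  fix i assume "i < length (w # ws)"
  then show "P i \<subset> P (Suc i)" using P'(1) lt unfolding prime_chain_def P_def by (cases i) auto
 qed
 then show ?case unfolding chain_above_def using P0(2) by (intro exI[of _ P]) (auto simp: P_def)
qed

text \<open>An element of the monoid has a leading monomial: peeling off the entries of the list
  produces its exponents, and all corrections are multiples of the powers just beyond them.\<close>

lemma (in cring) boundary_monoid_monomial: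
 fixes x :: "'i::finite => 'a" assumes x: "range x<=\<K>"
 shows "distinct is ==> t\<in>boundary_monoid R (map x is) ==>
  EX m. (ALL i. i~:set is --> m i = 0) & t\<ominus>monomial R x m\<in>Idl ((%i. x i [^] Suc (m i)) ` set is)"
proof (induction "is" arbitrary: t)
 case Nil
 have "ideal (Idl {}) R" by (intro genideal_ideal) simp
 from ideal_facts(2)[OF this] have "t\<ominus>monomial R x (%_. 0)\<in>Idl {}" using Nil by (simp add: monomial_zero minus_eq r_neg)
 then show ?case by (intro exI[of _ "%_. 0"]) simp
next
 case (Cons i "is")
 have xc: "x j\<in>\<K>" for j using x by auto
 have pc: "(%i. x i [^] Suc (m i)) ` J<=\<K>" for m J using xc by auto
 obtain n t' a where t: "t = x i [^] (n::nat)\<otimes>(t'\<oplus>a\<otimes>x i)" "t'\<in>boundary_monoid R (map x is)" "a\<in>\<K>"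
  using Cons.prems(2) by auto
 obtain m where m: "!!j. j~:set is ==> m j = 0" "t'\<ominus>monomial R x m\<in>Idl ((%i. x i [^] Suc (m i)) ` set is)"
  using Cons.IH[OF _ t(2)] Cons.prems(1) by auto
 have t'c: "t'\<in>\<K>" using boundary_monoid_props[of "map x is"] t(2) xc by auto
 define m' where "m' = m(i := n)"
 have mi: "m i = 0" using m(1) Cons.prems(1) by simp
 have "m' = (%j. (if j = i then n else 0) + m j)" unfolding m'_def using mi by auto
 then have mon: "monomial R x m' = x i [^] n\<otimes>monomial R x m" by (simp add: monomial_add[OF x] monomial_single[OF x])
 let ?K = "Idl ((%i. x i [^] Suc (m' i)) ` set (i # is))"
 have Ki: "ideal ?K R" by (rule genideal_ideal[OF pc])
 have "(%i. x i [^] Suc (m i)) ` set is<=?K"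
 proof (rule image_subsetI)
  fix j assume j: "j\<in>set is"
  then have "m' j = m j" unfolding m'_def using Cons.prems(1) by auto
  then show "x j [^] Suc (m j)\<in>?K" using genideal_self[OF pc[of m' "set (i # is)"]] j by force
 qed
 then have "Idl ((%i. x i [^] Suc (m i)) ` set is)<=?K" by (rule genideal_minimal[OF Ki])
 then have d: "t'\<ominus>monomial R x m\<in>?K" using m(2) by auto
 have "m' i = n" unfolding m'_def by simp
 then have xi: "x i [^] Suc n\<in>?K" using genideal_self[OF pc[of m' "set (i # is)"]] by force
 have xn: "x i [^] n\<in>\<K>" using xc by simp
 have mc: "monomial R x m\<in>\<K>" by (rule monomial_closed[OF x])
 have "t\<ominus>monomial R x m' = x i [^] n\<otimes>(t'\<ominus>monomial R x m)\<oplus>a\<otimes>(x i [^] n\<otimes>x i)"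
  unfolding t(1) mon using xn xc[of i] t'c mc t(3) by algebra
 also have "...\<in>?K" using ideal_facts(3)[OF Ki ideal_facts(4)[OF Ki d xn] ideal_facts(4)[OF Ki xi t(3)]] by simp
 finally have "t\<ominus>monomial R x m'\<in>?K" .
 moreover have "ALL j. j~:set (i # is) --> m' j = 0" using m(1) unfolding m'_def by auto
 ultimately show ?case by (intro exI[of _ m'] conjI)
qed

text \<open>A lower bound for the dimension that is tested on monomials alone. Unlike a chain of
  primes, such a test can be carried from \<open>R\<close> to its completion.\<close>

lemma (in noetherian_cring) chain_above_of_monomials:
 fixes x :: "'i::finite => 'a"
 assumes x: "range x<=\<K>" and nm: "!!m. monomial R x m~:Idl (range (%i. x i [^] Suc (m i)))"
 shows "chain_above R {\<zero>} CARD('i)"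
proof -
 obtain "is" :: "'i list" where "is": "set is = UNIV" "distinct is" using finite_distinct_list[OF finite] by blast
 have "\<zero>~:boundary_monoid R (map x is)"
 proof
  assume "\<zero>\<in>boundary_monoid R (map x is)"
  from boundary_monoid_monomial[OF x "is"(2) this] obtain m where
   m: "\<zero>\<ominus>monomial R x m\<in>Idl (range (%i. x i [^] Suc (m i)))" unfolding "is"(1) by (elim exE conjE)
  have mc: "monomial R x m\<in>\<K>" by (rule monomial_closed[OF x])
  have "ideal (Idl (range (%i. x i [^] Suc (m i)))) R" using x by (intro genideal_ideal) auto
  from ideal_facts(6)[OF this m] have "\<ominus>(\<zero>\<ominus>monomial R x m)\<in>Idl (range (%i. x i [^] Suc (m i)))" .
  moreover have "\<ominus>(\<zero>\<ominus>monomial R x m) = monomial R x m" using mc by algebra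
  ultimately show False using nm by simp
 qed
 then have "chain_above R {\<zero>} (length (map x is))" using x by (intro chain_above_boundary zeroideal) auto
 moreover have "length is = CARD('i)" using distinct_card[OF "is"(2)] "is"(1) by simp
 ultimately show ?thesis by simp
qed

lemma (in noetherian_local_ring) krull_dim_eqI:
 assumes "chain_above R {\<zero>} n" "finite W" "W<=\<K>" "M = Idl W" "card W<=n"
 shows "krull_dim R = enat n"
proof -
 define K where "K = {enat n | n P. prime_chain R n P}"
 have K: "krull_dim R = Sup K" unfolding krull_dim_def K_def prime_chain_def by simp
 have "M = Idl ({\<zero>}\<union>W)"
 proof -
  have c: "{\<zero>}\<union>W<=\<K>" using assms(3) by auto
  show ?thesis unfolding assms(4)
  proof
   show "Idl W<=Idl ({\<zero>}\<union>W)" using genideal_self[OF c] by (intro genideal_minimal genideal_ideal c) auto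
   show "Idl ({\<zero>}\<union>W)<=Idl W" using genideal_self[OF assms(3)] ideal_facts(2)[OF genideal_ideal[OF assms(3)]]
    by (intro genideal_minimal genideal_ideal assms(3)) auto
  qed
 qed
 then have le: "k<=n" if "prime_chain R k P" for k P
 proof -
  have "\<zero>\<in>P 0" using that ideal_facts(2)[OF prime_facts(1)] unfolding prime_chain_def by auto
  then have "chain_above R {\<zero>} k" using that unfolding chain_above_def by auto
  from chain_above_le[OF assms(2,3) zeroideal \<open>M = Idl ({\<zero>}\<union>W)\<close> this] show ?thesis using assms(5) by simp
 qed
 show ?thesis unfolding K
 proof (rule antisym)
  show "Sup K<=enat n"
  proof (rule Sup_least)
   fix e assume "e\<in>K"
   then obtain k P where "e = enat k" "prime_chain R k P" unfolding K_def by auto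
   then show "e<=enat n" using le by simp
  qed
  obtain P where "prime_chain R n P" using assms(1) unfolding chain_above_def by auto
  then have "enat n\<in>K" unfolding K_def by auto
  then show "enat n<=Sup K" by (rule Sup_upper)
 qed
qed

section \<open>The completion of a regular local ring\<close>

lemma (in ideal) coset_eq_of_mem:
 assumes "c\<in>\<K>" "a\<in>I +> c" shows "a\<in>\<K>" "I +> c = I +> a"
proof -
 obtain h where h: "h\<in>I" "a = h\<oplus>c" using assms(2) unfolding a_r_coset_def' by auto
 then have hc: "h\<in>\<K>" using Icarr by simp
 then show ac: "a\<in>\<K>" using h assms by simp
 have "c\<ominus>a = \<ominus>h" unfolding h(2) using hc assms(1) by algebra
 then have "c\<ominus>a\<in>I" using h(1) by simp
 then show "I +> c = I +> a" using quotient_eq_iff_same_a_r_cos[OF is_ideal assms(1) ac] by simp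
qed

context regular_system
begin

abbreviation "CR \<equiv> completion R"
abbreviation "P n \<equiv> ideal_pow R M n"
abbreviation "cls \<equiv> to_completion R"

lemma completion_simps:
 "carrier CR = {\<xi>. ALL n. \<xi> n\<in>carrier (R Quot P n) & \<xi> (Suc n)<=\<xi> n}"
 "\<xi>\<otimes>\<^bsub>CR\<^esub>Y = (%n. \<xi> n\<otimes>\<^bsub>R Quot P n\<^esub>Y n)" "\<xi>\<oplus>\<^bsub>CR\<^esub>Y = (%n. \<xi> n\<oplus>\<^bsub>R Quot P n\<^esub>Y n)"
 "\<one>\<^bsub>CR\<^esub> = (%n. P n +> \<one>)" "\<zero>\<^bsub>CR\<^esub> = (%n. P n)"
 unfolding completion_def Let_def max_ideal_eq by (simp_all add: FactRing_def)

lemma cls_eq: "cls a = (%n. P n +> a)" unfolding to_completion_def max_ideal_eq by simp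

text \<open>Computations with sequences of cosets become computations with one representative
  \<open>a\<close> of precision \<open>n\<close>, since all ring operations respect this
  relation.\<close>

definition approx :: "(nat => 'a set) => nat => 'a => bool"
 where "approx \<xi> n a <-> a\<in>\<K> & (\<forall>m\<le>n. \<xi> m = P m +> a)"

lemma P_coset_eq: "a\<in>\<K> ==> c\<in>\<K> ==> P n +> a = P n +> c <-> a\<ominus>c\<in>P n"
 using quotient_eq_iff_same_a_r_cos[OF Mpow_ideal] by blast

lemma P_antimono: "m<=n ==> P n<=P m" by (rule ideal_pow_antimono[OF M_ideal])

lemma P_coset_antimono: "m<=n ==> P n +> a<=P m +> a" using P_antimono unfolding a_r_coset_def' by blast

lemma self_in_coset: "a\<in>\<K> ==> a\<in>P n +> a"
proof -
 assume a: "a\<in>\<K>"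
 then have "a = \<zero>\<oplus>a" by simp
 then show ?thesis unfolding a_r_coset_def' using ideal_facts(2)[OF Mpow_ideal] by blast
qed

lemma approx_ex:
 assumes "\<xi>\<in>carrier CR" shows "EX a. approx \<xi> n a"
proof -
 have \<xi>: "\<xi> n\<in>carrier (R Quot P n)" "\<xi> (Suc n)<=\<xi> n" for n using assms unfolding completion_simps by auto
 have rep: "EX c:\<K>. \<xi> m = P m +> c" for m using \<xi>(1)[of m] unfolding FactRing_simps by auto
 obtain a where a: "a\<in>\<K>" "\<xi> n = P n +> a" using rep by blast
 have "\<xi> m = P m +> a" if "m<=n" for m
 proof -
  have "\<xi> n<=\<xi> m" by (rule lift_Suc_antimono_le[of \<xi>]) (rule \<xi>(2), rule that)
  then have "a\<in>\<xi> m" using self_in_coset[OF a(1), of n] a(2) by auto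
  moreover obtain c where c: "c\<in>\<K>" "\<xi> m = P m +> c" using rep by blast
  ultimately show ?thesis using ideal.coset_eq_of_mem(2)[OF Mpow_ideal c(1)] by simp
 qed
 then show ?thesis unfolding approx_def using a by auto
qed

lemma carrier_completionI:
 assumes "!!n. EX a. approx \<xi> n a" shows "\<xi>\<in>carrier CR" unfolding completion_simps mem_Collect_eq
proof (intro allI conjI)
 fix n
 obtain a where "approx \<xi> (Suc n) a" using assms by blast
 then have a: "a\<in>\<K>" "\<xi> n = P n +> a" "\<xi> (Suc n) = P (Suc n) +> a" unfolding approx_def by auto
 then show "\<xi> n\<in>carrier (R Quot P n)" unfolding FactRing_simps by auto
 show "\<xi> (Suc n)<=\<xi> n" using a(2,3) P_coset_antimono[of n "Suc n" a] by simp
qed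

lemma approx_mono: "approx \<xi> n a ==> m<=n ==> approx \<xi> m a" unfolding approx_def by auto

lemma approx_carr: "approx \<xi> n a ==> a\<in>\<K>" unfolding approx_def by auto

lemma approx_unique:
 assumes "approx \<xi> n a" "approx \<xi> n c" shows "a\<ominus>c\<in>P n"
proof -
 have "a\<in>\<K>" "c\<in>\<K>" "\<xi> n = P n +> a" "\<xi> n = P n +> c" using assms unfolding approx_def by simp_all
 then show ?thesis using P_coset_eq[of a c n] by simp
qed

lemma approx_shift:
 assumes "approx \<xi> n a" "c\<in>\<K>" "a\<ominus>c\<in>P n" shows "approx \<xi> n c" unfolding approx_def
proof (intro conjI allI impI)
 fix m assume m: "m<=n"
 have "a\<ominus>c\<in>P m" using assms(3) P_antimono[OF m] by auto
 then show "\<xi> m = P m +> c" using assms m P_coset_eq[of a c m] unfolding approx_def by simp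
qed (rule assms(2))

lemma completion_eqI:
 assumes "!!n. EX a. approx \<xi> n a & approx Y n a" shows "\<xi> = Y"
proof
 fix n
 obtain a where "approx \<xi> n a" "approx Y n a" using assms by blast
 then show "\<xi> n = Y n" unfolding approx_def by auto
qed

lemma approx_add: "approx \<xi> n a ==> approx Y n c ==> approx (\<xi>\<oplus>\<^bsub>CR\<^esub>Y) n (a\<oplus>c)"
 unfolding approx_def completion_simps by (auto simp: FactRing_def ideal.a_rcos_sum[OF Mpow_ideal])

lemma approx_mult: "approx \<xi> n a ==> approx Y n c ==> approx (\<xi>\<otimes>\<^bsub>CR\<^esub>Y) n (a\<otimes>c)"
 unfolding approx_def completion_simps by (auto simp: FactRing_def ideal.rcoset_mult_add[OF Mpow_ideal])

lemma approx_zero: "approx \<zero>\<^bsub>CR\<^esub>n \<zero>"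
 unfolding approx_def completion_simps using a_rcos_zero[OF Mpow_ideal ideal_facts(2)[OF Mpow_ideal]] by simp

lemma approx_one: "approx \<one>\<^bsub>CR\<^esub>n \<one>" unfolding approx_def completion_simps by simp

lemma approx_cls: "a\<in>\<K> ==> approx (cls a) n a" unfolding approx_def cls_eq by simp

lemma completion_cring: "cring CR"
proof -
 interpret Q: cring "R Quot P n" for n by (rule ideal.quotient_is_cring[OF Mpow_ideal is_cring])
 have cc: "\<xi> n\<in>carrier (R Quot P n)" if "\<xi>\<in>carrier CR" for \<xi> n using that unfolding completion_simps by simp
 have zo: "P n +> \<one> = \<one>\<^bsub>R Quot P n\<^esub>" "P n = \<zero>\<^bsub>R Quot P n\<^esub>" for n by (simp_all add: FactRing_def)
 have cl: "\<xi>\<oplus>\<^bsub>CR\<^esub>Y\<in>carrier CR" "\<xi>\<otimes>\<^bsub>CR\<^esub>Y\<in>carrier CR" if c: "\<xi>\<in>carrier CR" "Y\<in>carrier CR" for \<xi> Y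
 proof -
  show "\<xi>\<oplus>\<^bsub>CR\<^esub>Y\<in>carrier CR" using approx_ex[OF c(1)] approx_ex[OF c(2)] approx_add by (intro carrier_completionI) blast
  show "\<xi>\<otimes>\<^bsub>CR\<^esub>Y\<in>carrier CR"
   using approx_ex[OF c(1)] approx_ex[OF c(2)] approx_mult by (intro carrier_completionI) blast
 qed
 have c01: "\<zero>\<^bsub>CR\<^esub>\<in>carrier CR" "\<one>\<^bsub>CR\<^esub>\<in>carrier CR"
  by (rule carrier_completionI, use approx_zero in blast, rule carrier_completionI, use approx_one in blast)
 \<comment> \<open>The operations of the completion are addition and multiplication of cosets, so
   the negative is produced as the product with the image of \<open>-1\<close>.\<close>
 have neg: "\<exists>Y\<in>carrier CR. Y\<oplus>\<^bsub>CR\<^esub> \<xi> = \<zero>\<^bsub>CR\<^esub>" if \<xi>: "\<xi>\<in>carrier CR" for \<xi>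
 proof
  have m: "cls (\<ominus>\<one>)\<in>carrier CR" using approx_cls[of "\<ominus>\<one>"] by (intro carrier_completionI) auto
  show "\<xi>\<otimes>\<^bsub>CR\<^esub>cls (\<ominus>\<one>)\<in>carrier CR" by (rule cl(2)[OF \<xi> m])
  show "\<xi>\<otimes>\<^bsub>CR\<^esub>cls (\<ominus>\<one>)\<oplus>\<^bsub>CR\<^esub> \<xi> = \<zero>\<^bsub>CR\<^esub>"
  proof (rule completion_eqI)
   fix n
   obtain a where a: "approx \<xi> n a" using approx_ex[OF \<xi>] by meson
   have "a\<otimes>\<ominus>\<one>\<oplus>a = \<zero>" using approx_carr[OF a] by algebra
   then show "EX a. approx (\<xi>\<otimes>\<^bsub>CR\<^esub>cls (\<ominus>\<one>)\<oplus>\<^bsub>CR\<^esub> \<xi>) n a & approx \<zero>\<^bsub>CR\<^esub>n a"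
    using approx_add[OF approx_mult[OF a approx_cls[of "\<ominus>\<one>"]] a] approx_zero by auto
  qed
 qed
 show ?thesis
 proof (intro cringI abelian_groupI comm_monoidI)
  show "\<zero>\<^bsub>CR\<^esub>\<in>carrier CR" "\<one>\<^bsub>CR\<^esub>\<in>carrier CR" by (rule c01)+
  fix \<xi> assume x: "\<xi>\<in>carrier CR"
  show "\<zero>\<^bsub>CR\<^esub>\<oplus>\<^bsub>CR\<^esub> \<xi> = \<xi>" 
   unfolding completion_simps by (rule ext) (rule Q.l_zero[OF cc[OF x], folded zo(2)])
  show "\<one>\<^bsub>CR\<^esub>\<otimes>\<^bsub>CR\<^esub> \<xi> = \<xi>" unfolding completion_simps zo(1) by (rule ext) (rule Q.l_one[OF cc[OF x]])
  show "\<exists>Y\<in>carrier CR. Y\<oplus>\<^bsub>CR\<^esub> \<xi> = \<zero>\<^bsub>CR\<^esub>" by (rule neg[OF x])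
  fix Y assume y: "Y\<in>carrier CR"
  show "\<xi>\<oplus>\<^bsub>CR\<^esub>Y\<in>carrier CR" "\<xi>\<otimes>\<^bsub>CR\<^esub>Y\<in>carrier CR" by (rule cl[OF x y])+
  show "\<xi>\<oplus>\<^bsub>CR\<^esub>Y = Y\<oplus>\<^bsub>CR\<^esub> \<xi>" unfolding completion_simps by (rule ext) (rule Q.a_comm[OF cc[OF x] cc[OF y]])
  show "\<xi>\<otimes>\<^bsub>CR\<^esub>Y = Y\<otimes>\<^bsub>CR\<^esub> \<xi>" unfolding completion_simps by (rule ext) (rule Q.m_comm[OF cc[OF x] cc[OF y]])
  fix Z assume z: "Z\<in>carrier CR"
  note c = cc[OF x] cc[OF y] cc[OF z]
  show "\<xi>\<oplus>\<^bsub>CR\<^esub>Y\<oplus>\<^bsub>CR\<^esub>Z = \<xi>\<oplus>\<^bsub>CR\<^esub> (Y\<oplus>\<^bsub>CR\<^esub>Z)" unfolding completion_simps by (rule ext) (rule Q.a_assoc[OF c])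
  show "\<xi>\<otimes>\<^bsub>CR\<^esub>Y\<otimes>\<^bsub>CR\<^esub>Z = \<xi>\<otimes>\<^bsub>CR\<^esub> (Y\<otimes>\<^bsub>CR\<^esub>Z)" unfolding completion_simps by (rule ext) (rule Q.m_assoc[OF c])
  show "(\<xi>\<oplus>\<^bsub>CR\<^esub>Y)\<otimes>\<^bsub>CR\<^esub>Z = \<xi>\<otimes>\<^bsub>CR\<^esub>Z\<oplus>\<^bsub>CR\<^esub>Y\<otimes>\<^bsub>CR\<^esub>Z" unfolding completion_simps by (rule ext) (rule Q.l_distr[OF c])
 qed
qed

interpretation C: cring CR by (rule completion_cring)

lemma cls_closed: "a\<in>\<K> ==> cls a\<in>carrier CR" using approx_cls by (intro carrier_completionI) blast

lemma cls_hom: "cls\<in>ring_hom R CR"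
proof (rule ring_hom_memI)
 fix a assume a: "a\<in>\<K>"
 show "cls a\<in>carrier CR" by (rule cls_closed[OF a])
 fix c assume c: "c\<in>\<K>"
 show "cls (a\<otimes>c) = cls a\<otimes>\<^bsub>CR\<^esub>cls c"
 proof (rule completion_eqI)
  fix n show "EX d. approx (cls (a\<otimes>c)) n d & approx (cls a\<otimes>\<^bsub>CR\<^esub>cls c) n d"
   using approx_cls[of "a\<otimes>c" n] approx_mult[OF approx_cls[OF a, of n] approx_cls[OF c]] a c by auto
 qed
 show "cls (a\<oplus>c) = cls a\<oplus>\<^bsub>CR\<^esub>cls c"
 proof (rule completion_eqI)
  fix n show "EX d. approx (cls (a\<oplus>c)) n d & approx (cls a\<oplus>\<^bsub>CR\<^esub>cls c) n d"
   using approx_cls[of "a\<oplus>c" n] approx_add[OF approx_cls[OF a, of n] approx_cls[OF c]] a c by auto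
 qed
next
 show "cls \<one> = \<one>\<^bsub>CR\<^esub>" unfolding cls_eq completion_simps by simp
qed

lemma cls_ring_hom: "ring_hom_cring R CR cls" by (intro ring_hom_cring.intro ring_hom_cring_axioms.intro cls_hom completion_cring is_cring)

lemma approx_uminus:
 assumes "\<xi>\<in>carrier CR" "approx \<xi> n a" shows "approx (\<ominus>\<^bsub>CR\<^esub> \<xi>) n (\<ominus>a)"
proof -
 have a: "a\<in>\<K>" by (rule approx_carr[OF assms(2)])
 have c: "cls (\<ominus>\<one>)\<in>carrier CR" by (intro cls_closed) simp
 interpret h: ring_hom_cring R CR cls by (rule cls_ring_hom)
 have "cls (\<ominus>\<one>) = \<ominus>\<^bsub>CR\<^esub> \<one>\<^bsub>CR\<^esub>" by simp
 then have "\<xi>\<otimes>\<^bsub>CR\<^esub>cls (\<ominus>\<one>) = \<ominus>\<^bsub>CR\<^esub> \<xi>" using assms(1) by (simp add: C.r_minus)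
 moreover have "approx (\<xi>\<otimes>\<^bsub>CR\<^esub>cls (\<ominus>\<one>)) n (a\<otimes>\<ominus>\<one>)" by (intro approx_mult approx_cls assms(2)) simp
 ultimately show ?thesis using a by (simp add: r_minus)
qed

lemma approx_minus:
 assumes "Y\<in>carrier CR" "approx \<xi> n a" "approx Y n c"
 shows "approx (\<xi> \<ominus>\<^bsub>CR\<^esub>Y) n (a\<ominus>c)"
 unfolding a_minus_def[of CR] a_minus_def[of R] by (intro approx_add approx_uminus assms)

text \<open>The kernel of the projection to \<open>R/M^n\<close>. A priori it is larger than the
  \<open>n\<close>-th power of the maximal ideal of the completion, but completeness with respect to
  it is immediate.\<close>

definition filt :: "nat => (nat => 'a set) set"
 where "filt n = {\<xi>\<in>carrier CR. approx \<xi> n \<zero>}"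

lemma filt_iff: "\<xi>\<in>carrier CR ==> approx \<xi> n a ==> \<xi>\<in>filt n <-> a\<in>P n"
proof -
 assume \<xi>: "\<xi>\<in>carrier CR" "approx \<xi> n a"
 have a: "a\<in>\<K>" by (rule approx_carr[OF \<xi>(2)])
 have e: "a\<ominus>\<zero> = a" using a by algebra
 show ?thesis
 proof
  assume "\<xi>\<in>filt n"
  then have "approx \<xi> n \<zero>" unfolding filt_def by simp
  then have "a\<ominus>\<zero>\<in>P n" by (rule approx_unique[OF \<xi>(2)])
  then show "a\<in>P n" unfolding e .
 next
  assume "a\<in>P n"
  then show "\<xi>\<in>filt n" unfolding filt_def using \<xi> approx_shift[OF \<xi>(2), of \<zero>] e by simp
 qed
qed

lemma filt_ideal: "ideal (filt n) CR"
proof (rule C.cidealI)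
 show "filt n<=carrier CR" unfolding filt_def by auto
 show "\<zero>\<^bsub>CR\<^esub>\<in>filt n" unfolding filt_def using approx_zero by simp
 fix \<xi> assume "\<xi>\<in>filt n"
 then have \<xi>: "\<xi>\<in>carrier CR" "approx \<xi> n \<zero>" unfolding filt_def by auto
 show "\<xi>\<oplus>\<^bsub>CR\<^esub>Y\<in>filt n" if "Y\<in>filt n" for Y
  using \<xi> that approx_add[OF \<xi>(2), of Y \<zero>] unfolding filt_def by auto
 fix Y assume Y: "Y\<in>carrier CR"
 obtain c where c: "approx Y n c" using approx_ex Y by blast
 then show "Y\<otimes>\<^bsub>CR\<^esub> \<xi>\<in>filt n" using \<xi> Y approx_mult[OF c \<xi>(2)] approx_carr[OF c] unfolding filt_def by simp
qed

lemma filt_complete: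
 assumes "!!n. C n\<in>filt n"
 shows "\<exists>Y\<in>carrier CR. ALL n. Y \<ominus>\<^bsub>CR\<^esub> (\<Oplus>\<^bsub>CR\<^esub>k\<in>{..<n}. C k)\<in>filt n"
proof -
 define S where "S n = (\<Oplus>\<^bsub>CR\<^esub>k\<in>{..<n}. C k)" for n :: nat
 have Cc: "C n\<in>carrier CR" for n using assms[of n] unfolding filt_def by simp
 have Sc: "S n\<in>carrier CR" for n unfolding S_def using Cc by (intro C.finsum_closed) auto
 have SS: "S (Suc n) = C n\<oplus>\<^bsub>CR\<^esub>S n" for n unfolding S_def lessThan_Suc using Cc by (subst C.finsum_insert) auto
 have step: "S (Suc n) m = S n m" if "m<=n" for n m
 proof -
  obtain a where a: "approx (S n) n a" using approx_ex Sc by blast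
  have "approx (C n) n \<zero>" using assms unfolding filt_def by simp
  from approx_add[OF this a] have "approx (S (Suc n)) n a" unfolding SS using approx_carr[OF a] by simp
  then show ?thesis using a that unfolding approx_def by simp
 qed
 have stable: "m<=n ==> S n m = S m m" for n m
 proof (induction n)
  case (Suc n)
  then show ?case using step[of m n] by (cases "m = Suc n") auto
 qed simp
 \<comment> \<open>Components of index at most \<open>n\<close> no longer change after stage
   \<open>n\<close>, so the diagonal is the limit.\<close>
 define Y where "Y m = S m m" for m
 have Yap: "approx Y n a" if "approx (S n) n a" for n a unfolding approx_def
 proof (intro conjI allI impI)
  show "a\<in>\<K>" by (rule approx_carr[OF that])
  fix m assume m: "m<=n"
  show "Y m = P m +> a" unfolding Y_def stable[OF m, symmetric] using that m unfolding approx_def by simp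
 qed
 have Y: "Y\<in>carrier CR" using approx_ex[OF Sc] Yap by (intro carrier_completionI) blast
 moreover have "Y \<ominus>\<^bsub>CR\<^esub>S n\<in>filt n" for n
 proof -
  obtain a where a: "approx (S n) n a" using approx_ex Sc by blast
  have "approx (Y \<ominus>\<^bsub>CR\<^esub>S n) n (a\<ominus>a)" by (rule approx_minus[OF Sc Yap[OF a] a])
  moreover have "a\<ominus>a = \<zero>" using approx_carr[OF a] by algebra
  ultimately show ?thesis unfolding filt_def using Y Sc by simp
 qed
 ultimately show ?thesis unfolding S_def by blast
qed

lemma completion_filtered: "complete_filtered CR filt"
proof (intro complete_filtered.intro complete_filtered_axioms.intro completion_cring filt_ideal)
 show "filt 0 = carrier CR"
 proof -
  have "\<xi>\<in>filt 0" if \<xi>: "\<xi>\<in>carrier CR" for \<xi>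
  proof -
   obtain a where a: "approx \<xi> 0 a" using approx_ex[OF \<xi>] by blast
   then show ?thesis using filt_iff[OF \<xi> a] approx_carr[OF a] ideal_pow_0 by simp
  qed
  then show ?thesis unfolding filt_def by auto
 qed
 show "filt (Suc n)<=filt n" for n unfolding filt_def using approx_mono by auto
 show "\<xi>\<otimes>\<^bsub>CR\<^esub>Y\<in>filt (m + n)" if "\<xi>\<in>filt m" "Y\<in>filt n" for \<xi> Y m n
 proof -
  have \<xi>: "\<xi>\<in>carrier CR" and Y: "Y\<in>carrier CR" using that unfolding filt_def by auto
  obtain a c where a: "approx \<xi> (m + n) a" and c: "approx Y (m + n) c" using approx_ex \<xi> Y by meson
  have "a\<in>P m" using filt_iff[OF \<xi> approx_mono[OF a, of m]] that(1) by simp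
  moreover have "c\<in>P n" using filt_iff[OF Y approx_mono[OF c, of n]] that(2) by simp
  ultimately have "a\<otimes>c\<in>P (m + n)" by (rule ideal_pow_add[OF M_ideal])
  then show ?thesis using filt_iff[OF _ approx_mult[OF a c]] \<xi> Y by simp
 qed
 show "\<xi> = \<zero>\<^bsub>CR\<^esub>" if "!!n. \<xi>\<in>filt n" for \<xi>
  using that approx_zero unfolding filt_def by (intro completion_eqI) blast
qed (rule filt_complete)

lemma completion_units:
 assumes \<xi>: "\<xi>\<in>carrier CR" "\<xi>~:filt 1" shows "\<xi>\<in>Units CR"
proof -
 define f where "f n = (SOME a. approx \<xi> n a)" for n
 have f: "approx \<xi> n (f n)" for n unfolding f_def by (rule someI_ex[OF approx_ex[OF \<xi>(1)]])
 have fc: "f n\<in>\<K>" for n by (rule approx_carr[OF f])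
 have P1: "P 1 = M" using ideal_pow_1[OF M_ideal] by simp
 have fU: "f (Suc n)\<in>Units R" for n
 proof -
  have "approx \<xi> 1 (f (Suc n))" by (rule approx_mono[OF f]) simp
  then have "f (Suc n)~:M" using filt_iff[OF \<xi>(1)] \<xi>(2) P1 by blast
  then show ?thesis using Units_iff fc by blast
 qed
 \<comment> \<open>The shift to \<open>Suc m\<close> matters at \<open>m = 0\<close>: a
   representative modulo \<open>M^0\<close> carries no information and need not be a unit.\<close>
 define Y where "Y m = P m +> inv (f (Suc m))" for m
 have Yap: "approx Y n (inv (f (Suc n)))" for n unfolding approx_def
 proof (intro conjI allI impI)
  show "inv (f (Suc n))\<in>\<K>" using fU by simp
  fix m assume m: "m<=n"
  have "approx \<xi> m (f (Suc n))" "approx \<xi> m (f (Suc m))" using m by (auto intro: approx_mono[OF f])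
  then have d: "f (Suc n)\<ominus>f (Suc m)\<in>P m" by (rule approx_unique)
  define a c where "a = f (Suc n)" and "c = f (Suc m)"
  have u: "a\<in>Units R" "c\<in>Units R" unfolding a_def c_def by (rule fU)+
  have cl: "a\<in>\<K>" "c\<in>\<K>" "inv a\<in>\<K>" "inv c\<in>\<K>" using u by auto
  have "inv c\<ominus>inv a = (inv a\<otimes>inv c)\<otimes>(a\<ominus>c)"
  proof -
   have "(inv a\<otimes>inv c)\<otimes>(a\<ominus>c) = (inv a\<otimes>a)\<otimes>inv c\<ominus>(inv c\<otimes>c)\<otimes>inv a" using cl by algebra
   then show ?thesis using u cl by simp
  qed
  then have "inv c\<ominus>inv a\<in>P m" using ideal_facts(4)[OF Mpow_ideal d, of "inv a\<otimes>inv c"] cl unfolding a_def c_def by simp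
  then show "Y m = P m +> inv (f (Suc n))" unfolding Y_def using P_coset_eq[OF cl(4,3), of m] unfolding a_def c_def by simp
 qed
 have Y: "Y\<in>carrier CR" using Yap by (intro carrier_completionI) blast
 have "\<xi>\<otimes>\<^bsub>CR\<^esub>Y = \<one>\<^bsub>CR\<^esub>"
 proof (rule completion_eqI)
  fix n
  have "approx \<xi> n (f (Suc n))" by (rule approx_mono[OF f]) simp
  from approx_mult[OF this Yap] have "approx (\<xi>\<otimes>\<^bsub>CR\<^esub>Y) n \<one>" using fU[of n] by simp
  then show "EX a. approx (\<xi>\<otimes>\<^bsub>CR\<^esub>Y) n a & approx \<one>\<^bsub>CR\<^esub>n a" using approx_one by blast
 qed
 then show ?thesis unfolding Units_def using \<xi>(1) Y by (auto intro!: bexI[of _ Y] simp: C.m_comm)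
qed

lemma one_notin_filt: "\<one>\<^bsub>CR\<^esub>~:filt 1"
 using filt_iff[OF C.one_closed approx_one, of 1] one_not_M ideal_pow_1[OF M_ideal] by simp

lemma completion_maximal: "maximalideal N CR <-> N = filt 1"
proof -
 have carr: "I = carrier CR" if I: "ideal I CR" "\<xi>\<in>I" "\<xi>~:filt 1" for I \<xi>
 proof -
  have "\<xi>\<in>carrier CR" using C.ideal_facts(1)[OF I(1)] I(2) by auto
  then have "\<xi>\<in>Units CR" using completion_units I(3) by blast
  then have "inv\<^bsub>CR\<^esub> \<xi>\<otimes>\<^bsub>CR\<^esub> \<xi> = \<one>\<^bsub>CR\<^esub>" "inv\<^bsub>CR\<^esub> \<xi>\<in>carrier CR" by simp_all
  then have "\<one>\<^bsub>CR\<^esub>\<in>I" using C.ideal_facts(4)[OF I(1,2)] by metis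
  then show ?thesis by (rule ideal.one_imp_carrier[OF I(1)])
 qed
 have mx: "maximalideal (filt 1) CR"
 proof (rule maximalidealI[OF filt_ideal])
  show "carrier CR~=filt 1" using one_notin_filt by blast
  fix J assume "ideal J CR" "filt 1<=J" "J<=carrier CR"
  then show "J = filt 1 \<or> J = carrier CR" using carr by blast
 qed
 show ?thesis
 proof
  assume N: "maximalideal N CR"
  then have Ni: "ideal N CR" and Nc: "carrier CR~=N" by (auto intro: maximalideal.axioms(1) dest: maximalideal.I_notcarr)
  have "N<=filt 1" using carr[OF Ni] Nc by blast
  then show "N = filt 1" using maximalideal.I_maximal[OF N filt_ideal] C.ideal_facts(1)[OF filt_ideal, of 1] mx
   maximalideal.I_notcarr[OF mx] by auto
 next
  assume "N = filt 1"
  with mx show "maximalideal N CR" by (simp only:)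
 qed
qed

lemma cls_filt: "a\<in>P n ==> cls a\<in>filt n" using filt_iff[OF cls_closed approx_cls] ideal_facts(1)[OF Mpow_ideal, of n] by blast

text \<open>Successive approximation: a representative in \<open>M^(n+1)\<close>, the product of
  \<open>M^n\<close> and \<open>M\<close>, has coefficients in \<open>M^n\<close> with respect to
  the parameters, which is exactly the decay that convergence needs.\<close>

lemma filt_1_gen: "filt 1 = Idl\<^bsub>CR\<^esub> (cls ` range x)"
proof
 interpret h: ring_hom_cring R CR cls by (rule cls_ring_hom)
 interpret F: complete_filtered CR filt by (rule completion_filtered)
 have xM: "x i\<in>M" for i unfolding M_gen using genideal_self[OF xr] by auto
 have gc: "cls ` range x<=carrier CR" using cls_closed x_carr by auto
 show "Idl\<^bsub>CR\<^esub> (cls ` range x)<=filt 1"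
 proof (intro C.genideal_minimal filt_ideal image_subsetI)
  fix w assume "w\<in>range x"
  then show "cls w\<in>filt 1" using xM ideal_pow_1[OF M_ideal] by (intro cls_filt) auto
 qed
 show "filt 1<=Idl\<^bsub>CR\<^esub> (cls ` range x)"
 proof
  fix \<xi> assume xi: "\<xi>\<in>filt 1"
  define P1 where "P1 n r <-> r\<in>filt (Suc n) & (n = 0 --> r = \<xi>)" for n r
  define P2 where "P2 n r r' <-> (EX c. (\<forall>w\<in>range x. c w\<in>filt n) & r = (\<Oplus>\<^bsub>CR\<^esub>w\<in>range x. c w\<otimes>\<^bsub>CR\<^esub>cls w)\<oplus>\<^bsub>CR\<^esub>r')" for n r r'
  have "EX f. ALL n. P1 n (f n) & P2 n (f n) (f (Suc n))"
  proof (rule dependent_nat_choice)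
   show "EX r. P1 0 r" unfolding P1_def using xi by auto
   fix r n assume "P1 n r"
   then have r: "r\<in>filt (Suc n)" unfolding P1_def ..
   then have rc: "r\<in>carrier CR" unfolding filt_def by simp
   \<comment> \<open>Precision \<open>n + 2\<close> is taken so that the remainder falls into
     \<open>filt (n + 2)\<close>, the invariant of the next stage.\<close>
   obtain a where a: "approx r (Suc (Suc n)) a" using approx_ex[OF rc] by blast
   have "a\<in>P (Suc n)" using filt_iff[OF rc approx_mono[OF a, of "Suc n"]] r by simp
   then have "a\<in>P n \<cdot> (Idl (range x))" unfolding ideal_pow_Suc M_gen .
   from ideal_prod_Idl_finite[OF Mpow_ideal _ xr this] obtain c where
    c: "c\<in>range x \<rightarrow> P n" "a = (\<Oplus>w\<in>range x. c w\<otimes>w)" by auto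
   have cc: "c w\<in>\<K>" "w\<in>\<K>" if "w\<in>range x" for w using that c(1) ideal_facts(1)[OF Mpow_ideal, of n] xr by auto
   have s: "(\<Oplus>\<^bsub>CR\<^esub>w\<in>range x. cls (c w)\<otimes>\<^bsub>CR\<^esub>cls w) = cls a"
   proof -
    have "cls a = (\<Oplus>\<^bsub>CR\<^esub>w\<in>range x. (cls\<circ>(%w. c w\<otimes>w)) w)"
     unfolding c(2) using cc by (intro h.hom_finsum) auto
    also have "... = (\<Oplus>\<^bsub>CR\<^esub>w\<in>range x. cls (c w)\<otimes>\<^bsub>CR\<^esub>cls w)"
     using cc cls_closed by (intro C.finsum_cong') auto
    finally show ?thesis by simp
   qed
   have ac: "a\<in>\<K>" by (rule approx_carr[OF a])
   have "approx (r \<ominus>\<^bsub>CR\<^esub>cls a) (Suc (Suc n)) (a\<ominus>a)" by (rule approx_minus[OF cls_closed[OF ac] a approx_cls[OF ac]])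
   moreover have "a\<ominus>a = \<zero>" using ac by algebra
   ultimately have "r \<ominus>\<^bsub>CR\<^esub>cls a\<in>filt (Suc (Suc n))" unfolding filt_def using rc cls_closed[OF ac] by simp
   then have "P1 (Suc n) (r \<ominus>\<^bsub>CR\<^esub>cls a)" unfolding P1_def by simp
   moreover have "r = cls a\<oplus>\<^bsub>CR\<^esub> (r \<ominus>\<^bsub>CR\<^esub>cls a)" using rc cls_closed[OF ac] by algebra
   then have "P2 n r (r \<ominus>\<^bsub>CR\<^esub>cls a)" unfolding P2_def using s c(1) cls_filt by (intro exI[of _ "%w. cls (c w)"]) auto
   ultimately show "EX r'. P1 (Suc n) r' & P2 n r r'" by blast
  qed
  then obtain f where ff: "ALL n. P1 n (f n) & P2 n (f n) (f (Suc n))" by (rule exE)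
  have "f 0\<in>Idl\<^bsub>CR\<^esub> (cls ` range x)"
  proof (rule F.successive_approximation[OF _ gc])
   show "finite (range x)" by simp
   fix n
   show "f n\<in>filt n" using spec[OF ff, of n] F.F_dec unfolding P1_def by blast
   show "EX c. (\<forall>i\<in>range x. c i\<in>filt n) & f n = (\<Oplus>\<^bsub>CR\<^esub>i\<in>range x. c i\<otimes>\<^bsub>CR\<^esub>cls i)\<oplus>\<^bsub>CR\<^esub>f (Suc n)"
    using spec[OF ff, of n] unfolding P2_def ..
  qed
  moreover have "f 0 = \<xi>" using spec[OF ff, of 0] unfolding P1_def by simp
  ultimately show "\<xi>\<in>Idl\<^bsub>CR\<^esub> (cls ` range x)" by simp
 qed
qed

text \<open>Only the maximal ideal and the whole ring contain the parameters, and both are finitely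
  generated; \<open>noetherian_of_generators\<close> reaches all other ideals.\<close>

lemma completion_noetherian: "noetherian_ring CR"
proof -
 interpret F: complete_filtered CR filt by (rule completion_filtered)
 have gc: "cls ` range x<=carrier CR" using cls_closed x_carr by auto
 show ?thesis
 proof (rule F.noetherian_of_generators[of "cls ` range x"])
  show "finite (cls ` range x)" by simp
  show "cls ` range x<=filt 1" unfolding filt_1_gen by (rule C.genideal_self[OF gc])
  fix K assume K: "ideal K CR" "cls ` range x<=K"
  have sub: "filt 1<=K" unfolding filt_1_gen by (rule C.genideal_minimal[OF K])
  have mx: "maximalideal (filt 1) CR" by (rule completion_maximal[THEN iffD2, OF refl])
  have "K = filt 1 \<or> K = carrier CR" by (rule maximalideal.I_maximal[OF mx K(1) sub C.ideal_facts(1)[OF K(1)]])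
  then show "F.fin_gen K"
  proof
   assume "K = filt 1"
   then show ?thesis unfolding F.fin_gen_def filt_1_gen using gc by (intro exI[of _ "cls ` range x"]) simp
  next
   assume "K = carrier CR"
   then show ?thesis unfolding F.fin_gen_def using C.genideal_one by (intro exI[of _ "{\<one>\<^bsub>CR\<^esub>}"]) simp
  qed
 qed
qed

lemma completion_local: "local_ring CR" "max_ideal CR = filt 1"
 unfolding local_ring_def max_ideal_def completion_maximal using completion_cring by auto

text \<open>The inverse image in the completion of the image of \<open>J\<close> in
  \<open>R/M^n\<close>. Such ideals bring statements about generated ideals of the completion back
  to \<open>R\<close>.\<close>

lemma approx_ideal:
 assumes J: "ideal J R" shows "ideal {\<xi>\<in>carrier CR. EX a:J. approx \<xi> n a} CR" (is "ideal ?I CR")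
proof (rule C.cidealI)
 note Jf = ideal_facts[OF J]
 show "?I<=carrier CR" by auto
 show "\<zero>\<^bsub>CR\<^esub>\<in>?I" using approx_zero Jf(2) by auto
 fix \<xi> \<eta> :: "nat => 'a set" assume "\<xi>\<in>?I"
 then obtain a where a: "\<xi>\<in>carrier CR" "a\<in>J" "approx \<xi> n a" by auto
 show "\<xi>\<oplus>\<^bsub>CR\<^esub> \<eta>\<in>?I" if e: "\<eta>\<in>?I"
 proof -
  obtain c where c: "\<eta>\<in>carrier CR" "c\<in>J" "approx \<eta> n c" using e by auto
  have "a\<oplus>c\<in>J" "approx (\<xi>\<oplus>\<^bsub>CR\<^esub> \<eta>) n (a\<oplus>c)" using Jf(3)[OF a(2) c(2)] approx_add[OF a(3) c(3)] by auto
  then show ?thesis using a(1) c(1) by blast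
 qed
 show "\<eta>\<otimes>\<^bsub>CR\<^esub> \<xi>\<in>?I" if e: "\<eta>\<in>carrier CR"
 proof -
  obtain c where c: "approx \<eta> n c" using approx_ex[OF e] by blast
  have "c\<otimes>a\<in>J" "approx (\<eta>\<otimes>\<^bsub>CR\<^esub> \<xi>) n (c\<otimes>a)"
   using Jf(4)[OF a(2) approx_carr[OF c]] approx_mult[OF c a(3)] by auto
  then show ?thesis using a(1) e by blast
 qed
qed

lemma approx_pow: "approx \<xi> n a ==> approx (\<xi> [^]\<^bsub>CR\<^esub> (k::nat)) n (a [^] k)"
proof (induction k)
 case 0
 then show ?case using approx_one by simp
next
 case (Suc k)
 then show ?case using approx_mult by simp
qed

lemma approx_monomial:
 fixes \<xi> :: "'j::finite => nat => 'a set"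
 assumes "!!i. \<xi> i\<in>carrier CR" "!!i. approx (\<xi> i) n (a i)"
 shows "approx (monomial CR \<xi> m) n (monomial R a m)"
proof -
 have ac: "a i\<in>\<K>" for i by (rule approx_carr[OF assms(2)])
 have "finite T ==> approx (\<Otimes>\<^bsub>CR\<^esub>i\<in>T. \<xi> i [^]\<^bsub>CR\<^esub>m i) n (\<Otimes>i\<in>T. a i [^] m i)" for T
 proof (induction T rule: finite_induct)
  case empty
  then show ?case using approx_one by simp
 next
  case (insert i T)
  from approx_mult[OF approx_pow[OF assms(2)] insert.IH]
  show ?case using insert.hyps ac assms(1) by (simp add: Pi_iff)
 qed
 then show ?thesis unfolding monomial_def by simp
qed

lemma monomial_cls:
 fixes a :: "'j::finite => 'a" assumes "range a<=\<K>"
 shows "monomial CR (cls\<circ>a) m = cls (monomial R a m)"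
proof (rule completion_eqI)
 fix n
 have ac: "a i\<in>\<K>" for i using assms by auto
 have "approx (monomial CR (cls\<circ>a) m) n (monomial R a m)" using ac cls_closed approx_cls by (intro approx_monomial) auto
 then show "EX d. approx (monomial CR (cls\<circ>a) m) n d & approx (cls (monomial R a m)) n d"
  using approx_cls[OF monomial_closed[OF assms]] by blast
qed

text \<open>Generation of the maximal ideal is known, so the point is the lower bound on the
  dimension. By \<open>chain_above_of_monomials\<close> it is a statement on monomials, and it can
  be decided in \<open>R\<close> modulo a power of \<open>M\<close>.\<close>

theorem completion_regular_params:
 assumes "krull_dim R = enat CARD('i)" shows "regular_params CR UNIV (cls\<circ>x)"
proof -
 interpret N: noetherian_local_ring CR "filt 1"
  using noetherian_local_ring_max_ideal[OF completion_local(1) completion_noetherian] unfolding completion_local(2) .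
 have r: "range (cls\<circ>x) = cls ` range x" by auto
 have gc: "range (cls\<circ>x)<=carrier CR" using cls_closed x_carr by auto
 have "chain_above CR {\<zero>\<^bsub>CR\<^esub>} CARD('i)"
 proof (rule N.chain_above_of_monomials[OF gc])
  fix m :: "'i => nat"
  \<comment> \<open>This precision is enough because \<open>M^(|m|+1)\<close> already lies in the
    ideal of the powers attached to \<open>m\<close>.\<close>
  let ?n = "Suc (degree_of m)"
  let ?I = "{\<xi>\<in>carrier CR. \<exists>a\<in>Idl (pows UNIV m). approx \<xi> ?n a}"
  have I: "ideal ?I CR" by (rule approx_ideal[OF pows_ideal])
  have "Idl\<^bsub>CR\<^esub> (range (%i. (cls\<circ>x) i [^]\<^bsub>CR\<^esub>Suc (m i)))<=?I"
  proof (intro C.genideal_minimal I image_subsetI CollectI conjI)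
   fix i
   show "(cls\<circ>x) i [^]\<^bsub>CR\<^esub>Suc (m i)\<in>carrier CR" using gc by (intro C.nat_pow_closed) auto
   have "approx ((cls\<circ>x) i [^]\<^bsub>CR\<^esub>Suc (m i)) ?n (x i [^] Suc (m i))"
    unfolding comp_def by (rule approx_pow[OF approx_cls[OF x_carr]])
   moreover have "x i [^] Suc (m i)\<in>Idl (pows UNIV m)" using genideal_self[OF pows_carr[of UNIV m]] unfolding pows_def by blast
   ultimately show "\<exists>a\<in>Idl (pows UNIV m). approx ((cls\<circ>x) i [^]\<^bsub>CR\<^esub>Suc (m i)) ?n a" by (rule bexI)
  qed
  moreover have "monomial CR (cls\<circ>x) m~:?I"
  proof
   assume "monomial CR (cls\<circ>x) m\<in>?I"
   then obtain a where a: "a\<in>Idl (pows UNIV m)" "approx (cls (monomial R x m)) ?n a" unfolding monomial_cls[OF xr] by auto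
   have ac: "a\<in>\<K>" by (rule approx_carr[OF a(2)])
   have "monomial R x m\<ominus>a\<in>P ?n" by (rule approx_unique[OF approx_cls[OF mon_closed] a(2)])
   then have "monomial R x m\<ominus>a\<in>Idl (pows UNIV m)" using Mpow_sub_pows[of m ?n] by auto
   then have "monomial R x m\<ominus>a\<oplus>a\<in>Idl (pows UNIV m)" using a(1) by (rule ideal_facts(3)[OF pows_ideal])
   moreover have "monomial R x m\<ominus>a\<oplus>a = \<one>\<otimes>monomial R x m" using ac mon_closed[of m] by algebra
   ultimately have "\<one>\<in>M" using monomial_colon[of \<one> m] by simp
   then show False using one_not_M by simp
  qed
  ultimately show "monomial CR (cls\<circ>x) m~:Idl\<^bsub>CR\<^esub> (range (%i. (cls\<circ>x) i [^]\<^bsub>CR\<^esub>Suc (m i)))" by blast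
 qed
 then have "krull_dim CR = enat CARD('i)"
 proof (rule N.krull_dim_eqI)
  show "finite (range (cls\<circ>x))" by simp
  show "range (cls\<circ>x)<=carrier CR" by (rule gc)
  show "filt 1 = Idl\<^bsub>CR\<^esub> (range (cls\<circ>x))" unfolding r by (rule filt_1_gen)
  show "card (range (cls\<circ>x))<=CARD('i)" by (rule card_image_le) simp
 qed
 then show ?thesis unfolding regular_params_def completion_local(2)
  using completion_local(1) completion_noetherian gc filt_1_gen[folded r] by (intro conjI) simp_all
qed

end

section \<open>Newton polyhedra over the completion\<close>

lemma newton_polyhedron_completion_le:
 fixes R :: "('a, 'm) ring_scheme" (structure) and u :: "'d::finite => 'a" and y :: "'s::finite => 'a"
 assumes y: "regular_params R UNIV (case_sum u y)" and J: "J<=\<K>"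
 shows "newton_polyhedron (completion R) (Idl\<^bsub>completion R\<^esub> (to_completion R ` J), b) (to_completion R\<circ>u) (to_completion R\<circ>y)
<=newton_polyhedron R (J, b) u y"
proof (rule newton_polyhedron_subsetI)
 interpret regular_system R "max_ideal R" "case_sum u y" by (rule regular_params_system[OF y])
 interpret C: cring CR by (rule completion_cring)
 interpret h: ring_hom_cring R CR cls by (rule cls_ring_hom)
 have dim: "krull_dim R = enat CARD('d + 's)" using y unfolding regular_params_def by simp
 have cs: "case_sum (cls\<circ>u) (cls\<circ>y) = cls\<circ>case_sum u y" by (auto simp: fun_eq_iff split: sum.splits)
 have Cy: "regular_params CR UNIV (case_sum (cls\<circ>u) (cls\<circ>y))" unfolding cs by (rule completion_regular_params[OF dim])
 interpret CS: regular_system CR "max_ideal CR" "case_sum (cls\<circ>u) (cls\<circ>y)" by (rule regular_params_system[OF Cy])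
 fix L :: "'d => real" and g c A B
 assume L: "!!i. 0 < L i" "!!p. p\<in>newton_polyhedron R (J, b) u y ==> 1<=(\<Sum>i\<in>UNIV. L i * p $ i)"
  and g: "g\<in>Idl\<^bsub>CR\<^esub> (cls ` J)" "is_expansion CR (cls\<circ>u) (cls\<circ>y) g c" "c (A, B)~=\<zero>\<^bsub>CR\<^esub>" "degree_of B < b"
 have L0: "0<=L i" for i using L(1)[of i] by simp
 let ?w = "case_sum L (%_. 1) :: 'd + 's => real"
 define W where "W = weight_ideal CR (case_sum (cls\<circ>u) (cls\<circ>y)) ?w (real b)"
 have Wi: "ideal W CR" unfolding W_def by (rule C.weight_ideal_ideal[OF CS.xr])
 have JW: "J<=weight_ideal R (case_sum u y) ?w (real b)" by (rule newton_halfspace_weight_ideal[OF y J, where L = L]) (rule L0, rule L(2))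
 have "ideal {a\<in>\<K>. cls a\<in>W} R"
 proof (rule cidealI)
  note Wf = C.ideal_facts[OF Wi]
  fix a d assume a: "a\<in>{a\<in>\<K>. cls a\<in>W}"
  show "a\<oplus>d\<in>{a\<in>\<K>. cls a\<in>W}" if "d\<in>{a\<in>\<K>. cls a\<in>W}" using a that Wf(3) by simp
  show "r\<otimes>a\<in>{a\<in>\<K>. cls a\<in>W}" if r: "r\<in>\<K>" for r using a r Wf(4)[of "cls a" "cls r"] cls_closed[OF r] by simp
 qed (use C.ideal_facts(2)[OF Wi] in auto)
 then have "weight_ideal R (case_sum u y) ?w (real b)<={a\<in>\<K>. cls a\<in>W}" unfolding weight_ideal_def
 proof (rule genideal_minimal)
  show "monomial R (case_sum u y) ` {m. real b<=weight ?w m}<={a\<in>\<K>. cls a\<in>W}"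
  proof (intro image_subsetI CollectI conjI)
   fix m assume m: "m\<in>{m. real b<=weight ?w m}"
   show "monomial R (case_sum u y) m\<in>\<K>" by (rule mon_closed)
   have "monomial CR (case_sum (cls\<circ>u) (cls\<circ>y)) m\<in>W" unfolding W_def using m by (intro C.weight_ideal_monomial[OF CS.xr]) simp
   then show "cls (monomial R (case_sum u y) m)\<in>W" unfolding cs monomial_cls[OF xr] .
  qed
 qed
 then have "cls ` J<=W" using JW by auto
 then have "Idl\<^bsub>CR\<^esub> (cls ` J)<=W" by (rule C.genideal_minimal[OF Wi])
 then have "g\<in>W" using g(1) by auto
 then show "real b - real (degree_of B)<=(\<Sum>i\<in>UNIV. L i * real (A i))"
  unfolding W_def using L0 g(2,3) by (intro weight_ideal_newton[OF CS.regular_system_axioms, where g = g and c = c]) auto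
qed

lemma newton_polyhedron_le_completion:
 fixes R :: "('a, 'm) ring_scheme" (structure) and u :: "'d::finite => 'a" and y :: "'s::finite => 'a"
  and z :: "'s => nat => 'a set" assumes y: "regular_params R UNIV (case_sum u y)"
  and S: "subring S R" "range u<=S" and D: "attained_by_hasse_ops R S (J, b) y" and b: "0 < b" and J: "J<=\<K>"
  and z: "regular_params (completion R) UNIV (case_sum (to_completion R\<circ>u) z)"
 shows "newton_polyhedron R (J, b) u y<=
  newton_polyhedron (completion R) (Idl\<^bsub>completion R\<^esub> (to_completion R ` J), b) (to_completion R\<circ>u) z"
proof (rule newton_polyhedron_subsetI)
 interpret regular_system R "max_ideal R" "case_sum u y" by (rule regular_params_system[OF y])
 interpret C: cring CR by (rule completion_cring)
 interpret CS: regular_system CR "max_ideal CR" "case_sum (cls\<circ>u) z" by (rule regular_params_system[OF z])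
 define M where "M = max_ideal R"
 fix L :: "'d => real" and g c A B
 assume L: "!!i. 0 < L i" "!!p. p\<in>newton_polyhedron CR (Idl\<^bsub>CR\<^esub> (cls ` J), b) (cls\<circ>u) z ==> 1<=(\<Sum>i\<in>UNIV. L i * p $ i)"
  and g: "g\<in>J" "is_expansion R u y g c" "c (A, B)~=\<zero>" "degree_of B < b"
 have L0: "0<=L i" for i using L(1)[of i] by simp
 let ?w = "case_sum L (%_. 1) :: 'd + 's => real"
 have uc: "range u<=\<K>" using x_carr[of "Inl _"] by auto
 have clsJ: "cls ` J<=carrier CR" using J cls_closed by auto
 have JC: "Idl\<^bsub>CR\<^esub> (cls ` J)<=weight_ideal CR (case_sum (cls\<circ>u) z) ?w (real b)"
  by (rule newton_halfspace_weight_ideal[OF z, where L = L])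
   (rule C.ideal_facts(1)[OF C.genideal_ideal[OF clsJ]], rule L0, rule L(2))
 \<comment> \<open>The smallest weight, positive because the separating form is; hence a monomial of
   degree \<open>n\<close> has weight at least \<open>l n\<close>.\<close>
 define l where "l = Min (range ?w)"
 have lpos: "0 < l" unfolding l_def using L(1) by (subst Min_gr_iff) (auto split: sum.splits)
 have lw: "l * real (degree_of m)<=weight ?w m" for m
 proof -
  have "(\<Sum>i\<in>UNIV. l * real (m i))<=weight ?w m" unfolding weight_def l_def by (intro sum_mono mult_right_mono Min_le) auto
  then show ?thesis by (simp add: sum_distrib_left)
 qed
 \<comment> \<open>Large enough that all monomials of degree \<open>n\<close> have weight at least
   \<open>b\<close>, so that \<open>M^n\<close> lies in the weight ideal. The summand 2 keeps the
   approximated parameters correct modulo the square of the maximal ideal.\<close>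
 define n where "n = nat \<lceil>real b / l\<rceil> + 2"
 have n2: "2<=n" unfolding n_def by simp
 have nb: "real b<=l * real n"
 proof -
  have "real b / l<=real n" unfolding n_def by linarith
  then show ?thesis using lpos by (simp add: divide_le_eq mult.commute)
 qed
 have zc: "z k\<in>carrier CR" for k using CS.x_carr[of "Inr k"] by simp
 have "ALL k. EX a. approx (z k) n a" using approx_ex[OF zc] by blast
 from choice[OF this] obtain z' where z': "!!k. approx (z k) n (z' k)" by blast
 have z'c: "range z'<=\<K>" using approx_carr[OF z'] by auto
 define x' where "x' = case_sum u z'"
 have x'c: "range x'<=\<K>" unfolding x'_def range_case_sum using uc z'c by simp
 have xap: "approx (case_sum (cls\<circ>u) z i) n (x' i)" for i
  unfolding x'_def using z' approx_cls[of "u _"] uc by (cases i) (auto simp: image_subset_iff)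
 have P1: "P 1 = max_ideal R" using ideal_pow_1[OF M_ideal] by simp
 have max: "max_ideal CR = filt 1" by (rule completion_local(2))
 have x'M: "x' i\<in>max_ideal R" for i
 proof -
  have "case_sum (cls\<circ>u) z i\<in>filt 1" unfolding max[symmetric] CS.M_gen using C.genideal_self[OF CS.xr] by auto
  then have "x' i\<in>P 1" using filt_iff[OF CS.x_carr approx_mono[OF xap, of 1]] n2 by simp
  then show ?thesis using P1 by simp
 qed
 have idl: "ideal (Idl (range x')) R" by (rule genideal_ideal[OF x'c])
 \<comment> \<open>By Nakayama a system that agrees with parameters modulo the square of the maximal
   ideal still generates it.\<close>
 have gen: "max_ideal R = Idl (range x')"
 proof
  show "Idl (range x')<=max_ideal R" using x'M by (intro genideal_minimal M_ideal) auto
  show "max_ideal R<=Idl (range x')"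
  proof (rule nakayama[OF M_ideal idl])
   fix a assume a: "a\<in>max_ideal R"
   have ac: "a\<in>\<K>" using a M_carr by auto
   have "a\<in>P 1" using a P1 by simp
   then have "cls a\<in>max_ideal CR" unfolding max by (rule cls_filt)
   then have "cls a\<in>Idl\<^bsub>CR\<^esub> (range (case_sum (cls\<circ>u) z))" unfolding CS.M_gen .
   moreover have "Idl\<^bsub>CR\<^esub> (range (case_sum (cls\<circ>u) z))<={\<xi>\<in>carrier CR. \<exists>a\<in>Idl (range x'). approx \<xi> 2 a}"
   proof (intro C.genideal_minimal approx_ideal idl image_subsetI CollectI conjI)
    fix i show "case_sum (cls\<circ>u) z i\<in>carrier CR" by (rule CS.x_carr)
    show "\<exists>a\<in>Idl (range x'). approx (case_sum (cls\<circ>u) z i) 2 a"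
     using genideal_self[OF x'c] approx_mono[OF xap n2] by (intro bexI[of _ "x' i"]) auto
   qed
   ultimately obtain d where d: "d\<in>Idl (range x')" "approx (cls a) 2 d" by auto
   have dc: "d\<in>\<K>" by (rule approx_carr[OF d(2)])
   have "a\<ominus>d\<in>P 2" by (rule approx_unique[OF approx_cls[OF ac] d(2)])
   also have "P 2 = max_ideal R \<cdot> max_ideal R" using ideal_pow_Suc[of "max_ideal R" 1] P1 by (simp add: numeral_2_eq_2)
   finally have "a\<ominus>d\<in>max_ideal R \<cdot> max_ideal R" .
   moreover have "a = (a\<ominus>d)\<oplus>d" using ac dc by algebra
   ultimately show "\<exists>q\<in>max_ideal R \<cdot> max_ideal R. \<exists>n\<in>Idl (range x'). a = q\<oplus>n" using d(1) by blast
  qed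
 qed
 have rp: "regular_params R UNIV (case_sum u z')" using y x'c gen unfolding regular_params_def x'_def[symmetric] by simp
 define W where "W = weight_ideal R x' ?w (real b)"
 have Wi: "ideal W R" unfolding W_def by (rule weight_ideal_ideal[OF x'c])
 have PW: "P n<=W" unfolding gen ideal_pow_Idl_monomials[OF x'c]
 proof (intro genideal_minimal Wi image_subsetI)
  fix m assume "m\<in>{m :: 'd + 's => nat. degree_of m = n}"
  then have "real b<=weight ?w m" using lw[of m] nb by auto
  then show "monomial R x' m\<in>W" unfolding W_def by (rule weight_ideal_monomial[OF x'c])
 qed
 \<comment> \<open>Weight ideals are generated by monomials, and a monomial in \<open>z\<close> is
   approximated by the same monomial in the approximations of \<open>z\<close>. Hence elements of
   weight \<open>b\<close> are approximated by elements of \<open>W\<close>; the error lies in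
   \<open>M^n\<close>, which is also in \<open>W\<close>.\<close>
 have sub: "weight_ideal CR (case_sum (cls\<circ>u) z) ?w (real b)<={\<xi>\<in>carrier CR. EX a:W. approx \<xi> n a}"
  unfolding weight_ideal_def
 proof (intro C.genideal_minimal approx_ideal Wi image_subsetI CollectI conjI)
  fix m assume m: "m\<in>{m. real b<=weight ?w m}"
  show "monomial CR (case_sum (cls\<circ>u) z) m\<in>carrier CR" by (rule CS.mon_closed)
  have "approx (monomial CR (case_sum (cls\<circ>u) z) m) n (monomial R x' m)" by (rule approx_monomial[OF CS.x_carr xap])
  moreover have "monomial R x' m\<in>W" unfolding W_def using m by (intro weight_ideal_monomial[OF x'c]) simp
  ultimately show "EX a:W. approx (monomial CR (case_sum (cls\<circ>u) z) m) n a" by (rule bexI)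
 qed
 have apJ: "EX a:W. approx (cls f) n a" if "f\<in>J" for f
 proof -
  have "cls f\<in>Idl\<^bsub>CR\<^esub> (cls ` J)" using that C.genideal_self[OF clsJ] by auto
  with JC have "cls f\<in>weight_ideal CR (case_sum (cls\<circ>u) z) ?w (real b)" by (rule subsetD)
  with sub show ?thesis by auto
 qed
 have "J<=W"
 proof
  fix f assume f: "f\<in>J"
  obtain a where a: "a\<in>W" "approx (cls f) n a" using apJ[OF f] by auto
  have fc: "f\<in>\<K>" and ac: "a\<in>\<K>" using f J approx_carr[OF a(2)] by auto
  have "f\<ominus>a\<in>P n" by (rule approx_unique[OF approx_cls[OF fc] a(2)])
  then have "(f\<ominus>a)\<oplus>a\<in>W" using PW a(1) by (intro ideal_facts(3)[OF Wi]) auto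
  moreover have "(f\<ominus>a)\<oplus>a = f" using fc ac by algebra
  ultimately show "f\<in>W" by simp
 qed
 then have "J<=weight_ideal R (case_sum u y) ?w (real b)" unfolding W_def x'_def
  by (rule weight_ideal_transfer[OF y rp S D b, where L = L, rotated]) (rule L0)
 then show "real b - real (degree_of B)<=(\<Sum>i\<in>UNIV. L i * real (A i))"
  using g(1,2,3) L0 by (intro weight_ideal_newton[OF regular_system_axioms, where g = g and c = c]) auto
qed

theorem newton_polyhedron_eq_characteristic:
 fixes R :: "('a, 'm) ring_scheme" (structure) and u :: "'d::finite => 'a" and y :: "'s::finite => 'a"
 assumes y: "regular_params R UNIV (case_sum u y)"
  and S: "subring S R" "range u<=S" and D: "attained_by_hasse_ops R S (J, b) y" and b: "0 < b" and J: "J<=\<K>"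
 shows "newton_polyhedron R (J, b) u y = characteristic_polyhedron TYPE('s) R (J, b) u"
proof
 show "newton_polyhedron R (J, b) u y<=characteristic_polyhedron TYPE('s) R (J, b) u" unfolding characteristic_polyhedron_def
  using newton_polyhedron_le_completion[OF y S D b J] by auto
 interpret regular_system R "max_ideal R" "case_sum u y" by (rule regular_params_system[OF y])
 have dim: "krull_dim R = enat CARD('d + 's)" using y unfolding regular_params_def by simp
 have "case_sum (cls\<circ>u) (cls\<circ>y) = cls\<circ>case_sum u y" by (auto simp: fun_eq_iff split: sum.splits)
 then have "regular_params CR UNIV (case_sum (cls\<circ>u) (cls\<circ>y))" using completion_regular_params[OF dim] by simp
 \<comment> \<open>The image of \<open>(u,y)\<close> is one of the systems over which the
   intersection runs.\<close>
 then have "characteristic_polyhedron TYPE('s) R (J, b) u<=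
   newton_polyhedron CR (Idl\<^bsub>CR\<^esub> (cls ` J), b) (cls\<circ>u) (cls\<circ>y)" unfolding characteristic_polyhedron_def by auto
 also have "...<=newton_polyhedron R (J, b) u y" by (rule newton_polyhedron_completion_le[OF y J])
 finally show "characteristic_polyhedron TYPE('s) R (J, b) u<=newton_polyhedron R (J, b) u y" .
qed

section \<open>Polynomial rings\<close>

lemma finite_submultisets: "finite {k. k<=# (m :: 'i multiset)}"
proof (induction m)
 case (add x m)
 have "k\<in>{k. k<=# m}\<union>add_mset x ` {k. k<=# m}" if "k<=# add_mset x m" for k
 proof (cases "x\<in># k")
  case True
  then have "k = add_mset x (k - {#x#})" by simp
  moreover have "k - {#x#}<=# m" using that by (simp add: subset_eq_diff_conv)
  ultimately show ?thesis by blast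
 next
  case False
  have "k<=# m"
  proof (rule mset_subset_eqI)
   show "count k a<=count m a" for a using mset_subset_eq_count[OF that, of a] False by (cases "a = x") (auto simp: not_in_iff)
  qed
  then show ?thesis by simp
 qed
 then have "{k. k<=# add_mset x m}<={k. k<=# m}\<union>add_mset x ` {k. k<=# m}" by blast
 then show ?case using add by (meson finite_UnI finite_imageI finite_subset)
qed simp

text \<open>The product of \<open>mpoly_ring\<close> for arbitrary coefficient functions: each
  coefficient is a finite sum anyway, so closure and commutativity need no finite support.\<close>

definition convolution :: "('a, 'm) ring_scheme => ('i multiset => 'a) => ('i multiset => 'a) => 'i multiset => 'a"
 where "convolution R P Q = (%m. \<Oplus>\<^bsub>R\<^esub>k\<in>{k. k<=# m}. P k\<otimes>\<^bsub>R\<^esub>Q (m - k))"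

context cring
begin

lemma convolution_closed:
 assumes "carrier_coeff P" "carrier_coeff Q" shows "carrier_coeff (convolution R P Q)"
 using assms unfolding carrier_coeff_def convolution_def by (auto intro!: finsum_closed)

lemma convolution_commute:
 fixes P Q :: "'i multiset => 'a" assumes P: "carrier_coeff P" and Q: "carrier_coeff Q"
 shows "convolution R P Q = convolution R Q P"
proof
 fix m :: "'i multiset"
 have dd: "m - (m - k) = k" if "k<=# m" for k using that by (simp add: multiset_eq_iff subseteq_mset_def)
 have "k\<in>(%k. m - k) ` {k. k<=# m}" if "k<=# m" for k using dd[OF that] by (intro image_eqI[of _ _ "m - k"]) auto
 then have im: "(%k. m - k) ` {k. k<=# m} = {k. k<=# m}" by auto
 have inj: "inj_on (%k. m - k) {k. k<=# m}" by (rule inj_onI) (metis mem_Collect_eq dd)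
 have "convolution R P Q m = (\<Oplus>k\<in>(%k. m - k) ` {k. k<=# m}. P k\<otimes>Q (m - k))" unfolding im convolution_def ..
 also have "... = (\<Oplus>k\<in>{k. k<=# m}. P (m - k)\<otimes>Q (m - (m - k)))"
  using carrier_coeffE[OF P] carrier_coeffE[OF Q] inj by (intro finsum_reindex) auto
 also have "... = convolution R Q P m" unfolding convolution_def using carrier_coeffE[OF P] carrier_coeffE[OF Q]
  by (intro finsum_cong') (auto simp: m_comm dd)
 finally show "convolution R P Q m = convolution R Q P m" .
qed

lemma convolution_const:
 fixes Q :: "'i multiset => 'a" assumes Q: "carrier_coeff Q" and c: "c\<in>\<K>"
 shows "convolution R (indexed_const c) Q = (%m. c\<otimes>Q m)"
proof
 fix m
 have "convolution R (indexed_const c) Q m = (\<Oplus>k\<in>{{#} :: 'i multiset}. c\<otimes>Q m)"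
  unfolding convolution_def indexed_const_def using carrier_coeffE[OF Q] c by (intro add.finprod_mono_neutral_cong_right finite_submultisets) auto
 also have "... = c\<otimes>Q m" using carrier_coeffE[OF Q] c by simp
 finally show "convolution R (indexed_const c) Q m = c\<otimes>Q m" .
qed

lemma convolution_padd:
 assumes "carrier_coeff P" "carrier_coeff P'" "carrier_coeff Q"
 shows "convolution R (indexed_padd P P') Q = indexed_padd (convolution R P Q) (convolution R P' Q)"
proof
 fix m
 note c = assms[THEN carrier_coeffE]
 have "convolution R (indexed_padd P P') Q m = (\<Oplus>k\<in>{k. k<=# m}. P k\<otimes>Q (m - k)\<oplus>P' k\<otimes>Q (m - k))"
  unfolding convolution_def indexed_padd_def using c by (intro finsum_cong') (auto simp: l_distr)
 then show "convolution R (indexed_padd P P') Q m = indexed_padd (convolution R P Q) (convolution R P' Q) m"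
  unfolding convolution_def indexed_padd_def using c by (simp add: finsum_addf)
qed

lemma convolution_pmult:
 assumes "carrier_coeff P" "carrier_coeff Q"
 shows "convolution R (indexed_pmult P i) Q = indexed_pmult (convolution R P Q) i"
proof
 fix m
 note c = assms[THEN carrier_coeffE]
 let ?g = "%k. (if i\<in># k then P (k - {#i#}) else \<zero>)\<otimes>Q (m - k)"
 show "convolution R (indexed_pmult P i) Q m = indexed_pmult (convolution R P Q) i m"
 proof (cases "i\<in># m")
  case True
  have "convolution R (indexed_pmult P i) Q m = (\<Oplus>k\<in>add_mset i ` {k. k<=# m - {#i#}}. ?g k)"
   unfolding convolution_def indexed_pmult_def
  proof (intro add.finprod_mono_neutral_cong_right finite_submultisets)
   show "add_mset i ` {k. k<=# m - {#i#}}<={k. k<=# m}" using True by (auto simp: insert_subset_eq_iff)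
   fix k assume k: "k\<in>{k. k<=# m} - add_mset i ` {k. k<=# m - {#i#}}"
   have "i~:# k"
   proof
    assume "i\<in># k"
    then obtain k' where "k = add_mset i k'" by (rule mset_add)
    then show False using k True by (auto simp: insert_subset_eq_iff)
   qed
   then show "?g k = \<zero>" using c by simp
  qed (use c in auto)
  also have "... = (\<Oplus>k\<in>{k. k<=# m - {#i#}}. ?g (add_mset i k))" using c by (intro finsum_reindex) (auto intro: inj_onI)
  also have "... = convolution R P Q (m - {#i#})" unfolding convolution_def using c by (intro finsum_cong') auto
  finally show ?thesis unfolding indexed_pmult_def using True by simp
 next
  case False
  have "convolution R (indexed_pmult P i) Q m = (\<Oplus>k\<in>{k. k<=# m}. \<zero>)"
   unfolding convolution_def indexed_pmult_def using False c by (intro finsum_cong') (auto dest: mset_subset_eqD)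
  then show ?thesis unfolding indexed_pmult_def using False by simp
 qed
qed

abbreviation pset :: "'i set => ('i multiset => 'a) set" where "pset V \<equiv> indexed_pset V \<K>"

lemma pset_coeff: "P\<in>pset V ==> carrier_coeff P" by (rule indexed_pset_in_carrier[OF subset_refl])

lemma pset_scale:
 fixes V :: "'i set" assumes c: "c\<in>\<K>" and "P\<in>pset V" shows "(%m. c\<otimes>P m)\<in>pset V" using assms(2)
proof (induction rule: indexed_pset.induct)
 case (indexed_const k)
 have "(%m :: 'i multiset. c\<otimes>indexed_const k m) = indexed_const (c\<otimes>k)" using c unfolding indexed_const_def by auto
 then show ?case using c indexed_const by (simp add: indexed_pset.indexed_const)
next
 case (indexed_padd P Q)
 have "(%m. c\<otimes>indexed_padd P Q m) = indexed_padd (%m. c\<otimes>P m) (%m. c\<otimes>Q m)"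
  using c pset_coeff[OF indexed_padd(1)] pset_coeff[OF indexed_padd(2)] unfolding indexed_padd_def carrier_coeff_def by (auto simp: r_distr)
 then show ?case using indexed_padd by (simp add: indexed_pset.indexed_padd)
next
 case (indexed_pmult P i)
 have "(%m. c\<otimes>indexed_pmult P i m) = indexed_pmult (%m. c\<otimes>P m) i" using c unfolding indexed_pmult_def by auto
 then show ?case using indexed_pmult by (simp add: indexed_pset.indexed_pmult)
qed

lemma pset_convolution:
 assumes "P\<in>pset V" and Q: "Q\<in>pset V" shows "convolution R P Q\<in>pset V" using assms(1)
proof (induction rule: indexed_pset.induct)
 case (indexed_const k)
 then show ?case using convolution_const[OF pset_coeff[OF Q]] pset_scale[OF _ Q] by simp
next
 case (indexed_padd P P')
 then show ?case unfolding convolution_padd[OF pset_coeff[OF indexed_padd(1)] pset_coeff[OF indexed_padd(2)] pset_coeff[OF Q]]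
  by (intro indexed_pset.indexed_padd)
next
 case (indexed_pmult P i)
 then show ?case unfolding convolution_pmult[OF pset_coeff[OF indexed_pmult(1)] pset_coeff[OF Q]] by (intro indexed_pset.indexed_pmult)
qed

text \<open>Induction on the construction of the first factor. Constants, sums and multiplication by
  a variable pass through the convolution, which spares the reindexing of double sums.\<close>

lemma convolution_assoc:
 assumes "P\<in>pset V" and Q: "Q\<in>pset V" and T: "T\<in>pset V"
 shows "convolution R (convolution R P Q) T = convolution R P (convolution R Q T)" using assms(1)
proof (induction rule: indexed_pset.induct)
 case (indexed_const c)
 note q = pset_coeff[OF Q] and t = pset_coeff[OF T]
 have "convolution R (%m. c\<otimes>Q m) T m = c\<otimes>convolution R Q T m" for m
 proof -
  have "c\<otimes>(\<Oplus>k\<in>{k. k<=# m}. Q k\<otimes>T (m - k)) = (\<Oplus>k\<in>{k. k<=# m}. c\<otimes>(Q k\<otimes>T (m - k)))"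
   by (rule finsum_rdistr[OF finite_submultisets indexed_const]) (use carrier_coeffE[OF q] carrier_coeffE[OF t] in auto)
  also have "... = (\<Oplus>k\<in>{k. k<=# m}. (c\<otimes>Q k)\<otimes>T (m - k))"
   by (intro finsum_cong') (use indexed_const carrier_coeffE[OF q] carrier_coeffE[OF t] in \<open>auto simp: m_assoc\<close>)
  finally show ?thesis unfolding convolution_def by simp
 qed
 then show ?case unfolding convolution_const[OF q indexed_const] convolution_const[OF convolution_closed[OF q t] indexed_const] by (rule ext)
next
 case (indexed_padd P P')
 note p = pset_coeff[OF indexed_padd(1)] pset_coeff[OF indexed_padd(2)] pset_coeff[OF Q] pset_coeff[OF T]
 show ?case using indexed_padd(3,4) p by (simp add: convolution_padd convolution_closed)
next
 case (indexed_pmult P i)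
 note p = pset_coeff[OF indexed_pmult(1)] pset_coeff[OF Q] pset_coeff[OF T]
 show ?case using indexed_pmult(3) p by (simp add: convolution_pmult convolution_closed)
qed

lemma pset_finite_support: "P\<in>pset V ==> finite {m. P m~=\<zero>}"
proof (induction rule: indexed_pset.induct)
 case (indexed_const k)
 have "{m. indexed_const k m~=\<zero>}<={{#}}" unfolding indexed_const_def by auto
 then show ?case by (rule finite_subset) simp
next
 case (indexed_padd P Q)
 have "{m. indexed_padd P Q m~=\<zero>}<={m. P m~=\<zero>}\<union>{m. Q m~=\<zero>}" unfolding indexed_padd_def by auto
 then show ?case by (rule finite_subset) (simp add: indexed_padd)
next
 case (indexed_pmult P i)
 have "{m. indexed_pmult P i m~=\<zero>}<=add_mset i ` {m. P m~=\<zero>}"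
  unfolding indexed_pmult_def by (auto simp: image_iff split: if_splits) (metis insert_DiffM)
 then show ?case by (rule finite_subset) (simp add: indexed_pmult)
qed

lemma mpoly_ring_sel:
 "carrier (mpoly_ring R n) = pset {..<n}"
 "mult (mpoly_ring R n) = convolution R"
 "one (mpoly_ring R n) = indexed_const \<one>"
 "ring.zero (mpoly_ring R n) = indexed_const \<zero>"
 "add (mpoly_ring R n) = indexed_padd" unfolding mpoly_ring_def convolution_def by (simp_all add: fun_eq_iff)

lemma mpoly_ring_cring: "cring (mpoly_ring R n)"
proof (intro cringI abelian_groupI comm_monoidI; unfold mpoly_ring_sel)
 fix P assume P: "P\<in>pset {..<n}"
 note p = pset_coeff[OF P]
 show "indexed_padd (indexed_const \<zero>) P = P" by (rule indexed_padd_zero[OF p])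
 show "convolution R (indexed_const \<one>) P = P"  unfolding convolution_const[OF p one_closed] using carrier_coeffE[OF p] by simp
 have "indexed_padd (%m. \<ominus>\<one>\<otimes>P m) P = indexed_const \<zero>"
  using carrier_coeffE[OF p] unfolding indexed_padd_def indexed_zero_def by (simp add: l_minus l_neg)
 then show "\<exists>y\<in>pset {..<n}. indexed_padd y P = indexed_const \<zero>" using pset_scale[OF _ P, of "\<ominus>\<one>"] by blast
 fix Q assume Q: "Q\<in>pset {..<n}"
 note q = pset_coeff[OF Q]
 show "indexed_padd P Q\<in>pset {..<n}" by (rule indexed_pset.indexed_padd[OF P Q])
 show "indexed_padd P Q = indexed_padd Q P" using carrier_coeffE[OF p] carrier_coeffE[OF q] unfolding indexed_padd_def by (simp add: a_comm)
 show "convolution R P Q\<in>pset {..<n}" by (rule pset_convolution[OF P Q])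
 show "convolution R P Q = convolution R Q P" by (rule convolution_commute[OF p q])
 fix T assume T: "T\<in>pset {..<n}"
 note t = pset_coeff[OF T]
 show "indexed_padd (indexed_padd P Q) T = indexed_padd P (indexed_padd Q T)"
  using carrier_coeffE[OF p] carrier_coeffE[OF q] carrier_coeffE[OF t] unfolding indexed_padd_def by (simp add: a_assoc)
 show "convolution R (convolution R P Q) T = convolution R P (convolution R Q T)" by (rule convolution_assoc[OF P Q T])
 show "convolution R (indexed_padd P Q) T = indexed_padd (convolution R P T) (convolution R Q T)" by (rule convolution_padd[OF p q t])
qed (simp_all add: indexed_pset.indexed_const)

lemma indexed_const_hom: "ring_hom_cring R (mpoly_ring R n) indexed_const"
proof (intro ring_hom_cring.intro ring_hom_cring_axioms.intro ring_hom_memI is_cring mpoly_ring_cring; unfold mpoly_ring_sel)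
 fix a d assume a: "a\<in>\<K>" and d: "d\<in>\<K>"
 show "indexed_const a\<in>pset {..<n}" by (rule indexed_pset.indexed_const[OF a])
 have "carrier_coeff (indexed_const d :: nat multiset => 'a)" using pset_coeff[OF indexed_pset.indexed_const[OF d]] .
 from convolution_const[OF this a] show "(indexed_const (a\<otimes>d) :: nat multiset => 'a) = convolution R (indexed_const a) (indexed_const d)"
  using a unfolding indexed_const_def by auto
 show "indexed_const (a\<oplus>d) = indexed_padd (indexed_const a) (indexed_const d)" by (simp add: indexed_padd_const)
qed simp

end

text \<open>Leading terms: the order on multisets is linear and compatible with addition, so at the
  sum of the two leading monomials the product has exactly the product of the leading
  coefficients.\<close>

lemma (in domain) mpoly_ring_domain: "domain (mpoly_ring R n)"
proof (intro domain.intro domain_axioms.intro mpoly_ring_cring; unfold mpoly_ring_sel)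
 show "indexed_const \<one>~=indexed_const \<zero>" unfolding indexed_const_def fun_eq_iff using one_not_zero by (auto intro!: exI[of _ "{#}"])
 fix P Q :: "nat multiset => 'a"
 assume PQ: "convolution R P Q = indexed_const \<zero>" and P: "P\<in>pset {..<n}" and Q: "Q\<in>pset {..<n}"
 note p = carrier_coeffE[OF pset_coeff[OF P]] and q = carrier_coeffE[OF pset_coeff[OF Q]]
 show "P = indexed_const \<zero> \<or> Q = indexed_const \<zero>"
 proof (rule ccontr)
  assume "\<not> ?thesis"
  then have ne: "{m. P m~=\<zero>}~={}" "{m. Q m~=\<zero>}~={}" unfolding indexed_zero_def fun_eq_iff by auto
  define s where "s = Max {m. P m~=\<zero>}"
  define t where "t = Max {m. Q m~=\<zero>}"
  have s: "P s~=\<zero>" "!!m. P m~=\<zero> ==> m<=s"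
   using Max_in[OF pset_finite_support[OF P] ne(1)] Max_ge[OF pset_finite_support[OF P]] unfolding s_def by auto
  have t: "Q t~=\<zero>" "!!m. Q m~=\<zero> ==> m<=t"
   using Max_in[OF pset_finite_support[OF Q] ne(2)] Max_ge[OF pset_finite_support[OF Q]] unfolding t_def by auto
  have "convolution R P Q (s + t) = (\<Oplus>k\<in>{s}. P k\<otimes>Q (s + t - k))" unfolding convolution_def
  proof (intro add.finprod_mono_neutral_cong_right finite_submultisets)
   fix k assume k: "k\<in>{k. k<=# s + t} - {s}"
   show "P k\<otimes>Q (s + t - k) = \<zero>"
   proof (rule ccontr)
    assume "P k\<otimes>Q (s + t - k)~=\<zero>"
    then have "P k~=\<zero>" "Q (s + t - k)~=\<zero>" using p[of k] q[of "s + t - k"] by auto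
    then have "k < s" "s + t - k<=t" using k s(2) t(2) by (auto simp: order_less_le)
    then have "k + (s + t - k) < s + t" by (rule add_less_le_mono)
    then show False using k by simp
   qed
  qed (use p q in auto)
  also have "... = P s\<otimes>Q t" using p q by simp
  finally have "P s\<otimes>Q t = \<zero>" unfolding PQ indexed_zero_def by simp
  then show False using integral[OF _ p q] s(1) t(1) by blast
 qed
qed

section \<open>Fields of fractions\<close>

context domain
begin

lemma fraction_eq_iff:
 assumes "a\<in>\<K>" "s\<in>\<K> - {\<zero>}" "a'\<in>\<K>" "s'\<in>\<K> - {\<zero>}"
 shows "fraction R a s = fraction R a' s' <-> a\<otimes>s' = a'\<otimes>s"
proof
 assume "fraction R a s = fraction R a' s'"
 moreover have "(a, s)\<in>fraction R a s" using assms unfolding fraction_def by simp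
 ultimately have "(a, s)\<in>fraction R a' s'" by simp
 then show "a\<otimes>s' = a'\<otimes>s" unfolding fraction_def by simp
next
 have trans: "c\<otimes>t = d\<otimes>r" if "c\<otimes>r' = c'\<otimes>r" "c'\<otimes>t = d\<otimes>r'"
  "c\<in>\<K>" "c'\<in>\<K>" "d\<in>\<K>" "r\<in>\<K>" "t\<in>\<K>" "r'\<in>\<K> - {\<zero>}" for c c' d r r' t
 proof -
  have "r'\<otimes>(c\<otimes>t) = (c\<otimes>r')\<otimes>t" "r'\<otimes>(d\<otimes>r) = (d\<otimes>r')\<otimes>r" "(c'\<otimes>r)\<otimes>t = (c'\<otimes>t)\<otimes>r"
   using that(3-8) by (simp_all add: m_ac)
  then have "r'\<otimes>(c\<otimes>t) = r'\<otimes>(d\<otimes>r)" using that(1,2) by simp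
  then show ?thesis using that(3-8) by (simp add: m_lcancel)
 qed
 assume eq: "a\<otimes>s' = a'\<otimes>s"
 show "fraction R a s = fraction R a' s'"
 proof -
  have "(d, t)\<in>fraction R a s <-> (d, t)\<in>fraction R a' s'" for d t
   unfolding fraction_def using trans[OF eq[symmetric], of t d] trans[OF eq, of t d] assms by auto
  then show ?thesis by auto
 qed
qed

abbreviation (input) "FF \<equiv> fraction_field R"

lemma fraction_self: "a\<in>\<K> ==> s\<in>\<K> - {\<zero>} ==> (a, s)\<in>fraction R a s" unfolding fraction_def by simp

text \<open>The operations on fractions are unions over all representatives. Such a union collapses
  to a single value as soon as the value does not depend on the representative.\<close>

lemma fraction_UN:
 assumes "a\<in>\<K>" "s\<in>\<K> - {\<zero>}"
  and "!!a' s'. a'\<in>\<K> ==> s'\<in>\<K> - {\<zero>} ==> a\<otimes>s' = a'\<otimes>s ==> f a' s' = f a s"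
 shows "(\<Union>(a', s')\<in>fraction R a s. f a' s') = f a s"
proof -
 have "f a' s' = f a s" if "(a', s')\<in>fraction R a s" for a' s' using that assms(3) unfolding fraction_def by auto
 then have "(\<Union>(a', s')\<in>fraction R a s. f a' s') = (\<Union>(a', s')\<in>fraction R a s. f a s)" by (intro SUP_cong) auto
 also have "... = f a s" using fraction_self[OF assms(1,2)] by auto
 finally show ?thesis .
qed

lemma nonzero_mult: "s\<in>\<K> - {\<zero>} ==> s'\<in>\<K> - {\<zero>} ==> s\<otimes>s'\<in>\<K> - {\<zero>}" using integral by auto

lemma fraction_mult:
 assumes a: "a\<in>\<K>" "s\<in>\<K> - {\<zero>}" and d: "d\<in>\<K>" "t\<in>\<K> - {\<zero>}"
 shows "fraction R a s\<otimes>\<^bsub>FF\<^esub>fraction R d t = fraction R (a\<otimes>d) (s\<otimes>t)"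
proof -
 have "fraction R a s\<otimes>\<^bsub>FF\<^esub>fraction R d t =
   (\<Union>(a, s)\<in>fraction R a s. \<Union>(d, t)\<in>fraction R d t. fraction R (a\<otimes>d) (s\<otimes>t))"
  unfolding fraction_field_def by simp
 also have "... = (\<Union>(d, t)\<in>fraction R d t. fraction R (a\<otimes>d) (s\<otimes>t))"
 proof (intro fraction_UN[OF a] SUP_cong refl)
  fix a' s' x assume h: "a'\<in>\<K>" "s'\<in>\<K> - {\<zero>}" "a\<otimes>s' = a'\<otimes>s" and "x\<in>fraction R d t"
  then obtain d' t' where x: "x = (d', t')" "d'\<in>\<K>" "t'\<in>\<K> - {\<zero>}" unfolding fraction_def by auto
  have "(a'\<otimes>d')\<otimes>(s\<otimes>t') = (a'\<otimes>s)\<otimes>(d'\<otimes>t')" "(a\<otimes>s')\<otimes>(d'\<otimes>t') = (a\<otimes>d')\<otimes>(s'\<otimes>t')"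
   using h(1,2) a x by (simp_all add: m_ac)
  then have "(a'\<otimes>d')\<otimes>(s\<otimes>t') = (a\<otimes>d')\<otimes>(s'\<otimes>t')" using h(3) by simp
  then have "fraction R (a'\<otimes>d') (s'\<otimes>t') = fraction R (a\<otimes>d') (s\<otimes>t')"
   using h(1,2) a x by (subst fraction_eq_iff) (auto simp: integral_iff)
  then show "(case x of (d, t) => fraction R (a'\<otimes>d) (s'\<otimes>t)) = (case x of (d, t) => fraction R (a\<otimes>d) (s\<otimes>t))"
   using x by simp
 qed
 also have "... = fraction R (a\<otimes>d) (s\<otimes>t)"
 proof (intro fraction_UN[OF d])
  fix d' t' assume h: "d'\<in>\<K>" "t'\<in>\<K> - {\<zero>}" "d\<otimes>t' = d'\<otimes>t"
  have "(a\<otimes>d')\<otimes>(s\<otimes>t) = (a\<otimes>s)\<otimes>(d'\<otimes>t)" "(a\<otimes>s)\<otimes>(d\<otimes>t') = (a\<otimes>d)\<otimes>(s\<otimes>t')"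
   using h(1,2) a d by (simp_all add: m_ac)
  then have "(a\<otimes>d')\<otimes>(s\<otimes>t) = (a\<otimes>d)\<otimes>(s\<otimes>t')" using h(3) by simp
  then show "fraction R (a\<otimes>d') (s\<otimes>t') = fraction R (a\<otimes>d) (s\<otimes>t)"
   using h(1,2) a d by (subst fraction_eq_iff) (auto simp: integral_iff)
 qed
 finally show ?thesis .
qed

lemma fraction_add:
 assumes a: "a\<in>\<K>" "s\<in>\<K> - {\<zero>}" and d: "d\<in>\<K>" "t\<in>\<K> - {\<zero>}"
 shows "fraction R a s\<oplus>\<^bsub>FF\<^esub>fraction R d t = fraction R (a\<otimes>t\<oplus>d\<otimes>s) (s\<otimes>t)"
proof -
 have "fraction R a s\<oplus>\<^bsub>FF\<^esub>fraction R d t =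
   (\<Union>(a, s)\<in>fraction R a s. \<Union>(d, t)\<in>fraction R d t. fraction R (a\<otimes>t\<oplus>d\<otimes>s) (s\<otimes>t))"
  unfolding fraction_field_def by simp
 also have "... = (\<Union>(d, t)\<in>fraction R d t. fraction R (a\<otimes>t\<oplus>d\<otimes>s) (s\<otimes>t))"
 proof (intro fraction_UN[OF a] SUP_cong refl)
  fix a' s' x assume h: "a'\<in>\<K>" "s'\<in>\<K> - {\<zero>}" "a\<otimes>s' = a'\<otimes>s" and "x\<in>fraction R d t"
  then obtain d' t' where x: "x = (d', t')" "d'\<in>\<K>" "t'\<in>\<K> - {\<zero>}" unfolding fraction_def by auto
  have s: "s\<in>\<K>" "t'\<in>\<K>" "s'\<in>\<K>" using a x h by auto
  have "(a'\<otimes>t'\<oplus>d'\<otimes>s')\<otimes>(s\<otimes>t') = (a'\<otimes>s)\<otimes>(t'\<otimes>t')\<oplus>d'\<otimes>s'\<otimes>s\<otimes>t'"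
   "(a\<otimes>t'\<oplus>d'\<otimes>s)\<otimes>(s'\<otimes>t') = (a\<otimes>s')\<otimes>(t'\<otimes>t')\<oplus>d'\<otimes>s'\<otimes>s\<otimes>t'"
   using h(1) a(1) x(2) s by algebra+
  then have "(a'\<otimes>t'\<oplus>d'\<otimes>s')\<otimes>(s\<otimes>t') = (a\<otimes>t'\<oplus>d'\<otimes>s)\<otimes>(s'\<otimes>t')" using h(3) by simp
  then have "fraction R (a'\<otimes>t'\<oplus>d'\<otimes>s') (s'\<otimes>t') = fraction R (a\<otimes>t'\<oplus>d'\<otimes>s) (s\<otimes>t')"
   using h(1,2) a x s by (subst fraction_eq_iff) (auto simp: integral_iff)
  then show "(case x of (d, t) => fraction R (a'\<otimes>t\<oplus>d\<otimes>s') (s'\<otimes>t)) = (case x of (d, t) => fraction R (a\<otimes>t\<oplus>d\<otimes>s) (s\<otimes>t))"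
   using x by simp
 qed
 also have "... = fraction R (a\<otimes>t\<oplus>d\<otimes>s) (s\<otimes>t)"
 proof (intro fraction_UN[OF d])
  fix d' t' assume h: "d'\<in>\<K>" "t'\<in>\<K> - {\<zero>}" "d\<otimes>t' = d'\<otimes>t"
  have s: "s\<in>\<K>" "t'\<in>\<K>" "t\<in>\<K>" using a d h by auto
  have "(a\<otimes>t'\<oplus>d'\<otimes>s)\<otimes>(s\<otimes>t) = (d'\<otimes>t)\<otimes>(s\<otimes>s)\<oplus>a\<otimes>t'\<otimes>s\<otimes>t"
   "(a\<otimes>t\<oplus>d\<otimes>s)\<otimes>(s\<otimes>t') = (d\<otimes>t')\<otimes>(s\<otimes>s)\<oplus>a\<otimes>t'\<otimes>s\<otimes>t"
   using h(1) a(1) d(1) s by algebra+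
  then have "(a\<otimes>t'\<oplus>d'\<otimes>s)\<otimes>(s\<otimes>t) = (a\<otimes>t\<oplus>d\<otimes>s)\<otimes>(s\<otimes>t')" using h(3) by simp
  then show "fraction R (a\<otimes>t'\<oplus>d'\<otimes>s) (s\<otimes>t') = fraction R (a\<otimes>t\<oplus>d\<otimes>s) (s\<otimes>t)"
   using h(1,2) a d s by (subst fraction_eq_iff) (auto simp: integral_iff)
 qed
 finally show ?thesis .
qed

lemma fraction_field_sel:
 "carrier FF = {fraction R a s | a s. a\<in>\<K> & s\<in>\<K> - {\<zero>}}"
 "one FF = fraction R \<one> \<one>" "ring.zero FF = fraction R \<zero> \<one>" unfolding fraction_field_def by simp_all

lemma fraction_field_cring: "cring FF"
proof (intro cringI abelian_groupI comm_monoidI)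
 have one: "\<one>\<in>\<K> - {\<zero>}" using one_not_zero by simp
 show "\<one>\<^bsub>FF\<^esub>\<in>carrier FF" "\<zero>\<^bsub>FF\<^esub>\<in>carrier FF" unfolding fraction_field_sel using one by blast+
 fix x assume "x\<in>carrier FF"
 then obtain a s where x: "x = fraction R a s" "a\<in>\<K>" "s\<in>\<K> - {\<zero>}" unfolding fraction_field_sel by blast
 then have s: "s\<in>\<K>" by simp
 show "\<zero>\<^bsub>FF\<^esub>\<oplus>\<^bsub>FF\<^esub>x = x" "\<one>\<^bsub>FF\<^esub>\<otimes>\<^bsub>FF\<^esub>x = x"
  unfolding x(1) fraction_field_sel using x one by (simp_all add: fraction_add fraction_mult)
 have "fraction R (\<ominus>a) s\<oplus>\<^bsub>FF\<^esub>x = \<zero>\<^bsub>FF\<^esub>"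
  unfolding x(1) fraction_field_sel using x one nonzero_mult[OF x(3) x(3)] by (subst fraction_add) (auto simp: fraction_eq_iff l_minus l_neg)
 then show "\<exists>y\<in>carrier FF. y\<oplus>\<^bsub>FF\<^esub>x = \<zero>\<^bsub>FF\<^esub>"
  using x(2,3) a_inv_closed unfolding fraction_field_sel by blast
 fix y assume "y\<in>carrier FF"
 then obtain d t where y: "y = fraction R d t" "d\<in>\<K>" "t\<in>\<K> - {\<zero>}" unfolding fraction_field_sel by blast
 then have t: "t\<in>\<K>" by simp
 note st = nonzero_mult[OF x(3) y(3)]
 have "a\<otimes>t\<oplus>d\<otimes>s\<in>\<K>" "a\<otimes>d\<in>\<K>" using x y by simp_all
 then show "x\<oplus>\<^bsub>FF\<^esub>y\<in>carrier FF" "x\<otimes>\<^bsub>FF\<^esub>y\<in>carrier FF"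
  unfolding x(1) y(1) fraction_add[OF x(2,3) y(2,3)] fraction_mult[OF x(2,3) y(2,3)] fraction_field_sel using st by blast+
 show "x\<oplus>\<^bsub>FF\<^esub>y = y\<oplus>\<^bsub>FF\<^esub>x" "x\<otimes>\<^bsub>FF\<^esub>y = y\<otimes>\<^bsub>FF\<^esub>x"
  unfolding x(1) y(1) fraction_add[OF x(2,3) y(2,3)] fraction_add[OF y(2,3) x(2,3)]
   fraction_mult[OF x(2,3) y(2,3)] fraction_mult[OF y(2,3) x(2,3)] using x y s t by (simp_all add: a_comm m_comm)
 fix z assume "z\<in>carrier FF"
 then obtain e r where z: "z = fraction R e r" "e\<in>\<K>" "r\<in>\<K> - {\<zero>}" unfolding fraction_field_sel by blast
 then have r: "r\<in>\<K>" by simp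
 note nz = st nonzero_mult[OF x(3) z(3)] nonzero_mult[OF y(3) z(3)] nonzero_mult[OF nonzero_mult[OF x(3) z(3)] nonzero_mult[OF y(3) z(3)]]
  nonzero_mult[OF st z(3)]
 note c = x(2) y(2) z(2) s t r
 have e1: "(a\<otimes>t\<oplus>d\<otimes>s)\<otimes>r\<oplus>e\<otimes>(s\<otimes>t) = a\<otimes>(t\<otimes>r)\<oplus>(d\<otimes>r\<oplus>e\<otimes>t)\<otimes>s"
  using c by algebra
 have e2: "(a\<otimes>t\<oplus>d\<otimes>s)\<otimes>e\<otimes>(s\<otimes>r\<otimes>(t\<otimes>r)) = (a\<otimes>e\<otimes>(t\<otimes>r)\<oplus>d\<otimes>e\<otimes>(s\<otimes>r))\<otimes>(s\<otimes>t\<otimes>r)"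
  using c by algebra
 have "fraction R ((a\<otimes>t\<oplus>d\<otimes>s)\<otimes>e) (s\<otimes>t\<otimes>r) = fraction R (a\<otimes>e\<otimes>(t\<otimes>r)\<oplus>d\<otimes>e\<otimes>(s\<otimes>r)) (s\<otimes>r\<otimes>(t\<otimes>r))"
  using e2 c nz by (subst fraction_eq_iff) auto
 then show "(x\<oplus>\<^bsub>FF\<^esub>y)\<otimes>\<^bsub>FF\<^esub>z = x\<otimes>\<^bsub>FF\<^esub>z\<oplus>\<^bsub>FF\<^esub>y\<otimes>\<^bsub>FF\<^esub>z"
  unfolding x(1) y(1) z(1) using x(2,3) y(2,3) z(2,3) nz c by (simp add: fraction_add fraction_mult)
 show "(x\<oplus>\<^bsub>FF\<^esub>y)\<oplus>\<^bsub>FF\<^esub>z = x\<oplus>\<^bsub>FF\<^esub> (y\<oplus>\<^bsub>FF\<^esub>z)"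
  unfolding x(1) y(1) z(1) using x(2,3) y(2,3) z(2,3) nz c e1 by (simp add: fraction_add m_assoc)
 show "(x\<otimes>\<^bsub>FF\<^esub>y)\<otimes>\<^bsub>FF\<^esub>z = x\<otimes>\<^bsub>FF\<^esub> (y\<otimes>\<^bsub>FF\<^esub>z)"
  unfolding x(1) y(1) z(1) using x(2,3) y(2,3) z(2,3) nz c by (simp add: fraction_mult m_assoc)
qed

lemma fraction_field_field: "field FF"
proof (rule cring.cring_fieldI2[OF fraction_field_cring])
 have one: "\<one>\<in>\<K> - {\<zero>}" using one_not_zero by simp
 show "\<zero>\<^bsub>FF\<^esub>~=\<one>\<^bsub>FF\<^esub>" unfolding fraction_field_sel using one by (subst fraction_eq_iff) auto
 fix x assume "x\<in>carrier FF" and nz: "x~=\<zero>\<^bsub>FF\<^esub>"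
 then obtain a s where x: "x = fraction R a s" "a\<in>\<K>" "s\<in>\<K> - {\<zero>}" unfolding fraction_field_sel by blast
 have "a~=\<zero>" using nz x one unfolding fraction_field_sel x(1) by (subst (asm) fraction_eq_iff) auto
 then have a: "a\<in>\<K> - {\<zero>}" using x by simp
 have "x\<otimes>\<^bsub>FF\<^esub>fraction R s a = \<one>\<^bsub>FF\<^esub>" unfolding x(1) fraction_field_sel using x a one nonzero_mult[OF x(3) a]
  by (subst fraction_mult) (auto simp: fraction_eq_iff m_comm)
 then show "\<exists>b\<in>carrier FF. x\<otimes>\<^bsub>FF\<^esub>b = \<one>\<^bsub>FF\<^esub>" using x(2,3) a unfolding fraction_field_sel by blast
qed

lemma fraction_hom: "ring_hom_cring R FF (%a. fraction R a \<one>)"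
proof (intro ring_hom_cring.intro ring_hom_cring_axioms.intro ring_hom_memI is_cring fraction_field_cring)
 have one: "\<one>\<in>\<K> - {\<zero>}" using one_not_zero by simp
 fix a assume a: "a\<in>\<K>"
 show "fraction R a \<one>\<in>carrier FF" unfolding fraction_field_sel using a one by blast
 fix d assume d: "d\<in>\<K>"
 show "fraction R (a\<otimes>d) \<one> = fraction R a \<one>\<otimes>\<^bsub>FF\<^esub>fraction R d \<one>"
  "fraction R (a\<oplus>d) \<one> = fraction R a \<one>\<oplus>\<^bsub>FF\<^esub>fraction R d \<one>"
  using a d one by (simp_all add: fraction_mult fraction_add)
qed (simp add: fraction_field_sel)

lemma fraction_hom_inj: "inj_on (%a. fraction R a \<one>) \<K>" by (rule inj_onI) (simp add: fraction_eq_iff)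

lemma fraction_hom_denominator:
 assumes "x\<in>carrier FF"
 shows "\<exists>s\<in>\<K> - {\<zero>}. EX a:\<K>. fraction R s \<one>\<otimes>\<^bsub>FF\<^esub>x = fraction R a \<one>"
proof -
 obtain a s where x: "x = fraction R a s" "a\<in>\<K>" "s\<in>\<K> - {\<zero>}" using assms unfolding fraction_field_sel by blast
 have "fraction R s \<one>\<otimes>\<^bsub>FF\<^esub>x = fraction R (s\<otimes>a) (\<one>\<otimes>s)"
  unfolding x(1) using x by (intro fraction_mult) auto
 also have "... = fraction R a \<one>" using x by (subst fraction_eq_iff) (auto simp: m_comm)
 finally show ?thesis using x by blast
qed

end

section \<open>Local rings of a field and blow-ups\<close>

context field
begin

lemma inv_nonzero:
 assumes "s\<in>\<K>" "s~=\<zero>"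
 shows "inv s\<in>\<K>" "s\<otimes>inv s = \<one>" "inv s\<otimes>s = \<one>" "inv s~=\<zero>" "inv (inv s) = s"
proof -
 have s: "s\<in>Units R" using assms field_Units by simp
 then show "inv s\<in>\<K>" "s\<otimes>inv s = \<one>" "inv s\<otimes>s = \<one>" "inv (inv s) = s" by simp_all
 have "inv s\<in>Units R" using s by simp
 then show "inv s~=\<zero>" using field_Units by simp
qed

text \<open>\<open>[D, s^-1] = - s^-1 [D, s] s^-1\<close>. Together with the product rule behind
  \<open>commutator_subring\<close> this reduces commutators with fractions to commutators with
  elements of \<open>A\<close>.\<close>

lemma dop_localization:
 assumes A: "subring A R" and L: "subring L R" "A<=L"
  and fr: "!!x. x\<in>L ==> EX a:A. EX s:A. s~=\<zero> & inv s\<in>L & x = a\<otimes>inv s"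
 shows "dop R A q D ==> dop R L q D"
proof (induction q arbitrary: D)
 interpret A: cring_with_subring R A by (intro cring_with_subring.intro cring_with_subring_axioms.intro is_cring A)
 interpret L: cring_with_subring R L by (intro cring_with_subring.intro cring_with_subring_axioms.intro is_cring L(1))
 case (Suc q)
 have D: "D\<in>\<K> \<rightarrow> \<K>" "!!x y. x\<in>\<K> ==> y\<in>\<K> ==> D (x\<oplus>y) = D x\<oplus>D y"
  using Suc.prems by auto
 note sub = L.commutator_subring[OF D, of q]
 have AL: "a\<in>L & dop R L q (commutator R a D)" if "a\<in>A" for a using Suc that L(2) by auto
 have "dop R L q (commutator R x D)" if x: "x\<in>L" for x
 proof -
  obtain a s where as: "a\<in>A" "s\<in>A" "s~=\<zero>" "inv s\<in>L" "x = a\<otimes>inv s" using fr[OF x] by blast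
  note i = inv_nonzero[OF A.Ac[OF as(2)] as(3)]
  have "dop R L q (commutator R (inv s) D)"
  proof (rule L.dop_cong)
   show "dop R L q (%x. \<ominus>(inv s\<otimes>commutator R s D (inv s\<otimes>x)))"
    by (rule L.dop_uminus, rule L.dop_lmult[OF as(4)], rule L.dop_rmult[OF as(4)]) (use AL as(2) in blast)
   fix x assume x: "x\<in>\<K>"
   have c: "s\<in>\<K>" "inv s\<in>\<K>" "D x\<in>\<K>" "D (inv s\<otimes>x)\<in>\<K>" using as i x D(1) by auto
   have "s\<otimes>(inv s\<otimes>x) = x" using i(2) c(1,2) x by (simp add: m_assoc[symmetric])
   then have "commutator R s D (inv s\<otimes>x) = D x\<ominus>s\<otimes>D (inv s\<otimes>x)" unfolding commutator_def by simp
   moreover have "\<ominus>(inv s\<otimes>(D x\<ominus>s\<otimes>D (inv s\<otimes>x))) = (s\<otimes>inv s)\<otimes>D (inv s\<otimes>x)\<ominus>inv s\<otimes>D x"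
    using c by algebra
   ultimately show "\<ominus>(inv s\<otimes>commutator R s D (inv s\<otimes>x)) = commutator R (inv s) D x"
    unfolding commutator_def using i(2) c by simp
  qed
  then show ?thesis using subringE(6)[OF sub, of a "inv s"] AL[OF as(1)] as(4,5) by simp
 qed
 then show ?case using Suc.prems L(2) by auto
qed simp

text \<open>The operator is \<open>f^(q-1-N) D f^N\<close>. For \<open>N = 0\<close> it is tested on
  the generators of the chart: \<open>[f^(q-1) D, c/f] = f^(q-2) ([D, c] - [D, f] (c/f))\<close> has
  smaller order by the induction on \<open>q\<close>. Then \<open>N\<close> is raised by
  \<open>f^(q-2-N) D f^(N+1) = f^(q-1-N) D f^N + f^(q-2-N) [D, f] f^N\<close>.\<close>

lemma dop_chart:
 fixes N :: nat assumes p: "subring p R" and C: "C<=p" and f: "f\<in>p" "f~=\<zero>"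
  and A: "A = generate_ring R (p\<union>{c\<otimes>inv f | c. c\<in>C})"
 shows "dop R p q D ==> dop R A q (%x. f [^] q\<otimes>inv f [^] N\<otimes>inv f\<otimes>D (f [^] N\<otimes>x))"
proof (induction q arbitrary: D N)
 interpret p: cring_with_subring R p by (intro cring_with_subring.intro cring_with_subring_axioms.intro is_cring p)
 have fc: "f\<in>\<K>" using f by simp
 note i = inv_nonzero[OF fc f(2)]
 have Gc: "p\<union>{c\<otimes>inv f | c. c\<in>C}<=\<K>" using C p.Asub i(1) by auto
 have As: "subring A R" unfolding A by (rule generate_ring_is_subring[OF Gc])
 interpret A: cring_with_subring R A by (intro cring_with_subring.intro cring_with_subring_axioms.intro is_cring As)
 case 0
 have "(%x. f [^] (0::nat)\<otimes>inv f [^] N\<otimes>inv f\<otimes>D (f [^] N\<otimes>x)) x = \<zero>" if "x\<in>\<K>" for x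
  using 0 that fc i(1) by simp
 then show ?case by simp
next
 interpret p: cring_with_subring R p by (intro cring_with_subring.intro cring_with_subring_axioms.intro is_cring p)
 have fc: "f\<in>\<K>" using f by simp
 note i = inv_nonzero[OF fc f(2)]
 have Gc: "p\<union>{c\<otimes>inv f | c. c\<in>C}<=\<K>" using C p.Asub i(1) by auto
 have As: "subring A R" unfolding A by (rule generate_ring_is_subring[OF Gc])
 interpret A: cring_with_subring R A by (intro cring_with_subring.intro cring_with_subring_axioms.intro is_cring As)
 have pA: "p<=A" and CA: "!!c. c\<in>C ==> c\<otimes>inv f\<in>A" unfolding A by (auto intro: generate_ring.incl)
 case (Suc q)
 define F where "F = f [^] q"
 have Fp: "F\<in>p" unfolding F_def by (induction q) (use f subringE(3,6)[OF p] in auto)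
 have Fc: "F\<in>\<K>" using Fp by simp
 note D = p.dop_add[OF Suc.prems]
 have com: "dop R A q (%x. F\<otimes>inv f [^] M\<otimes>inv f\<otimes>commutator R c D (f [^] M\<otimes>x))" if "c\<in>p" for c and M :: nat
  unfolding F_def by (rule Suc.IH) (use Suc.prems that in simp)
 show ?case
 proof (induction N)
  case 0
  have "dop R A (Suc q) (%x. F\<otimes>D x)"
  proof (rule A.dop_generated[OF A Gc])
   show "(%x. F\<otimes>D x)\<in>\<K> \<rightarrow> \<K>" using Fc D(1) by auto
   show "F\<otimes>D (x\<oplus>y) = F\<otimes>D x\<oplus>F\<otimes>D y" if "x\<in>\<K>" "y\<in>\<K>" for x y
    using D that Fc by (simp add: r_distr)
   show "F\<otimes>D \<one>\<in>A" using Suc.prems Fp subringE(6)[OF p] pA by auto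
   fix g assume "g\<in>p\<union>{c\<otimes>inv f |c. c\<in>C}"
   then consider "g\<in>p" | c where "c\<in>C" "g = c\<otimes>inv f" by blast
   then show "dop R A q (commutator R g (%x. F\<otimes>D x))"
   proof cases
    case 1
    show ?thesis
    proof (rule A.dop_cong)
     show "dop R A q (%x. f\<otimes>(F\<otimes>inv f [^] (0::nat)\<otimes>inv f\<otimes>commutator R g D (f [^] (0::nat)\<otimes>x)))"
      by (rule A.dop_lmult[OF _ com[OF 1, of 0]]) (use pA f(1) in auto)
     fix x assume x: "x\<in>\<K>"
     have c: "D (g\<otimes>x)\<in>\<K>" "D x\<in>\<K>" "g\<in>\<K>" "inv f\<in>\<K>" using 1 x D(1) i(1) by auto
     have "f\<otimes>(F\<otimes>inv f\<otimes>(D (g\<otimes>x)\<ominus>g\<otimes>D x)) = (f\<otimes>inv f)\<otimes>(F\<otimes>D (g\<otimes>x)\<ominus>g\<otimes>(F\<otimes>D x))"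
      using c Fc fc by algebra
     then show "f\<otimes>(F\<otimes>inv f [^] (0::nat)\<otimes>inv f\<otimes>commutator R g D (f [^] (0::nat)\<otimes>x)) = commutator R g (%x. F\<otimes>D x) x"
      unfolding commutator_def using c Fc fc i(2) x by simp
    qed
   next
    case (2 c)
    have cp: "c\<in>p" using 2(1) C by auto
    let ?h = "%c x. F\<otimes>inv f [^] (0::nat)\<otimes>inv f\<otimes>commutator R c D (f [^] (0::nat)\<otimes>x)"
    show ?thesis
    proof (rule A.dop_cong)
     show "dop R A q (%x. ?h c x\<oplus>\<ominus>?h f (g\<otimes>x))"
      by (intro A.dop_plus A.dop_uminus A.dop_rmult[where D = "?h f"] com cp f(1)) (use 2 CA in simp)
     fix x assume x: "x\<in>\<K>"
     have gc: "g\<in>\<K>" and cc: "c\<in>\<K>" using 2 cp i(1) by auto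
     have fg: "f\<otimes>(g\<otimes>x) = c\<otimes>x"
     proof -
      have "f\<otimes>((c\<otimes>inv f)\<otimes>x) = (f\<otimes>inv f)\<otimes>(c\<otimes>x)" using cc fc i(1) x by algebra
      then show ?thesis unfolding 2(2) i(2) using cc x by simp
     qed
     define \<xi> Y Z where "\<xi> = D x" and "Y = D (g\<otimes>x)" and "Z = D (c\<otimes>x)"
     have xyz: "\<xi>\<in>\<K>" "Y\<in>\<K>" "Z\<in>\<K>" unfolding \<xi>_def Y_def Z_def using D(1) x gc cc by auto
     have "F\<otimes>inv f\<otimes>(Z\<ominus>c\<otimes>\<xi>)\<oplus>\<ominus>(F\<otimes>inv f\<otimes>(Z\<ominus>f\<otimes>Y)) =
       (f\<otimes>inv f)\<otimes>(F\<otimes>Y)\<ominus>(c\<otimes>inv f)\<otimes>(F\<otimes>\<xi>)" using xyz Fc fc cc i(1) by algebra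
     then show "?h c x\<oplus>\<ominus>?h f (g\<otimes>x) = commutator R g (%x. F\<otimes>D x) x"
      unfolding commutator_def using x gc cc Fc fc i(1,2) fg xyz by (simp flip: \<xi>_def Y_def Z_def 2(2))
    qed
   qed
  qed
  moreover have "F\<otimes>D x = f [^] Suc q\<otimes>inv f [^] (0::nat)\<otimes>inv f\<otimes>D (f [^] (0::nat)\<otimes>x)" if x: "x\<in>\<K>" for x
  proof -
   have "f [^] Suc q\<otimes>inv f = F" unfolding F_def using fc i by (simp add: m_assoc)
   then show ?thesis using x fc i(1) by simp
  qed
  ultimately show ?case by (rule A.dop_cong[rotated])
 next
  case (Suc N)
  let ?h = "%x. F\<otimes>inv f [^] N\<otimes>inv f\<otimes>commutator R f D (f [^] N\<otimes>x)"
  show ?case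
  proof (rule A.dop_cong)
   show "dop R A (Suc q) (%x. f [^] Suc q\<otimes>inv f [^] N\<otimes>inv f\<otimes>D (f [^] N\<otimes>x)\<oplus>?h x)"
    by (rule A.dop_plus[OF Suc.IH A.dop_mono[OF com[OF f(1)]]])
   fix x assume x: "x\<in>\<K>"
   define G \<xi> Y where "G = inv f [^] N" and "\<xi> = D (f [^] N\<otimes>x)" and "Y = D (f\<otimes>(f [^] N\<otimes>x))"
   have c: "G\<in>\<K>" "\<xi>\<in>\<K>" "Y\<in>\<K>" unfolding G_def \<xi>_def Y_def using D(1) x fc i(1) by auto
   have Y': "D (f [^] Suc N\<otimes>x) = Y" unfolding Y_def nat_pow_Suc2[OF fc] using fc x by (simp add: m_assoc)
   have "(F\<otimes>f)\<otimes>(G\<otimes>inv f)\<otimes>inv f\<otimes>Y = (f\<otimes>inv f)\<otimes>(F\<otimes>G\<otimes>inv f\<otimes>Y)"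
    using c Fc fc i(1) by algebra
   also have "... = (F\<otimes>f)\<otimes>G\<otimes>inv f\<otimes>\<xi>\<oplus>F\<otimes>G\<otimes>inv f\<otimes>(Y\<ominus>f\<otimes>\<xi>)"
   proof -
    have "(F\<otimes>f)\<otimes>G\<otimes>inv f\<otimes>\<xi>\<oplus>F\<otimes>G\<otimes>inv f\<otimes>(Y\<ominus>f\<otimes>\<xi>) = F\<otimes>G\<otimes>inv f\<otimes>Y"
     using c Fc fc i(1) by algebra
    then show ?thesis using i(2) c Fc i(1) by simp
   qed
   finally show "f [^] Suc q\<otimes>inv f [^] N\<otimes>inv f\<otimes>D (f [^] N\<otimes>x)\<oplus>?h x =
     f [^] Suc q\<otimes>inv f [^] Suc N\<otimes>inv f\<otimes>D (f [^] Suc N\<otimes>x)"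
    unfolding Y' commutator_def by (simp add: F_def G_def \<xi>_def Y_def)
  qed
 qed
qed

end

lemma (in cring_with_subring) on_carrier_minus:
 assumes "a\<in>A" "d\<in>A" shows "a \<ominus>\<^bsub>on_carrier R A\<^esub>d = a\<ominus>d"
proof -
 interpret Q: cring "on_carrier R A" using subcring_iff[OF Asub] subcringI'[OF A] by simp
 have "\<ominus>\<^bsub>on_carrier R A\<^esub>d = \<ominus>d"
  by (rule Q.minus_equality) (use assms subringE(5)[OF A] in \<open>auto simp: l_neg\<close>)
 then show ?thesis by (simp add: Q.minus_eq minus_eq)
qed

context field
begin

lemma subring_with: "subring p R ==> cring_with_subring R p" by (intro cring_with_subring.intro cring_with_subring_axioms.intro is_cring)

lemma subring_cring: "subring q R ==> cring (on_carrier R q)" using subcring_iff[OF subringE(1)] subcringI' by blast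

text \<open>The operator obtained acts only on the image \<open>B\<close> as a ring in its own
  right; \<open>dop_extend\<close> carries it to the field.\<close>

lemma dop_transport:
 assumes hom: "ring_hom_cring A R h" and inj: "inj_on h (carrier A)"
 defines "B \<equiv> h ` carrier A"
 assumes B: "subring B R"
 shows "dop A (carrier A) q D ==> dop (on_carrier R B) B q (%x. h (D (inv_into (carrier A) h x)))"
proof (induction q arbitrary: D)
 case 0
 interpret h: ring_hom_cring A R h by (rule hom)
 have "inv_into (carrier A) h x\<in>carrier A" if "x\<in>B" for x using inv_into_into[of x h "carrier A"] that unfolding B_def by simp
 then show ?case using 0 by simp
next
 case (Suc q)
 interpret h: ring_hom_cring A R h by (rule hom)
 interpret A: cring_with_subring A "carrier A" by (rule h.R.cring_with_carrier)
 interpret B: cring_with_subring R B by (rule subring_with[OF B])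
 interpret Q: cring "on_carrier R B" by (rule subring_cring[OF B])
 interpret Q: cring_with_subring "on_carrier R B" B using Q.cring_with_carrier by simp
 note D = A.dop_add[OF Suc.prems]
 define k where "k = inv_into (carrier A) h"
 have kh: "k (h a) = a" if "a\<in>carrier A" for a unfolding k_def by (rule inv_into_f_f[OF inj that])
 have hB: "h a\<in>B" if "a\<in>carrier A" for a using that unfolding B_def by simp
 have BE: "\<exists>a\<in>carrier A. x = h a" if "x\<in>B" for x using that unfolding B_def by blast
 have k: "k x\<in>carrier A" "h (k x) = x" if "x\<in>B" for x using BE[OF that] kh by auto
 have sum: "k (x\<oplus>y) = k x\<oplus>\<^bsub>A\<^esub>k y" "k (x\<otimes>y) = k x\<otimes>\<^bsub>A\<^esub>k y" if "x\<in>B" "y\<in>B" for x y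
  using kh[of "k x\<oplus>\<^bsub>A\<^esub>k y"] kh[of "k x\<otimes>\<^bsub>A\<^esub>k y"] k[OF that(1)] k[OF that(2)] by simp_all
 have "dop (on_carrier R B) B q (commutator (on_carrier R B) a (%x. h (D (k x))))" if a: "a\<in>B" for a
 proof (rule Q.dop_cong)
  show "dop (on_carrier R B) B q (%x. h (commutator A (k a) D (k x)))"
   unfolding k_def by (rule Suc.IH) (use Suc.prems k(1)[OF a] in \<open>simp add: k_def\<close>)
  fix x assume "x\<in>carrier (on_carrier R B)"
  then have x: "x\<in>B" by simp
  have c: "D (k a\<otimes>\<^bsub>A\<^esub>k x)\<in>carrier A" "k a\<otimes>\<^bsub>A\<^esub>D (k x)\<in>carrier A" using D(1) k(1) a x by auto
  have "h (commutator A (k a) D (k x)) = h (D (k a\<otimes>\<^bsub>A\<^esub>k x))\<ominus>h (k a\<otimes>\<^bsub>A\<^esub>D (k x))"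
   unfolding commutator_def using c by (simp add: h.R.minus_eq minus_eq)
  also have "... = h (D (k a\<otimes>\<^bsub>A\<^esub>k x)) \<ominus>\<^bsub>on_carrier R B\<^esub>h (k a\<otimes>\<^bsub>A\<^esub>D (k x))"
   using B.on_carrier_minus hB c by simp
  also have "h (k a\<otimes>\<^bsub>A\<^esub>D (k x)) = a\<otimes>h (D (k x))" using k a x D(1) by simp
  finally show "h (commutator A (k a) D (k x)) = commutator (on_carrier R B) a (%x. h (D (k x))) x"
   unfolding commutator_def using sum(2)[OF a x] by simp
 qed
 moreover have "h (D (k \<one>))\<in>B" using D(1) k(1)[OF subringE(3)[OF B]] hB by simp
 ultimately show ?case using D sum(1) k hB by (simp add: k_def)
qed

text \<open>\<open>s F(x) = F(s x) - [F, s](x)\<close>. With \<open>s x\<close> in \<open>B\<close>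
  the first term vanishes, and the commutator vanishes on \<open>B\<close> as well and has smaller
  order.\<close>

lemma dop_unique:
 assumes B: "subring B R" and fr: "!!x. x\<in>\<K> ==> EX s:B. s~=\<zero> & s\<otimes>x\<in>B"
 shows "dop R B q F ==> (!!x. x\<in>B ==> F x = \<zero>) ==> x\<in>\<K> ==> F x = \<zero>"
proof (induction q arbitrary: F x)
 interpret B: cring_with_subring R B by (rule subring_with[OF B])
 case (Suc q)
 obtain s where s: "s\<in>B" "s~=\<zero>" "s\<otimes>x\<in>B" using fr[OF Suc.prems(3)] by blast
 have Fx: "F x\<in>\<K>" using B.dop_closed[OF Suc.prems(1,3)] .
 have "commutator R s F x = \<zero>"
 proof (rule Suc.IH[of "commutator R s F" x])
  show "commutator R s F z = \<zero>" if "z\<in>B" for z unfolding commutator_def using Suc.prems(2) that s subringE(6)[OF B] by (simp add: minus_eq)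
 qed (use Suc.prems s in simp_all)
 then have "\<ominus>(s\<otimes>F x) = \<zero>" unfolding commutator_def using Suc.prems(2)[OF s(3)] Fx B.Ac[OF s(1)] by (simp add: minus_eq)
 then have "s\<otimes>F x = \<zero>" using minus_minus[of "s\<otimes>F x"] Fx B.Ac[OF s(1)] by simp
 then show ?case using integral[of s "F x"] s Fx by auto
qed simp

text \<open>\<open>[D, s]\<close> extends by induction, and \<open>s D(x) = D(s x) - [D, s](x)\<close> determines \<open>D(x)\<close> from
  any denominator \<open>s\<close> of \<open>x\<close>.\<close>

lemma dop_extend:
 assumes B: "subring B R" and fr: "!!x. x\<in>\<K> ==> EX s:B. s~=\<zero> & s\<otimes>x\<in>B"
 shows "dop (on_carrier R B) B q D ==> EX E. dop R B q E & (ALL a:B. E a = D a)"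
proof (induction q arbitrary: D)
 case 0
 then show ?case by (intro exI[of _ "%_. \<zero>"]) simp
next
 interpret B: cring_with_subring R B by (rule subring_with[OF B])
 case (Suc q)
 note Bm = subringE(6)[OF B]
 have D: "!!x. x\<in>B ==> D x\<in>B" "!!x y. x\<in>B ==> y\<in>B ==> D (x\<oplus>y) = D x\<oplus>D y" using Suc.prems by auto
 have "ALL s:B. EX E. dop R B q E & (ALL a:B. E a = commutator (on_carrier R B) s D a)" using Suc by simp
 from bchoice[OF this] obtain E where E: "!!s. s\<in>B ==> dop R B q (E s)"
  and E': "!!s a. s\<in>B ==> a\<in>B ==> E s a = commutator (on_carrier R B) s D a" by blast
 have EB: "E s a = D (s\<otimes>a)\<ominus>s\<otimes>D a" if "s\<in>B" "a\<in>B" for s a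
  using E'[OF that] B.on_carrier_minus D(1) Bm that unfolding commutator_def by simp
 note Ec = B.dop_closed[OF E]
 \<comment> \<open>\<open>E s\<close> extends \<open>[D, s]\<close>, and the double commutators of
   \<open>D\<close> with \<open>s\<close> and \<open>t\<close> are symmetric. The two sides agree on
   \<open>B\<close> for this reason, hence everywhere by uniqueness.\<close>
 have sym: "E t (s\<otimes>x)\<ominus>s\<otimes>E t x = E s (t\<otimes>x)\<ominus>t\<otimes>E s x"
  if s: "s\<in>B" and t: "t\<in>B" and x: "x\<in>\<K>" for s t x
 proof -
  define G where "G = (%s t x. E t (s\<otimes>x)\<oplus>\<ominus>(s\<otimes>E t x))"
  have G: "dop R B q (G s t)" if "s\<in>B" "t\<in>B" for s t
   unfolding G_def by (rule B.dop_plus[OF B.dop_rmult[where D = "E t"] B.dop_uminus[OF B.dop_lmult]]) (use that E in auto)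
  note Gc = B.dop_closed[OF G]
  have "G s t x\<oplus>\<ominus>G t s x = \<zero>"
  proof (rule dop_unique[OF B fr B.dop_plus[OF G[OF s t] B.dop_uminus[OF G[OF t s]]] _ x])
   fix a assume a: "a\<in>B"
   have eq: "G s t a = D (t\<otimes>(s\<otimes>a))\<ominus>t\<otimes>D (s\<otimes>a)\<ominus>s\<otimes>(D (t\<otimes>a)\<ominus>t\<otimes>D a)"
    if "s\<in>B" "t\<in>B" for s t unfolding G_def EB[OF that(2) a] EB[OF that(2) Bm[OF that(1) a]] by (simp add: minus_eq)
   have st: "s\<otimes>(t\<otimes>a) = t\<otimes>(s\<otimes>a)" using s t a by (simp add: m_lcomm)
   have "w\<ominus>s\<otimes>w1\<ominus>t\<otimes>(w2\<ominus>s\<otimes>w3) = w\<ominus>t\<otimes>w2\<ominus>s\<otimes>(w1\<ominus>t\<otimes>w3)"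
    if "w\<in>\<K>" "w1\<in>\<K>" "w2\<in>\<K>" "w3\<in>\<K>" for w w1 w2 w3 using that B.Ac[OF s] B.Ac[OF t] by algebra
   then have "G t s a = G s t a" unfolding eq[OF s t] eq[OF t s] st using D(1) Bm s t a by simp
   then show "G s t a\<oplus>\<ominus>G t s a = \<zero>" using Gc[OF s t] a by (simp add: r_neg)
  qed
  then have "G s t x = G t s x" using Gc[OF s t x] Gc[OF t s x] by (metis add.inv_closed add.inv_inv minus_equality)
  then show ?thesis unfolding G_def minus_eq .
 qed
 \<comment> \<open>Two denominators prescribe the same value for the extension: the symmetry shows
   it after multiplication by both of them.\<close>
 have cross: "t\<otimes>(D (s\<otimes>x)\<ominus>E s x) = s\<otimes>(D (t\<otimes>x)\<ominus>E t x)"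
  if st: "s\<in>B" "t\<in>B" and x: "x\<in>\<K>" "s\<otimes>x\<in>B" "t\<otimes>x\<in>B" for s t x
 proof -
  define P Q U V a d where "P = E t (s\<otimes>x)" and "Q = E s (t\<otimes>x)" and "U = E t x" and "V = E s x"
   and "a = D (s\<otimes>x)" and "d = D (t\<otimes>x)"
  have c: "P\<in>\<K>" "Q\<in>\<K>" "U\<in>\<K>" "V\<in>\<K>" "a\<in>\<K>" "d\<in>\<K>" "s\<in>\<K>" "t\<in>\<K>"
   unfolding P_def Q_def U_def V_def a_def d_def using Ec st x D(1) by auto
  have tD: "D (t\<otimes>a) = E t a\<oplus>t\<otimes>D a" if "t\<in>B" "a\<in>B" for t a
  proof -
   have "D (t\<otimes>a)\<in>\<K>" "t\<otimes>D a\<in>\<K>" using D(1) Bm that by auto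
   then show ?thesis unfolding EB[OF that] by (simp add: minus_eq a_assoc l_neg)
  qed
  have "t\<otimes>(s\<otimes>x) = s\<otimes>(t\<otimes>x)" using st x by (simp add: m_lcomm)
  then have 1: "P\<oplus>t\<otimes>a = Q\<oplus>s\<otimes>d" using tD[OF st(2) x(2)] tD[OF st(1) x(3)] unfolding P_def Q_def a_def d_def by simp
  have 2: "P\<ominus>s\<otimes>U = Q\<ominus>t\<otimes>V" using sym[OF st x(1)] unfolding P_def Q_def U_def V_def .
  define N where "N = Q\<ominus>P"
  have N: "N\<in>\<K>" unfolding N_def using c by simp
  have "t\<otimes>a = (P\<oplus>t\<otimes>a)\<ominus>P" using c by algebra
  then have ta: "t\<otimes>a = N\<oplus>s\<otimes>d" unfolding 1 N_def using c by algebra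
  have "t\<otimes>V = Q\<ominus>(Q\<ominus>t\<otimes>V)" using c by algebra
  then have tV: "t\<otimes>V = N\<oplus>s\<otimes>U" unfolding 2[symmetric] N_def using c by algebra
  have "t\<otimes>(a\<ominus>V) = t\<otimes>a\<ominus>t\<otimes>V" using c by algebra
  also have "... = s\<otimes>(d\<ominus>U)" unfolding ta tV using c N by algebra
  finally show ?thesis unfolding U_def V_def a_def d_def .
 qed
 have "ALL x:\<K>. EX v. v\<in>\<K> & (ALL s:B. s\<otimes>x\<in>B --> s\<otimes>v = D (s\<otimes>x)\<ominus>E s x)"
 proof
  fix x assume x: "x\<in>\<K>"
  obtain t where t: "t\<in>B" "t~=\<zero>" "t\<otimes>x\<in>B" using fr[OF x] by blast
  note i = inv_nonzero[OF B.Ac[OF t(1)] t(2)]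
  define w where "w = D (t\<otimes>x)\<ominus>E t x"
  have wc: "w\<in>\<K>" unfolding w_def using D(1) Ec t x by simp
  have "s\<otimes>(inv t\<otimes>w) = D (s\<otimes>x)\<ominus>E s x" if s: "s\<in>B" "s\<otimes>x\<in>B" for s
  proof -
   have vc: "D (s\<otimes>x)\<ominus>E s x\<in>\<K>" using D(1) Ec s x by simp
   have "s\<otimes>(inv t\<otimes>w) = inv t\<otimes>(s\<otimes>w)" using s wc i by (simp add: m_lcomm)
   also have "s\<otimes>w = t\<otimes>(D (s\<otimes>x)\<ominus>E s x)" unfolding w_def using cross[OF s(1) t(1) x s(2) t(3)] by simp
   also have "inv t\<otimes>... = D (s\<otimes>x)\<ominus>E s x" using i t vc by (simp add: m_assoc[symmetric])
   finally show ?thesis .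
  qed
  then show "EX v. v\<in>\<K> & (ALL s:B. s\<otimes>x\<in>B --> s\<otimes>v = D (s\<otimes>x)\<ominus>E s x)"
   using i wc by (intro exI[of _ "inv t\<otimes>w"]) simp
 qed
 from bchoice[OF this] obtain T where T: "!!x. x\<in>\<K> ==> T x\<in>\<K>"
  and Ts: "!!x s. x\<in>\<K> ==> s\<in>B ==> s\<otimes>x\<in>B ==> s\<otimes>T x = D (s\<otimes>x)\<ominus>E s x" by blast
 have TB: "T a = D a" if a: "a\<in>B" for a
 proof -
  have ac: "a\<in>\<K>" "D a\<in>\<K>" using a D(1) by auto
  have "E \<one> a = \<zero>" using EB[OF subringE(3)[OF B] a] ac by (simp add: minus_eq r_neg)
  then have "\<one>\<otimes>T a = D a" using Ts[OF ac(1) subringE(3)[OF B], simplified] a ac by (simp add: minus_eq)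
  then show ?thesis using T[OF ac(1)] by simp
 qed
 have cancel: "v = w" if "s\<in>\<K>" "s~=\<zero>" "v\<in>\<K>" "w\<in>\<K>" "s\<otimes>v = s\<otimes>w" for s v w
  using that m_lcancel by blast
 have "dop R B (Suc q) T" unfolding dop.simps
 proof (intro conjI ballI)
  show "T\<in>\<K> \<rightarrow> \<K>" using T by auto
  show "T \<one>\<in>B" using TB D(1) subringE(3)[OF B] by simp
  fix x y assume x: "x\<in>\<K>" and y: "y\<in>\<K>"
  obtain s where s: "s\<in>B" "s~=\<zero>" "s\<otimes>x\<in>B" using fr[OF x] by blast
  obtain t where t: "t\<in>B" "t~=\<zero>" "t\<otimes>y\<in>B" using fr[OF y] by blast
  define r where "r = s\<otimes>t"
  have r: "r\<in>B" "r~=\<zero>" unfolding r_def using s(1,2) t(1,2) Bm by (simp_all add: integral_iff)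
  have "r\<otimes>x = t\<otimes>(s\<otimes>x)" "r\<otimes>y = s\<otimes>(t\<otimes>y)" unfolding r_def using s(1) t(1) x y by (simp_all add: m_ac)
  then have rx: "r\<otimes>x\<in>B" and ry: "r\<otimes>y\<in>B" using Bm s t by simp_all
  have rxy: "r\<otimes>(x\<oplus>y) = r\<otimes>x\<oplus>r\<otimes>y" using r x y by (simp add: r_distr)
  have c: "D (r\<otimes>x)\<in>\<K>" "D (r\<otimes>y)\<in>\<K>" "E r x\<in>\<K>" "E r y\<in>\<K>" "r\<in>\<K>" "T x\<in>\<K>" "T y\<in>\<K>"
   using D(1) rx ry Ec r x y T by auto
  have "r\<otimes>T (x\<oplus>y) = (D (r\<otimes>x)\<oplus>D (r\<otimes>y))\<ominus>(E r x\<oplus>E r y)"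
   using Ts[of "x\<oplus>y" r] rx ry subringE(7)[OF B] r(1) x y D(2)[OF rx ry] B.dop_additive[OF E[OF r(1)] x y] unfolding rxy by simp
  also have "... = (D (r\<otimes>x)\<ominus>E r x)\<oplus>(D (r\<otimes>y)\<ominus>E r y)" using c(1-4) by algebra
  also have "... = r\<otimes>(T x\<oplus>T y)" using Ts[OF x r(1) rx] Ts[OF y r(1) ry] c by (simp add: r_distr)
  finally show "T (x\<oplus>y) = T x\<oplus>T y" by (rule cancel[OF c(5) r(2), rotated -1]) (use x y T in auto)
 next
  fix e assume e: "e\<in>B"
  \<comment> \<open>The commutator of \<open>T\<close> with \<open>e\<close> is \<open>E e\<close>,
    which has the required order. Multiplication by a denominator of \<open>x\<close> reduces this
    identity to \<open>sym\<close>.\<close>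
  show "dop R B q (commutator R e T)"
  proof (rule B.dop_cong[OF _ E[OF e]])
   fix x assume x: "x\<in>\<K>"
   obtain s where s: "s\<in>B" "s~=\<zero>" "s\<otimes>x\<in>B" using fr[OF x] by blast
   have sex: "s\<otimes>(e\<otimes>x) = e\<otimes>(s\<otimes>x)" using s e x by (simp add: m_lcomm)
   define P Q U V m n where "P = E e (s\<otimes>x)" and "Q = E s (e\<otimes>x)" and "U = E e x" and "V = E s x"
    and "m = D (e\<otimes>(s\<otimes>x))" and "n = D (s\<otimes>x)"
   have c: "P\<in>\<K>" "Q\<in>\<K>" "U\<in>\<K>" "V\<in>\<K>" "s\<in>\<K>" "e\<in>\<K>"
    "T (e\<otimes>x)\<in>\<K>" "T x\<in>\<K>" "m\<in>\<K>" "n\<in>\<K>"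
    unfolding P_def Q_def U_def V_def m_def n_def using Ec s e x T D(1) Bm by auto
   have P: "P = m\<ominus>e\<otimes>n" unfolding P_def m_def n_def by (rule EB[OF e s(3)])
   have "Q = (Q\<ominus>e\<otimes>V)\<oplus>e\<otimes>V" using c by algebra
   also have "Q\<ominus>e\<otimes>V = m\<ominus>e\<otimes>n\<ominus>s\<otimes>U"
    using sym[OF s(1) e x] unfolding P[symmetric] unfolding P_def Q_def U_def V_def by simp
   finally have Q: "Q = m\<ominus>e\<otimes>n\<ominus>s\<otimes>U\<oplus>e\<otimes>V" .
   have "s\<otimes>(T (e\<otimes>x)\<ominus>e\<otimes>T x) = s\<otimes>T (e\<otimes>x)\<ominus>e\<otimes>(s\<otimes>T x)" using c by algebra
   also have "s\<otimes>T (e\<otimes>x) = m\<ominus>Q" using Ts[of "e\<otimes>x" s] s(1) e x Bm[OF e s(3)] unfolding Q_def m_def sex by simp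
   also have "s\<otimes>T x = n\<ominus>V" unfolding V_def n_def by (rule Ts[OF x s(1,3)])
   also have "m\<ominus>Q\<ominus>e\<otimes>(n\<ominus>V) = s\<otimes>U" unfolding Q using c(3-6,9,10) by algebra
   finally have "T (e\<otimes>x)\<ominus>e\<otimes>T x = U" by (rule cancel[OF c(5) s(2), rotated -1]) (use c in simp_all)
   then show "E e x = commutator R e T x" unfolding commutator_def U_def by simp
  qed
 qed
 then show ?case using TB by blast
qed

end

context cring
begin

text \<open>Applied to coefficients, the operator commutes with the variables, and its commutator
  with a constant is again an operator on coefficients, of smaller order. Induction on the
  construction of a polynomial covers the general commutator.\<close>

lemma dop_mpoly:
 "dop R \<K> q D ==> dop (mpoly_ring R n) (carrier (mpoly_ring R n)) q (%P m. D (P m))"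
 (is "_ ==> dop ?M _ _ _")
proof (induction q arbitrary: D)
 case 0
 then show ?case using carrier_coeffE[OF pset_coeff] by (auto simp: mpoly_ring_sel indexed_zero_def fun_eq_iff)
next
 interpret A: cring_with_subring R "\<K>" by (rule cring_with_carrier)
 interpret M: cring "mpoly_ring R n" by (rule mpoly_ring_cring)
 interpret M: cring_with_subring ?M "carrier ?M" by (rule M.cring_with_carrier)
 case (Suc q)
 note D = A.dop_add[OF Suc.prems]
 have D0: "D \<zero> = \<zero>" by (rule A.dop_zero[OF Suc.prems])
 define E where "E = (%(P :: nat multiset => 'a) m. D (P m))"
 have E: "E (indexed_pmult P i) = indexed_pmult (E P) i" "E (indexed_const k) = indexed_const (D k)" for P i k
  unfolding E_def indexed_pmult_def indexed_const_def using D0 by auto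
 have Ea: "E (indexed_padd P Q) = indexed_padd (E P) (E Q)" if "carrier_coeff P" "carrier_coeff Q" for P Q
  unfolding E_def indexed_padd_def using D(2) that[THEN carrier_coeffE] by auto
 have Ec: "E P\<in>pset {..<n}" if "P\<in>pset {..<n}" for P using that
 proof (induction rule: indexed_pset.induct)
  case (indexed_padd P Q)
  then show ?case using Ea[OF indexed_padd(1,2)[THEN pset_coeff]] indexed_pset.indexed_padd by simp
 qed (simp_all add: E D(1) indexed_pset.intros)
 have E1: "E\<in>carrier ?M \<rightarrow> carrier ?M"
  "!!P Q. P\<in>carrier ?M ==> Q\<in>carrier ?M ==>
   E (P\<oplus>\<^bsub>?M\<^esub>Q) = E P\<oplus>\<^bsub>?M\<^esub>E Q" unfolding mpoly_ring_sel using Ec Ea[OF pset_coeff pset_coeff] by auto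
 note sub = M.commutator_subring[OF E1, of q]
 have "dop (mpoly_ring R n) (carrier ?M) q (commutator (mpoly_ring R n) P E)" if "P\<in>pset {..<n}" for P using that
 proof (induction rule: indexed_pset.induct)
  case (indexed_const c)
  show ?case
  proof (rule M.dop_cong)
   show "dop (mpoly_ring R n) (carrier ?M) q (%P m. commutator R c D (P m))" by (rule Suc.IH) (use Suc.prems indexed_const in simp)
   fix Q assume "Q\<in>carrier ?M"
   then have Q: "Q\<in>pset {..<n}" unfolding mpoly_ring_sel .
   note q = pset_coeff[OF Q]
   have neg: "a_inv (mpoly_ring R n) P = (%m. \<ominus>P m)" if P: "P\<in>pset {..<n}" for P
   proof (rule M.minus_equality)
    have "(%m. \<ominus>\<one>\<otimes>P m)\<in>pset {..<n}" by (rule pset_scale[OF _ P]) simp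
    then show "(%m. \<ominus>P m)\<in>carrier ?M" using carrier_coeffE[OF pset_coeff[OF P]] unfolding mpoly_ring_sel by (simp add: l_minus)
    show "(%m. \<ominus>P m)\<oplus>\<^bsub>?M\<^esub>P = \<zero>\<^bsub>?M\<^esub>"
     unfolding mpoly_ring_sel indexed_padd_def indexed_zero_def using carrier_coeffE[OF pset_coeff[OF P]] by (simp add: l_neg)
   qed (use P in \<open>simp add: mpoly_ring_sel\<close>)
   have "E (convolution R (indexed_const c) Q) \<ominus>\<^bsub>?M\<^esub>convolution R (indexed_const c) (E Q)
    = (%m. commutator R c D (Q m))" unfolding M.minus_eq neg[OF pset_convolution[OF indexed_pset.indexed_const[OF indexed_const] Ec[OF Q]]]
    unfolding convolution_const[OF q indexed_const] convolution_const[OF pset_coeff[OF Ec[OF Q]] indexed_const]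
    by (simp add: mpoly_ring_sel indexed_padd_def E_def commutator_def minus_eq)
   then show "(%m. commutator R c D (Q m)) = commutator (mpoly_ring R n) (indexed_const c) E Q"
    unfolding commutator_def[of "mpoly_ring R n"] mpoly_ring_sel(2) by simp
  qed
 next
  case (indexed_padd P Q)
  then show ?case using subringE(7)[OF sub, of P Q] by (simp add: mpoly_ring_sel)
 next
  case (indexed_pmult P i)
  define v :: "nat multiset => 'a" where "v = indexed_pmult (indexed_const \<one>) i"
  have v: "v\<in>pset {..<n}" unfolding v_def by (intro indexed_pset.intros one_closed indexed_pmult)
  have vQ: "convolution R v Q = indexed_pmult Q i" if "Q\<in>pset {..<n}" for Q
   unfolding v_def convolution_pmult[OF pset_coeff[OF indexed_pset.indexed_const[OF one_closed]] pset_coeff[OF that]]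
    convolution_const[OF pset_coeff[OF that] one_closed] using carrier_coeffE[OF pset_coeff[OF that]] by simp
  show ?case
  proof (rule M.dop_cong)
   show "dop (mpoly_ring R n) (carrier ?M) q (%Q. v\<otimes>\<^bsub>?M\<^esub>commutator (mpoly_ring R n) P E Q)"
    by (rule M.dop_lmult) (use v indexed_pmult in \<open>simp_all add: mpoly_ring_sel\<close>)
   fix Q assume Qc: "Q\<in>carrier ?M"
   then have Q: "Q\<in>pset {..<n}" unfolding mpoly_ring_sel .
   have c: "P\<in>carrier ?M" "E Q\<in>carrier ?M" "v\<in>carrier ?M"
    "E (P\<otimes>\<^bsub>?M\<^esub>Q)\<in>carrier ?M" using indexed_pmult Ec Q v pset_convolution by (auto simp: mpoly_ring_sel)
   have Pi: "indexed_pmult P i = v\<otimes>\<^bsub>?M\<^esub>P" using vQ[OF indexed_pmult(1)] by (simp add: mpoly_ring_sel)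
   have "E (v\<otimes>\<^bsub>?M\<^esub> (P\<otimes>\<^bsub>?M\<^esub>Q)) = v\<otimes>\<^bsub>?M\<^esub>E (P\<otimes>\<^bsub>?M\<^esub>Q)"
    using pset_convolution[OF indexed_pmult(1) Q] by (simp add: mpoly_ring_sel vQ E Ec)
   then have Ev: "E (v\<otimes>\<^bsub>?M\<^esub>P\<otimes>\<^bsub>?M\<^esub>Q) = v\<otimes>\<^bsub>?M\<^esub>E (P\<otimes>\<^bsub>?M\<^esub>Q)"
    using c Qc by (simp add: M.m_assoc)
   show "v\<otimes>\<^bsub>?M\<^esub>commutator (mpoly_ring R n) P E Q = commutator (mpoly_ring R n) (indexed_pmult P i) E Q"
    unfolding commutator_def Pi Ev using c Qc by (simp add: M.r_distr M.minus_eq M.m_assoc M.r_minus)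
  qed
 qed
 moreover have "E \<one>\<^bsub>?M\<^esub>\<in>carrier ?M" using E1(1) M.one_closed by blast
 ultimately have "dop (mpoly_ring R n) (carrier ?M) (Suc q) E" using E1 by (simp add: mpoly_ring_sel(1))
 then show ?case unfolding E_def .
qed

end

section \<open>Local subrings, localizations and centers\<close>

context field
begin

abbreviation span_in :: "'a set => 'a set => 'a set" where "span_in q F \<equiv> Idl\<^bsub>on_carrier R q\<^esub>F"

text \<open>Zero is listed separately, because the library does not fix the value of
  \<open>inv\<close> at zero.\<close>

definition nonunits :: "'a set => 'a set" where "nonunits q = {x\<in>q. x = \<zero> \<or> inv x~:q}"

text \<open>Locality expressed by sums of nonunits. No finiteness is included, so that arbitrary
  local rings can serve as test objects for points of a scheme.\<close>

definition local_subring :: "'a set => bool"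
 where "local_subring q <-> subring q R & (\<forall>x\<in>nonunits q. \<forall>y\<in>nonunits q. x\<oplus>y\<in>nonunits q)"

lemma ideal_on_iff:
 assumes "subring q R" shows "ideal I (on_carrier R q) <->
  I<=q & \<zero>\<in>I & (ALL a:I. ALL d:I. a\<oplus>d\<in>I) & (ALL a:I. ALL r:q. r\<otimes>a\<in>I)"
proof -
 interpret Q: cring "on_carrier R q" by (rule subring_cring[OF assms])
 show ?thesis using Q.ideal_facts(1-4)[of I] by (auto intro!: Q.cidealI)
qed

lemma primeideal_on_iff:
 assumes "subring q R" shows "primeideal P (on_carrier R q) <->
  ideal P (on_carrier R q) & \<one>~:P & (ALL a:q. ALL d:q. a\<otimes>d\<in>P --> a\<in>P \<or> d\<in>P)"
proof
 interpret Q: cring "on_carrier R q" by (rule subring_cring[OF assms])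
 assume P: "primeideal P (on_carrier R q)"
 then interpret P: primeideal P "on_carrier R q" .
 show "ideal P (on_carrier R q) & \<one>~:P & (ALL a:q. ALL d:q. a\<otimes>d\<in>P --> a\<in>P \<or> d\<in>P)"
  using P.I_notcarr P.one_imp_carrier P.I_prime P.is_ideal by auto
next
 interpret Q: cring "on_carrier R q" by (rule subring_cring[OF assms])
 assume "ideal P (on_carrier R q) & \<one>~:P & (ALL a:q. ALL d:q. a\<otimes>d\<in>P --> a\<in>P \<or> d\<in>P)"
 then show "primeideal P (on_carrier R q)" using subringE(3)[OF assms] by (intro primeidealI Q.is_cring) auto
qed

lemma span_in_facts:
 assumes "subring q R" "F<=q"
 shows "ideal (span_in q F) (on_carrier R q)" "F<=span_in q F" "span_in q F<=q"
  "!!I. ideal I (on_carrier R q) ==> F<=I ==> span_in q F<=I"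
proof -
 interpret Q: cring "on_carrier R q" by (rule subring_cring[OF assms(1)])
 show i: "ideal (span_in q F) (on_carrier R q)" and "F<=span_in q F" using Q.genideal_ideal Q.genideal_self assms(2) by auto
 show "span_in q F<=q" using i ideal_on_iff[OF assms(1)] by simp
 show "!!I. ideal I (on_carrier R q) ==> F<=I ==> span_in q F<=I" by (rule Q.genideal_minimal)
qed

lemma ideal_on_restrict:
 assumes p: "subring p R" and q: "subring q R" and pq: "p<=q" and I: "ideal I (on_carrier R q)"
 shows "ideal (I\<inter>p) (on_carrier R p)" using I subringE(2,6,7)[OF p] pq unfolding ideal_on_iff[OF p] ideal_on_iff[OF q] by auto

lemma span_in_mono:
 assumes p: "subring p R" and q: "subring q R" and pq: "p<=q" and F: "F<=p" "F<=G" "G<=q"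
 shows "span_in p F<=span_in q G"
proof -
 have "span_in p F<=span_in q G\<inter>p" using F span_in_facts(2)[OF q F(3)]
  by (intro span_in_facts(4)[OF p F(1)] ideal_on_restrict[OF p q pq] span_in_facts(1)[OF q F(3)]) auto
 then show ?thesis by simp
qed

lemma span_in_span_in:
 assumes p: "subring p R" and q: "subring q R" and pq: "p<=q" and F: "F<=p"
 shows "span_in q (span_in p F) = span_in q F"
proof
 have Fq: "F<=q" using F pq by simp
 have s: "span_in p F<=q" using span_in_facts(3)[OF p F] pq by simp
 show "span_in q (span_in p F)<=span_in q F"
  by (rule span_in_facts(4)[OF q s span_in_facts(1)[OF q Fq] span_in_mono[OF p q pq F subset_refl Fq]])
 show "span_in q F<=span_in q (span_in p F)" by (rule span_in_mono[OF q q subset_refl Fq span_in_facts(2)[OF p F] s])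
qed

text \<open>Membership in an ideal involves only finitely many coefficients, so it spreads from one
  point to all points whose local rings contain these.\<close>

lemma span_in_finite_coefficients:
 assumes p: "subring p R" and F: "F<=p" and x: "x\<in>span_in p F"
 shows "EX E. finite E & E<=p & (ALL q. subring q R --> E\<union>F<=q --> x\<in>span_in q F)"
proof -
 interpret Q: cring "on_carrier R p" by (rule subring_cring[OF p])
 have Fc: "F<=carrier (on_carrier R p)" using F by simp
 have i: "\<zero>\<in>span_in q F" "a\<in>span_in q F ==> d\<in>span_in q F ==> a\<oplus>d\<in>span_in q F"
  "a\<in>span_in q F ==> r\<in>q ==> r\<otimes>a\<in>span_in q F" if "subring q R" "F<=q" for q a d r
  using span_in_facts(1)[OF that] ideal_on_iff[OF that(1)] by simp_all
 show ?thesis using x Fc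
 proof (induction rule: Q.Idl_induct)
  case (gen s)
  then show ?case using span_in_facts(2) by (intro exI[of _ "{}"]) auto
 next
  case zero
  then show ?case using i(1) by (intro exI[of _ "{}"]) auto
 next
  case (add a d)
  from add(3) obtain E where E: "finite E" "E<=p" "!!q. subring q R ==> E\<union>F<=q ==> a\<in>span_in q F" by blast
  from add(4) obtain G where G: "finite G" "G<=p" "!!q. subring q R ==> G\<union>F<=q ==> d\<in>span_in q F" by blast
  show ?case using E(1,2) G(1,2) i(2)[OF _ _ E(3) G(3)] by (intro exI[of _ "E\<union>G"]) simp
 next
  case (mult a r)
  from mult(3) obtain E where E: "finite E" "E<=p" "!!q. subring q R ==> E\<union>F<=q ==> a\<in>span_in q F" by blast
  have rp: "r\<in>p" using mult(2) by simp
  have ra: "a\<otimes>r = r\<otimes>a" using mult(1) rp span_in_facts(3)[OF p F] subringE(1)[OF p] by (auto intro: m_comm)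
  have "EX E. finite E & E<=p & (ALL q. subring q R --> E\<union>F<=q --> r\<otimes>a\<in>span_in q F)"
   using E(1,2) i(3)[OF _ _ E(3)] rp by (intro exI[of _ "insert r E"]) simp
  then show ?case using ra by simp
 qed
qed

lemma generate_ring_subset:
 assumes "G<=H" shows "generate_ring R G<=generate_ring R H"
proof
 fix x assume "x\<in>generate_ring R G"
 then show "x\<in>generate_ring R H" by (induction rule: generate_ring.induct) (use assms in \<open>auto intro: generate_ring.intros\<close>)
qed

lemma generate_ring_finite:
 assumes "x\<in>generate_ring R (p\<union>G)"
 shows "EX E. finite E & E<=p & x\<in>generate_ring R (E\<union>G)"
proof -
 have "EX E. finite E & E<=p & h\<in>generate_ring R (E\<union>G) & k\<in>generate_ring R (E\<union>G)"
  if h: "EX E. finite E & E<=p & h\<in>generate_ring R (E\<union>G)" and k: "EX E. finite E & E<=p & k\<in>generate_ring R (E\<union>G)" for h k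
 proof -
  obtain E where E: "finite E" "E<=p" "h\<in>generate_ring R (E\<union>G)" using h by (elim exE conjE)
  obtain F where F: "finite F" "F<=p" "k\<in>generate_ring R (F\<union>G)" using k by (elim exE conjE)
  have "generate_ring R (E\<union>G)<=generate_ring R (E\<union>F\<union>G)" "generate_ring R (F\<union>G)<=generate_ring R (E\<union>F\<union>G)"
   by (rule generate_ring_subset; blast)+
  then show ?thesis using E F by (intro exI[of _ "E\<union>F"]) auto
 qed
 note both = this
 show ?thesis using assms
 proof (induction rule: generate_ring.induct)
  case one
  then show ?case using generate_ring.one by (intro exI[of _ "{}"]) auto
 next
  case (incl h)
  show ?case
  proof (cases "h\<in>p")
   case True
   then show ?thesis by (intro exI[of _ "{h}"]) (auto intro: generate_ring.incl)
  next
   case False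
   then show ?thesis using incl by (intro exI[of _ "{}"]) (auto intro: generate_ring.incl)
  qed
 next
  case (a_inv h)
  from a_inv(2) show ?case by (elim exE conjE) (intro exI conjI, assumption+, rule generate_ring.a_inv)
 next
  case (eng_add h k)
  from both[OF eng_add(3,4)] show ?case by (elim exE conjE) (intro exI conjI, assumption+, rule generate_ring.eng_add)
 next
  case (eng_mult h k)
  from both[OF eng_mult(3,4)] show ?case by (elim exE conjE) (intro exI conjI, assumption+, rule generate_ring.eng_mult)
 qed
qed

lemma local_subring_facts:
 assumes "local_subring q"
 shows "subring q R" "ideal (nonunits q) (on_carrier R q)" "max_ideal (on_carrier R q) = nonunits q"
  "\<one>~:nonunits q" "nonunits q<=q" "primeideal (nonunits q) (on_carrier R q)"
proof -
 show q: "subring q R" using assms unfolding local_subring_def by simp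
 interpret Q: cring "on_carrier R q" by (rule subring_cring[OF q])
 note qf = subringE[OF q]
 show sub: "nonunits q<=q" unfolding nonunits_def by auto
 show one: "\<one>~:nonunits q" unfolding nonunits_def using qf(3) by simp
 have mult: "r\<otimes>x\<in>nonunits q" if x: "x\<in>nonunits q" and r: "r\<in>q" for x r
 proof (rule ccontr)
  assume "r\<otimes>x~:nonunits q"
  then have rx: "r\<otimes>x~=\<zero>" "inv (r\<otimes>x)\<in>q" using x r qf(6) unfolding nonunits_def by auto
  have c: "x\<in>\<K>" "r\<in>\<K>" using x r sub qf(1) by auto
  have ne: "x~=\<zero>" using rx c by auto
  have ic: "inv (r\<otimes>x)\<in>\<K>" using rx(2) qf(1) by auto
  have "x\<otimes>(r\<otimes>inv (r\<otimes>x)) = (r\<otimes>x)\<otimes>inv (r\<otimes>x)" using c ic by (simp add: m_comm m_assoc[symmetric])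
  also have "... = \<one>" using inv_nonzero(2)[of "r\<otimes>x"] c rx by simp
  finally have "inv x = r\<otimes>inv (r\<otimes>x)" using c rx qf(1) by (intro comm_inv_char) auto
  then have "inv x\<in>q" using qf(6)[OF r rx(2)] by simp
  then show False using x ne unfolding nonunits_def by simp
 qed
 show N: "ideal (nonunits q) (on_carrier R q)"
  unfolding ideal_on_iff[OF q] using sub mult assms qf(2) unfolding local_subring_def by (auto simp: nonunits_def)
 have big: "J = q" if J: "ideal J (on_carrier R q)" "x\<in>J" "x~:nonunits q" for J x
 proof -
  have "x\<in>q" using J ideal_on_iff[OF q] by auto
  then have x: "x~=\<zero>" "inv x\<in>q" "x\<in>\<K>" using J(3) qf(1) unfolding nonunits_def by auto
  then have "inv x\<otimes>x\<in>J" using J(1,2) ideal_on_iff[OF q] by auto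
  then have "\<one>\<in>J" using inv_nonzero(3)[OF x(3,1)] by simp
  then show ?thesis using J(1) qf(1) unfolding ideal_on_iff[OF q] by force
 qed
 have max: "maximalideal (nonunits q) (on_carrier R q)" using N one qf(3) big by (intro maximalidealI) auto
 have uniq: "M = nonunits q" if "maximalideal M (on_carrier R q)" for M
 proof -
  interpret M: maximalideal M "on_carrier R q" by (rule that)
  have "M<=nonunits q" using big[OF M.is_ideal] M.I_notcarr by auto
  then show ?thesis using M.I_maximal[OF N] sub one qf(3) by auto
 qed
 show "max_ideal (on_carrier R q) = nonunits q" unfolding max_ideal_def by (rule the_equality, rule max, rule uniq)
 show "primeideal (nonunits q) (on_carrier R q)" by (rule Q.maximalideal_prime[OF max])
qed

lemma dominates_iff: "local_subring p ==> local_subring q ==> dominates R q p <-> p<=q & nonunits q\<inter>p = nonunits p"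
 unfolding dominates_def using local_subring_facts(3) by simp

lemma localization_facts:
 assumes A: "subring A R" and P: "primeideal P (on_carrier R A)"
 defines "L \<equiv> localization_at R A P"
 shows "local_subring L" "A<=L" "nonunits L\<inter>A = P" "nonunits L = {a\<otimes>inv s | a s. a\<in>P & s\<in>A - P}"
  "!!x. x\<in>L ==> EX a:A. EX s:A. s~:P & s~=\<zero> & inv s\<in>L & x = a\<otimes>inv s"
  "!!q. subring q R ==> A<=q ==> (!!s. s\<in>A - P ==> inv s\<in>q) ==> L<=q"
proof -
 note Af = subringE[OF A]
 have Pf: "P<=A" "\<zero>\<in>P" "!!a d. a\<in>P ==> d\<in>P ==> a\<oplus>d\<in>P" "!!a r. a\<in>P ==> r\<in>A ==> r\<otimes>a\<in>P"
  "\<one>~:P" "!!a d. a\<in>A ==> d\<in>A ==> a\<otimes>d\<in>P ==> a\<in>P \<or> d\<in>P"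
  using P unfolding primeideal_on_iff[OF A] ideal_on_iff[OF A] by auto
 have Ac: "a\<in>\<K>" if "a\<in>A" for a using that Af(1) by auto
 have si: "s\<in>\<K>" "inv s\<in>\<K>" "s~=\<zero>" "s\<otimes>inv s = \<one>" "inv s~=\<zero>" "inv (inv s) = s" if "s\<in>A - P" for s
  using inv_nonzero[of s] that Pf(2) Ac by auto
 have sm: "s\<otimes>t\<in>A - P" if "s\<in>A - P" "t\<in>A - P" for s t using that Af(6) Pf(6) by auto
 have im: "inv (s\<otimes>t) = inv s\<otimes>inv t" if "s\<in>A - P" "t\<in>A - P" for s t
 proof (rule comm_inv_char)
  have "(s\<otimes>t)\<otimes>(inv s\<otimes>inv t) = (s\<otimes>inv s)\<otimes>(t\<otimes>inv t)" using si[OF that(1)] si[OF that(2)] by (simp add: m_ac)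
  then show "(s\<otimes>t)\<otimes>(inv s\<otimes>inv t) = \<one>" using si[OF that(1)] si[OF that(2)] by simp
 qed (use si[OF that(1)] si[OF that(2)] in auto)
 have one: "\<one>\<in>A - P" using Af(3) Pf(5) by simp
 have LI: "a\<otimes>inv s\<in>L" if "a\<in>A" "s\<in>A - P" for a s unfolding L_def localization_at_def using that by blast
 have LE: "EX a s. a\<in>A & s\<in>A - P & x = a\<otimes>inv s" if "x\<in>L" for x using that unfolding L_def localization_at_def by blast
 have sum: "a\<otimes>inv s\<oplus>d\<otimes>inv t = (a\<otimes>t\<oplus>d\<otimes>s)\<otimes>inv (s\<otimes>t)" if "a\<in>A" "d\<in>A" "s\<in>A - P" "t\<in>A - P" for a d s t
 proof -
  note c = si[OF that(3)] si[OF that(4)] Ac[OF that(1)] Ac[OF that(2)]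
  have "(a\<otimes>t\<oplus>d\<otimes>s)\<otimes>(inv s\<otimes>inv t) = a\<otimes>inv s\<otimes>(t\<otimes>inv t)\<oplus>d\<otimes>inv t\<otimes>(s\<otimes>inv s)" using c(1,2,7,8,13,14) by algebra
  then show ?thesis unfolding im[OF that(3,4)] using c by simp
 qed
 show AL: "A<=L"
 proof
  fix a assume a: "a\<in>A"
  then show "a\<in>L" using LI[OF a one] Ac by simp
 qed
 have Ls: "subring L R"
 proof (rule subringI)
  show "L<=\<K>" using LE Ac si by blast
  show "\<one>\<in>L" using AL Af(3) by auto
  fix x assume "x\<in>L"
  then obtain a s where x: "a\<in>A" "s\<in>A - P" "x = a\<otimes>inv s" using LE by blast
  have "\<ominus>x = (\<ominus>a)\<otimes>inv s" unfolding x(3) using Ac[OF x(1)] si[OF x(2)] by (simp add: l_minus)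
  then show "\<ominus>x\<in>L" using LI[OF Af(5)[OF x(1)] x(2)] by simp
  fix y assume "y\<in>L"
  then obtain d t where y: "d\<in>A" "t\<in>A - P" "y = d\<otimes>inv t" using LE by blast
  have "x\<otimes>y = (a\<otimes>d)\<otimes>inv (s\<otimes>t)"
   unfolding x(3) y(3) im[OF x(2) y(2)] using Ac[OF x(1)] si(2)[OF x(2)] Ac[OF y(1)] si(2)[OF y(2)] by (simp add: m_ac)
  then show "x\<otimes>y\<in>L" using LI[OF Af(6)[OF x(1) y(1)] sm[OF x(2) y(2)]] by simp
  show "x\<oplus>y\<in>L" unfolding x(3) y(3) sum[OF x(1) y(1) x(2) y(2)] using x y by (intro LI sm Af(6,7)) auto
 qed
 show fr: "EX a:A. EX s:A. s~:P & s~=\<zero> & inv s\<in>L & x = a\<otimes>inv s" if xL: "x\<in>L" for x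
 proof -
  obtain a s where x: "a\<in>A" "s\<in>A - P" "x = a\<otimes>inv s" using LE[OF xL] by blast
  have "inv s\<in>L" using LI[OF Af(3) x(2)] si(2)[OF x(2)] by simp
  then show ?thesis using x si(3)[OF x(2)] by auto
 qed
 have PN: "a\<otimes>inv s\<in>nonunits L <-> a\<in>P" if a: "a\<in>A" and s: "s\<in>A - P" for a s
 proof
  assume N: "a\<otimes>inv s\<in>nonunits L"
  show "a\<in>P"
  proof (rule ccontr)
   assume "a~:P"
   then have aP: "a\<in>A - P" using a by simp
   have "(a\<otimes>inv s)\<otimes>(s\<otimes>inv a) = (a\<otimes>inv a)\<otimes>(s\<otimes>inv s)" using si(1,2)[OF aP] si(1,2)[OF s] by algebra
   also have "... = \<one>" using si(4)[OF aP] si(4)[OF s] by simp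
   finally have "(a\<otimes>inv s)\<otimes>(s\<otimes>inv a) = \<one>" .
   then have "inv (a\<otimes>inv s) = s\<otimes>inv a" using si[OF aP] si[OF s] by (intro comm_inv_char) auto
   then have "inv (a\<otimes>inv s)\<in>L" using LI[of s a] s aP by simp
   moreover have "a\<otimes>inv s~=\<zero>" using si[OF aP] si[OF s] by (simp add: integral_iff)
   ultimately show False using N unfolding nonunits_def by simp
  qed
 next
  assume aP: "a\<in>P"
  show "a\<otimes>inv s\<in>nonunits L"
  proof (rule ccontr)
   assume "a\<otimes>inv s~:nonunits L"
   then have ne: "a\<otimes>inv s~=\<zero>" and "inv (a\<otimes>inv s)\<in>L" using LI[OF a s] unfolding nonunits_def by auto
   from LE[OF this(2)] obtain d t where y: "d\<in>A" "t\<in>A - P" "inv (a\<otimes>inv s) = d\<otimes>inv t" by blast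
   note c = Ac[OF a] Ac[OF y(1)] si[OF s] si[OF y(2)]
   have "(a\<otimes>inv s)\<otimes>(d\<otimes>inv t) = \<one>" using inv_nonzero(2)[OF _ ne] c(1,4) unfolding y(3) by simp
   then have "s\<otimes>t = s\<otimes>t\<otimes>((a\<otimes>inv s)\<otimes>(d\<otimes>inv t))" using c(3,9) by simp
   also have "... = (s\<otimes>inv s)\<otimes>(t\<otimes>inv t)\<otimes>(d\<otimes>a)" using c(1-4,9,10) by algebra
   also have "... = d\<otimes>a" using c(1,2,6,12) by simp
   finally have "s\<otimes>t\<in>P" using Pf(4)[OF aP y(1)] by simp
   then show False using sm[OF s y(2)] by simp
  qed
 qed
 show NL: "nonunits L = {a\<otimes>inv s | a s. a\<in>P & s\<in>A - P}"
 proof (intro equalityI subsetI)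
  fix x assume x: "x\<in>nonunits L"
  then have "x\<in>L" unfolding nonunits_def by simp
  then show "x\<in>{a\<otimes>inv s | a s. a\<in>P & s\<in>A - P}" using LE PN x by blast
 next
  fix x assume "x\<in>{a\<otimes>inv s | a s. a\<in>P & s\<in>A - P}"
  then show "x\<in>nonunits L" using PN Pf(1) by blast
 qed
 show "nonunits L\<inter>A = P" using PN[OF _ one] Ac Pf(1) by auto
 show "local_subring L" unfolding local_subring_def
 proof (intro conjI ballI Ls)
  fix x y assume "x\<in>nonunits L" "y\<in>nonunits L"
  then obtain a s d t where xy: "a\<in>P" "s\<in>A - P" "x = a\<otimes>inv s" "d\<in>P" "t\<in>A - P" "y = d\<otimes>inv t" unfolding NL by blast
  have ad: "a\<in>A" "d\<in>A" "s\<in>A" "t\<in>A" using xy Pf(1) by auto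
  have "a\<otimes>t\<oplus>d\<otimes>s = t\<otimes>a\<oplus>s\<otimes>d" using ad Ac by (simp add: m_comm)
  then have "a\<otimes>t\<oplus>d\<otimes>s\<in>P" using xy(1,4) ad Pf(3,4) by simp
  then show "x\<oplus>y\<in>nonunits L" unfolding xy(3,6) sum[OF ad(1,2) xy(2,5)] NL using sm[OF xy(2,5)] by blast
 qed
 show "L<=q" if "subring q R" "A<=q" "!!s. s\<in>A - P ==> inv s\<in>q" for q
 proof
  fix x assume "x\<in>L"
  then obtain a s where "a\<in>A" "s\<in>A - P" "x = a\<otimes>inv s" using LE by blast
  then show "x\<in>q" using subringE(6)[OF that(1)] that(2,3) by auto
 qed
qed

text \<open>The center of a local ring \<open>q\<close> on \<open>Spec A\<close>: the localization
  at the contraction of the maximal ideal of \<open>q\<close>.\<close>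

lemma spec_points_dominated:
 assumes A: "subring A R" and q: "local_subring q" "A<=q"
 defines "L \<equiv> localization_at R A (nonunits q\<inter>A)"
 shows "L\<in>spec_points R A" "dominates R q L" "local_subring L" "A<=L"
  "!!s. s\<in>A ==> s~=\<zero> ==> inv s\<in>q ==> inv s\<in>L"
proof -
 note qf = local_subring_facts[OF q(1)]
 have P: "primeideal (nonunits q\<inter>A) (on_carrier R A)" unfolding primeideal_on_iff[OF A]
  using ideal_on_restrict[OF A qf(1) q(2) qf(2)] qf(2,4,6) q(2) subringE(6)[OF A] unfolding primeideal_on_iff[OF qf(1)] by blast
 note Lf = localization_facts[OF A P, folded L_def]
 show "L\<in>spec_points R A" unfolding spec_points_def L_def using P by blast
 show "local_subring L" "A<=L" by (rule Lf(1), rule Lf(2))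
 have Lq: "L<=q" by (rule Lf(6)[OF qf(1) q(2)]) (use q(2) in \<open>auto simp: nonunits_def\<close>)
 have "nonunits q\<inter>L = nonunits L"
 proof
  show "nonunits q\<inter>L<=nonunits L" using Lq unfolding nonunits_def by auto
  show "nonunits L<=nonunits q\<inter>L"
  proof
   fix x assume x: "x\<in>nonunits L"
   then have "EX a s. x = a\<otimes>inv s & a\<in>nonunits q\<inter>A & s\<in>A - (nonunits q\<inter>A)" unfolding Lf(4) by blast
   then obtain a s where as: "x = a\<otimes>inv s" "a\<in>nonunits q" "s\<in>A" "s~:nonunits q" by blast
   have "inv s\<in>q" "a\<in>q" using as q(2) unfolding nonunits_def by auto
   then have "inv s\<otimes>a\<in>nonunits q" using qf(2) as(2) unfolding ideal_on_iff[OF qf(1)] by simp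
   moreover have "inv s\<otimes>a = x" unfolding as(1) using \<open>inv s\<in>q\<close> \<open>a\<in>q\<close> subringE(1)[OF qf(1)] by (auto intro: m_comm)
   ultimately show "x\<in>nonunits q\<inter>L" using x unfolding nonunits_def by auto
  qed
 qed
 then show "dominates R q L" using Lq dominates_iff[OF Lf(1) q(1)] by simp
 show "inv s\<in>L" if s: "s\<in>A" "s~=\<zero>" "inv s\<in>q" for s
 proof -
  have "s~:nonunits q" using s unfolding nonunits_def by simp
  then have "\<one>\<otimes>inv s\<in>L" unfolding L_def localization_at_def using s(1) subringE(3)[OF A] by blast
  then show ?thesis using inv_nonzero(1)[of s] s subringE(1)[OF A] by auto
 qed
qed

lemma spec_points_facts:
 assumes A: "subring A R" and L: "L\<in>spec_points R A"
 shows "local_subring L" "A<=L" "L = localization_at R A (nonunits L\<inter>A)"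
  "!!x. x\<in>L ==> EX a:A. EX s:A. s~=\<zero> & inv s\<in>L & x = a\<otimes>inv s"
  "!!P. primeideal P (on_carrier R L) ==> localization_at R L P\<in>spec_points R A"
proof -
 obtain P where P: "primeideal P (on_carrier R A)" "L = localization_at R A P" using L unfolding spec_points_def by auto
 note Lf = localization_facts[OF A P(1), folded P(2)]
 show "local_subring L" "A<=L" by (rule Lf(1), rule Lf(2))
 show "L = localization_at R A (nonunits L\<inter>A)" unfolding Lf(3) by (fact P(2))
 show fr: "EX a:A. EX s:A. s~=\<zero> & inv s\<in>L & x = a\<otimes>inv s" if "x\<in>L" for x using Lf(5)[OF that] by blast
 note Ls = local_subring_facts(1)[OF Lf(1)]
 \<comment> \<open>A localization of \<open>L\<close> is a local ring containing \<open>A\<close>;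
   it coincides with its own center on \<open>A\<close>.\<close>
 show "localization_at R L Q\<in>spec_points R A" if Q: "primeideal Q (on_carrier R L)" for Q
 proof -
  let ?T = "localization_at R L Q"
  note T = localization_facts[OF Ls Q]
  note D = spec_points_dominated[OF A T(1) subset_trans[OF Lf(2) T(2)]]
  let ?D = "localization_at R A (nonunits ?T\<inter>A)"
  have Ds: "subring ?D R" by (rule local_subring_facts(1)[OF D(3)])
  have LD: "L<=?D"
  proof
   fix x assume "x\<in>L"
   from fr[OF this] obtain a s where x: "a\<in>A" "s\<in>A" "s~=\<zero>" "inv s\<in>L" "x = a\<otimes>inv s" by blast
   have "inv s\<in>?D" using D(5)[OF x(2,3)] x(4) T(2) by auto
   then show "x\<in>?D" unfolding x(5) using x(1) D(4) subringE(6)[OF Ds] by auto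
  qed
  have "?T<=?D"
  proof (rule T(6)[OF Ds LD])
   fix s assume s: "s\<in>L - Q"
   then have sn: "s~:nonunits ?T" using T(3) by auto
   have sD: "s\<in>?D" using s LD by auto
   have "nonunits ?T\<inter>?D = nonunits ?D" using D(2) dominates_iff[OF D(3) T(1)] by simp
   then have "s~:nonunits ?D" using sn by auto
   then show "inv s\<in>?D" using sD unfolding nonunits_def by simp
  qed
  moreover have "?D<=?T" using D(2) dominates_iff[OF D(3) T(1)] by simp
  ultimately show ?thesis using D(1) by simp
 qed
qed

end

lemma (in cring) ideal_prod_principal:
 assumes I: "ideal I R" and g: "g\<in>\<K>"
 shows "I \<cdot> {g\<otimes>a | a. a\<in>\<K>} = {a\<otimes>g | a. a\<in>I}"
proof
 note If = ideal_facts[OF I]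
 have "ideal {a\<otimes>g | a. a\<in>I} R"
 proof (rule cidealI)
  show "{a\<otimes>g | a. a\<in>I}<=\<K>" using If(1) g by auto
  show "\<zero>\<in>{a\<otimes>g | a. a\<in>I}" using If(2) g by (auto intro!: exI[of _ \<zero>])
  fix x assume "x\<in>{a\<otimes>g | a. a\<in>I}"
  then obtain a where a: "a\<in>I" "x = a\<otimes>g" by auto
  show "x\<oplus>y\<in>{a\<otimes>g | a. a\<in>I}" if y: "y\<in>{a\<otimes>g | a. a\<in>I}" for y
  proof -
   obtain d where d: "d\<in>I" "y = d\<otimes>g" using y by auto
   have "x\<oplus>y = (a\<oplus>d)\<otimes>g" unfolding a d using a d If(1) g by (subst l_distr) auto
   then show ?thesis using If(3)[OF a(1) d(1)] by blast
  qed
  show "r\<otimes>x\<in>{a\<otimes>g | a. a\<in>I}" if r: "r\<in>\<K>" for r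
  proof -
   have "r\<otimes>x = (r\<otimes>a)\<otimes>g" unfolding a using a If(1) g r by (subst m_assoc) auto
   then show ?thesis using If(4)[OF a(1) r] by blast
  qed
 qed
 then show "I \<cdot> {g\<otimes>a | a. a\<in>\<K>}<={a\<otimes>g | a. a\<in>I}"
 proof (rule ideal_prod_sub)
  fix i j assume i: "i\<in>I" and "j\<in>{g\<otimes>a | a. a\<in>\<K>}"
  then obtain a where a: "a\<in>\<K>" "j = g\<otimes>a" by auto
  have ic: "i\<in>\<K>" using i If(1) by auto
  have "i\<otimes>j = (a\<otimes>i)\<otimes>g" unfolding a(2) using a(1) ic g by algebra
  then show "i\<otimes>j\<in>{a\<otimes>g | a. a\<in>I}" using If(4)[OF i a(1)] by blast
 qed
 show "{a\<otimes>g | a. a\<in>I}<=I \<cdot> {g\<otimes>a | a. a\<in>\<K>}"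
 proof
  fix x assume "x\<in>{a\<otimes>g | a. a\<in>I}"
  then obtain a where a: "a\<in>I" "x = a\<otimes>g" by auto
  have "g\<in>{g\<otimes>a | a. a\<in>\<K>}" using g by (auto intro!: exI[of _ \<one>])
  then show "x\<in>I \<cdot> {g\<otimes>a | a. a\<in>\<K>}" unfolding a(2) using a(1) by (intro ideal_prod.prod)
 qed
qed

lemma (in cring) ideal_pow_principal:
 assumes f: "f\<in>\<K>"
 shows "ideal_pow R {f\<otimes>a | a. a\<in>\<K>} n = {f [^] n\<otimes>a | a. a\<in>\<K>}"
proof (induction n)
 case 0
 show ?case unfolding ideal_pow_0 by (force intro: l_one[symmetric])
next
 case (Suc n)
 have "ideal {f [^] n\<otimes>a | a. a\<in>\<K>} R"
 proof -
  have "{f [^] n\<otimes>a | a. a\<in>\<K>} = PIdl (f [^] n)"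
   unfolding cgenideal_def by (intro Collect_cong arg_cong[where f = Ex] ext) (use f in \<open>auto simp: m_comm\<close>)
  then show ?thesis using cgenideal_ideal f by simp
 qed
 note i = ideal_prod_principal[OF this f]
 have "{a\<otimes>f | a. a\<in>{f [^] n\<otimes>a | a. a\<in>\<K>}} = {f [^] Suc n\<otimes>a | a. a\<in>\<K>}" (is "?L = ?R")
 proof -
  have eq: "f [^] Suc n\<otimes>a = (f [^] n\<otimes>a)\<otimes>f" if "a\<in>\<K>" for a using that f by (simp add: m_ac)
  show ?thesis
  proof (intro equalityI subsetI)
   fix x assume "x\<in>?L"
   then obtain a where a: "a\<in>\<K>" and x: "x = (f [^] n\<otimes>a)\<otimes>f" by (elim CollectE exE conjE) simp
   show "x\<in>?R" unfolding x eq[OF a, symmetric] using a by (intro CollectI exI[of _ a]) simp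
  next
   fix x assume "x\<in>?R"
   then obtain a where a: "a\<in>\<K>" and x: "x = f [^] Suc n\<otimes>a" by (elim CollectE exE conjE)
   show "x\<in>?L" unfolding x eq[OF a] using a by (intro CollectI exI[of _ "f [^] n\<otimes>a"] conjI refl exI[of _ a])
  qed
 qed
 then show ?case unfolding ideal_pow_Suc Suc.IH i .
qed

section \<open>Models, charts and blow-ups\<close>

context field
begin

definition chart :: "'a set => 'a set => 'a => 'a set"
 where "chart p C f = generate_ring R (p\<union>{c\<otimes>inv f | c. c\<in>C})"

text \<open>The properties of a model that survive blowing up and passing to open subsets. Points
  are closed under generization; a local ring dominates at most one point, which is separatedness.
  The last clause stands for finite type: near \<open>p\<close> any local ring containing finitely
  many suitable functions has a center on the model, as close to \<open>p\<close> as
  \<open>F\<close> demands.\<close>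

definition good :: "'a set => 'a set set => bool"
 where "good B Z <-> (ALL p:Z. local_subring p & B<=p) &
  (ALL p:Z. ALL P. primeideal P (on_carrier R p) --> localization_at R p P\<in>Z) &
  (ALL q. ALL p:Z. ALL p':Z. local_subring q --> dominates R q p --> dominates R q p' --> p = p') &
  (ALL p:Z. ALL F. finite F --> F<=p --> (EX H. finite H & H<=p &
   (ALL q. local_subring q --> B\<union>H<=q --> (EX p':Z. dominates R q p' & F<=p'))))"

lemma good_facts:
 assumes "good B Z"
 shows "!!p. p\<in>Z ==> local_subring p" "!!p. p\<in>Z ==> subring p R" "!!p. p\<in>Z ==> B<=p"
  "!!p P. p\<in>Z ==> primeideal P (on_carrier R p) ==> localization_at R p P\<in>Z"
  "!!q p p'. local_subring q ==> p\<in>Z ==> p'\<in>Z ==> dominates R q p ==> dominates R q p' ==> p = p'"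
  "!!p F. p\<in>Z ==> finite F ==> F<=p ==> EX H. finite H & H<=p &
   (ALL q. local_subring q --> B\<union>H<=q --> (EX p':Z. dominates R q p' & F<=p'))"
 using assms local_subring_facts(1) unfolding good_def by simp_all

lemma dominates_inv:
 assumes "dominates R q p" "local_subring p" "local_subring q" "s\<in>p" "s~=\<zero>" "inv s\<in>q"
 shows "inv s\<in>p" using assms dominates_iff[OF assms(2,3)] unfolding nonunits_def by auto

lemma dominates_trans:
 assumes "dominates R q p" "dominates R p p'" "local_subring p'" "local_subring p" "local_subring q"
 shows "dominates R q p'" using assms(1,2) unfolding dominates_iff[OF assms(3,4)] dominates_iff[OF assms(4,5)] dominates_iff[OF assms(3,5)] by blast

text \<open>Finitely many elements of a local ring are regular wherever their numerators are regular
  and their denominators are invertible; this turns neighbourhoods into finite conditions.\<close>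

lemma finite_fractions:
 assumes A: "subring A R" and L: "L\<in>spec_points R A" and F: "finite F" "F<=L"
 shows "EX E S. finite E & E<=A & finite S & S<=A - {\<zero>} & m_inv R ` S<=L &
  (ALL T. subring T R --> E<=T --> m_inv R ` S<=T --> F<=T)"
proof -
 have "ALL x:F. EX as. fst as\<in>A & snd as\<in>A & snd as~=\<zero> & inv (snd as)\<in>L & x = fst as\<otimes>inv (snd as)"
 proof
  fix x assume "x\<in>F"
  then have "x\<in>L" using F by auto
  from spec_points_facts(4)[OF A L this] obtain a s where "a\<in>A" "s\<in>A" "s~=\<zero>" "inv s\<in>L" "x = a\<otimes>inv s" by blast
  then show "EX as. fst as\<in>A & snd as\<in>A & snd as~=\<zero> & inv (snd as)\<in>L & x = fst as\<otimes>inv (snd as)"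
   by (intro exI[of _ "(a, s)"]) simp
 qed
 from bchoice[OF this] obtain g where g: "!!x. x\<in>F ==> fst (g x)\<in>A" "!!x. x\<in>F ==> snd (g x)\<in>A - {\<zero>}"
  "!!x. x\<in>F ==> inv (snd (g x))\<in>L" "!!x. x\<in>F ==> x = fst (g x)\<otimes>inv (snd (g x))" by auto
 have "F<=T" if T: "subring T R" "(fst\<circ>g) ` F<=T" "m_inv R ` ((snd\<circ>g) ` F)<=T" for T
 proof
  fix x assume x: "x\<in>F"
  have "fst (g x)\<otimes>inv (snd (g x))\<in>T" using T x by (intro subringE(6)[OF T(1)]) auto
  then show "x\<in>T" using g(4)[OF x] by simp
 qed
 moreover have "finite ((fst\<circ>g) ` F)" "finite ((snd\<circ>g) ` F)" "(fst\<circ>g) ` F<=A"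
  "(snd\<circ>g) ` F<=A - {\<zero>}" "m_inv R ` ((snd\<circ>g) ` F)<=L" using F(1) g(1,2,3) by auto
 ultimately show ?thesis by (intro exI[of _ "(fst\<circ>g) ` F"] exI[of _ "(snd\<circ>g) ` F"]) simp
qed

text \<open>A local ring containing \<open>B\<close> has a center on \<open>Spec B\<close>. For the
  last clause of \<open>good\<close> the inverses of the denominators of \<open>F\<close> are
  required as well, which forces \<open>F\<close> into the center.\<close>

lemma good_spec_points:
 assumes B: "subring B R" shows "good B (spec_points R B)" unfolding good_def
proof (intro conjI ballI allI impI)
 fix p assume p: "p\<in>spec_points R B"
 note pf = spec_points_facts[OF B p]
 show "local_subring p" "B<=p" by (rule pf(1), rule pf(2))
 show "localization_at R p P\<in>spec_points R B" if "primeideal P (on_carrier R p)" for P by (rule pf(5)[OF that])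
 fix F assume F: "finite F" "F<=p"
 obtain E S where E: "E<=B" "finite S" "S<=B - {\<zero>}" "m_inv R ` S<=p"
  and T: "!!T. subring T R ==> E<=T ==> m_inv R ` S<=T ==> F<=T"
  using finite_fractions[OF B p F] by (elim exE conjE) metis
 show "EX H. finite H & H<=p & (ALL q. local_subring q --> B\<union>H<=q --> (\<exists>p'\<in>spec_points R B. dominates R q p' & F<=p'))"
 proof (intro exI[of _ "m_inv R ` S"] conjI allI impI)
  fix q assume q: "local_subring q" "B\<union>m_inv R ` S<=q"
  have Bq: "B<=q" using q by simp
  note D = spec_points_dominated[OF B q(1) Bq]
  have "F<=localization_at R B (nonunits q\<inter>B)"
  proof (rule T[OF local_subring_facts(1)[OF D(3)]])
   show "m_inv R ` S<=localization_at R B (nonunits q\<inter>B)"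
   proof (rule image_subsetI)
    fix s assume "s\<in>S"
    then show "inv s\<in>localization_at R B (nonunits q\<inter>B)" using E(3) q(2) by (intro D(5)) auto
   qed
  qed (use E(1) D(4) in auto)
  with D(1,2) show "\<exists>p'\<in>spec_points R B. dominates R q p' & F<=p'" by blast
 next
  show "finite (m_inv R ` S)" "m_inv R ` S<=p" using E(2,4) by simp_all
 qed
next
 have key: "p = localization_at R B (nonunits q\<inter>B)"
  if q: "local_subring q" and p: "p\<in>spec_points R B" and d: "dominates R q p" for q p
 proof -
  note pf = spec_points_facts[OF B p]
  have "nonunits q\<inter>B = nonunits p\<inter>B" using d pf(2) unfolding dominates_iff[OF pf(1) q] by blast
  then show ?thesis using pf(3) by simp
 qed
 fix q p p' assume "p\<in>spec_points R B" "p'\<in>spec_points R B" "local_subring q" "dominates R q p" "dominates R q p'"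
 then show "p = p'" using key[of q p] key[of q p'] by simp
qed

lemma good_open:
 assumes Z: "good B Z" and U: "zariski_open Z U" shows "good B U"
proof -
 note g = good_facts[OF Z]
 have UZ: "U<=Z" using U unfolding zariski_open_def by simp
 have nbhd: "EX G. finite G & G<=p & (ALL q:Z. G<=q --> q\<in>U)" if "p\<in>U" for p
 proof -
  have "EX G. finite G & G<=p & {q\<in>Z. G<=q}<=U" using U that unfolding zariski_open_def by simp
  then obtain G where "finite G" "G<=p" "{q\<in>Z. G<=q}<=U" by (elim exE conjE)
  then show ?thesis by (intro exI[of _ G]) auto
 qed
 show ?thesis unfolding good_def
 proof (intro conjI ballI allI impI)
  fix p assume p: "p\<in>U"
  then have pZ: "p\<in>Z" using UZ by auto
  show "local_subring p" "B<=p" using g(1,3)[OF pZ] .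
  obtain G where G: "finite G" "G<=p" "!!q. q\<in>Z ==> G<=q ==> q\<in>U" using nbhd[OF p] by (elim exE conjE) simp
  show "localization_at R p P\<in>U" if P: "primeideal P (on_carrier R p)" for P
   using G(2) localization_facts(2)[OF g(2)[OF pZ] P] by (intro G(3) g(4)[OF pZ P]) auto
  fix F assume F: "finite F" "F<=p"
  have FG: "finite (F\<union>G)" "F\<union>G<=p" using F G by auto
  obtain H where H: "finite H" "H<=p" and
   Hq: "ALL q. local_subring q --> B\<union>H<=q --> (EX p':Z. dominates R q p' & F\<union>G<=p')"
   using g(6)[OF pZ FG] by (elim exE conjE)
  show "EX H. finite H & H<=p & (ALL q. local_subring q --> B\<union>H<=q --> (EX p':U. dominates R q p' & F<=p'))"
  proof (intro exI[of _ H] conjI allI impI H)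
   fix q assume q: "local_subring q" "B\<union>H<=q"
   then obtain p' where "p'\<in>Z" "dominates R q p'" "F\<union>G<=p'" using Hq[rule_format, OF q] by blast
   then show "EX p':U. dominates R q p' & F<=p'" using G(3)[of p'] by auto
  qed
 next
  fix q p p' assume "p\<in>U" "p'\<in>U" "local_subring q" "dominates R q p" "dominates R q p'"
  then show "p = p'" using g(5) UZ by blast
 qed
qed

lemma ideal_sheaf_near:
 assumes "ideal_sheaf R Z C" "p\<in>Z" shows "ideal (C p) (on_carrier R p)"
  "EX F G. finite F & finite G & F\<union>G<=p & (ALL q:Z. G<=q --> F<=q & C q = span_in q F)"
proof -
 show "ideal (C p) (on_carrier R p)" using assms unfolding ideal_sheaf_def by blast
 have "EX F W. finite F & zariski_open Z W & p\<in>W & (ALL q:W. F<=q & C q = span_in q F)"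
  using assms unfolding ideal_sheaf_def by simp
 then obtain F W where F: "finite F" "zariski_open Z W" "p\<in>W" and FW: "ALL q:W. F<=q & C q = span_in q F"
  by (elim exE conjE)
 have "EX G. finite G & G<=p & {q\<in>Z. G<=q}<=W" using F(2,3) unfolding zariski_open_def by simp
 then obtain G where G: "finite G" "G<=p" "{q\<in>Z. G<=q}<=W" by (elim exE conjE)
 show "EX F G. finite F & finite G & F\<union>G<=p & (ALL q:Z. G<=q --> F<=q & C q = span_in q F)"
 proof (intro exI conjI ballI impI)
  show "finite F" "finite G" by fact+
  show "F\<union>G<=p" using bspec[OF FW F(3)] G(2) by simp
  fix q assume "q\<in>Z" "G<=q"
  then have "q\<in>W" using G(3) by auto
  from bspec[OF FW this] show "F<=q" "C q = span_in q F" by simp_all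
 qed
qed

lemma ideal_sheaf_obtain:
 assumes C: "ideal_sheaf R Z C" and p: "p\<in>Z"
 obtains F G where "finite F" "finite G" "F<=p" "G<=p"
  "!!q. q\<in>Z ==> G<=q ==> F<=q" "!!q. q\<in>Z ==> G<=q ==> C q = span_in q F"
proof -
 obtain F G where F: "finite F" "finite G" "F\<union>G<=p" and FG: "ALL q:Z. G<=q --> F<=q & C q = span_in q F"
  using ideal_sheaf_near(2)[OF C p] by (elim exE conjE)
 show ?thesis by (rule that[OF F(1,2)]) (use F(3) FG in simp_all)
qed

lemma ideal_sheaf_generization:
 assumes Z: "good B Z" and C: "ideal_sheaf R Z C" and p: "p\<in>Z" and q: "q\<in>Z" "p<=q"
 shows "C q = span_in q (C p)"
proof -
 obtain F G where F: "finite F" "finite G" "F<=p" "G<=p" "!!q. q\<in>Z ==> G<=q ==> F<=q"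
  "!!q. q\<in>Z ==> G<=q ==> C q = span_in q F" using ideal_sheaf_obtain[OF C p] by metis
 have "C p = span_in p F" by (rule F(6)[OF p F(4)])
 moreover have "C q = span_in q F" by (rule F(6)[OF q(1) subset_trans[OF F(4) q(2)]])
 moreover have "span_in q (span_in p F) = span_in q F" by (rule span_in_span_in[OF good_facts(2)[OF Z p] good_facts(2)[OF Z q(1)] q(2) F(3)])
 ultimately show ?thesis by simp
qed

lemma span_in_divide:
 assumes p: "subring p R" and q: "subring q R" and pq: "p<=q" and F: "F<=p" and g: "g\<in>\<K>"
  and Fg: "!!c. c\<in>F ==> c\<otimes>g\<in>I" and I: "ideal I (on_carrier R q)"
 shows "c\<in>span_in p F ==> c\<otimes>g\<in>I"
proof -
 have Ii: "I<=q" "\<zero>\<in>I" "!!a d. a\<in>I ==> d\<in>I ==> a\<oplus>d\<in>I" "!!a r. a\<in>I ==> r\<in>q ==> r\<otimes>a\<in>I"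
  using I unfolding ideal_on_iff[OF q] by auto
 note pc = subringE[OF p]
 have "ideal {c\<in>p. c\<otimes>g\<in>I} (on_carrier R p)" unfolding ideal_on_iff[OF p]
 proof (intro conjI ballI)
  show "\<zero>\<in>{c\<in>p. c\<otimes>g\<in>I}" using pc(2) g Ii(2) by simp
  fix a assume a: "a\<in>{c\<in>p. c\<otimes>g\<in>I}"
  show "a\<oplus>d\<in>{c\<in>p. c\<otimes>g\<in>I}" if "d\<in>{c\<in>p. c\<otimes>g\<in>I}" for d
   using a that pc(1,7) g Ii(3) by (auto simp: l_distr subset_iff)
  show "r\<otimes>a\<in>{c\<in>p. c\<otimes>g\<in>I}" if "r\<in>p" for r using a that pc(1,6) g Ii(4) pq by (auto simp: m_assoc subset_iff)
 qed auto
 then have "span_in p F<={c\<in>p. c\<otimes>g\<in>I}" using F Fg by (intro span_in_facts(4)[OF p F]) auto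
 then show "c\<in>span_in p F ==> c\<otimes>g\<in>I" by auto
qed

text \<open>A chart over \<open>p\<close> is controlled by the quotients of generators of the
  center. With finitely many generators this makes containment of a chart an open condition.\<close>

lemma chart_subset:
 assumes p: "subring p R" and q: "subring q R" and pq: "p<=q" and F: "F<=p" and f: "f\<in>p" "f~=\<zero>"
  and Fq: "!!c. c\<in>F ==> c\<otimes>inv f\<in>q" shows "chart p (span_in p F) f<=q"
proof -
 have fc: "f\<in>\<K>" using f subringE(1)[OF p] by auto
 note i = inv_nonzero(1)[OF fc f(2)]
 have "ideal q (on_carrier R q)" using subringE[OF q] unfolding ideal_on_iff[OF q] by simp
 note d = span_in_divide[OF p q pq F i Fq this]
 show ?thesis unfolding chart_def by (rule generate_ring_min_subring1[OF _ q]) (use d pq subringE(1)[OF q] in auto)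
qed

lemma chart_facts:
 assumes p: "subring p R" and C: "C<=p" and f: "f\<in>p" "f~=\<zero>"
 shows "subring (chart p C f) R" "p<=chart p C f" "!!c. c\<in>C ==> c\<otimes>inv f\<in>chart p C f"
proof -
 have "f\<in>\<K>" using f subringE(1)[OF p] by auto
 from inv_nonzero(1)[OF this f(2)] have "p\<union>{c\<otimes>inv f | c. c\<in>C}<=\<K>" using C subringE(1)[OF p] by auto
 then show "subring (chart p C f) R" unfolding chart_def by (rule generate_ring_is_subring)
 show "p<=chart p C f" "!!c. c\<in>C ==> c\<otimes>inv f\<in>chart p C f" unfolding chart_def by (auto intro: generate_ring.incl)
qed

lemma blowup_iff: "q\<in>blowup R Z C <-> (EX p:Z. \<exists>f\<in>C p. f~=\<zero> & q\<in>spec_points R (chart p (C p) f))"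
 unfolding blowup_def chart_def by blast

lemma spec_points_mono:
 assumes A: "subring A R" and A': "subring A' R" "A<=A'" "A'<=q" and q: "q\<in>spec_points R A"
 shows "q\<in>spec_points R A'"
proof -
 note qf = spec_points_facts[OF A q]
 note D = spec_points_dominated[OF A'(1) qf(1) A'(3)]
 let ?L = "localization_at R A' (nonunits q\<inter>A')"
 have "q<=?L"
 proof
  fix x assume "x\<in>q"
  from qf(4)[OF this] obtain a s where x: "a\<in>A" "s\<in>A" "s~=\<zero>" "inv s\<in>q" "x = a\<otimes>inv s" by blast
  have "inv s\<in>?L" using D(5)[OF _ x(3,4)] x(2) A'(2) by auto
  then show "x\<in>?L" unfolding x(5) using x(1) A'(2) D(4) subringE(6)[OF local_subring_facts(1)[OF D(3)]] by auto
 qed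
 moreover have "?L<=q" using D(2) dominates_iff[OF D(3) qf(1)] by simp
 ultimately show ?thesis using D(1) by simp
qed

text \<open>In the definition of a blow-up the base \<open>p1\<close> of a chart need not be the
  image of \<open>q\<close>. It is replaced by the center \<open>p\<close> of \<open>q\<close> on
  \<open>Spec p1\<close>, a generization of \<open>p1\<close>, and the chart grows accordingly
  without leaving \<open>q\<close>.\<close>

lemma blowup_point:
 assumes Z: "good B Z" and C: "ideal_sheaf R Z C" and q: "q\<in>blowup R Z C"
 shows "EX p:Z. \<exists>f\<in>C p. f~=\<zero> & local_subring q & dominates R q p & q\<in>spec_points R (chart p (C p) f)"
proof -
 note g = good_facts[OF Z]
 obtain p1 f where p1: "p1\<in>Z" "f\<in>C p1" "f~=\<zero>" "q\<in>spec_points R (chart p1 (C p1) f)" using q unfolding blowup_iff by blast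
 note p1s = g(2)[OF p1(1)]
 have C1: "C p1<=p1" using ideal_sheaf_near(1)[OF C p1(1)] unfolding ideal_on_iff[OF p1s] by simp
 have f1: "f\<in>p1" using C1 p1 by auto
 have fi: "inv f\<in>\<K>" using inv_nonzero(1)[of f] f1 p1(3) subringE(1)[OF p1s] by auto
 note ch1 = chart_facts[OF p1s C1 f1 p1(3)]
 note qf = spec_points_facts[OF ch1(1) p1(4)]
 note qs = local_subring_facts(1)[OF qf(1)]
 have p1q: "p1<=q" using ch1(2) qf(2) by simp
 note D = spec_points_dominated[OF p1s qf(1) p1q]
 define p where "p = localization_at R p1 (nonunits q\<inter>p1)"
 have pZ: "p\<in>Z" using D(1) g(4)[OF p1(1)] unfolding p_def[symmetric] spec_points_def by blast
 have d: "dominates R q p" and pl: "local_subring p" and p1p: "p1<=p" using D unfolding p_def by auto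
 have pq: "p<=q" using d dominates_iff[OF pl qf(1)] by simp
 note ps = g(2)[OF pZ]
 have Cp: "C p = span_in p (C p1)" by (rule ideal_sheaf_generization[OF Z C p1(1) pZ p1p])
 have C1p: "C p1<=p" using C1 p1p by simp
 have C1C: "C p1<=C p" unfolding Cp by (rule span_in_facts(2)[OF ps C1p])
 have Cpp: "C p<=p" unfolding Cp by (rule span_in_facts(3)[OF ps C1p])
 have fp: "f\<in>p" using f1 p1p by auto
 have sub: "chart p (C p) f<=q" unfolding Cp by (rule chart_subset[OF ps qs pq C1p fp p1(3)]) (use ch1(3) qf(2) in auto)
 have "chart p1 (C p1) f<=chart p (C p) f" unfolding chart_def by (rule generate_ring_subset) (use p1p C1C in auto)
 from spec_points_mono[OF ch1(1) chart_facts(1)[OF ps Cpp fp p1(3)] this sub p1(4)]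
 show ?thesis using pZ C1C p1(2,3) qf(1) d by blast
qed

end

context field
begin

lemma good_obtain:
 assumes "good B Z" "p\<in>Z" "finite F" "F<=p"
 obtains H where "finite H" "H<=p"
  "!!q. local_subring q ==> B<=q ==> H<=q ==> EX p'. p'\<in>Z & dominates R q p' & F<=p'"
proof -
 obtain H where H: "finite H" "H<=p"
  and Hq: "ALL q. local_subring q --> B\<union>H<=q --> (EX p':Z. dominates R q p' & F<=p')"
  using good_facts(6)[OF assms] by (elim exE conjE)
 show ?thesis by (rule that[OF H]) (use Hq in auto)
qed

lemma blowup_point_obtain:
 assumes "good B Z" "ideal_sheaf R Z C" "q\<in>blowup R Z C"
 obtains p f where "p\<in>Z" "f\<in>C p" "f~=\<zero>" "local_subring q" "dominates R q p" "q\<in>spec_points R (chart p (C p) f)"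
 using blowup_point[OF assms] by (elim bexE conjE)

lemma dominates_subset: "dominates R q p ==> p<=q" unfolding dominates_def by simp

text \<open>For the finiteness clause: all data of a chart at \<open>q\<close> involve finitely many
  elements of \<open>p\<close>, and these persist at points near \<open>p\<close>. For
  separatedness: two points dominated by one local ring lie over the same \<open>p\<close>, and each
  contains the chart of the other.\<close>

lemma good_blowup:
 assumes Z: "good B Z" and C: "ideal_sheaf R Z C" shows "good B (blowup R Z C)"
proof -
 note g = good_facts[OF Z]
 have Cp: "C p<=p" if "p\<in>Z" for p using ideal_sheaf_near(1)[OF C that] unfolding ideal_on_iff[OF g(2)[OF that]] by simp
 note bp = blowup_point_obtain[OF Z C]
 show ?thesis unfolding good_def
 proof (intro conjI ballI allI impI)
  fix q assume q: "q\<in>blowup R Z C"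
  obtain p f where p: "p\<in>Z" "f\<in>C p" "f~=\<zero>" "local_subring q" "dominates R q p" "q\<in>spec_points R (chart p (C p) f)"
   using bp[OF q] by metis
  note ps = g(2)[OF p(1)]
  have fp: "f\<in>p" using p(2) Cp[OF p(1)] by auto
  note ch = chart_facts[OF ps Cp[OF p(1)] fp p(3)]
  note qs = local_subring_facts(1)[OF p(4)]
  note pq = dominates_subset[OF p(5)]
  note qf = spec_points_facts[OF ch(1) p(6)]
  show "local_subring q" by (rule p(4))
  show "B<=q" using g(3)[OF p(1)] pq by simp
  show "localization_at R q P\<in>blowup R Z C" if "primeideal P (on_carrier R q)" for P unfolding blowup_iff using qf(5)[OF that] p(1-3) by blast
  fix F assume F: "finite F" "F<=q"
  obtain E S where ES: "finite E" "E<=chart p (C p) f" "finite S" "S<=chart p (C p) f - {\<zero>}" "m_inv R ` S<=q"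
   and T: "!!T. subring T R ==> E<=T ==> m_inv R ` S<=T ==> F<=T"
   using finite_fractions[OF ch(1) p(6) F] by (elim exE conjE) simp
  obtain FC W where FC: "finite FC" "finite W" "FC<=p" "W<=p" "!!q. q\<in>Z ==> W<=q ==> FC<=q"
   "!!q. q\<in>Z ==> W<=q ==> C q = span_in q FC" using ideal_sheaf_obtain[OF C p(1)] by metis
  have Cpe: "C p = span_in p FC" by (rule FC(6)[OF p(1) FC(4)])
  let ?D = "(%c. c\<otimes>inv f) ` FC"
  have fc: "f\<in>\<K>" using fp subringE(1)[OF ps] by auto
  note fi = inv_nonzero(1)[OF fc p(3)]
  have Tc: "p\<union>?D<=\<K>" using subringE(1)[OF ps] FC(3) fi by auto
  have "chart p (C p) f<=generate_ring R (p\<union>?D)" unfolding Cpe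
  proof (rule chart_subset[OF ps generate_ring_is_subring[OF Tc] _ FC(3) fp p(3)])
   show "p<=generate_ring R (p\<union>?D)" by (auto intro: generate_ring.incl)
   show "c\<otimes>inv f\<in>generate_ring R (p\<union>?D)" if "c\<in>FC" for c using that by (auto intro: generate_ring.incl)
  qed
  then have "ALL x:E\<union>S. EX G. finite G & G<=p & x\<in>generate_ring R (G\<union>?D)"
   using ES(2,4) by (intro ballI generate_ring_finite) auto
  from bchoice[OF this] obtain G where G: "!!x. x\<in>E\<union>S ==> finite (G x)" "!!x. x\<in>E\<union>S ==> G x<=p"
   "!!x. x\<in>E\<union>S ==> x\<in>generate_ring R (G x\<union>?D)" by metis
  obtain Ef where Ef: "finite Ef" "Ef<=p" "!!q. subring q R ==> Ef\<union>FC<=q ==> f\<in>span_in q FC"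
   using span_in_finite_coefficients[OF ps FC(3) p(2)[unfolded Cpe]] by (elim exE conjE) simp
  \<comment> \<open>Everything from \<open>p\<close> on which the chart at \<open>q\<close> relies:
    coefficients of numerators and denominators, coefficients expressing \<open>f\<close> by
    generators of the center, and functions marking where these generators are valid.\<close>
  define F1 where "F1 = (\<Union>x\<in>E\<union>S. G x)\<union>Ef\<union>W"
  have F1: "finite F1" "F1<=p" unfolding F1_def using G(1,2) Ef(1,2) FC(2,4) ES(1,3) by auto
  obtain H where H: "finite H" "H<=p"
   "!!q. local_subring q ==> B<=q ==> H<=q ==> EX p'. p'\<in>Z & dominates R q p' & F1<=p'"
   using good_obtain[OF Z p(1) F1] by metis
  have Dq: "?D<=q" using ch(3) qf(2) span_in_facts(2)[OF ps FC(3)] unfolding Cpe by auto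
  show "EX H. finite H & H<=q & (ALL r. local_subring r --> B\<union>H<=r --> (\<exists>q'\<in>blowup R Z C. dominates R r q' & F<=q'))"
  proof (intro exI[of _ "H\<union>?D\<union>m_inv R ` S"] conjI allI impI)
   show "finite (H\<union>?D\<union>m_inv R ` S)" using H(1) FC(1) ES(3) by simp
   show "H\<union>?D\<union>m_inv R ` S<=q" using H(2) pq Dq ES(5) by auto
   fix r assume r: "local_subring r" "B\<union>(H\<union>?D\<union>m_inv R ` S)<=r"
   then have rB: "B<=r" "H<=r" and rD: "?D<=r" and rS: "m_inv R ` S<=r" by simp_all
   obtain p' where p': "p'\<in>Z" "dominates R r p'" "F1<=p'" using H(3)[OF r(1) rB] by blast
   note p's = g(2)[OF p'(1)] and p'r = dominates_subset[OF p'(2)] and rs = local_subring_facts(1)[OF r(1)]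
   have Wp': "W<=p'" and Efp': "Ef<=p'" using p'(3) unfolding F1_def by auto
   have FCp': "FC<=p'" by (rule FC(5)[OF p'(1) Wp'])
   have Cp': "C p' = span_in p' FC" by (rule FC(6)[OF p'(1) Wp'])
   have fC: "f\<in>C p'" unfolding Cp' using Ef(3)[OF p's] Efp' FCp' by simp
   have fp': "f\<in>p'" using fC Cp[OF p'(1)] by auto
   have ch': "chart p' (C p') f<=r" unfolding Cp' by (rule chart_subset[OF p's rs p'r FCp' fp' p(3)]) (use rD in auto)
   note ch'f = chart_facts[OF p's Cp[OF p'(1)] fp' p(3)]
   note D = spec_points_dominated[OF ch'f(1) r(1) ch']
   let ?L = "localization_at R (chart p' (C p') f) (nonunits r\<inter>chart p' (C p') f)"
   have ESin: "x\<in>chart p' (C p') f" if x: "x\<in>E\<union>S" for x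
   proof -
    have "G x\<union>?D<=chart p' (C p') f" using p'(3) x ch'f(2,3) span_in_facts(2)[OF p's FCp'] unfolding F1_def Cp' by blast
    then have "generate_ring R (G x\<union>?D)<=chart p' (C p') f"
     by (intro generate_ring_min_subring1[OF _ ch'f(1)]) (use subringE(1)[OF ch'f(1)] in auto)
    then show ?thesis using G(3)[OF x] by auto
   qed
   have "F<=?L"
   proof (rule T[OF local_subring_facts(1)[OF D(3)]])
    show "E<=?L" using ESin D(4) by auto
    show "m_inv R ` S<=?L"
    proof (rule image_subsetI)
     fix s assume s: "s\<in>S"
     show "inv s\<in>?L" by (rule D(5)) (use s ESin ES(4) rS in auto)
    qed
   qed
   moreover have "?L\<in>blowup R Z C" unfolding blowup_iff using D(1) fC p(3) p'(1) by blast
   ultimately show "\<exists>q'\<in>blowup R Z C. dominates R r q' & F<=q'" using D(2) by blast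
  qed
 next
  have key: "q1<=q2" if q: "local_subring q" and q1: "q1\<in>blowup R Z C" and q2: "q2\<in>blowup R Z C"
   and d1: "dominates R q q1" and d2: "dominates R q q2" for q q1 q2
  proof -
   obtain p1 f1 where p1: "p1\<in>Z" "f1\<in>C p1" "f1~=\<zero>" "local_subring q1" "dominates R q1 p1" "q1\<in>spec_points R (chart p1 (C p1) f1)"
    using bp[OF q1] by metis
   obtain p f2 where p2: "p\<in>Z" "f2\<in>C p" "f2~=\<zero>" "local_subring q2" "dominates R q2 p" "q2\<in>spec_points R (chart p (C p) f2)"
    using bp[OF q2] by metis
   have pp: "p1 = p"
    by (rule g(5)[OF q p1(1) p2(1) dominates_trans[OF d1 p1(5) g(1)[OF p1(1)] p1(4) q] dominates_trans[OF d2 p2(5) g(1)[OF p2(1)] p2(4) q]])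
   note p1 = p1[unfolded pp]
   note ps = g(2)[OF p2(1)]
   have f: "f1\<in>p" "f2\<in>p" using p1(2) p2(2) Cp[OF p2(1)] by auto
   have fc: "f1\<in>\<K>" "f2\<in>\<K>" using f subringE(1)[OF ps] by auto
   note i1 = inv_nonzero[OF fc(1) p1(3)] and i2 = inv_nonzero[OF fc(2) p2(3)]
   note ch1 = chart_facts[OF ps Cp[OF p2(1)] f(1) p1(3)] and ch2 = chart_facts[OF ps Cp[OF p2(1)] f(2) p2(3)]
   note qf1 = spec_points_facts[OF ch1(1) p1(6)] and qf2 = spec_points_facts[OF ch2(1) p2(6)]
   note q2s = local_subring_facts(1)[OF p2(4)]
   have "(f1\<otimes>inv f2)\<otimes>(f2\<otimes>inv f1) = (f1\<otimes>inv f1)\<otimes>(f2\<otimes>inv f2)" using fc i1(1) i2(1) by algebra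
   also have "... = \<one>" using i1(2) i2(2) by simp
   finally have "inv (f1\<otimes>inv f2) = f2\<otimes>inv f1" using fc i1(1) i2(1) by (intro comm_inv_char) auto
   moreover have "f1\<otimes>inv f2\<in>q2" using ch2(3)[OF p1(2)] qf2(2) by auto
   moreover have "f2\<otimes>inv f1\<in>q" using ch1(3)[OF p2(2)] qf1(2) dominates_subset[OF d1] by auto
   moreover have "f1\<otimes>inv f2~=\<zero>" using fc i2 p1(3) by (simp add: integral_iff)
   \<comment> \<open>\<open>f1/f2\<close> lies in \<open>q2\<close> and is invertible in the
     dominating ring \<open>q\<close>, hence invertible in \<open>q2\<close>. This lets
     \<open>q2\<close> contain the chart of \<open>f1\<close>.\<close>
   ultimately have u: "f2\<otimes>inv f1\<in>q2" using dominates_inv[OF d2 p2(4) q, of "f1\<otimes>inv f2"] by simp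
   have "c\<otimes>inv f1\<in>q2" if c: "c\<in>C p" for c
   proof -
    have cc: "c\<in>\<K>" using c Cp[OF p2(1)] subringE(1)[OF ps] by auto
    have "(c\<otimes>inv f2)\<otimes>(f2\<otimes>inv f1) = (f2\<otimes>inv f2)\<otimes>(c\<otimes>inv f1)" using cc fc i1(1) i2(1) by algebra
    also have "... = c\<otimes>inv f1" using i2(2) cc i1(1) by simp
    finally have "c\<otimes>inv f1 = (c\<otimes>inv f2)\<otimes>(f2\<otimes>inv f1)" ..
    moreover have "c\<otimes>inv f2\<in>q2" using ch2(3)[OF c] qf2(2) by auto
    ultimately show ?thesis using subringE(6)[OF q2s] u by simp
   qed
   then have sub: "chart p (C p) f1<=q2" unfolding chart_def using dominates_subset[OF p2(5)] subringE(1)[OF q2s]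
    by (intro generate_ring_min_subring1[OF _ q2s]) auto
   show "q1<=q2"
   proof
    fix x assume "x\<in>q1"
    from qf1(4)[OF this] obtain a s where x: "a\<in>chart p (C p) f1" "s\<in>chart p (C p) f1" "s~=\<zero>" "inv s\<in>q1" "x = a\<otimes>inv s" by blast
    have "inv s\<in>q2" using dominates_inv[OF d2 p2(4) q, of s] x(2,3,4) sub dominates_subset[OF d1] by auto
    then show "x\<in>q2" unfolding x(5) using subringE(6)[OF q2s] x(1) sub by auto
   qed
  qed
  fix q q1 q2 assume "q1\<in>blowup R Z C" "q2\<in>blowup R Z C" "local_subring q" "dominates R q q1" "dominates R q q2"
  then show "q1 = q2" by (intro equalityI key)
 qed
qed

text \<open>On the chart of \<open>f\<close> every \<open>c\<close> in the center is
  \<open>f (c/f)\<close>, so the ideal of the exceptional divisor is generated by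
  \<open>f\<close>.\<close>

lemma blowup_center:
 assumes Z: "good B Z" and C: "ideal_sheaf R Z C" and p: "p\<in>Z" "f\<in>C p" "f~=\<zero>"
  and q: "subring q R" "chart p (C p) f<=q"
 shows "span_in q (C p) = {f\<otimes>a | a. a\<in>q}" and "f\<in>p" and "f\<in>\<K>" and "C p<=p" and "p<=q"
proof -
 note ps = good_facts(2)[OF Z p(1)]
 show Cp: "C p<=p" using ideal_sheaf_near(1)[OF C p(1)] unfolding ideal_on_iff[OF ps] by simp
 show fp: "f\<in>p" using Cp p(2) by auto
 show fc: "f\<in>\<K>" using fp subringE(1)[OF ps] by auto
 note ch = chart_facts[OF ps Cp fp p(3)]
 note i = inv_nonzero[OF fc p(3)]
 show pq: "p<=q" using ch(2) q(2) by simp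
 have Cq: "C p<=q" using Cp pq by simp
 have fq: "f\<in>q" using fp pq by auto
 interpret Q: cring "on_carrier R q" by (rule subring_cring[OF q(1)])
 have "ideal (PIdl\<^bsub>on_carrier R q\<^esub>f) (on_carrier R q)" using Q.cgenideal_ideal fq by simp
 moreover have eq: "PIdl\<^bsub>on_carrier R q\<^esub>f = {f\<otimes>a | a. a\<in>q}" unfolding cgenideal_def using subringE(1)[OF q(1)] fc
  by (intro Collect_cong arg_cong[where f = Ex] ext) (auto simp: m_comm subset_iff)
 ultimately have id: "ideal {f\<otimes>a | a. a\<in>q} (on_carrier R q)" by simp
 show "span_in q (C p) = {f\<otimes>a | a. a\<in>q}"
 proof
  have "c\<in>{f\<otimes>a | a. a\<in>q}" if c: "c\<in>C p" for c
  proof -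
   have cc: "c\<in>\<K>" using c Cp subringE(1)[OF ps] by auto
   have "f\<otimes>(c\<otimes>inv f) = (f\<otimes>inv f)\<otimes>c" using cc fc i(1) by algebra
   then have "c = f\<otimes>(c\<otimes>inv f)" using i(2) cc by simp
   moreover have "c\<otimes>inv f\<in>q" using ch(3)[OF c] q(2) by auto
   ultimately show ?thesis by blast
  qed
  then show "span_in q (C p)<={f\<otimes>a | a. a\<in>q}" by (intro span_in_facts(4)[OF q(1) Cq id]) blast
  have "f\<in>span_in q (C p)" using span_in_facts(2)[OF q(1) Cq] p(2) by auto
  moreover note span_in_facts(1)[OF q(1) Cq]
  ultimately have "f\<otimes>a\<in>span_in q (C p)" if "a\<in>q" for a
   using that fc subringE(1)[OF q(1)] unfolding ideal_on_iff[OF q(1)] by (auto simp: m_comm[of f])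
  then show "{f\<otimes>a | a. a\<in>q}<=span_in q (C p)" by blast
 qed
qed

lemma ideal_prod_pow_principal:
 assumes q: "subring q R" and I: "ideal I (on_carrier R q)" and f: "f\<in>q"
 shows "I \<cdot>\<^bsub>on_carrier R q\<^esub>ideal_pow (on_carrier R q) {f\<otimes>a | a. a\<in>q} n = {a\<otimes>f [^] n | a. a\<in>I}"
proof -
 interpret Q: cring "on_carrier R q" by (rule subring_cring[OF q])
 have pw: "f [^]\<^bsub>on_carrier R q\<^esub>n = f [^] n" using nat_pow_consistent by simp
 have "f [^] n\<in>q" using Q.nat_pow_closed[of f n] f pw by simp
 then show ?thesis using Q.ideal_pow_principal[of f n] Q.ideal_prod_principal[OF I, of "f [^] n"] f pw by simp
qed

end

section \<open>Transforms of ideals and permissibility\<close>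

context field
begin

lemma pow_inv:
 fixes n :: nat assumes "f\<in>\<K>" "f~=\<zero>"
 shows "f [^] n\<in>\<K>" "f [^] n~=\<zero>" "inv f [^] n\<in>\<K>" "f [^] n\<otimes>inv f [^] n = \<one>" "inv f [^] n\<otimes>f [^] n = \<one>"
proof -
 note i = inv_nonzero[OF assms]
 show c: "f [^] n\<in>\<K>" "inv f [^] n\<in>\<K>" using assms i by simp_all
 have "f [^] n\<otimes>inv f [^] n = (f\<otimes>inv f) [^] n" by (rule nat_pow_distrib[symmetric, OF assms(1) i(1)])
 then show e: "f [^] n\<otimes>inv f [^] n = \<one>" using i(2) by simp
 then show "inv f [^] n\<otimes>f [^] n = \<one>" using c by (simp add: m_comm)
 show "f [^] n~=\<zero>" using e c by auto
qed

lemma pow_subring: "subring q R ==> f\<in>q ==> f [^] (n::nat)\<in>q" by (induction n) (simp_all add: subringE(3,6))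

lemma ideal_quotient:
 assumes q: "subring q R" and I: "ideal I (on_carrier R q)" and g: "g\<in>\<K>"
 shows "ideal {a\<in>q. a\<otimes>g\<in>I} (on_carrier R q)"
proof -
 have Ii: "\<zero>\<in>I" "!!a d. a\<in>I ==> d\<in>I ==> a\<oplus>d\<in>I" "!!a r. a\<in>I ==> r\<in>q ==> r\<otimes>a\<in>I"
  using I unfolding ideal_on_iff[OF q] by auto
 show ?thesis unfolding ideal_on_iff[OF q]
 proof (intro conjI ballI)
  show "\<zero>\<in>{a\<in>q. a\<otimes>g\<in>I}" using subringE(2)[OF q] g Ii(1) by simp
  fix a assume a: "a\<in>{a\<in>q. a\<otimes>g\<in>I}"
  show "a\<oplus>d\<in>{a\<in>q. a\<otimes>g\<in>I}" if "d\<in>{a\<in>q. a\<otimes>g\<in>I}" for d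
   using a that subringE(1,7)[OF q] g Ii(2) by (auto simp: l_distr subset_iff)
  show "r\<otimes>a\<in>{a\<in>q. a\<otimes>g\<in>I}" if "r\<in>q" for r using a that subringE(1,6)[OF q] g Ii(3) by (auto simp: m_assoc subset_iff)
 qed auto
qed

text \<open>The quotient of the extended ideal by the \<open>b\<close>-th power of the exceptional
  ideal. Asking the condition for all local equations \<open>f\<close> of the exceptional divisor
  avoids a choice; by \<open>controlled_transform_eq\<close> one of them decides.\<close>

definition controlled_transform :: "'a set set => ('a set => 'a set) => nat => ('a set => 'a set) => 'a set => 'a set"
 where "controlled_transform Z C b J q = {a\<in>q. ALL p:Z. dominates R q p --> (\<forall>f\<in>C p.
  f~=\<zero> --> span_in q (C p) = {f\<otimes>a | a. a\<in>q} --> a\<otimes>f [^] b\<in>span_in q (J p))}"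

text \<open>Any other \<open>g\<close> in the center is a multiple \<open>f v\<close>, so
  \<open>a g^b = v^b (a f^b)\<close>; and the image point \<open>p\<close> is unique because the
  model is separated.\<close>

lemma controlled_transform_eq:
 assumes Z: "good B Z" and C: "ideal_sheaf R Z C" and J: "ideal_sheaf R Z J" and q: "local_subring q"
  and p: "p\<in>Z" "dominates R q p" and f: "f\<in>C p" "f~=\<zero>" "span_in q (C p) = {f\<otimes>a | a. a\<in>q}"
 shows "controlled_transform Z C b J q = {a\<in>q. a\<otimes>f [^] b\<in>span_in q (J p)}"
proof -
 note qs = local_subring_facts(1)[OF q]
 note ps = good_facts(2)[OF Z p(1)]
 have Cp: "C p<=p" "J p<=p" using ideal_sheaf_near(1)[OF C p(1)] ideal_sheaf_near(1)[OF J p(1)] unfolding ideal_on_iff[OF ps] by simp_all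
 have Cq: "C p<=q" "J p<=q" using Cp dominates_subset[OF p(2)] by auto
 have id: "ideal (span_in q (J p)) (on_carrier R q)" by (rule span_in_facts(1)[OF qs Cq(2)])
 have fc: "f\<in>\<K>" using f(1) Cq subringE(1)[OF qs] by auto
 have "a\<otimes>g [^] b\<in>span_in q (J p)"
  if a: "a\<in>q" "a\<otimes>f [^] b\<in>span_in q (J p)" and g: "g\<in>C p" for a g
 proof -
  have "g\<in>{f\<otimes>a | a. a\<in>q}" using span_in_facts(2)[OF qs Cq(1)] g f(3) by auto
  then obtain v where v: "v\<in>q" "g = f\<otimes>v" by blast
  have vc: "v\<in>\<K>" "a\<in>\<K>" using v a subringE(1)[OF qs] by auto
  have "a\<otimes>g [^] b = v [^] b\<otimes>(a\<otimes>f [^] b)" unfolding v(2) using vc fc by (simp add: nat_pow_distrib m_ac)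
  then show ?thesis using id a(2) pow_subring[OF qs v(1), of b] unfolding ideal_on_iff[OF qs] by simp
 qed
 moreover have "p' = p" if "p'\<in>Z" "dominates R q p'" for p' by (rule good_facts(5)[OF Z q that(1) p(1) that(2) p(2)])
 ultimately show ?thesis unfolding controlled_transform_def using p f by blast
qed

text \<open>Once \<open>f^b\<close> divides the extension of \<open>J\<close>, the transform is
  generated by the quotients \<open>x/f^b\<close> of generators \<open>x\<close> of
  \<open>J\<close>. The same quotients generate it at all points near \<open>q\<close> where
  \<open>f\<close> remains an equation of the exceptional divisor, which gives
  quasi-coherence.\<close>

lemma controlled_transform:
 assumes Z: "good B Z" and C: "ideal_sheaf R Z C" and J: "ideal_sheaf R Z J"
  and div: "!!q p f. q\<in>blowup R Z C ==> p\<in>Z ==> dominates R q p ==> f\<in>C p ==> f~=\<zero> ==>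
   q\<in>spec_points R (chart p (C p) f) ==> span_in q (J p)<={f [^] b\<otimes>a | a. a\<in>q}"
 shows "ideal_sheaf R (blowup R Z C) (controlled_transform Z C b J)"
  and "is_transform R Z C b J (controlled_transform Z C b J)"
proof -
 let ?J = "controlled_transform Z C b J"
 note g = good_facts[OF Z]
 note bp = blowup_point_obtain[OF Z C]
 note gb = good_facts[OF good_blowup[OF Z C]]
 have Cp: "C p<=p" "J p<=p" if "p\<in>Z" for p
  using ideal_sheaf_near(1)[OF C that] ideal_sheaf_near(1)[OF J that] unfolding ideal_on_iff[OF g(2)[OF that]] by simp_all
 have tr: "ideal (?J q) (on_carrier R q) & span_in q (J p) = {a\<otimes>f [^] b | a. a\<in>?J q}"
  if q: "q\<in>blowup R Z C" and p: "p\<in>Z" "dominates R q p" "f\<in>C p" "f~=\<zero>" "q\<in>spec_points R (chart p (C p) f)" for q p f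
 proof -
  note qs = gb(2)[OF q] and ps = g(2)[OF p(1)]
  have fp: "f\<in>p" using Cp[OF p(1)] p(3) by auto
  note ch = chart_facts[OF ps Cp(1)[OF p(1)] fp p(4)]
  note bc = blowup_center[OF Z C p(1,3,4) qs spec_points_facts(2)[OF ch(1) p(5)]]
  note fb = pow_inv[OF bc(3) p(4), of b]
  have eq: "?J q = {a\<in>q. a\<otimes>f [^] b\<in>span_in q (J p)}" by (rule controlled_transform_eq[OF Z C J gb(1)[OF q] p(1,2,3,4) bc(1)])
  have Jq: "J p<=q" using Cp(2)[OF p(1)] bc(5) by simp
  have id: "ideal (span_in q (J p)) (on_carrier R q)" by (rule span_in_facts(1)[OF qs Jq])
  have "span_in q (J p)<={a\<otimes>f [^] b | a. a\<in>?J q}"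
  proof
   fix x assume x: "x\<in>span_in q (J p)"
   then have "x\<in>{f [^] b\<otimes>a | a. a\<in>q}" using div[OF q p] by auto
   then obtain a where a: "a\<in>q" "x = f [^] b\<otimes>a" by blast
   moreover have "a\<in>\<K>" using a(1) subringE(1)[OF qs] by auto
   ultimately have "x = a\<otimes>f [^] b" using fb(1) by (simp add: m_comm)
   then show "x\<in>{a\<otimes>f [^] b | a. a\<in>?J q}" unfolding eq using a(1) x by blast
  qed
  moreover have "{a\<otimes>f [^] b | a. a\<in>?J q}<=span_in q (J p)" unfolding eq by auto
  ultimately show ?thesis unfolding eq using ideal_quotient[OF qs id fb(1)] by (simp add: equalityI)
 qed
 show sheaf: "ideal_sheaf R (blowup R Z C) ?J" unfolding ideal_sheaf_def
 proof (intro conjI ballI)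
  fix q assume q: "q\<in>blowup R Z C"
  obtain p f where p: "p\<in>Z" "f\<in>C p" "f~=\<zero>" "local_subring q" "dominates R q p" "q\<in>spec_points R (chart p (C p) f)"
   using bp[OF q] by metis
  note trq = tr[OF q p(1,5,2,3,6)]
  show "ideal (?J q) (on_carrier R q)" using trq by simp
  note ps = g(2)[OF p(1)] and qs = gb(2)[OF q]
  have fp: "f\<in>p" using Cp[OF p(1)] p(2) by auto
  note ch = chart_facts[OF ps Cp(1)[OF p(1)] fp p(3)]
  note chq = spec_points_facts(2)[OF ch(1) p(6)]
  note bc = blowup_center[OF Z C p(1,2,3) qs chq]
  note fb = pow_inv[OF bc(3) p(3), of b]
  obtain FC W where FC: "finite FC" "finite W" "FC<=p" "W<=p" "!!q. q\<in>Z ==> W<=q ==> FC<=q"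
   "!!q. q\<in>Z ==> W<=q ==> C q = span_in q FC" using ideal_sheaf_obtain[OF C p(1)] by metis
  obtain FJ V where FJ: "finite FJ" "finite V" "FJ<=p" "V<=p" "!!q. q\<in>Z ==> V<=q ==> FJ<=q"
   "!!q. q\<in>Z ==> V<=q ==> J q = span_in q FJ" using ideal_sheaf_obtain[OF J p(1)] by metis
  have Cpe: "C p = span_in p FC" and Jpe: "J p = span_in p FJ" by (rule FC(6)[OF p(1) FC(4)], rule FJ(6)[OF p(1) FJ(4)])
  obtain Ef where Ef: "finite Ef" "Ef<=p" "!!q. subring q R ==> Ef\<union>FC<=q ==> f\<in>span_in q FC"
   using span_in_finite_coefficients[OF ps FC(3) p(2)[unfolded Cpe]] by (elim exE conjE) simp
  have F1: "finite (W\<union>V\<union>Ef)" "W\<union>V\<union>Ef<=p" using FC(2,4) FJ(2,4) Ef(1,2) by auto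
  obtain H where H: "finite H" "H<=p"
   "!!q. local_subring q ==> B<=q ==> H<=q ==> EX p'. p'\<in>Z & dominates R q p' & W\<union>V\<union>Ef<=p'"
   using good_obtain[OF Z p(1) F1] by metis
  let ?D = "(%c. c\<otimes>inv f) ` FC" and ?G = "(%x. x\<otimes>inv f [^] b) ` FJ"
  \<comment> \<open>\<open>H\<close> provides an image point close to \<open>p\<close>,
    \<open>?D\<close> keeps \<open>f\<close> an equation of the exceptional divisor, and
    \<open>?G\<close> keeps the proposed generators regular.\<close>
  define N where "N = {r\<in>blowup R Z C. H\<union>?D\<union>?G<=r}"
  have fin: "finite (H\<union>?D\<union>?G)" using H(1) FC(1) FJ(1) by simp
  have "?D<=q" using ch(3) chq span_in_facts(2)[OF ps FC(3)] unfolding Cpe by auto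
  moreover have "?G<=q"
  proof (rule image_subsetI)
   fix x assume x: "x\<in>FJ"
   have "x\<in>J p" unfolding Jpe using span_in_facts(2)[OF ps FJ(3)] x by auto
   then have "x\<in>span_in q (J p)" using span_in_facts(2)[OF qs] Cp(2)[OF p(1)] bc(5) by blast
   then have "x\<in>{a\<otimes>f [^] b | a. a\<in>?J q}" using trq by simp
   then obtain a where a: "a\<in>?J q" "x = a\<otimes>f [^] b" by blast
   then have aq: "a\<in>q" unfolding controlled_transform_def by simp
   then have "a\<in>\<K>" using subringE(1)[OF qs] by auto
   then have "x\<otimes>inv f [^] b = a" unfolding a(2) using fb by (simp add: m_assoc)
   then show "x\<otimes>inv f [^] b\<in>q" using aq by simp
  qed
  ultimately have qN: "q\<in>N" unfolding N_def using q H(2) bc(5) by simp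
  have "zariski_open (blowup R Z C) N" unfolding zariski_open_def
  proof (intro conjI ballI)
   fix r assume "r\<in>N"
   then show "EX F. finite F & F<=r & {q\<in>blowup R Z C. F<=q}<=N"
    unfolding N_def using fin by (intro exI[of _ "H\<union>?D\<union>?G"]) auto
  qed (auto simp: N_def)
  moreover have "?G<=r & ?J r = span_in r ?G" if r: "r\<in>N" for r
  proof
   have rb: "r\<in>blowup R Z C" and rH: "H<=r" and rD: "?D<=r" and rG: "?G<=r" using r unfolding N_def by simp_all
   show "?G<=r" by (rule rG)
   note rs = gb(2)[OF rb]
   obtain p' where p': "p'\<in>Z" "dominates R r p'" "W\<union>V\<union>Ef<=p'" using H(3)[OF gb(1,3)[OF rb] rH] by blast
   note p's = g(2)[OF p'(1)] and p'r = dominates_subset[OF p'(2)]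
   have Wp': "W<=p'" and Vp': "V<=p'" and Efp': "Ef<=p'" using p'(3) by auto
   note FCp' = FC(5)[OF p'(1) Wp'] and FJp' = FJ(5)[OF p'(1) Vp']
   have Cp': "C p' = span_in p' FC" and Jp': "J p' = span_in p' FJ" by (rule FC(6)[OF p'(1) Wp'], rule FJ(6)[OF p'(1) Vp'])
   have fC: "f\<in>C p'" unfolding Cp' using Ef(3)[OF p's] Efp' FCp' by simp
   have fp': "f\<in>p'" using fC Cp[OF p'(1)] by auto
   have ch': "chart p' (C p') f<=r" unfolding Cp' by (rule chart_subset[OF p's rs p'r FCp' fp' p(3)]) (use rD in auto)
   note bc' = blowup_center[OF Z C p'(1) fC p(3) rs ch']
   have FJr: "FJ<=r" using FJp' p'r by simp
   have Jr: "?J r = {a\<in>r. a\<otimes>f [^] b\<in>span_in r FJ}" using controlled_transform_eq[OF Z C J gb(1)[OF rb] p'(1,2) fC p(3) bc'(1), of b]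
     span_in_span_in[OF p's rs p'r FJp'] unfolding Jp' by simp
   have idr: "ideal (?J r) (on_carrier R r)" unfolding Jr by (rule ideal_quotient[OF rs span_in_facts(1)[OF rs FJr] fb(1)])
   show "?J r = span_in r ?G"
   proof
    show "span_in r ?G<=?J r"
    proof (rule span_in_facts(4)[OF rs rG idr], rule image_subsetI)
     fix x assume x: "x\<in>FJ"
     have "x\<in>\<K>" using x FJr subringE(1)[OF rs] by auto
     then have "(x\<otimes>inv f [^] b)\<otimes>f [^] b = x" using fb by (simp add: m_assoc)
     then show "x\<otimes>inv f [^] b\<in>?J r" unfolding Jr using x rG span_in_facts(2)[OF rs FJr] by auto
    qed
    show "?J r<=span_in r ?G"
    proof
     fix a assume "a\<in>?J r"
     then have a: "a\<in>r" "a\<otimes>f [^] b\<in>span_in r FJ" unfolding Jr by simp_all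
     have "(a\<otimes>f [^] b)\<otimes>inv f [^] b\<in>span_in r ?G"
      by (rule span_in_divide[OF rs rs subset_refl FJr fb(3) _ span_in_facts(1)[OF rs rG] a(2)])
       (use span_in_facts(2)[OF rs rG] in auto)
     moreover have "a\<in>\<K>" using a subringE(1)[OF rs] by auto
     ultimately show "a\<in>span_in r ?G" using fb by (simp add: m_assoc)
    qed
   qed
  qed
  ultimately show "EX F W. finite F & zariski_open (blowup R Z C) W & q\<in>W & (ALL q:W. F<=q & ?J q = span_in q F)"
   using qN FJ(1) by (intro exI[of _ ?G] exI[of _ N]) simp
 qed
 show "is_transform R Z C b J ?J" unfolding is_transform_def
 proof (intro conjI ballI impI sheaf)
  fix q p' assume q: "q\<in>blowup R Z C" and p': "p'\<in>Z" "dominates R q p'"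
  obtain p f where p: "p\<in>Z" "f\<in>C p" "f~=\<zero>" "local_subring q" "dominates R q p" "q\<in>spec_points R (chart p (C p) f)"
   using bp[OF q] by metis
  have "p' = p" by (rule g(5)[OF p(4) p'(1) p(1) p'(2) p(5)])
  note trq = tr[OF q p(1,5,2,3,6)]
  note qs = gb(2)[OF q]
  have fp: "f\<in>p" using Cp[OF p(1)] p(2) by auto
  note ch = chart_facts[OF g(2)[OF p(1)] Cp(1)[OF p(1)] fp p(3)]
  note bc = blowup_center[OF Z C p(1,2,3) qs spec_points_facts(2)[OF ch(1) p(6)]]
  have fq: "f\<in>q" using fp bc(5) by auto
  show "span_in q (J p') = ?J q \<cdot>\<^bsub>on_carrier R q\<^esub>ideal_pow (on_carrier R q) (span_in q (C p')) b"
   unfolding \<open>p' = p\<close> bc(1) using trq ideal_prod_pow_principal[OF qs _ fq] by simp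
 qed
qed

text \<open>The exceptional ideal is principal at \<open>q\<close>, so multiplication by its
  \<open>b\<close>-th power is multiplication by \<open>f^b\<close>.\<close>

lemma is_transform_eq:
 assumes Z: "good B Z" and C: "ideal_sheaf R Z C" and tr: "is_transform R Z C b J J'"
  and q: "q\<in>blowup R Z C" and p: "p\<in>Z" "dominates R q p" "f\<in>C p" "f~=\<zero>" "q\<in>spec_points R (chart p (C p) f)"
 shows "span_in q (J p) = {a\<otimes>f [^] b | a. a\<in>J' q}"
proof -
 note qs = good_facts(2)[OF good_blowup[OF Z C] q] and ps = good_facts(2)[OF Z p(1)]
 have Cp: "C p<=p" using ideal_sheaf_near(1)[OF C p(1)] unfolding ideal_on_iff[OF ps] by simp
 have fp: "f\<in>p" using Cp p(3) by auto
 note ch = chart_facts[OF ps Cp fp p(4)]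
 note bc = blowup_center[OF Z C p(1,3,4) qs spec_points_facts(2)[OF ch(1) p(5)]]
 have fq: "f\<in>q" using fp bc(5) by auto
 have J': "ideal (J' q) (on_carrier R q)" using tr q unfolding is_transform_def ideal_sheaf_def by blast
 have "span_in q (J p) = J' q \<cdot>\<^bsub>on_carrier R q\<^esub>ideal_pow (on_carrier R q) (span_in q (C p)) b"
  using tr q p(1,2) unfolding is_transform_def by blast
 then show ?thesis unfolding bc(1) ideal_prod_pow_principal[OF qs J' fq] .
qed

lemma ideal_sheaf_open:
 assumes J: "ideal_sheaf R Z J" and U: "zariski_open Z U" shows "ideal_sheaf R U J" unfolding ideal_sheaf_def
proof (intro conjI ballI)
 have UZ: "U<=Z" using U unfolding zariski_open_def by simp
 fix p assume p: "p\<in>U"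
 then have pZ: "p\<in>Z" using UZ by auto
 show "ideal (J p) (on_carrier R p)" by (rule ideal_sheaf_near(1)[OF J pZ])
 obtain F G where F: "finite F" "finite G" "F<=p" "G<=p" "!!q. q\<in>Z ==> G<=q ==> F<=q"
  "!!q. q\<in>Z ==> G<=q ==> J q = span_in q F" using ideal_sheaf_obtain[OF J pZ] by metis
 have "zariski_open U {q\<in>U. G<=q}" unfolding zariski_open_def using F(2) by (auto intro!: exI[of _ G])
 moreover have "\<forall>q\<in>{q\<in>U. G<=q}. F<=q & J q = span_in q F" using F(5,6) UZ by auto
 ultimately show "EX F W. finite F & zariski_open U W & p\<in>W & (ALL q:W. F<=q & J q = span_in q F)"
  using F(1,4) p by (intro exI[of _ F] exI[of _ "{q\<in>U. G<=q}"]) simp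
qed

primrec controlled_transforms :: "(nat => 'a set set) => (nat => 'a set => 'a set) => nat => ('a set => 'a set) => nat => 'a set => 'a set" where
 "controlled_transforms U C b J 0 = J"
| "controlled_transforms U C b J (Suc i) = controlled_transform (U i) (C i) b (controlled_transforms U C b J i)"

text \<open>The transforms of the pair have to be constructed along with the proof. An invariant
  \<open>Q\<close> of the stalks does both tasks: \<open>sing\<close> places the centers in the
  singular locus, while \<open>step\<close> supplies the divisibility by \<open>f^b\<close> that the
  next transform needs and hands the invariant on.\<close>

lemma permissible_of_invariant:
 assumes Z0: "good B Z\<^sub>0" and lsb: "lsb R Z\<^sub>0 l Z U C" and J: "ideal_sheaf R Z\<^sub>0 J"
  and init: "!!p. p\<in>Z\<^sub>0 ==> Q 0 p (J p)"
  and sing: "!!i p T. enat i < l ==> p\<in>U i ==> good B (U i) ==> ideal T (on_carrier R p) ==> Q i p T ==> C i p~=p ==>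
   T<=ideal_pow (on_carrier R p) (max_ideal (on_carrier R p)) b"
  and step: "!!i p q f T. enat i < l ==> good B (Z i) ==> zariski_open (Z i) (U i) ==> good B (U i) ==> regular_center R (U i) (C i) ==>
   Z (Suc i) = blowup R (U i) (C i) ==> q\<in>Z (Suc i) ==> p\<in>U i ==> dominates R q p ==> f\<in>C i p ==> f~=\<zero> ==>
   q\<in>spec_points R (chart p (C i p) f) ==> ideal T (on_carrier R p) ==> Q i p T ==>
   span_in q T<={f [^] b\<otimes>a | a. a\<in>q} & Q (Suc i) q {a\<in>q. a\<otimes>f [^] b\<in>span_in q T}"
 shows "permissible R J b l Z U C"
proof -
 let ?J = "controlled_transforms U C b J"
 have Z0': "Z 0 = Z\<^sub>0" using lsb unfolding lsb_def by simp
 have lsb': "zariski_open (Z i) (U i)" "regular_center R (U i) (C i)" "Z (Suc i) = blowup R (U i) (C i)" if "enat i < l" for i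
  using lsb that unfolding lsb_def by auto
 define P where "P i <-> good B (Z i) & ideal_sheaf R (Z i) (?J i) & (\<forall>p\<in>Z i. Q i p (?J i p))" for i
 have next_step: "good B (U i) & ideal_sheaf R (U i) (?J i) & (\<forall>p\<in>U i. Q i p (?J i p)) &
   is_transform R (U i) (C i) b (?J i) (?J (Suc i)) & P (Suc i)" if i: "enat i < l" and Pi: "P i" for i
 proof -
  note o = lsb'[OF i]
  have gZ: "good B (Z i)" using Pi unfolding P_def by simp
  have gU: "good B (U i)" by (rule good_open[OF gZ o(1)])
  have sJ: "ideal_sheaf R (U i) (?J i)" using Pi ideal_sheaf_open[OF _ o(1)] unfolding P_def by simp
  have sC: "ideal_sheaf R (U i) (C i)" using o(2) unfolding regular_center_def by simp
  have iU: "Q i p (?J i p)" if "p\<in>U i" for p using Pi o(1) that unfolding P_def zariski_open_def by auto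
  have st: "span_in q (?J i p)<={f [^] b\<otimes>a | a. a\<in>q} & Q (Suc i) q {a\<in>q. a\<otimes>f [^] b\<in>span_in q (?J i p)}"
   if "q\<in>blowup R (U i) (C i)" "p\<in>U i" "dominates R q p" "f\<in>C i p" "f~=\<zero>" "q\<in>spec_points R (chart p (C i p) f)" for q p f
   by (rule step[OF i gZ o(1) gU o(2) o(3) _ that(2-6) ideal_sheaf_near(1)[OF sJ that(2)] iU[OF that(2)]]) (simp add: o(3) that(1))
  note ct = controlled_transform[OF gU sC sJ conjunct1[OF st]]
  have gB: "good B (blowup R (U i) (C i))" by (rule good_blowup[OF gU sC])
  have "Q (Suc i) q (?J (Suc i) q)" if q: "q\<in>blowup R (U i) (C i)" for q
  proof -
   obtain p f where p: "p\<in>U i" "f\<in>C i p" "f~=\<zero>" "local_subring q" "dominates R q p" "q\<in>spec_points R (chart p (C i p) f)"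
    using blowup_point_obtain[OF gU sC q] by metis
   note ps = good_facts(2)[OF gU p(1)]
   have Cp: "C i p<=p" using ideal_sheaf_near(1)[OF sC p(1)] unfolding ideal_on_iff[OF ps] by simp
   have fp: "f\<in>p" using Cp p(2) by auto
   note ch = chart_facts[OF ps Cp fp p(3)]
   note bc = blowup_center[OF gU sC p(1,2,3) good_facts(2)[OF gB q] spec_points_facts(2)[OF ch(1) p(6)]]
   show ?thesis using conjunct2[OF st[OF q p(1,5,2,3,6)]] controlled_transform_eq[OF gU sC sJ p(4,1,5,2,3) bc(1), of b] by simp
  qed
  then show ?thesis unfolding P_def o(3) using gU sJ iU ct gB by simp
 qed
 have P: "P i" if "enat i<=l" for i using that
 proof (induction i)
  case 0
  then show ?case unfolding P_def Z0' using Z0 J init by simp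
 next
  case (Suc i)
  then have "enat i < l" by (simp add: Suc_ile_eq)
  then show ?case using next_step Suc.IH by simp
 qed
 show ?thesis unfolding permissible_def
 proof (intro exI[of _ ?J] conjI ballI allI impI)
  fix i assume i: "enat i < l"
  then have Pi: "P i" using P by simp
  note n = next_step[OF i Pi]
  show "is_transform R (U i) (C i) b (?J i) (?J (Suc i))" using n by simp
  show "closed_support (U i) (C i)<=sing R (U i) (?J i) b" unfolding closed_support_def sing_def
   using sing[OF i] n ideal_sheaf_near(1)[of "U i" "?J i"] by blast
 qed simp
qed

lemma ideal_sheaf_span:
 assumes "finite F" "!!p. p\<in>Z ==> subring p R" "!!p. p\<in>Z ==> F<=p" "!!p. p\<in>Z ==> J p = span_in p F"
 shows "ideal_sheaf R Z J" unfolding ideal_sheaf_def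
proof (intro conjI ballI)
 fix p assume p: "p\<in>Z"
 show "ideal (J p) (on_carrier R p)" unfolding assms(4)[OF p] by (rule span_in_facts(1)[OF assms(2,3)[OF p]])
 show "EX F W. finite F & zariski_open Z W & p\<in>W & (ALL q:W. F<=q & J q = span_in q F)"
  using assms(1,3,4) p unfolding zariski_open_def by (intro exI[of _ F] exI[of _ Z]) (auto intro: exI[of _ "{}"])
qed

lemma ideal_sheaf_cong:
 assumes "ideal_sheaf R Z J" "!!p. p\<in>Z ==> J' p = J p" shows "ideal_sheaf R Z J'" unfolding ideal_sheaf_def
proof (intro conjI ballI)
 fix p assume p: "p\<in>Z"
 show "ideal (J' p) (on_carrier R p)" using ideal_sheaf_near(1)[OF assms(1) p] assms(2)[OF p] by simp
 have "EX F W. finite F & zariski_open Z W & p\<in>W & (ALL q:W. F<=q & J q = span_in q F)"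
  using assms(1) p unfolding ideal_sheaf_def by simp
 then obtain F W where F: "finite F" "zariski_open Z W" "p\<in>W" "ALL q:W. F<=q & J q = span_in q F" by (elim exE conjE)
 then have "ALL q:W. F<=q & J' q = span_in q F" using assms(2) unfolding zariski_open_def by auto
 then show "EX F W. finite F & zariski_open Z W & p\<in>W & (ALL q:W. F<=q & J' q = span_in q F)"
  using F(1-3) by (intro exI[of _ F] exI[of _ W]) simp
qed

lemma permissible_obtain:
 assumes lsb: "lsb R Z\<^sub>0 l Z U C" and J: "ideal_sheaf R Z\<^sub>0 J" and perm: "permissible R J b l Z U C"
 obtains Js where "!!p. p\<in>Z\<^sub>0 ==> Js 0 p = J p" "!!i. enat i < l ==> ideal_sheaf R (U i) (Js i)"
  "!!i p. enat i < l ==> p\<in>U i ==> C i p~=p ==> Js i p<=ideal_pow (on_carrier R p) (max_ideal (on_carrier R p)) b"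
  "!!i. enat i < l ==> is_transform R (U i) (C i) b (Js i) (Js (Suc i))"
proof -
 have Z0: "Z 0 = Z\<^sub>0" and op: "!!i. enat i < l ==> zariski_open (Z i) (U i)" "!!i. enat i < l ==> Z (Suc i) = blowup R (U i) (C i)"
  using lsb unfolding lsb_def by auto
 obtain Js where Js: "\<forall>p\<in>Z 0. Js 0 p = J p" and
  tr: "ALL i. enat i < l --> closed_support (U i) (C i)<=sing R (U i) (Js i) b & is_transform R (U i) (C i) b (Js i) (Js (Suc i))"
  using perm unfolding permissible_def by (elim exE conjE)
 have sh: "ideal_sheaf R (Z i) (Js i)" if "enat i<=l" for i
 proof (cases i)
  case 0
  then show ?thesis using ideal_sheaf_cong[OF J] Js Z0 by simp
 next
  case (Suc k)
  then have "enat k < l" using that by (simp add: Suc_ile_eq)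
  then show ?thesis using tr op(2) unfolding Suc is_transform_def by simp
 qed
 show ?thesis
 proof (rule that[of Js])
  show "Js 0 p = J p" if "p\<in>Z\<^sub>0" for p using Js Z0 that by simp
  fix i assume i: "enat i < l"
  show "ideal_sheaf R (U i) (Js i)" using ideal_sheaf_open[OF sh op(1)[OF i]] i by simp
  show "is_transform R (U i) (C i) b (Js i) (Js (Suc i))" using tr i by simp
  show "Js i p<=ideal_pow (on_carrier R p) (max_ideal (on_carrier R p)) b" if "p\<in>U i" "C i p~=p" for p
   using tr i that unfolding closed_support_def sing_def by auto
 qed
qed

end

text \<open>Regular local rings are domains. This gives a center a generic point inside the local
  ring \<open>p\<close>.\<close>

lemma (in field) prime_of_regular_center:
 assumes p: "subring p R" and C: "ideal C (on_carrier R p)" and reg: "regular_local_ring (on_carrier R p Quot C)"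
 shows "primeideal C (on_carrier R p)" by (rule cring.quot_domain_imp_primeideal[OF subring_cring[OF p] C regular_local_ring_domain[OF reg]])

lemma (in cring) monomial_in_ideal_pow:
 fixes y :: "'s::finite => 'a" assumes p: "subring p R" and I: "ideal I (on_carrier R p)" and y: "!!j. y j\<in>I"
 shows "monomial R y m\<in>ideal_pow (on_carrier R p) I (degree_of m)"
proof -
 interpret Q: cring "on_carrier R p" using subcring_iff[OF subringE(1)[OF p]] subcringI'[OF p] by simp
 have Ip: "I<=p" using Q.ideal_facts(1)[OF I] by simp
 have yc: "y j\<in>\<K>" for j using y Ip subringE(1)[OF p] by blast
 have pw: "y j [^] (k::nat)\<in>ideal_pow (on_carrier R p) I k" for j k
 proof (induction k)
  case 0
  then show ?case unfolding Q.ideal_pow_0 using subringE(3)[OF p] by simp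
 next
  case (Suc k)
  then show ?case using Q.ideal_pow_add[OF I Suc, of "y j" "Suc 0"] y Q.ideal_pow_1[OF I] by simp
 qed
 have "(\<Otimes>i\<in>T. y i [^] m i)\<in>ideal_pow (on_carrier R p) I (\<Sum>i\<in>T. m i)" if "finite T" for T using that
 proof (induction T)
  case empty
  then show ?case using Q.ideal_pow_0 subringE(3)[OF p] by simp
 next
  case (insert i T)
  then show ?case using Q.ideal_pow_add[OF I pw[of i "m i"] insert.IH] yc by simp
 qed
 then show ?thesis unfolding monomial_def by simp
qed

lemma (in cring) monomial_scale:
 fixes y :: "'s::finite => 'a" assumes "!!j. y j\<in>\<K>" and f: "f\<in>\<K>"
 shows "monomial R (%j. f\<otimes>y j) m = f [^] degree_of m\<otimes>monomial R y m"
proof -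
 have "(\<Otimes>i\<in>T. (f\<otimes>y i) [^] m i) = f [^] (\<Sum>i\<in>T. m i)\<otimes>(\<Otimes>i\<in>T. y i [^] m i)" if "finite T" for T
  using that
 proof (induction T)
  case (insert i T)
  have c: "(\<Otimes>i\<in>T. y i [^] m i)\<in>\<K>" using assms by (intro finprod_closed) auto
  show ?case using insert assms c by (simp add: nat_pow_distrib nat_pow_mult[symmetric] m_ac)
 qed simp
 then show ?thesis unfolding monomial_def by simp
qed

lemma (in ring_hom_cring) hom_monomial:
 fixes y :: "'s::finite => 'a" assumes "!!j. y j\<in>\<K>"
 shows "h (monomial R y m) = monomial S (%j. h (y j)) m" unfolding monomial_def using assms
 by (subst hom_finprod) (auto intro!: S.finprod_cong' simp: hom_pow)

lemma (in field) hom_preimage_ideal: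
 assumes h: "ring_hom_cring A R h" and q: "subring q R" "h ` carrier A<=q" and T: "ideal T (on_carrier R q)"
 shows "ideal {a\<in>carrier A. h a\<in>T} A"
proof -
 interpret h: ring_hom_cring A R h by (rule h)
 show ?thesis using T h.hom_mult q(2) unfolding ideal_on_iff[OF q(1)] by (intro h.R.cidealI) auto
qed

lemma (in field) span_in_hom_Idl:
 assumes h: "ring_hom_cring A R h" and q: "subring q R" "h ` carrier A<=q" and F: "F<=carrier A"
 shows "span_in q (h ` (Idl\<^bsub>A\<^esub>F)) = span_in q (h ` F)"
proof -
 interpret h: ring_hom_cring A R h by (rule h)
 have hF: "h ` F<=q" using F q(2) by auto
 have "Idl\<^bsub>A\<^esub>F<=carrier A" by (rule h.R.ideal_facts(1)[OF h.R.genideal_ideal[OF F]])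
 then have hI: "h ` (Idl\<^bsub>A\<^esub>F)<=q" using q(2) by auto
 have "F<={a\<in>carrier A. h a\<in>span_in q (h ` F)}" using F span_in_facts(2)[OF q(1) hF] by auto
 from h.R.genideal_minimal[OF hom_preimage_ideal[OF h q span_in_facts(1)[OF q(1) hF]] this]
 have "h ` (Idl\<^bsub>A\<^esub>F)<=span_in q (h ` F)" by auto
 then show ?thesis using span_in_mono[OF q(1) q(1) subset_refl hF image_mono[OF h.R.genideal_self[OF F]] hI]
   span_in_facts(4)[OF q(1) hI span_in_facts(1)[OF q(1) hF]] by blast
qed

section \<open>The function field of the polynomial extension\<close>

locale generic_extension = domain R + noetherian_ring R for R (structure) + fixes n :: nat
begin

abbreviation "FK \<equiv> function_field R n"
abbreviation "const a \<equiv> fraction (mpoly_ring R n) (indexed_const a) \<one>\<^bsub>mpoly_ring R n\<^esub>"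
abbreviation "FB \<equiv> (%a. fraction (mpoly_ring R n) a \<one>\<^bsub>mpoly_ring R n\<^esub>) ` carrier (mpoly_ring R n)"

sublocale A: domain "mpoly_ring R n" by (rule mpoly_ring_domain)
sublocale K: field FK by (rule A.fraction_field_field)

lemma const_hom: "ring_hom_cring R FK (%a. const a)"
proof -
 interpret i: ring_hom_cring R "mpoly_ring R n" indexed_const by (rule indexed_const_hom)
 interpret h: ring_hom_cring "mpoly_ring R n" FK "%a. fraction (mpoly_ring R n) a \<one>\<^bsub>mpoly_ring R n\<^esub>" by (rule A.fraction_hom)
 show ?thesis by (intro ring_hom_cring.intro ring_hom_cring_axioms.intro ring_hom_memI is_cring K.is_cring) simp_all
qed

lemma FB_subring: "subring FB FK" using A.fraction_hom A.ring_axioms K.ring_axioms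
 by (intro ring_hom_ring.img_is_subring[OF ring_hom_ringI2 A.carrier_is_subring]) (auto simp: ring_hom_cring_def ring_hom_cring_axioms_def)

lemma const_FB: "(%a. const a) ` carrier R<=FB"
proof -
 interpret i: ring_hom_cring R "mpoly_ring R n" indexed_const by (rule indexed_const_hom)
 show ?thesis by auto
qed

lemma good_affine_space: "K.good FB (affine_space R n)" unfolding affine_space_def by (rule K.good_spec_points[OF FB_subring])

lemma affine_space_const:
 assumes "p\<in>affine_space R n" shows "subring p FK" "(%a. const a) ` carrier R<=p"
 using K.good_facts(2,3)[OF good_affine_space assms] const_FB by auto

lemma extended_ideal_sheaf:
 assumes I: "ideal I R" shows "ideal_sheaf FK (affine_space R n) (extended_ideal R n I)"
proof -
 obtain F where F: "F<=carrier R" "finite F" "I = Idl F" using finetely_gen[OF I] by blast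
 show ?thesis
 proof (rule K.ideal_sheaf_span)
  show "finite ((%a. const a) ` F)" using F(2) by simp
  fix p assume p: "p\<in>affine_space R n"
  note pf = affine_space_const[OF p]
  show "subring p FK" by (rule pf(1))
  show "(%a. const a) ` F<=p" using pf(2) F(1) by auto
  show "extended_ideal R n I p = K.span_in p ((%a. const a) ` F)"
   unfolding extended_ideal_def F(3) by (rule K.span_in_hom_Idl[OF const_hom pf F(1)])
 qed
qed

end

section \<open>The contact invariant along blow-ups\<close>

context field
begin

text \<open>The invariant at a point \<open>p\<close>: \<open>I\<close> is the stalk of the
  transform of the first ideal, \<open>y\<close> the divided family, \<open>T\<close> the stalk of
  the transform of the second ideal. The bound on \<open>T\<close> by \<open>I\<close> and the
  monomials of degree \<open>b\<close> is what survives of an inclusion in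
  \<open>J + (y)^b\<close>.\<close>

definition contact :: "nat => 'a set => 'a set => ('s::finite => 'a) => 'a set => bool"
 where "contact b p I y T <-> (ALL j. EX D g. dop R p b D & g\<in>I & D g = y j) &
  T<=span_in p (I\<union>monomial R y ` {m. degree_of m = b})"

lemma contactE:
 assumes "contact b p I y T"
 obtains D g where "dop R p b D" "g\<in>I" "D g = y j" using assms unfolding contact_def by blast

lemma contact_closed:
 assumes p: "subring p R" and I: "I<=p" and c: "contact b p I y T"
 shows "y j\<in>p" "I\<union>monomial R y ` {m. degree_of m = b}<=p" "y j\<in>\<K>"
proof -
 interpret P: cring_with_subring R p by (rule subring_with[OF p])
 have yp: "y j\<in>p" for j
 proof (rule contactE[OF c, of j])
  fix D g assume "dop R p b D" and g: "g\<in>I" "D g = y j"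
  from P.dop_preserve[OF this(1), of g] show ?thesis using g I by auto
 qed
 show "y j\<in>p" by (rule yp)
 show "y j\<in>\<K>" using yp P.Asub by auto
 have "monomial R y m\<in>p" for m by (rule monomial_in_subring[OF p]) (use yp in auto)
 then show "I\<union>monomial R y ` {m. degree_of m = b}<=p" using I by auto
qed

text \<open>Operators of order below \<open>b\<close> map \<open>P^b\<close> into \<open>P\<close>,
  so the family lies in \<open>P\<close>, and its monomials of degree \<open>b\<close> lie in
  \<open>P^b\<close>.\<close>

lemma contact_ideal_pow:
 assumes p: "subring p R" and c: "contact b p I y T"
  and P: "ideal P (on_carrier R p)" and IP: "I<=ideal_pow (on_carrier R p) P b"
 shows "y j\<in>P" "T<=ideal_pow (on_carrier R p) P b"
proof -
 interpret P: cring_with_subring R p by (rule subring_with[OF p])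
 interpret Q: cring "on_carrier R p" by (rule subring_cring[OF p])
 have yP: "y j\<in>P" for j
 proof (rule contactE[OF c, of j])
  fix D g assume "dop R p b D" and g: "g\<in>I" "D g = y j"
  from P.dop_ideal_pow[OF P this(1), of g] show ?thesis using g IP by auto
 qed
 show "y j\<in>P" by (rule yP)
 have Pi: "ideal (ideal_pow (on_carrier R p) P b) (on_carrier R p)" by (rule Q.ideal_pow_ideal[OF P])
 then have "I<=p" using IP unfolding ideal_on_iff[OF p] by auto
 note G = contact_closed(2)[OF p this c]
 have "I\<union>monomial R y ` {m. degree_of m = b}<=ideal_pow (on_carrier R p) P b" using IP monomial_in_ideal_pow[OF p P yP] by auto
 from span_in_facts(4)[OF p G Pi this] show "T<=ideal_pow (on_carrier R p) P b" using c unfolding contact_def by auto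
qed

text \<open>Arguing at \<open>p\<close> itself would only give nonunits, whereas membership in the
  ideal of the center is needed in order to divide by \<open>f\<close>. So the operators are
  localized at the generic point of the center; there permissibility puts the transform into the
  \<open>b\<close>-th power of the maximal ideal, whose contraction is \<open>C p\<close>.\<close>

lemma contact_center:
 assumes U: "good B U" and C: "regular_center R U C" and J: "ideal_sheaf R U J" and p: "p\<in>U"
  and c: "contact b p (J p) y T"
  and sing: "!!r. r\<in>U ==> C r~=r ==> J r<=ideal_pow (on_carrier R r) (max_ideal (on_carrier R r)) b"
 shows "y j\<in>C p"
proof -
 note g = good_facts[OF U]
 note ps = g(2)[OF p]
 have sC: "ideal_sheaf R U C" using C unfolding regular_center_def by simp
 have Cpi: "ideal (C p) (on_carrier R p)" by (rule ideal_sheaf_near(1)[OF sC p])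
 have Jp: "J p<=p" using ideal_sheaf_near(1)[OF J p] unfolding ideal_on_iff[OF ps] by simp
 note yp = contact_closed(1)[OF ps Jp c, of j]
 show ?thesis
 proof (cases "C p = p")
  case True
  then show ?thesis using yp by simp
 next
  case False
  then have "regular_local_ring (on_carrier R p Quot C p)" using C p unfolding regular_center_def closed_support_def by auto
  from prime_of_regular_center[OF ps Cpi this] have P: "primeideal (C p) (on_carrier R p)" .
  let ?r = "localization_at R p (C p)"
  note L = localization_facts[OF ps P]
  have rU: "?r\<in>U" by (rule g(4)[OF p P])
  note rf = local_subring_facts[OF L(1)]
  have Cpp: "C p<=p" using Cpi unfolding ideal_on_iff[OF ps] by simp
  have "C ?r = span_in ?r (C p)" by (rule ideal_sheaf_generization[OF U sC p rU L(2)])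
  also have "...<=nonunits ?r" by (rule span_in_facts(4)[OF rf(1) subset_trans[OF Cpp L(2)] rf(2)]) (use L(3) in auto)
  finally have "C ?r~=?r" using rf(4) subringE(3)[OF rf(1)] by auto
  from sing[OF rU this] have JM: "J ?r<=ideal_pow (on_carrier R ?r) (nonunits ?r) b" unfolding rf(3) .
  have Jr: "J ?r = span_in ?r (J p)" by (rule ideal_sheaf_generization[OF U J p rU L(2)])
  interpret r: cring_with_subring R ?r by (rule subring_with[OF rf(1)])
  have "y j\<in>nonunits ?r"
  proof (rule contactE[OF c, of j])
   fix D g assume D: "dop R p b D" "g\<in>J p" "D g = y j"
   have "dop R ?r b D" by (rule dop_localization[OF ps rf(1) L(2) _ D(1)]) (use L(5) in blast)
   moreover have "g\<in>J ?r" unfolding Jr using span_in_facts(2)[OF rf(1) subset_trans[OF Jp L(2)]] D(2) by auto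
   ultimately show ?thesis using r.dop_ideal_pow[OF rf(2), of b D g] JM D(3) by auto
  qed
  then show ?thesis using L(3) yp by auto
 qed
qed

text \<open>Dividing the family by \<open>f\<close> divides its monomials of degree \<open>b\<close>
  by \<open>f^b\<close>, just as the transform divides the ideal; so the bound on \<open>T\<close>
  keeps its shape and also shows that \<open>T\<close> is divisible by \<open>f^b\<close>.\<close>

lemma contact_blowup:
 assumes U: "good B U" and C: "ideal_sheaf R U C" and p: "p\<in>U" "f\<in>C p" "f~=\<zero>" "q\<in>spec_points R (chart p (C p) f)"
  and J: "J<=p" "J'<=q" "span_in q J = {a\<otimes>f [^] b | a. a\<in>J'}"
  and c: "contact b p J y T" and yC: "!!j. y j\<in>C p"
 shows "span_in q T<={f [^] b\<otimes>a | a. a\<in>q}"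
  and "contact b q J' (%j. y j\<otimes>inv f) {a\<in>q. a\<otimes>f [^] b\<in>span_in q T}"
proof -
 note ps = good_facts(2)[OF U p(1)]
 have Cp: "C p<=p" using ideal_sheaf_near(1)[OF C p(1)] unfolding ideal_on_iff[OF ps] by simp
 have fp: "f\<in>p" using Cp p(2) by auto
 note ch = chart_facts[OF ps Cp fp p(3)]
 note qf = spec_points_facts[OF ch(1) p(4)]
 note qs = local_subring_facts(1)[OF qf(1)]
 have pq: "p<=q" using ch(2) qf(2) by simp
 have fc: "f\<in>\<K>" using fp subringE(1)[OF ps] by auto
 note i = inv_nonzero[OF fc p(3)] and fb = pow_inv[OF fc p(3), of b]
 have qc: "a\<in>\<K>" if "a\<in>q" for a using that subringE(1)[OF qs] by auto
 let ?y = "%j. y j\<otimes>inv f"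
 let ?G = "J\<union>monomial R y ` {m. degree_of m = b}" and ?H = "J'\<union>monomial R ?y ` {m. degree_of m = b}"
 have yq: "?y j\<in>q" for j using ch(3)[OF yC] qf(2) by auto
 have Gp: "?G<=p" by (rule contact_closed(2)[OF ps J(1) c])
 have Gq: "?G<=q" by (rule subset_trans[OF Gp pq])
 have "monomial R ?y m\<in>q" for m by (rule monomial_in_subring[OF qs]) (use yq in auto)
 then have Hq: "?H<=q" using J(2) by auto
 have idH: "ideal (span_in q ?H) (on_carrier R q)" by (rule span_in_facts(1)[OF qs Hq])
 have JJ: "EX a:J'. g = a\<otimes>f [^] b" if "g\<in>J" for g
  using span_in_facts(2)[OF qs subset_trans[OF J(1) pq]] that unfolding J(3) by auto
 have div: "x\<otimes>inv f [^] b\<in>span_in q ?H" if x: "x\<in>span_in q T" for x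
 proof -
  have "T<=span_in p ?G" using c unfolding contact_def by simp
  then have "span_in q T<=span_in q (span_in p ?G)" using span_in_facts(3)[OF ps Gp] pq by (intro span_in_mono[OF qs qs]) auto
  also have "... = span_in q ?G" by (rule span_in_span_in[OF ps qs pq Gp])
  finally have xG: "x\<in>span_in q ?G" using x by auto
  have "d\<otimes>inv f [^] b\<in>span_in q ?H" if d: "d\<in>?G" for d
  proof (cases "d\<in>J")
   case True
   then obtain a where a: "a\<in>J'" "d = a\<otimes>f [^] b" using JJ by blast
   have "a\<in>\<K>" using a(1) J(2) qc by auto
   then have "d\<otimes>inv f [^] b = a" unfolding a(2) using fb by (simp add: m_assoc)
   then show ?thesis using span_in_facts(2)[OF qs Hq] a(1) by auto
  next
   case False
   then obtain m where m: "degree_of m = b" "d = monomial R y m" using d by auto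
   have yc: "y j\<in>\<K>" for j by (rule contact_closed(3)[OF ps J(1) c])
   have "monomial R ?y m = monomial R (%j. inv f\<otimes>y j) m" using yc i(1) by (simp add: m_comm)
   also have "... = inv f [^] b\<otimes>monomial R y m" using monomial_scale[OF yc i(1), where m = m] m(1) by simp
   also have "... = d\<otimes>inv f [^] b" unfolding m(2) by (rule m_comm[OF fb(3) monomial_closed]) (use yc in auto)
   finally show ?thesis using span_in_facts(2)[OF qs Hq] m(1) by auto
  qed
  then show ?thesis by (rule span_in_divide[OF qs qs subset_refl Gq fb(3) _ idH xG])
 qed
 show "span_in q T<={f [^] b\<otimes>a | a. a\<in>q}"
 proof
  fix x assume x: "x\<in>span_in q T"
  have xq: "x\<otimes>inv f [^] b\<in>q" using div[OF x] span_in_facts(3)[OF qs Hq] by auto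
  have "T<=span_in p ?G" using c unfolding contact_def by simp
  then have "T<=q" using span_in_facts(3)[OF ps Gp] pq by (meson subset_trans)
  from subsetD[OF span_in_facts(3)[OF qs this] x] have xc: "x\<in>\<K>" by (rule qc)
  have "x = f [^] b\<otimes>(x\<otimes>inv f [^] b)" using m_lcomm[OF fb(1) xc fb(3)] fb(4) xc by simp
  then show "x\<in>{f [^] b\<otimes>a | a. a\<in>q}" using xq by blast
 qed
 show "contact b q J' ?y {a\<in>q. a\<otimes>f [^] b\<in>span_in q T}" unfolding contact_def
 proof (intro conjI allI)
  show "{a\<in>q. a\<otimes>f [^] b\<in>span_in q T}<=span_in q ?H"
  proof
   fix a assume "a\<in>{a\<in>q. a\<otimes>f [^] b\<in>span_in q T}"
   then have a: "a\<in>\<K>" "a\<otimes>f [^] b\<in>span_in q T" using qc by auto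
   have "(a\<otimes>f [^] b)\<otimes>inv f [^] b = a" using a(1) fb by (simp add: m_assoc)
   then show "a\<in>span_in q ?H" using div[OF a(2)] by simp
  qed
  fix j
  obtain D g where D: "dop R p b D" "g\<in>J" "D g = y j" by (rule contactE[OF c])
  obtain a where a: "a\<in>J'" "g = a\<otimes>f [^] b" using JJ[OF D(2)] by blast
  have ac: "a\<in>\<K>" using a(1) J(2) qc by auto
  \<comment> \<open>\<open>dop_chart\<close> with order and exponent both equal to \<open>b\<close>:
    this is \<open>f^-1 D f^b\<close>, and it sends \<open>a = g/f^b\<close> to
    \<open>(D g)/f\<close>.\<close>
  define E where "E = (%x. f [^] b\<otimes>inv f [^] b\<otimes>inv f\<otimes>D (f [^] b\<otimes>x))"
  have "dop R (chart p (C p) f) b E" unfolding E_def by (rule dop_chart[OF ps Cp fp p(3) chart_def D(1)])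
  then have "dop R q b E" by (rule dop_localization[OF ch(1) qs qf(2), rotated]) (use qf(4) in blast)
  moreover have "E a = ?y j" unfolding E_def using a ac D(3) fb i(1) contact_closed(3)[OF ps J(1) c, of j] by (simp add: m_comm)
  ultimately show "EX D g. dop R q b D & g\<in>J' & D g = ?y j" using a(1) by blast
 qed
qed

end

context generic_extension
begin

text \<open>Stated for any ideal \<open>I\<close> inside \<open>J + (y)^b\<close>, because both
  inclusions in the equivalence of pairs are instances of it.\<close>

lemma permissible_contact:
 fixes y :: "'s::finite => 'a"
 assumes J: "ideal J R" and I: "ideal I R" and IJ: "I<=Idl (J\<union>monomial R y ` {m. degree_of m = b})"
  and y: "!!j. y j\<in>\<K>" and ops: "!!j. EX D f. dop R \<K> b D & f\<in>J & D f = y j"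
  and lsb: "lsb FK (affine_space R n) l Z U C" and perm: "permissible FK (extended_ideal R n J) b l Z U C"
 shows "permissible FK (extended_ideal R n I) b l Z U C"
proof (rule K.permissible_obtain[OF lsb extended_ideal_sheaf[OF J] perm])
 fix Js
 assume Js: "!!p. p\<in>affine_space R n ==> Js 0 p = extended_ideal R n J p" "!!i. enat i < l ==> ideal_sheaf FK (U i) (Js i)"
  "!!i p. enat i < l ==> p\<in>U i ==> C i p~=p ==> Js i p<=ideal_pow (on_carrier FK p) (max_ideal (on_carrier FK p)) b"
  "!!i. enat i < l ==> is_transform FK (U i) (C i) b (Js i) (Js (Suc i))"
 interpret c: ring_hom_cring R FK "%a. const a" by (rule const_hom)
 let ?h = "%a. const a"
 \<comment> \<open>The family is quantified inside the invariant: each blow-up divides it by a local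
   equation of the exceptional divisor, so it varies with the point.\<close>
 show ?thesis
 proof (rule K.permissible_of_invariant[OF good_affine_space lsb extended_ideal_sheaf[OF I],
    where Q = "%i p T. \<exists>y :: 's => _. K.contact b p (Js i p) y T"])
  fix p assume p: "p\<in>affine_space R n"
  note pf = affine_space_const[OF p]
  have Jc: "J<=\<K>" by (rule ideal_facts(1)[OF J])
  have Jp: "?h ` J<=p" by (rule subset_trans[OF image_mono[OF Jc] pf(2)])
  have Js0: "Js 0 p = K.span_in p (?h ` J)" unfolding Js(1)[OF p] extended_ideal_def ..
  let ?G = "Js 0 p\<union>monomial FK (%j. ?h (y j)) ` {m. degree_of m = b}"
  have mon: "?h (monomial R y m) = monomial FK (%j. ?h (y j)) m" for m by (rule c.hom_monomial[OF y])
  have monc: "monomial R y m\<in>\<K>" for m by (rule monomial_closed) (use y in auto)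
  have "monomial FK (%j. ?h (y j)) m\<in>p" for m unfolding mon[symmetric] using pf(2) monc by blast
  then have Gp: "?G<=p" using K.span_in_facts(3)[OF pf(1) Jp] unfolding Js0 by auto
  note idG = K.span_in_facts(1,2)[OF pf(1) Gp]
  have "I<={a\<in>\<K>. ?h a\<in>K.span_in p ?G}"
  proof (rule subset_trans[OF IJ genideal_minimal[OF K.hom_preimage_ideal[OF const_hom pf idG(1)]]])
   have "?h ` J<=K.span_in p ?G" using K.span_in_facts(2)[OF pf(1) Jp] idG(2) unfolding Js0 by blast
   then show "J\<union>monomial R y ` {m. degree_of m = b}<={a\<in>\<K>. ?h a\<in>K.span_in p ?G}" using Jc monc idG(2) mon by auto
  qed
  then have "?h ` I<=K.span_in p ?G" by blast
  moreover have "?h ` I<=p" by (rule subset_trans[OF image_mono[OF ideal_facts(1)[OF I]] pf(2)])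
  ultimately have sub: "extended_ideal R n I p<=K.span_in p ?G"
   unfolding extended_ideal_def using K.span_in_facts(4)[OF pf(1) _ idG(1)] by blast
  have "EX D g. dop FK p b D & g\<in>Js 0 p & D g = ?h (y j)" for j
  proof -
   obtain D f where D: "dop R \<K> b D" "f\<in>J" "D f = y j" using ops by blast
   interpret R: cring_with_subring R "\<K>" by (rule cring_with_carrier)
   let ?c = "%a. fraction (mpoly_ring R n) a \<one>\<^bsub>mpoly_ring R n\<^esub>"
   \<comment> \<open>Three steps up: from \<open>R\<close> to \<open>R[t]\<close> on coefficients,
     to the copy of \<open>R[t]\<close> in the function field, and to the field itself by means of
     denominators.\<close>
   have "EX E. dop FK FB b E & (ALL a:FB. E a = ?c (%m. D (inv_into (carrier (mpoly_ring R n)) ?c a m)))"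
   proof (rule K.dop_extend[OF FB_subring _ K.dop_transport[OF A.fraction_hom A.fraction_hom_inj FB_subring dop_mpoly[OF D(1)]]])
    fix x assume "x\<in>carrier FK"
    from A.fraction_hom_denominator[OF this] obtain s a where s: "s\<in>carrier (mpoly_ring R n) - {\<zero>\<^bsub>mpoly_ring R n\<^esub>}"
     "a\<in>carrier (mpoly_ring R n)" "?c s\<otimes>\<^bsub>FK\<^esub>x = ?c a" by blast
    have "?c s~=\<zero>\<^bsub>FK\<^esub>" unfolding A.fraction_field_sel using s(1) A.fraction_hom_inj unfolding inj_on_def by auto
    then show "EX s:FB. s~=\<zero>\<^bsub>FK\<^esub> & s\<otimes>\<^bsub>FK\<^esub>x\<in>FB" using s by (intro bexI[of _ "?c s"]) auto
   qed
   then obtain E where E: "dop FK FB b E" and EB: "ALL a:FB. E a = ?c (%m. D (inv_into (carrier (mpoly_ring R n)) ?c a m))" by blast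
   have E2: "E (?c a) = ?c (%m. D (a m))" if "a\<in>carrier (mpoly_ring R n)" for a
    using bspec[OF EB imageI[OF that]] inv_into_f_f[OF A.fraction_hom_inj that] by simp
   have "p\<in>spec_points FK FB" using p unfolding affine_space_def .
   note sp = K.spec_points_facts[OF FB_subring this]
   have "dop FK p b E" by (rule K.dop_localization[OF FB_subring pf(1) sp(2) _ E]) (use sp(4) in blast)
   moreover have "E (?h f) = ?h (y j)"
   proof -
    have f: "f\<in>\<K>" using Jc D(2) by auto
    have "(indexed_const f :: nat multiset => 'a)\<in>carrier (mpoly_ring R n)" unfolding mpoly_ring_sel by (rule indexed_pset.indexed_const[OF f])
    from E2[OF this] have "E (?h f) = fraction (mpoly_ring R n) (%m. D (indexed_const f m)) \<one>\<^bsub>mpoly_ring R n\<^esub>" .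
    also have "(%m. D (indexed_const f m)) = (indexed_const (D f) :: nat multiset => 'a)"
     unfolding indexed_const_def using R.dop_zero[OF D(1)] by auto
    finally show ?thesis unfolding D(3) .
   qed
   moreover have "?h f\<in>Js 0 p" unfolding Js0 using K.span_in_facts(2)[OF pf(1) Jp] D(2) by blast
   ultimately show ?thesis by blast
  qed
  then show "\<exists>y :: 's => _. K.contact b p (Js 0 p) y (extended_ideal R n I p)"
   unfolding K.contact_def using sub by (intro exI[of _ "%j. ?h (y j)"]) simp
 next
  fix i p T
  assume i: "enat i < l" and p: "p\<in>U i" and U: "K.good FB (U i)" and C: "C i p~=p"
   and "\<exists>y :: 's => _. K.contact b p (Js i p) y T"
  then obtain y :: "'s => _" where c: "K.contact b p (Js i p) y T" by blast
  note lf = K.local_subring_facts[OF K.good_facts(1)[OF U p]]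
  show "T<=ideal_pow (on_carrier FK p) (max_ideal (on_carrier FK p)) b"
   using K.contact_ideal_pow(2)[OF lf(1) c lf(2)] Js(3)[OF i p C] unfolding lf(3) by simp
 next
  fix i p q f T
  assume i: "enat i < l" and U: "K.good FB (U i)" and C: "regular_center FK (U i) (C i)" and Z: "Z (Suc i) = blowup FK (U i) (C i)"
   and q: "q\<in>Z (Suc i)" and p: "p\<in>U i" "dominates FK q p" "f\<in>C i p" "f~=\<zero>\<^bsub>FK\<^esub>" "q\<in>spec_points FK (K.chart p (C i p) f)"
   and "\<exists>y :: 's => _. K.contact b p (Js i p) y T"
  then obtain y :: "'s => _" where c: "K.contact b p (Js i p) y T" by blast
  have sC: "ideal_sheaf FK (U i) (C i)" using C unfolding regular_center_def by simp
  have qb: "q\<in>blowup FK (U i) (C i)" using q Z by simp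
  note qs = K.good_facts(2)[OF K.good_blowup[OF U sC] qb] and ps = K.good_facts(2)[OF U p(1)]
  have Jp: "Js i p<=p" using K.ideal_sheaf_near(1)[OF Js(2)[OF i] p(1)] unfolding K.ideal_on_iff[OF ps] by simp
  have "ideal_sheaf FK (blowup FK (U i) (C i)) (Js (Suc i))" using Js(4)[OF i] unfolding is_transform_def by simp
  then have J'q: "Js (Suc i) q<=q" using K.ideal_sheaf_near(1)[OF _ qb] unfolding K.ideal_on_iff[OF qs] by blast
  have yC: "y j\<in>C i p" for j by (rule K.contact_center[OF U C Js(2)[OF i] p(1) c Js(3)[OF i]])
  note cb = K.contact_blowup[OF U sC p(1,3,4,5) Jp J'q K.is_transform_eq[OF U sC Js(4)[OF i] qb p] c yC]
  show "K.span_in q T<={f [^]\<^bsub>FK\<^esub>b\<otimes>\<^bsub>FK\<^esub>a | a. a\<in>q} &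
    (\<exists>y :: 's => _. K.contact b q (Js (Suc i) q) y {a\<in>q. a\<otimes>\<^bsub>FK\<^esub>f [^]\<^bsub>FK\<^esub>b\<in>K.span_in q T})"
   using cb by blast
 qed
qed

end

section \<open>Maximal contact and the conclusion\<close>

lemma maximal_contact_hasse:
 fixes y :: "'s::finite => 'a" and R :: "('a, 'm) ring_scheme" (structure)
 assumes dom: "domain R" and noeth: "noetherian_ring R" and J: "ideal J R" and b: "0 < b"
  and y: "!!j. y j\<in>\<K>" and ops: "attained_by_hasse_ops R S (J, b) y" shows "maximal_contact R y (J, b)"
proof -
 interpret domain R by (rule dom)
 have yc: "range y<=\<K>" using y by auto
 have Y: "ideal (Idl (range y)) R" by (rule genideal_ideal[OF yc])
 define I where "I = set_add R (ideal_pow R (Idl (range y)) b) (ideal_pow R J 1)"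
 have J1: "ideal_pow R J 1 = J" using ideal_pow_1[OF J] by simp
 have Yb: "ideal (ideal_pow R (Idl (range y)) b) R" by (rule ideal_pow_ideal[OF Y])
 \<comment> \<open>The least common multiple of 1 and \<open>b\<close> is \<open>b\<close>, so the
   family contributes its \<open>b\<close>-th power and \<open>J\<close> its first power.\<close>
 have inter: "pair_inter R (Idl (range y), 1) (J, b) = (I, b)" unfolding pair_inter_def I_def using b by simp
 note sa = set_add_facts[OF Yb J]
 have I: "ideal I R" unfolding I_def J1 by (rule add_ideals[OF Yb J])
 have JI: "J<=I" unfolding I_def J1 by (rule sa(2))
 have mc: "J\<union>monomial R y ` {m. degree_of m = b}<=\<K>" using ideal_facts(1)[OF J] monomial_closed[OF yc] by auto
 have G: "ideal (Idl (J\<union>monomial R y ` {m. degree_of m = b})) R" by (rule genideal_ideal[OF mc])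
 have "ideal_pow R (Idl (range y)) b<=Idl (J\<union>monomial R y ` {m. degree_of m = b})"
  unfolding ideal_pow_Idl_monomials[OF yc] by (rule genideal_minimal[OF G]) (use genideal_self[OF mc] in auto)
 then have IJ: "I<=Idl (J\<union>monomial R y ` {m. degree_of m = b})"
  unfolding I_def J1 by (rule sa(3)[OF G]) (use genideal_self[OF mc] in simp)
 have ops': "EX D f. dop R \<K> b D & f\<in>J & D f = y j" for j
 proof -
  obtain D f where "diff_op R S (b - 1) D" "f\<in>J" "D f = y j" using spec[OF ops[unfolded attained_by_hasse_ops_def], of j] by auto
  then show ?thesis using diff_op_dop[OF _ ring_axioms, of S "b - 1" D] b by auto
 qed
 have ext: "generic_extension R" by (intro generic_extension.intro dom noeth)
 show ?thesis unfolding maximal_contact_def inter pair_equiv_def pair_le_def fst_conv snd_conv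
 proof (intro conjI allI impI)
  fix n l Z U C
  interpret generic_extension R n by (rule ext)
  assume "lsb FK (affine_space R n) l Z U C" "permissible FK (extended_ideal R n J) b l Z U C"
  then show "permissible FK (extended_ideal R n I) b l Z U C" by (rule permissible_contact[OF J I IJ y ops'])
 next
  fix n l Z U C
  interpret generic_extension R n by (rule ext)
  assume "lsb FK (affine_space R n) l Z U C" "permissible FK (extended_ideal R n I) b l Z U C"
  \<comment> \<open>For the converse the family is the single element 0, attained by the zero
    operator; the inclusion required holds because \<open>J\<close> lies in
    \<open>I\<close>.\<close>
  moreover have "dop R \<K> b (%_. \<zero>)" by (rule cring_with_subring.dop_null[OF cring_with_carrier])
  then have "EX D f. dop R \<K> b D & f\<in>I & D f = \<zero>" using ideal_facts(2)[OF I] by blast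
  moreover have "J<=Idl (I\<union>monomial R (%_ :: unit. \<zero>) ` {m. degree_of m = b})"
   using JI genideal_self[of "I\<union>monomial R (%_ :: unit. \<zero>) ` {m. degree_of m = b}"]
    ideal_facts(1)[OF I] monomial_closed[of "%_ :: unit. \<zero>"] by blast
  ultimately show "permissible FK (extended_ideal R n J) b l Z U C" by (intro permissible_contact[OF I J, of "%_ :: unit. \<zero>"]) auto
 qed
qed

theorem proposition4p4:
  fixes R :: "('a, 'm) ring_scheme"
    and J :: "'a set" and b :: nat
    and u :: "'d::finite \<Rightarrow> 'a" and y :: "'s::finite \<Rightarrow> 'a"
    and S :: "'a set"
  assumes "regular_local_ring R"
    and "ideal J R" and "0 < b"
    and "J \<subseteq> ideal_pow R (max_ideal R) b"
    and "\<exists>n (v :: nat \<Rightarrow> 'a). regular_params R (Inl ` UNIV \<union> Inr ` {..<n}) (case_sum u v)"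
    and "regular_params R UNIV (case_sum u y)"
    and "is_localized_polynomial_ring R S u y"
    and "attained_by_hasse_ops R S (J, b) y"
  shows "maximal_contact R y (J, b)
    \<and> (\<forall>(z :: 's \<Rightarrow> 'a) S'.
        regular_params R UNIV (case_sum u z) \<longrightarrow>
        is_localized_polynomial_ring R S' u z \<longrightarrow>
        attained_by_hasse_ops R S' (J, b) z \<longrightarrow>
        newton_polyhedron R (J, b) u y = newton_polyhedron R (J, b) u z)
    \<and> (let R' = R Quot (Idl\<^bsub>R\<^esub> (range u));
           \<pi> = (\<lambda>a. Idl\<^bsub>R\<^esub> (range u) +>\<^bsub>R\<^esub> a)
       in defines_directrix R' (\<pi> ` J, b) (\<pi> \<circ> y) \<longrightarrow>
          newton_polyhedron R (J, b) u y = characteristic_polyhedron TYPE('s) R (J, b) u)"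
proof -
 interpret domain R by (rule regular_local_ring_domain[OF assms(1)])
 have noeth: "noetherian_ring R" and yc: "y j\<in>carrier R" for j
  using assms(6) unfolding regular_params_def by (auto simp: image_subset_iff dest: spec[of _ "Inr j"])
 have Jc: "J<=carrier R" by (rule ideal_facts(1)[OF assms(2)])
 have sub: "subring S R & range u<=S" if "is_localized_polynomial_ring R S u z" for S and z :: "'s => 'a"
  using that unfolding is_localized_polynomial_ring_def regular_params_def by simp
 note S = conjunct1[OF sub[OF assms(7)]] conjunct2[OF sub[OF assms(7)]]
 have "maximal_contact R y (J, b)" by (rule maximal_contact_hasse[OF domain_axioms noeth assms(2,3) yc assms(8)])
 moreover have "newton_polyhedron R (J, b) u y = newton_polyhedron R (J, b) u z"
  if z: "regular_params R UNIV (case_sum u z)" "is_localized_polynomial_ring R S' u z" "attained_by_hasse_ops R S' (J, b) z"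
  for z :: "'s => 'a" and S' using newton_polyhedron_le[OF assms(6) z(1) S assms(8,3) Jc]
   newton_polyhedron_le[OF z(1) assms(6) conjunct1[OF sub[OF z(2)]] conjunct2[OF sub[OF z(2)]] z(3) assms(3) Jc] by (rule equalityI)
 moreover have "newton_polyhedron R (J, b) u y = characteristic_polyhedron TYPE('s) R (J, b) u"
  by (rule newton_polyhedron_eq_characteristic[OF assms(6) S assms(8,3) Jc])
 ultimately show ?thesis unfolding Let_def by blast
qed

end
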